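(* Let $1\le p<\infty$, $0<\alpha\le 1$, $w\in A_p$, and let $\varphi_1,\varphi_2$ be positive measurable functions on $\mathbb{R}^n\times(0,\infty)$ for which there is a constant $C>0$ such that for all $x\in\mathbb{R}^n$ and $r>0$ $$\int_r^\infty \frac{\operatorname{ess\,inf}_{t<s<\infty}\varphi_1(x,s)\,w(B(x,s))^{1/p}}{w(B(x,t))^{1/p}}\,\frac{dt}{t}\le C\,\varphi_2(x,r).$$ Then the operator $\mathrm{g}_\alpha$ is bounded from $M^{p,\varphi_1}_w(l_2)$ to $M^{p,\varphi_2}_w(l_2)$ if $p>1$, and from $M^{1,\varphi_1}_w(l_2)$ to $WM^{1,\varphi_2}_w(l_2)$ if $p=1$.
   Context: $B(x,r)$ is the open ball in $\mathbb{R}^n$ with centre $x$ and radius $r$. A weight is a locally integrable function on $\mathbb{R}^n$ that is positive and finite a.e.; $w(E)=\int_E w(x)\,dx$. $A_p$ denotes the Muckenhoupt class of weights: for $1<p<\infty$, $\sup_B\big(\frac1{|B|}\int_B w\big)\big(\frac1{|B|}\int_B w^{1-p'}\big)^{p-1}<\infty$ over all balls $B$, where $1/p+1/p'=1$; for $p=1$, $Mw\le Cw$ a.e., $M$ being the Hardy-Littlewood maximal operator. Vector-valued functions are sequences $\vec f=(f_j)_{j\ge1}$ of Lebesgue measurable functions on $\mathbb{R}^n$ with $\|\vec f(x)\|_{l_2}=(\sum_j|f_j(x)|^2)^{1/2}$. For a ball $B$, $\|\vec f\|_{L^p_w(B,l_2)}=\big(\int_B\|\vec f(y)\|_{l_2}^p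 w(y)\,dy\big)^{1/p}$ and $\|\vec f\|_{WL^p_w(B,l_2)}=\sup_{t>0}t\,w(\{y\in B:\|\vec f(y)\|_{l_2}>t\})^{1/p}$; $L^{p,\mathrm{loc}}_w(l_2)$ (resp. $WL^{p,\mathrm{loc}}_w(l_2)$) is the set of $\vec f$ for which $\|\vec f\|_{L^p_w(B,l_2)}$ (resp. $\|\vec f\|_{WL^p_w(B,l_2)}$) is finite for every ball $B$. For a positive measurable $\varphi$ on $\mathbb{R}^n\times(0,\infty)$, $M^{p,\varphi}_w(l_2)$ is the set of $\vec f\in L^{p,\mathrm{loc}}_w(l_2)$ with $$\|\vec f\|_{M^{p,\varphi}_w(l_2)}=\sup_{x\in\mathbb{R}^n,\,r>0}\varphi(x,r)^{-1}w(B(x,r))^{-1/p}\|\vec f\|_{L^p_w(B(x,r),l_2)}<\infty,$$ and $WM^{p,\varphi}_w(l_2)$ is the set of $\vec f\in WL^{p,\mathrm{loc}}_w(l_2)$ with finite quasinorm $\|\vec f\|_{WM^{p,\varphi}_w(l_2)}$ obtained by replacing $\|\vec f\|_{L^p_w(B(x,r),l_2)}$ by $\|\vec f\|_{WL^p_w(B(x,r),l_2)}$ in the same formula. For $0<\alpha\le1$, $\mathcal{C}_\alpha$ is the family of functions $\phi:\mathbb{R}^n\to\mathbb{R}$ supported in $\{|x|\le1\}$ with $\int\phi=0$ and $|\phi(x)-\phi(x')|\le|x-x'|^\alpha$ for all $x,x'$. Put $\phi_t(y)=t^{-n}\phi(y/t)$ and, for locally integrable $f$, $A_\alpha f(t,y)=\sup_{\phi\in\mathcal{C}_\alpha}|f*\phi_t(y)|$.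 The intrinsic Littlewood-Paley $\mathrm{g}$-function is $$\mathrm{g}_\alpha f(x)=\Big(\int_0^\infty(A_\alpha f(t,x))^2\frac{dt}{t}\Big)^{1/2}.$$ It acts on sequences componentwise: $\mathrm{g}_\alpha\vec f=(\mathrm{g}_\alpha f_j)_{j\ge1}$. An operator $T$ is bounded from $X$ to $Y$ if there is a constant $C$ with $\|T\vec f\|_Y\le C\|\vec f\|_X$ for all $\vec f\in X$. *)

theory Defs
  imports "HOL-Analysis.Analysis"
begin

section \<open>Powers and moduli in the extended half-line\<close>

text \<open>
  All norms, averages and suprema below take values in \<open>ennreal\<close>, so that none of them depends on
  the default value of a divergent integral or an unbounded supremum. The usual conventions
  \<open>0\<^sup>a = \<infinity>\<close> and \<open>\<infinity>\<^sup>a = 0\<close> for \<open>a < 0\<close> are used.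
\<close>

definition epowr :: "ennreal \<Rightarrow> real \<Rightarrow> ennreal" where
  "epowr x a =
     (if a = 0 then 1
      else if x = 0 then (if a > 0 then 0 else \<infinity>)
      else if x = \<infinity> then (if a > 0 then \<infinity> else 0)
      else ennreal (enn2real x powr a))"

text \<open>
  The functions to which the operator is applied are complex-valued, while the square function
  takes values in \<open>[0, \<infinity>]\<close>. The class below provides the absolute value for both, so that one
  definition of each function space serves as domain and as codomain.
\<close>

class modulus = topological_space +
  fixes modulus :: "'a \<Rightarrow> ennreal"

instantiation complex :: modulus
begin
definition modulus_complex :: "complex \<Rightarrow> ennreal" where
  "modulus_complex z = ennreal (cmod z)"
instance ..
end

instantiation ennreal :: modulus
begin
definition modulus_ennreal :: "ennreal \<Rightarrow> ennreal" where
  "modulus_ennreal x = x"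
instance ..
end


section \<open>Weights and Muckenhoupt classes\<close>

definition wmeas :: "('a::euclidean_space \<Rightarrow> ennreal) \<Rightarrow> 'a set \<Rightarrow> ennreal" where
  "wmeas w E = (\<integral>\<^sup>+ x\<in>E. w x \<partial>lebesgue)"

definition is_weight :: "('a::euclidean_space \<Rightarrow> ennreal) \<Rightarrow> bool" where
  "is_weight w \<longleftrightarrow>
     w \<in> borel_measurable lebesgue \<and>
     (\<forall>x. \<forall>r>0. wmeas w (ball x r) < \<infinity>) \<and>
     (AE x in lebesgue. 0 < w x \<and> w x < \<infinity>)"

definition ball_average :: "('a::euclidean_space \<Rightarrow> ennreal) \<Rightarrow> 'a \<Rightarrow> real \<Rightarrow> ennreal" where
  "ball_average u x r = (\<integral>\<^sup>+ y\<in>ball x r. u y \<partial>lebesgue) / emeasure lebesgue (ball x r)"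

text \<open>The centred maximal operator, on nonnegative functions. The uncentred one differs from it by
  at most a factor \<open>2\<^sup>n\<close> and yields the same class \<open>A\<^sub>1\<close>.\<close>

definition hardy_littlewood :: "('a::euclidean_space \<Rightarrow> ennreal) \<Rightarrow> 'a \<Rightarrow> ennreal" where
  "hardy_littlewood u x = (SUP r\<in>{0<..}. ball_average u x r)"

definition conj_exponent :: "real \<Rightarrow> real" where
  "conj_exponent p = p / (p - 1)"

text \<open>Meaningful for \<open>p \<ge> 1\<close> only.\<close>

definition muckenhoupt :: "real \<Rightarrow> ('a::euclidean_space \<Rightarrow> ennreal) set" where
  "muckenhoupt p =
     {w. is_weight w \<and>
         (if p = 1
          then \<exists>C::real. AE x in lebesgue. hardy_littlewood w x \<le> ennreal C * w x
          else (SUP x. SUP r\<in>{0<..}.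
                  ball_average w x r *
                  epowr (ball_average (\<lambda>y. epowr (w y) (1 - conj_exponent p)) x r) (p - 1)) < \<infinity>)}"


section \<open>Generalized weighted Morrey spaces of sequences\<close>

definition l2norm :: "(nat \<Rightarrow> 'a \<Rightarrow> 'b::modulus) \<Rightarrow> 'a \<Rightarrow> ennreal" where
  "l2norm f x = epowr (\<Sum>j. (modulus (f j x))\<^sup>2) (1/2)"

definition Lp_norm ::
  "real \<Rightarrow> ('a::euclidean_space \<Rightarrow> ennreal) \<Rightarrow> 'a set \<Rightarrow> (nat \<Rightarrow> 'a \<Rightarrow> 'b::modulus) \<Rightarrow> ennreal" where
  "Lp_norm p w B f = epowr (\<integral>\<^sup>+ y\<in>B. (epowr (l2norm f y) p * w y) \<partial>lebesgue) (1/p)"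

definition WLp_norm ::
  "real \<Rightarrow> ('a::euclidean_space \<Rightarrow> ennreal) \<Rightarrow> 'a set \<Rightarrow> (nat \<Rightarrow> 'a \<Rightarrow> 'b::modulus) \<Rightarrow> ennreal" where
  "WLp_norm p w B f =
     (SUP t\<in>{0<..}. ennreal t * epowr (wmeas w {y\<in>B. ennreal t < l2norm f y}) (1/p))"

definition Lp_loc ::
  "real \<Rightarrow> ('a::euclidean_space \<Rightarrow> ennreal) \<Rightarrow> (nat \<Rightarrow> 'a \<Rightarrow> 'b::modulus) set" where
  "Lp_loc p w = {f. (\<forall>j. f j \<in> borel_measurable lebesgue) \<and>
                    (\<forall>x. \<forall>r>0. Lp_norm p w (ball x r) f < \<infinity>)}"

definition WLp_loc ::
  "real \<Rightarrow> ('a::euclidean_space \<Rightarrow> ennreal) \<Rightarrow> (nat \<Rightarrow> 'a \<Rightarrow> 'b::modulus) set" where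
  "WLp_loc p w = {f. (\<forall>j. f j \<in> borel_measurable lebesgue) \<and>
                     (\<forall>x. \<forall>r>0. WLp_norm p w (ball x r) f < \<infinity>)}"

definition morrey_norm ::
  "real \<Rightarrow> ('a::euclidean_space \<Rightarrow> real \<Rightarrow> real) \<Rightarrow> ('a \<Rightarrow> ennreal)
     \<Rightarrow> (nat \<Rightarrow> 'a \<Rightarrow> 'b::modulus) \<Rightarrow> ennreal" where
  "morrey_norm p \<phi> w f =
     (SUP x. SUP r\<in>{0<..}.
        inverse (ennreal (\<phi> x r)) * epowr (wmeas w (ball x r)) (- 1/p) * Lp_norm p w (ball x r) f)"

definition weak_morrey_norm ::
  "real \<Rightarrow> ('a::euclidean_space \<Rightarrow> real \<Rightarrow> real) \<Rightarrow> ('a \<Rightarrow> ennreal)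
     \<Rightarrow> (nat \<Rightarrow> 'a \<Rightarrow> 'b::modulus) \<Rightarrow> ennreal" where
  "weak_morrey_norm p \<phi> w f =
     (SUP x. SUP r\<in>{0<..}.
        inverse (ennreal (\<phi> x r)) * epowr (wmeas w (ball x r)) (- 1/p) * WLp_norm p w (ball x r) f)"

definition morrey ::
  "real \<Rightarrow> ('a::euclidean_space \<Rightarrow> real \<Rightarrow> real) \<Rightarrow> ('a \<Rightarrow> ennreal)
     \<Rightarrow> (nat \<Rightarrow> 'a \<Rightarrow> 'b::modulus) set" where
  "morrey p \<phi> w = {f \<in> Lp_loc p w. morrey_norm p \<phi> w f < \<infinity>}"

definition weak_morrey ::
  "real \<Rightarrow> ('a::euclidean_space \<Rightarrow> real \<Rightarrow> real) \<Rightarrow> ('a \<Rightarrow> ennreal)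
     \<Rightarrow> (nat \<Rightarrow> 'a \<Rightarrow> 'b::modulus) set" where
  "weak_morrey p \<phi> w = {f \<in> WLp_loc p w. weak_morrey_norm p \<phi> w f < \<infinity>}"

definition positive_measurable :: "('a::euclidean_space \<Rightarrow> real \<Rightarrow> real) \<Rightarrow> bool" where
  "positive_measurable \<phi> \<longleftrightarrow>
     (\<forall>x. \<forall>r>0. 0 < \<phi> x r) \<and>
     (\<lambda>(x, r). \<phi> x r) \<in> borel_measurable (lebesgue_on (UNIV \<times> {0<..}))"

text \<open>
  The essential infimum of \<open>g\<close> over \<open>(t, \<infinity>)\<close>. It makes sense for every \<open>g\<close>, which matters because
  a Lebesgue measurable function of \<open>(x, s)\<close> has measurable sections in \<open>s\<close> only for almost every \<open>x\<close>.
\<close>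

definition ess_inf_above :: "real \<Rightarrow> (real \<Rightarrow> ennreal) \<Rightarrow> ennreal" where
  "ess_inf_above t g = Sup {c. AE s in lebesgue. t < s \<longrightarrow> c \<le> g s}"


section \<open>The intrinsic square function\<close>

definition C_family :: "real \<Rightarrow> ('a::euclidean_space \<Rightarrow> real) set" where
  "C_family \<alpha> =
     {\<phi>. (\<forall>x. 1 < norm x \<longrightarrow> \<phi> x = 0) \<and>
         (LINT x|lebesgue. \<phi> x) = 0 \<and>
         (\<forall>x x'. \<bar>\<phi> x - \<phi> x'\<bar> \<le> norm (x - x') powr \<alpha>)}"

definition dilate :: "real \<Rightarrow> ('a::euclidean_space \<Rightarrow> real) \<Rightarrow> 'a \<Rightarrow> real" where
  "dilate t \<phi> y = \<phi> (y /\<^sub>R t) / t ^ DIM('a)"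

definition convolve :: "('a::euclidean_space \<Rightarrow> complex) \<Rightarrow> ('a \<Rightarrow> real) \<Rightarrow> 'a \<Rightarrow> complex" where
  "convolve f \<psi> y = (LINT z|lebesgue. f z * complex_of_real (\<psi> (y - z)))"

definition A_sup :: "real \<Rightarrow> ('a::euclidean_space \<Rightarrow> complex) \<Rightarrow> real \<Rightarrow> 'a \<Rightarrow> ennreal" where
  "A_sup \<alpha> f t y = (SUP \<phi>\<in>C_family \<alpha>. ennreal (cmod (convolve f (dilate t \<phi>) y)))"

definition g_function :: "real \<Rightarrow> ('a::euclidean_space \<Rightarrow> complex) \<Rightarrow> 'a \<Rightarrow> ennreal" where
  "g_function \<alpha> f x = epowr (\<integral>\<^sup>+ t\<in>{0<..}. ((A_sup \<alpha> f t x)\<^sup>2 / ennreal t) \<partial>lebesgue) (1/2)"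

definition g_seq ::
  "real \<Rightarrow> (nat \<Rightarrow> 'a::euclidean_space \<Rightarrow> complex) \<Rightarrow> nat \<Rightarrow> 'a \<Rightarrow> ennreal" where
  "g_seq \<alpha> f j = g_function \<alpha> (f j)"


section \<open>Boundedness\<close>

definition bounded_operator ::
  "('f \<Rightarrow> 'h) \<Rightarrow> 'f set \<Rightarrow> ('f \<Rightarrow> ennreal) \<Rightarrow> 'h set \<Rightarrow> ('h \<Rightarrow> ennreal) \<Rightarrow> bool" where
  "bounded_operator T X normX Y normY \<longleftrightarrow>
     (\<forall>f\<in>X. T f \<in> Y) \<and> (\<exists>C::real. \<forall>f\<in>X. normY (T f) \<le> ennreal C * normX f)"

end

theory Submission
  imports Defs
begin

section \<open>Powers and integral inequalities in the extended half-line\<close>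

lemma epowr_zero [simp]: "0 < a \<Longrightarrow> epowr 0 a = 0"
  by (simp add: epowr_def)

lemma epowr_top [simp]: "0 < a \<Longrightarrow> epowr \<infinity> a = \<infinity>"
  by (simp add: epowr_def)

lemma epowr_top' [simp]: "0 < a \<Longrightarrow> epowr top a = top"
  by (simp add: epowr_def)

lemma epowr_one_left [simp]: "epowr 1 a = 1"
  by (simp add: epowr_def)

lemma epowr_ennreal: "0 < a \<Longrightarrow> 0 \<le> x \<Longrightarrow> epowr (ennreal x) a = ennreal (x powr a)"
  by (cases "x = 0") (auto simp: epowr_def)

lemma epowr_pos_ennreal: "0 < x \<Longrightarrow> epowr (ennreal x) a = ennreal (x powr a)"
  by (auto simp: epowr_def)

lemma epowr_mono: "0 < a \<Longrightarrow> x \<le> y \<Longrightarrow> epowr x a \<le> epowr y a"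
  by (cases x; cases y) (auto simp: epowr_ennreal top_unique intro!: ennreal_leI powr_mono2)

lemma epowr_mult:
  assumes a: "0 < a" shows "epowr (x * y) a = epowr x a * epowr y a"
proof -
  consider "x = 0" | "y = 0" | "x = \<infinity>" "y \<noteq> 0" | "y = \<infinity>" "x \<noteq> 0"
    | r s where "x = ennreal r" "0 < r" "y = ennreal s" "0 < s"
    by (cases x; cases y) (auto simp: less_le)
  then show ?thesis
  proof cases
    case 3
    then show ?thesis using a by (cases y) (auto simp: epowr_def ennreal_top_mult)
  next
    case 4
    then show ?thesis using a by (cases x) (auto simp: epowr_def ennreal_mult_top)
  next
    case 5
    then have "x * y = ennreal (r * s)" by (simp add: ennreal_mult)
    then have "epowr (x * y) a = ennreal ((r * s) powr a)"
      using 5 by (simp only: epowr_pos_ennreal mult_pos_pos)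
    then show ?thesis using 5 by (simp add: epowr_pos_ennreal powr_mult ennreal_mult)
  qed (use a in auto)
qed

lemma epowr_epowr: "0 < a \<Longrightarrow> epowr (epowr x a) b = epowr x (a * b)"
proof -
  assume a: "0 < a"
  consider "x = 0" | "x = \<infinity>" | r where "x = ennreal r" "0 < r"
    by (cases x) (auto simp: less_le)
  then show ?thesis
    using a by cases (auto simp: epowr_pos_ennreal powr_powr epowr_def zero_less_mult_iff mult_less_0_iff
        ennreal_mult_less_top)
qed

lemma epowr_one [simp]: "epowr x 1 = x"
  by (cases x) (auto simp: epowr_def)

lemma epowr_two: "epowr x 2 = x\<^sup>2"
  by (cases x) (auto simp: epowr_ennreal ennreal_power power_eq_top_ennreal epowr_def)

lemma epowr_half_square [simp]: "(epowr x (1/2))\<^sup>2 = x"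
  by (simp add: epowr_two[symmetric] epowr_epowr)

lemma epowr_square_half [simp]: "epowr (x\<^sup>2) (1/2) = x"
  by (simp add: epowr_two[symmetric] epowr_epowr)

lemma epowr_inverse_power: "0 < a \<Longrightarrow> epowr (epowr x a) (1/a) = x"
  by (simp add: epowr_epowr)

lemma epowr_power_inverse: "0 < a \<Longrightarrow> epowr (epowr x (1/a)) a = x"
  by (simp add: epowr_epowr)

lemma epowr_add: "0 < a \<Longrightarrow> 0 < b \<Longrightarrow> epowr x (a + b) = epowr x a * epowr x b"
  by (cases x) (auto simp: epowr_ennreal ennreal_mult[symmetric] powr_add epowr_def)

lemma epowr_le_iff: "0 < a \<Longrightarrow> epowr x a \<le> epowr y a \<longleftrightarrow> x \<le> y"
  by (metis epowr_inverse_power epowr_mono zero_less_divide_1_iff)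

lemma epowr_less_iff: "0 < a \<Longrightarrow> epowr x a < epowr y a \<longleftrightarrow> x < y"
  by (meson epowr_le_iff not_le)

lemma epowr_less_top: "0 < a \<Longrightarrow> epowr x a < \<infinity> \<longleftrightarrow> x < \<infinity>"
  by (metis epowr_less_iff epowr_top)

lemma epowr_gt_zero: "0 < a \<Longrightarrow> 0 < epowr x a \<longleftrightarrow> 0 < x"
  by (metis epowr_less_iff epowr_zero)

lemma epowr_minus: "0 < a \<Longrightarrow> epowr x (- a) = inverse (epowr x a)"
proof -
  assume a: "0 < a"
  consider "x = 0" | "x = \<infinity>" | r where "x = ennreal r" "0 < r"
    by (cases x) (auto simp: less_le)
  then show ?thesis
    using a by cases (auto simp: epowr_pos_ennreal powr_minus epowr_def inverse_ennreal)
qed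

lemma epowr_add_le:
  assumes "0 < a" shows "epowr (x + y) a \<le> ennreal (2 powr a) * (epowr x a + epowr y a)"
proof -
  have "x + y \<le> 2 * max x y"
    by (metis add_mono max.cobounded1 max.cobounded2 mult_2)
  then have "epowr (x + y) a \<le> epowr (2 * max x y) a"
    by (rule epowr_mono[OF assms])
  also have "\<dots> = ennreal (2 powr a) * epowr (max x y) a"
    using epowr_ennreal[OF assms, of 2] by (simp add: epowr_mult assms)
  also have "\<dots> \<le> ennreal (2 powr a) * (epowr x a + epowr y a)"
    by (intro mult_left_mono) (auto simp: max_def)
  finally show ?thesis .
qed

lemma measurable_epowr [measurable (raw)]:
  "f \<in> borel_measurable M \<Longrightarrow> (\<lambda>x. epowr (f x) a) \<in> borel_measurable M"
proof -
  define g :: "ennreal \<Rightarrow> ennreal" where "g x = ennreal (enn2real x powr a)" for x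
  have "(\<lambda>x. enn2real x powr a) \<in> borel_measurable borel"
    by (intro powr_real_measurable borel_measurable_enn2real measurable_const) simp_all
  then have g: "g \<in> borel_measurable borel"
    unfolding g_def by (rule measurable_compose[OF _ measurable_ennreal])
  have "(\<lambda>x. epowr x a) = (\<lambda>x. if x \<in> {0} then epowr 0 a
      else if x \<in> {\<infinity>} then epowr \<infinity> a else if x \<in> UNIV then (if a = 0 then 1 else g x) else 0)"
    by (auto simp: epowr_def fun_eq_iff g_def)
  moreover have "\<dots> \<in> borel_measurable borel"
    using g by (intro measurable_If_set) (cases "a = 0", auto)
  ultimately have e: "(\<lambda>x. epowr x a) \<in> borel_measurable borel" by (simp only:)
  show "f \<in> borel_measurable M \<Longrightarrow> (\<lambda>x. epowr (f x) a) \<in> borel_measurable M"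
    by (rule measurable_compose[OF _ e])
qed

lemma sigma_finite_lebesgue: "sigma_finite_measure (lebesgue :: 'a::euclidean_space measure)"
proof
  obtain A :: "'a set set" where A: "countable A" "A \<subseteq> sets lborel" "\<Union>A = UNIV" "\<forall>a\<in>A. emeasure lborel a \<noteq> \<infinity>"
    using lborel.sigma_finite_countable by auto
  then show "\<exists>A::'a set set. countable A \<and> A \<subseteq> sets lebesgue \<and> \<Union> A = space lebesgue
      \<and> (\<forall>a\<in>A. emeasure lebesgue a \<noteq> \<infinity>)"
    by (intro exI[of _ A]) (auto simp: subset_eq)
qed

interpretation lebesgue: sigma_finite_measure "lebesgue :: 'a::euclidean_space measure"
  by (rule sigma_finite_lebesgue)

lemma epowr_integral_Holder:
  assumes p: "1 < p" and [measurable]: "u \<in> borel_measurable M" "w \<in> borel_measurable M"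
    and w: "AE x in M. 0 < w x \<and> w x < \<infinity>"
  shows "epowr (\<integral>\<^sup>+x. u x \<partial>M) p
       \<le> (\<integral>\<^sup>+x. epowr (u x) p * w x \<partial>M) * epowr (\<integral>\<^sup>+x. epowr (w x) (-1/(p-1)) \<partial>M) (p-1)"
proof -
  define A where "A = (\<integral>\<^sup>+x. epowr (u x) p * w x \<partial>M)"
  define S where "S = (\<integral>\<^sup>+x. epowr (w x) (-1/(p-1)) \<partial>M)"
  have sig: "0 < epowr (w x) (-1/(p-1))" if "0 < w x \<and> w x < \<infinity>" for x
    using that p by (cases "w x") (auto simp: epowr_pos_ennreal)
  have zero: ?thesis if "(\<integral>\<^sup>+x. u x \<partial>M) = 0"
    using that p by simp
  consider "A = 0" | "S = 0" | "A \<noteq> 0" "S \<noteq> 0" "A = \<infinity> \<or> S = \<infinity>"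
    | a s where "A = ennreal a" "S = ennreal s" "0 < a" "0 < s"
    by (cases A; cases S) (auto simp: less_le)
  then show ?thesis
  proof cases
    case 1
    then have "AE x in M. epowr (u x) p * w x = 0"
      unfolding A_def by (subst (asm) nn_integral_0_iff_AE) auto
    with w have "AE x in M. u x = 0"
    proof eventually_elim
      case (elim x) then show ?case using p epowr_gt_zero[of p "u x"] by (auto simp: zero_less_iff_neq_zero)
    qed
    then show ?thesis by (intro zero) (simp add: nn_integral_0_iff_AE)
  next
    case 2
    then have "AE x in M. epowr (w x) (-1/(p-1)) = 0"
      unfolding S_def by (subst (asm) nn_integral_0_iff_AE) auto
    with w have "AE x in M. u x = 0"
    proof eventually_elim
      case (elim x) then show ?case using sig[of x] by auto
    qed
    then show ?thesis by (intro zero) (simp add: nn_integral_0_iff_AE)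
  next
    case 3
    then have "A * epowr S (p - 1) = \<infinity>"
      using p epowr_gt_zero[of "p-1" S]
      by (auto simp: ennreal_mult_eq_top_iff zero_less_iff_neq_zero)
    then show ?thesis unfolding A_def S_def by simp
  next
    case 4
    define K where "K = a powr (1/p) * s powr (1 - 1/p)"
    have K: "K > 0" using 4 by (simp add: K_def)
    have pt: "AE x in M. u x \<le> ennreal (K/(p*a)) * (epowr (u x) p * w x) + ennreal (K*(1-1/p)/s) * epowr (w x) (-1/(p-1))"
      using w
    proof eventually_elim
      case (elim x)
      then obtain v where v: "w x = ennreal v" "0 < v"
        by (cases "w x") auto
      show ?case
      proof (cases "u x")
        case top
        then have "epowr (u x) p * w x = \<infinity>" using v p by (simp add: ennreal_top_mult)
        then show ?thesis using 4 K p by (simp add: ennreal_mult_top)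
      next
        case (real r)
        show ?thesis
        proof (cases "r = 0")
          case True then show ?thesis using real by simp
        next
          case False
          then have r: "r > 0" using real by simp
          have "r = K * ((r powr p * v / a) powr (1/p) * (v powr (-1/(p-1)) / s) powr (1 - 1/p))"
          proof -
            have X: "(r powr p * v / a) powr (1/p) = r * v powr (1/p) / a powr (1/p)"
              using r v 4 p by (simp add: powr_divide powr_mult powr_powr)
            have "(-1/(p-1)) * (1-1/p) = -(1/p)"
              using p by (simp add: field_simps)
            then have Y: "(v powr (-1/(p-1)) / s) powr (1 - 1/p) = v powr (-(1/p)) / s powr (1-1/p)"
              using v 4 p by (simp add: powr_divide powr_powr)
            show ?thesis unfolding X Y K_def using r v 4 by (simp add: powr_minus divide_simps)
          qed
          also have "\<dots> \<le> K * ((1/p) * (r powr p * v / a) + (1-1/p) * (v powr (-1/(p-1)) / s))"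
            using r v 4 p K by (intro mult_left_mono Youngs_inequality_0) auto
          also have "\<dots> = K/(p*a) * (r powr p * v) + K*(1-1/p)/s * v powr (-1/(p-1))"
            by (simp add: field_simps)
          finally have "ennreal r \<le> ennreal (K/(p*a) * (r powr p * v) + K*(1-1/p)/s * v powr (-1/(p-1)))"
            by (rule ennreal_leI)
          also have "\<dots> = ennreal (K/(p*a)) * (epowr (u x) p * w x) + ennreal (K*(1-1/p)/s) * epowr (w x) (-1/(p-1))"
          proof -
            define c1 where "c1 = K/(p*a)"
            define c2 where "c2 = K*(1-1/p)/s"
            have nn: "0 \<le> c1" "0 \<le> c2" using K p 4 by (auto simp: c1_def c2_def)
            have e: "epowr (w x) (-1/(p-1)) = ennreal (v powr (-1/(p-1)))" "epowr (u x) p = ennreal (r powr p)"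
              using v p r by (simp_all only: real v epowr_pos_ennreal)
            show ?thesis unfolding c1_def[symmetric] c2_def[symmetric] e unfolding v(1)
              using v(2) nn by (simp add: ennreal_mult)
          qed
          finally show ?thesis using real by simp
        qed
      qed
    qed
    have "(\<integral>\<^sup>+x. u x \<partial>M) \<le> (\<integral>\<^sup>+x. ennreal (K/(p*a)) * (epowr (u x) p * w x) + ennreal (K*(1-1/p)/s) * epowr (w x) (-1/(p-1)) \<partial>M)"
      by (rule nn_integral_mono_AE[OF pt])
    also have "\<dots> = (\<integral>\<^sup>+x. ennreal (K/(p*a)) * (epowr (u x) p * w x) \<partial>M) + (\<integral>\<^sup>+x. ennreal (K*(1-1/p)/s) * epowr (w x) (-1/(p-1)) \<partial>M)"
      by (rule nn_integral_add) measurable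
    also have "(\<integral>\<^sup>+x. ennreal (K/(p*a)) * (epowr (u x) p * w x) \<partial>M) = ennreal (K/(p*a)) * A"
      unfolding A_def by (rule nn_integral_cmult) measurable
    also have "(\<integral>\<^sup>+x. ennreal (K*(1-1/p)/s) * epowr (w x) (-1/(p-1)) \<partial>M) = ennreal (K*(1-1/p)/s) * S"
      unfolding S_def by (rule nn_integral_cmult) measurable
    also have "ennreal (K/(p*a)) * A + ennreal (K*(1-1/p)/s) * S = ennreal (K/(p*a) * a + K*(1-1/p)/s * s)"
    proof -
      define c1 where "c1 = K/(p*a)"
      define c2 where "c2 = K*(1-1/p)/s"
      have nn: "0 \<le> c1" "0 \<le> c2" using K p 4 by (auto simp: c1_def c2_def)
      show ?thesis unfolding c1_def[symmetric] c2_def[symmetric] 4(1,2)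
        using nn 4(3,4) by (simp add: ennreal_mult)
    qed
    also have "K/(p*a) * a + K*(1-1/p)/s * s = K * (1/p) + K * (1-1/p)" using 4(3,4) by simp
    also have "K * (1/p) + K * (1-1/p) = K" by (simp only: distrib_left[symmetric]) simp
    finally have "epowr (\<integral>\<^sup>+x. u x \<partial>M) p \<le> epowr (ennreal K) p"
      using p by (intro epowr_mono) auto
    also have "\<dots> = ennreal (a * s powr (p - 1))"
    proof -
      have "(1 - 1/p) * p = p - 1" using p by (simp add: left_diff_distrib)
      then have "K powr p = a * s powr (p - 1)"
        unfolding K_def using p 4(3,4) by (subst powr_mult) (simp_all add: powr_powr)
      then show ?thesis using K by (simp only: epowr_pos_ennreal)
    qed
    also have "\<dots> = A * epowr S (p-1)"
      using 4 p by (simp add: epowr_pos_ennreal ennreal_mult)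
    finally show ?thesis unfolding A_def S_def .
  qed
qed

lemma Minkowski_l2_integral:
  fixes u :: "nat \<Rightarrow> 'a \<Rightarrow> ennreal"
  assumes [measurable]: "\<And>j. u j \<in> borel_measurable M" "h \<in> borel_measurable M"
  shows "(\<Sum>j. (\<integral>\<^sup>+x. u j x * h x \<partial>M)\<^sup>2) \<le> (\<integral>\<^sup>+x. epowr (\<Sum>j. (u j x)\<^sup>2) (1/2) * h x \<partial>M)\<^sup>2"
proof -
  define c where "c j = (\<integral>\<^sup>+x. u j x * h x \<partial>M)" for j
  define U where "U x = epowr (\<Sum>j. (u j x)\<^sup>2) (1/2)" for x
  define I where "I = (\<integral>\<^sup>+x. U x * h x \<partial>M)"
  have [measurable]: "U \<in> borel_measurable M" unfolding U_def by measurable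
  have cI: "c j \<le> I" for j
    unfolding c_def I_def
  proof (intro nn_integral_mono mult_right_mono)
    fix x
    have "(u j x)\<^sup>2 \<le> (\<Sum>j. (u j x)\<^sup>2)"
      using sum_le_suminf[of "\<lambda>j. (u j x)\<^sup>2" "{j}"] by simp
    then show "u j x \<le> U x" unfolding U_def using epowr_mono[of "1/2" "(u j x)\<^sup>2"] by simp
  qed simp
  have "(\<Sum>j<N. (c j)\<^sup>2) \<le> I\<^sup>2" for N
  proof (cases "I = \<infinity>")
    case False
    then have fin: "c j < \<infinity>" for j using cI[of j] by (auto simp: less_top[symmetric] top_unique)
    define C where "C = (\<Sum>j<N. (c j)\<^sup>2)"
    have Cfin: "C < \<infinity>" unfolding C_def using fin
      by (auto simp: less_top[symmetric] power_eq_top_ennreal)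
    have cs: "(\<Sum>j<N. c j * u j x) \<le> epowr C (1/2) * U x" for x
    proof -
      have "(\<Sum>j<N. c j * u j x)\<^sup>2 \<le> (\<Sum>j<N. (c j)\<^sup>2) * (\<Sum>j<N. (u j x)\<^sup>2)"
        using Cauchy_Schwarz_nn_integral[of c "count_space {..<N}" "\<lambda>j. u j x"]
        by (simp add: nn_integral_count_space_finite)
      also have "\<dots> \<le> C * (\<Sum>j. (u j x)\<^sup>2)"
        unfolding C_def by (intro mult_left_mono sum_le_suminf) auto
      finally have "epowr ((\<Sum>j<N. c j * u j x)\<^sup>2) (1/2) \<le> epowr (C * (\<Sum>j. (u j x)\<^sup>2)) (1/2)"
        by (intro epowr_mono) auto
      then show ?thesis by (simp add: epowr_mult U_def)
    qed
    have "C = (\<Sum>j<N. c j * (\<integral>\<^sup>+x. u j x * h x \<partial>M))"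
      unfolding C_def by (simp add: c_def power2_eq_square)
    also have "\<dots> = (\<integral>\<^sup>+x. (\<Sum>j<N. c j * u j x) * h x \<partial>M)"
      by (subst sum_distrib_right, subst nn_integral_sum)
         (auto intro!: sum.cong simp: nn_integral_cmult[symmetric] mult.assoc)
    also have "\<dots> \<le> (\<integral>\<^sup>+x. epowr C (1/2) * (U x * h x) \<partial>M)"
      using cs by (intro nn_integral_mono) (auto simp: mult.assoc[symmetric] intro!: mult_right_mono)
    also have "\<dots> = epowr C (1/2) * I"
      unfolding I_def by (rule nn_integral_cmult) auto
    finally have *: "C \<le> epowr C (1/2) * I" .
    have "C \<le> I\<^sup>2"
    proof (cases "C = 0")
      case False
      define s where "s = epowr C (1/2)"
      have s: "s \<noteq> 0" "s \<noteq> \<infinity>"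
        using False Cfin epowr_gt_zero[of "1/2" C] epowr_less_top[of "1/2" C]
        by (auto simp: s_def zero_less_iff_neq_zero)
      have "s * s \<le> s * I" using * unfolding s_def
        using epowr_half_square[of C] by (simp add: power2_eq_square)
      then have "s \<le> I" using s
        using ennreal_mult_le_mult_iff by (auto)
      then have "s\<^sup>2 \<le> I\<^sup>2" by (rule power_mono) simp
      then show ?thesis unfolding s_def by simp
    qed simp
    then show ?thesis unfolding C_def .
  qed (simp add: power_eq_top_ennreal)
  then show ?thesis
    unfolding suminf_eq_SUP c_def I_def U_def by (intro SUP_least) auto
qed

section \<open>Layer cake\<close>

lemma nn_integral_power_below:
  assumes a: "0 < a"
  shows "(\<integral>\<^sup>+t. ennreal (a * t powr (a - 1)) * indicator {t. 0 < t \<and> ennreal t < c} t \<partial>lborel) = epowr c a"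
    (is "?I c = _")
proof -
  have fin: "?I (ennreal r) = epowr (ennreal r) a" if r: "0 \<le> r" for r
  proof -
    have "((\<lambda>t. t powr (a - 1)) has_integral (r powr (a - 1 + 1) / (a - 1 + 1))) {0..r}"
      using a r by (intro has_integral_powr_from_0) simp_all
    from has_integral_mult_right[OF this, of a] have "((\<lambda>t. a * t powr (a - 1)) has_integral r powr a) {0..r}" using a by simp
    then have "(\<integral>\<^sup>+t. ennreal (a * t powr (a - 1)) * indicator {0..r} t \<partial>lborel) = ennreal (r powr a)"
      using a by (intro nn_integral_has_integral_lebesgue') auto
    moreover have "?I (ennreal r) = (\<integral>\<^sup>+t. ennreal (a * t powr (a - 1)) * indicator {0..r} t \<partial>lborel)"
    proof (rule nn_integral_cong_AE)
      have "AE t in lborel. t \<noteq> 0 \<and> t \<noteq> r"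
        using AE_lborel_singleton[of 0] AE_lborel_singleton[of r] by auto
      then show "AE t in lborel. ennreal (a * t powr (a - 1)) * indicator {t. 0 < t \<and> ennreal t < ennreal r} t
        = ennreal (a * t powr (a - 1)) * indicator {0..r} t"
        by eventually_elim (auto simp: indicator_def ennreal_less_iff)
    qed
    ultimately show ?thesis using a r by (simp add: epowr_ennreal)
  qed
  show ?thesis
  proof (cases c)
    case (real r)
    then show ?thesis using fin[of r] by simp
  next
    case top
    have "ennreal x \<le> ?I c" if "0 < x" for x
    proof -
      define r where "r = x powr (1/a)"
      have "?I (ennreal r) \<le> ?I c"
        unfolding top by (intro nn_integral_mono) (auto simp: indicator_def)
      moreover have "?I (ennreal r) = ennreal x"
        using a that by (subst fin) (auto simp: r_def epowr_ennreal powr_powr)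
      ultimately show ?thesis by simp
    qed
    then have "?I c = \<infinity>"
    proof (cases "?I c")
      case (real y)
      then show ?thesis using \<open>\<And>x. 0 < x \<Longrightarrow> ennreal x \<le> ?I c\<close>[of "y + 1"] by (simp add: ennreal_le_iff2)
    qed simp
    then show ?thesis using top a by simp
  qed
qed

lemma layer_cake:
  fixes h w :: "'a \<Rightarrow> ennreal"
  assumes "sigma_finite_measure M" and q: "0 < q"
    and [measurable]: "h \<in> borel_measurable M" "w \<in> borel_measurable M"
  shows "(\<integral>\<^sup>+x. epowr (h x) q * w x \<partial>M)
    = (\<integral>\<^sup>+t. ennreal (q * t powr (q - 1)) * indicator {0<..} t * (\<integral>\<^sup>+x. indicator {x. ennreal t < h x} x * w x \<partial>M) \<partial>lborel)"
proof -
  interpret M: sigma_finite_measure M by fact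
  interpret P: pair_sigma_finite lborel M ..
  have [measurable]: "Measurable.pred (lborel \<Otimes>\<^sub>M M) (\<lambda>z. ennreal (fst z) < h (snd z))"
    by measurable
  have [measurable]: "(\<lambda>(t, x). indicator {x. ennreal t < h x} x :: ennreal) \<in> borel_measurable (lborel \<Otimes>\<^sub>M M)"
    unfolding indicator_def mem_Collect_eq split_beta' by measurable
  have "(\<integral>\<^sup>+x. epowr (h x) q * w x \<partial>M)
    = (\<integral>\<^sup>+x. (\<integral>\<^sup>+t. ennreal (q * t powr (q - 1)) * indicator {0<..} t * (indicator {x. ennreal t < h x} x * w x) \<partial>lborel) \<partial>M)"
  proof (intro nn_integral_cong)
    fix x
    have "epowr (h x) q * w x = (\<integral>\<^sup>+t. ennreal (q * t powr (q - 1)) * indicator {t. 0 < t \<and> ennreal t < h x} t * w x \<partial>lborel)"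
      by (subst nn_integral_multc) (auto simp: nn_integral_power_below q)
    also have "\<dots> = (\<integral>\<^sup>+t. ennreal (q * t powr (q - 1)) * indicator {0<..} t * (indicator {x. ennreal t < h x} x * w x) \<partial>lborel)"
      by (intro nn_integral_cong) (auto simp: indicator_def)
    finally show "epowr (h x) q * w x = \<dots>" .
  qed
  also have "\<dots> = (\<integral>\<^sup>+t. (\<integral>\<^sup>+x. ennreal (q * t powr (q - 1)) * indicator {0<..} t * (indicator {x. ennreal t < h x} x * w x) \<partial>M) \<partial>lborel)"
    by (rule P.Fubini') measurable
  also have "\<dots> = (\<integral>\<^sup>+t. ennreal (q * t powr (q - 1)) * indicator {0<..} t * (\<integral>\<^sup>+x. indicator {x. ennreal t < h x} x * w x \<partial>M) \<partial>lborel)"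
    by (intro nn_integral_cong nn_integral_cmult) measurable
  finally show ?thesis .
qed

section \<open>Dyadic cubes and stopping cubes\<close>

definition cube :: "real \<Rightarrow> 'a::euclidean_space \<Rightarrow> 'a set" where
  "cube s x = {y. \<forall>b\<in>Basis. \<lfloor>(y \<bullet> b) / s\<rfloor> = \<lfloor>(x \<bullet> b) / s\<rfloor>}"

lemma cube_self [simp]: "x \<in> cube s x"
  by (simp add: cube_def)

lemma cube_eq: "y \<in> cube s x \<Longrightarrow> cube s y = cube s x"
  by (auto simp: cube_def)

lemma cube_sym: "y \<in> cube s x \<Longrightarrow> x \<in> cube s y"
  by (simp add: cube_def)

lemma cube_half: "cube (s/2) x \<subseteq> cube s x"
proof -
  have *: "\<lfloor>u\<rfloor> \<le> \<lfloor>v\<rfloor>" if "\<lfloor>2 * u\<rfloor> = \<lfloor>2 * v\<rfloor>" for u v :: real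
  proof -
    have "2 * \<lfloor>u\<rfloor> \<le> \<lfloor>2 * u\<rfloor>" by (simp add: le_floor_iff)
    then have "2 * \<lfloor>u\<rfloor> \<le> \<lfloor>2 * v\<rfloor>" using that by simp
    then show ?thesis by (simp add: le_floor_iff)
  qed
  have eq: "\<lfloor>u\<rfloor> = \<lfloor>v\<rfloor>" if "\<lfloor>2 * u\<rfloor> = \<lfloor>2 * v\<rfloor>" for u v :: real
    using *[of u v] *[of v u] that by simp
  have half: "u / (s/2) = 2 * (u/s)" for u by simp
  show ?thesis
    unfolding cube_def half using eq by blast
qed

lemma cube_antimono: "i \<le> j \<Longrightarrow> cube (s/2^j) x \<subseteq> cube (s/2^i) x"
proof (induction j rule: dec_induct)
  case (step j)
  have "cube (s/2^j/2) x \<subseteq> cube (s/2^j) x" by (rule cube_half)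
  then show ?case using step by (simp add: field_simps)
qed simp

lemma cube_dist:
  fixes x :: "'a::euclidean_space"
  assumes s: "0 < s" and y: "y \<in> cube s x" shows "dist x y < real DIM('a) * s"
proof -
  have *: "\<bar>(x - y) \<bullet> b\<bar> < s" if "b \<in> Basis" for b
  proof -
    have "\<lfloor>(y \<bullet> b) / s\<rfloor> = \<lfloor>(x \<bullet> b) / s\<rfloor>" using y that by (simp add: cube_def)
    then have "\<bar>(y \<bullet> b) / s - (x \<bullet> b) / s\<bar> < 1" by linarith
    then have "\<bar>((y - x) \<bullet> b) / s\<bar> < 1" by (simp add: inner_diff_left diff_divide_distrib)
    then show ?thesis using s by (simp add: abs_divide inner_diff_left abs_minus_commute)
  qed
  have "norm (x - y) \<le> (\<Sum>b\<in>Basis. \<bar>(x - y) \<bullet> b\<bar>)" by (rule norm_le_l1)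
  also have "\<dots> < (\<Sum>b\<in>(Basis::'a set). s)" by (rule sum_strict_mono) (use * in auto)
  finally show ?thesis by (simp add: dist_norm)
qed

lemma cube_subset_ball: "0 < s \<Longrightarrow> cube s x \<subseteq> ball x (real DIM('a) * s)" for x :: "'a::euclidean_space"
  by (auto simp: cube_dist)

lemma sets_cube [measurable, simp]: "cube s x \<in> sets borel"
proof -
  have "cube s x = (\<Inter>b\<in>Basis. (\<lambda>y. \<lfloor>(y \<bullet> b) / s\<rfloor>) -` {\<lfloor>(x \<bullet> b) / s\<rfloor>} \<inter> space borel)"
    by (auto simp: cube_def)
  moreover have "(\<lambda>y. \<lfloor>(y \<bullet> b) / s\<rfloor>) -` {\<lfloor>(x \<bullet> b) / s\<rfloor>} \<inter> space borel \<in> sets borel" for b :: 'a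
    by (rule measurable_sets[where A="count_space UNIV"]) measurable
  ultimately show ?thesis by auto
qed

lemma sets_lebesgue_cube [measurable, simp]: "cube s x \<in> sets lebesgue"
  by (simp add: sets_completionI_sets)

lemma emeasure_cube:
  fixes x :: "'a::euclidean_space"
  assumes s: "0 < s" shows "emeasure lebesgue (cube s x) = ennreal (s ^ DIM('a))"
proof -
  define a where "a = (\<Sum>b\<in>Basis. (s * \<lfloor>(x \<bullet> b) / s\<rfloor>) *\<^sub>R b)"
  define c where "c = a + (\<Sum>b\<in>Basis. s *\<^sub>R b)"
  have ab: "a \<bullet> b = s * \<lfloor>(x \<bullet> b) / s\<rfloor>" if "b \<in> Basis" for b
    using that by (simp add: a_def)
  have cb: "c \<bullet> b = s * \<lfloor>(x \<bullet> b) / s\<rfloor> + s" if "b \<in> Basis" for b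
    using that ab by (simp add: c_def inner_add_left)
  have pr: "(\<Prod>b\<in>Basis. (c - a) \<bullet> b) = s ^ DIM('a)"
    by (simp add: inner_diff_left ab cb)
  have fl: "\<lfloor>(y \<bullet> b) / s\<rfloor> = \<lfloor>(x \<bullet> b) / s\<rfloor> \<longleftrightarrow> a \<bullet> b \<le> y \<bullet> b \<and> y \<bullet> b < c \<bullet> b" if "b \<in> Basis" for b y
    using s that by (simp add: floor_eq_iff ab cb field_simps)
  have "box a c \<subseteq> cube s x" "cube s x \<subseteq> cbox a c"
    by (auto simp: cube_def fl mem_box less_imp_le)
  then have "emeasure lebesgue (box a c) \<le> emeasure lebesgue (cube s x)"
     "emeasure lebesgue (cube s x) \<le> emeasure lebesgue (cbox a c)"
    by (auto intro!: emeasure_mono)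
  moreover have "emeasure lebesgue (box a c) = ennreal (s ^ DIM('a))"
    "emeasure lebesgue (cbox a c) = ennreal (s ^ DIM('a))"
    using s pr by (auto simp: emeasure_lborel_box_eq emeasure_lborel_cbox_eq ab cb)
  ultimately show ?thesis by simp
qed

lemma countable_cubes: "countable (range (cube s :: 'a::euclidean_space \<Rightarrow> _))"
proof -
  have "range (cube s :: 'a \<Rightarrow> _) \<subseteq>
    (\<lambda>f. {y. \<forall>b\<in>Basis. \<lfloor>(y \<bullet> b) / s\<rfloor> = f b}) ` (Basis \<rightarrow>\<^sub>E (UNIV :: int set))"
  proof (clarify, rule image_eqI)
    fix x :: 'a
    show "cube s x = {y. \<forall>b\<in>Basis. \<lfloor>(y \<bullet> b) / s\<rfloor> = (restrict (\<lambda>b. \<lfloor>(x \<bullet> b) / s\<rfloor>) Basis) b}"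
      by (auto simp: cube_def)
  qed auto
  moreover have "countable (Basis \<rightarrow>\<^sub>E (UNIV :: int set) :: ('a \<Rightarrow> int) set)"
    by (intro countable_PiE) auto
  ultimately show ?thesis
    by (meson countable_image countable_subset)
qed

lemma measurable_constant_on_cubes:
  assumes h: "\<And>x y. y \<in> cube s x \<Longrightarrow> h y = h x" and sp: "\<And>x. h x \<in> space M"
  shows "h \<in> borel \<rightarrow>\<^sub>M M"
proof (rule measurableI)
  fix A assume "A \<in> sets M"
  have "h -` A \<inter> space borel = \<Union>((cube s) ` (h -` A))"
    using h by auto
  moreover have "countable ((cube s) ` (h -` A))"
    by (rule countable_subset[OF _ countable_cubes[of s]]) auto
  moreover have "\<Union>((cube s) ` (h -` A)) \<in> sets borel"
    using calculation(2) by (intro sets.countable_Union) auto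
  ultimately show "h -` A \<inter> space borel \<in> sets borel" by simp
qed (use sp in auto)

definition nbhd :: "real \<Rightarrow> 'a::euclidean_space \<Rightarrow> 'a set" where
  "nbhd s x = (\<Union>y\<in>cube s x. ball y (2 * s))"

lemma open_nbhd [simp]: "open (nbhd s x)"
  by (auto simp: nbhd_def)

lemma sets_nbhd [measurable, simp]: "nbhd s x \<in> sets borel" "nbhd s x \<in> sets lebesgue"
  by (auto simp: sets_completionI_sets)

lemma nbhd_eq: "y \<in> cube s x \<Longrightarrow> nbhd s y = nbhd s x"
  by (simp add: nbhd_def cube_eq)

lemma ball_subset_nbhd: "ball x (2 * s) \<subseteq> nbhd s x"
  using cube_self by (fastforce simp: nbhd_def)

lemma nbhd_subset_ball:
  fixes x :: "'a::euclidean_space"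
  assumes s: "0 < s" shows "nbhd s x \<subseteq> ball x ((real DIM('a) + 2) * s)"
proof
  fix z assume "z \<in> nbhd s x"
  then obtain y where y: "y \<in> cube s x" "dist y z < 2 * s" by (auto simp: nbhd_def)
  have "dist x z \<le> dist x y + dist y z" by (rule dist_triangle)
  also have "\<dots> < real DIM('a) * s + 2 * s" using cube_dist[OF s y(1)] y(2) by simp
  finally show "z \<in> ball x ((real DIM('a) + 2) * s)" by (simp add: algebra_simps)
qed

lemma nbhd_antimono:
  assumes "0 < s" "i \<le> j" shows "nbhd (s/2^j) x \<subseteq> nbhd (s/2^i) x"
proof -
  have "s/2^j \<le> s/2^i" using assms by (intro divide_left_mono) (auto simp: power_increasing)
  then have "ball y (2 * (s/2^j)) \<subseteq> ball y (2 * (s/2^i))" for y :: 'a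
    by (intro subset_ball) simp
  then show ?thesis
    unfolding nbhd_def by (intro UN_mono cube_antimono[OF assms(2)])
qed

text \<open>For a property of dyadic cubes, the largest cubes that have it form a countable disjoint
  family.  Every stopping-time construction below is an instance.\<close>

definition first_level :: "(nat \<Rightarrow> 'a \<Rightarrow> bool) \<Rightarrow> 'a \<Rightarrow> nat" where
  "first_level P x = (LEAST i. P i x)"

definition stop_cube :: "real \<Rightarrow> (nat \<Rightarrow> 'a::euclidean_space \<Rightarrow> bool) \<Rightarrow> 'a \<Rightarrow> 'a set" where
  "stop_cube s P x = cube (s / 2 ^ first_level P x) x"

locale stopping =
  fixes s :: real and P :: "nat \<Rightarrow> 'a::euclidean_space \<Rightarrow> bool"
  assumes s_pos: "0 < s"
    and inv: "\<And>i x y. y \<in> cube (s/2^i) x \<Longrightarrow> P i x \<Longrightarrow> P i y"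
begin

abbreviation "\<Omega> \<equiv> {x. \<exists>i. P i x}"
abbreviation "\<tau> \<equiv> first_level P"
abbreviation "Q \<equiv> stop_cube s P"

lemma inv_iff: "y \<in> cube (s/2^i) x \<Longrightarrow> P i y \<longleftrightarrow> P i x"
  using inv cube_sym by blast

lemma at_first: "x \<in> \<Omega> \<Longrightarrow> P (\<tau> x) x"
  unfolding first_level_def by (auto intro: LeastI)

lemma before_first: "i < \<tau> x \<Longrightarrow> \<not> P i x"
  unfolding first_level_def by (rule not_less_Least)

lemma first_eqI: "P i x \<Longrightarrow> (\<And>l. l < i \<Longrightarrow> \<not> P l x) \<Longrightarrow> \<tau> x = i"
  unfolding first_level_def by (rule Least_equality) (auto simp: not_less[symmetric])

lemma Q_self [simp]: "x \<in> Q x" by (simp add: stop_cube_def)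

lemma in_Q:
  assumes x: "x \<in> \<Omega>" and y: "y \<in> Q x"
  shows "y \<in> \<Omega>" "\<tau> y = \<tau> x" "Q y = Q x"
proof -
  have y': "y \<in> cube (s/2^\<tau> x) x" using y by (simp add: stop_cube_def)
  have Py: "P (\<tau> x) y" using inv[OF y'] at_first[OF x] by blast
  then show "y \<in> \<Omega>" by blast
  show t: "\<tau> y = \<tau> x"
  proof (rule first_eqI[OF Py])
    fix l assume l: "l < \<tau> x"
    then have "y \<in> cube (s/2^l) x" using y' cube_antimono[of l "\<tau> x" s x] by auto
    then show "\<not> P l y" using before_first[OF l] inv_iff by blast
  qed
  show "Q y = Q x" using cube_eq[OF y'] by (simp add: stop_cube_def t)
qed

lemma sets_Q [measurable, simp]: "Q x \<in> sets borel" "Q x \<in> sets lebesgue"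
  by (auto simp: stop_cube_def)

lemma enumerate:
  "\<exists>A :: nat \<Rightarrow> 'a set. disjoint_family A \<and> (\<Union>n. A n) = \<Omega> \<and> (\<forall>n. A n = {} \<or> (\<exists>x\<in>\<Omega>. A n = Q x))"
proof -
  define F where "F = Q ` \<Omega>"
  have "F \<subseteq> (\<Union>i. range (cube (s/2^i)))" by (auto simp: F_def stop_cube_def)
  then have cF: "countable F" by (rule countable_subset) (auto simp: countable_cubes)
  define A where "A n = (if n \<in> to_nat_on F ` F then from_nat_into F n else {})" for n
  have "disjoint_family A"
  proof (unfold disjoint_family_on_def, clarify)
    fix m n :: nat assume mn: "m \<noteq> n"
    show "A m \<inter> A n = {}"
    proof (rule ccontr)
      assume "A m \<inter> A n \<noteq> {}"
      then obtain z where z: "z \<in> A m" "z \<in> A n" by blast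
      then obtain B C where B: "B \<in> F" "m = to_nat_on F B" "A m = B" and C: "C \<in> F" "n = to_nat_on F C" "A n = C"
        using cF by (auto simp: A_def split: if_splits)
      then obtain x y where "x \<in> \<Omega>" "B = Q x" "y \<in> \<Omega>" "C = Q y" by (auto simp: F_def)
      then have "B = C" using z B C in_Q(3)[of x z] in_Q(3)[of y z] by auto
      then show False using B C mn by simp
    qed
  qed
  moreover have "(\<Union>n. A n) = \<Omega>"
  proof
    show "(\<Union>n. A n) \<subseteq> \<Omega>"
    proof
      fix z assume "z \<in> (\<Union>n. A n)"
      then obtain n where "z \<in> A n" by blast
      then obtain B where "B \<in> F" "z \<in> B"
        using cF by (auto simp: A_def split: if_splits)
      then obtain x where "x \<in> \<Omega>" "z \<in> Q x" by (auto simp: F_def)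
      then show "z \<in> \<Omega>" using in_Q(1)[of x z] by blast
    qed
    show "\<Omega> \<subseteq> (\<Union>n. A n)"
    proof
      fix x assume "x \<in> \<Omega>"
      then have "Q x \<in> F" by (auto simp: F_def)
      then have "A (to_nat_on F (Q x)) = Q x" using cF by (simp add: A_def)
      then show "x \<in> (\<Union>n. A n)" using Q_self[of x] by blast
    qed
  qed
  moreover have "A n = {} \<or> (\<exists>x\<in>\<Omega>. A n = Q x)" for n
  proof (cases "n \<in> to_nat_on F ` F")
    case True
    then obtain B where "B \<in> F" "n = to_nat_on F B" by blast
    then have "A n = B" using cF by (simp add: A_def)
    then show ?thesis using \<open>B \<in> F\<close> by (auto simp: F_def)
  qed (simp add: A_def)
  ultimately show ?thesis by (intro exI[of _ A] conjI allI)
qed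

lemma sets_\<Omega> [measurable, simp]: "\<Omega> \<in> sets borel" "\<Omega> \<in> sets lebesgue"
proof -
  from enumerate obtain A :: "nat \<Rightarrow> 'a set" where
    "disjoint_family A \<and> (\<Union>n. A n) = \<Omega> \<and> (\<forall>n. A n = {} \<or> (\<exists>x\<in>\<Omega>. A n = Q x))" ..
  then have A: "disjoint_family A" "(\<Union>n. A n) = \<Omega>" "\<And>n. A n = {} \<or> (\<exists>x\<in>\<Omega>. A n = Q x)"
    by simp_all
  have "A n \<in> sets borel" for n using A(3)[of n] by auto
  then have "(\<Union>n. A n) \<in> sets borel" by blast
  then show "\<Omega> \<in> sets borel" by (simp only: A(2))
  then show "\<Omega> \<in> sets lebesgue" by (simp add: sets_completionI_sets)
qed

lemma nn_integral_stop_le: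
  fixes u v :: "'a \<Rightarrow> ennreal"
  assumes [measurable]: "u \<in> borel_measurable lebesgue" "v \<in> borel_measurable lebesgue"
    and le: "\<And>x. x \<in> \<Omega> \<Longrightarrow> (\<integral>\<^sup>+y\<in>Q x. u y \<partial>lebesgue) \<le> (\<integral>\<^sup>+y\<in>Q x. v y \<partial>lebesgue)"
  shows "(\<integral>\<^sup>+y\<in>\<Omega>. u y \<partial>lebesgue) \<le> (\<integral>\<^sup>+y\<in>\<Omega>. v y \<partial>lebesgue)"
proof -
  from enumerate obtain A :: "nat \<Rightarrow> 'a set" where
    "disjoint_family A \<and> (\<Union>n. A n) = \<Omega> \<and> (\<forall>n. A n = {} \<or> (\<exists>x\<in>\<Omega>. A n = Q x))" ..
  then have A: "disjoint_family A" "(\<Union>n. A n) = \<Omega>" "\<And>n. A n = {} \<or> (\<exists>x\<in>\<Omega>. A n = Q x)"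
    by simp_all
  have [measurable]: "A n \<in> sets lebesgue" for n using A(3)[of n] by auto
  have eq: "(\<integral>\<^sup>+y\<in>\<Omega>. h y \<partial>lebesgue) = (\<Sum>n. \<integral>\<^sup>+y\<in>A n. h y \<partial>lebesgue)"
    if [measurable]: "h \<in> borel_measurable lebesgue" for h
  proof -
    have "(\<integral>\<^sup>+y\<in>\<Omega>. h y \<partial>lebesgue) = (\<integral>\<^sup>+y. (\<Sum>n. h y * indicator (A n) y) \<partial>lebesgue)"
      using A(1) by (intro nn_integral_cong) (simp add: A(2)[symmetric] suminf_indicator)
    also have "\<dots> = (\<Sum>n. \<integral>\<^sup>+y\<in>A n. h y \<partial>lebesgue)"
      by (rule nn_integral_suminf) measurable
    finally show ?thesis .
  qed
  show ?thesis unfolding eq[OF assms(1)] eq[OF assms(2)]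
  proof (intro suminf_le)
    fix n show "(\<integral>\<^sup>+y\<in>A n. u y \<partial>lebesgue) \<le> (\<integral>\<^sup>+y\<in>A n. v y \<partial>lebesgue)"
    proof (cases "A n = {}")
      case False
      then obtain x where "x \<in> \<Omega>" "A n = Q x" using A(3)[of n] by blast
      then show ?thesis using le[of x] by simp
    qed simp
  qed auto
qed

lemma integral_stop_eq:
  fixes u v :: "'a \<Rightarrow> complex"
  assumes iu: "set_integrable lebesgue \<Omega> u" and iv: "set_integrable lebesgue \<Omega> v"
    and eq: "\<And>x. x \<in> \<Omega> \<Longrightarrow> (LINT y:Q x|lebesgue. u y) = (LINT y:Q x|lebesgue. v y)"
  shows "(LINT y:\<Omega>|lebesgue. u y) = (LINT y:\<Omega>|lebesgue. v y)"
proof -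
  from enumerate obtain A :: "nat \<Rightarrow> 'a set" where
    "disjoint_family A \<and> (\<Union>n. A n) = \<Omega> \<and> (\<forall>n. A n = {} \<or> (\<exists>x\<in>\<Omega>. A n = Q x))" ..
  then have A: "disjoint_family A" "(\<Union>n. A n) = \<Omega>" "\<And>n. A n = {} \<or> (\<exists>x\<in>\<Omega>. A n = Q x)"
    by simp_all
  have [measurable]: "A n \<in> sets lebesgue" for n using A(3)[of n] by auto
  have dj: "A i \<inter> A j = {}" if "i \<noteq> j" for i j using A(1) that by (auto simp: disjoint_family_on_def)
  have e: "(LINT y:A n|lebesgue. u y) = (LINT y:A n|lebesgue. v y)" for n
  proof (cases "A n = {}")
    case False
    then obtain x where "x \<in> \<Omega>" "A n = Q x" using A(3)[of n] by blast
    then show ?thesis using eq[of x] by simp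
  qed (simp add: set_lebesgue_integral_def)
  show ?thesis
    using lebesgue_integral_countable_add[of A lebesgue u] lebesgue_integral_countable_add[of A lebesgue v]
      iu iv dj e by (simp add: A(2))
qed

lemma borel_measurable_stop:
  assumes "\<And>i x y. y \<in> cube (s/2^i) x \<Longrightarrow> h i y = h i x" and "\<And>i x. h i x \<in> space M"
  shows "(\<lambda>x. h (\<tau> x) x) \<in> borel \<rightarrow>\<^sub>M M"
proof -
  have P: "(\<lambda>x. P i x) \<in> borel \<rightarrow>\<^sub>M count_space UNIV" for i
    by (rule measurable_constant_on_cubes[of "s/2^i"]) (auto simp: inv_iff)
  have \<tau>: "\<tau> \<in> borel \<rightarrow>\<^sub>M count_space UNIV"
    unfolding first_level_def by (rule measurable_Least) (rule P)
  show ?thesis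
  proof (rule measurable_compose_countable[OF _ \<tau>])
    show "h i \<in> borel \<rightarrow>\<^sub>M M" for i
      using assms by (rule measurable_constant_on_cubes)
  qed
qed

end

section \<open>Discretised intrinsic square function\<close>

lemma emeasure_lebesgue_ball:
  fixes x :: "'a::euclidean_space"
  shows "0 \<le> r \<Longrightarrow> emeasure lebesgue (ball x r) = ennreal (unit_ball_vol (DIM('a)) * r ^ DIM('a))"
  by (simp add: emeasure_ball)

lemma emeasure_ball_less_top [simp]: "emeasure lborel (ball x r) < top"
  using emeasure_lborel_ball_finite[of x r] by simp

lemma ennreal_norm_integral_le:
  fixes f :: "'b \<Rightarrow> 'c::{banach, second_countable_topology}"
  shows "ennreal (norm (LINT z|M. f z)) \<le> (\<integral>\<^sup>+z. ennreal (norm (f z)) \<partial>M)"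
proof (cases "integrable M f")
  case True then show ?thesis by (rule integral_norm_bound_ennreal)
qed (simp add: not_integrable_integral_eq)

definition cube_kernels :: "real \<Rightarrow> real \<Rightarrow> 'a::euclidean_space \<Rightarrow> ('a \<Rightarrow> real) set" where
  "cube_kernels \<alpha> s x = {\<psi>. (\<forall>z. z \<notin> nbhd s x \<longrightarrow> \<psi> z = 0) \<and> (LINT z|lebesgue. \<psi> z) = 0 \<and>
     (\<forall>z z'. \<bar>\<psi> z - \<psi> z'\<bar> \<le> (norm (z - z') / s) powr \<alpha> / s ^ DIM('a))}"

definition cube_sup :: "real \<Rightarrow> real \<Rightarrow> 'a::euclidean_space \<Rightarrow> ('a \<Rightarrow> complex) \<Rightarrow> ennreal" where
  "cube_sup \<alpha> s x f = (SUP \<psi>\<in>cube_kernels \<alpha> s x. ennreal (cmod (LINT z|lebesgue. f z * complex_of_real (\<psi> z))))"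

definition dyadic_sq :: "real \<Rightarrow> real \<Rightarrow> (nat \<Rightarrow> 'a::euclidean_space \<Rightarrow> complex) \<Rightarrow> 'a \<Rightarrow> ennreal" where
  "dyadic_sq \<alpha> s F x = (\<Sum>i j. (cube_sup \<alpha> (s/2^i) x (F j))\<^sup>2)"

lemma zero_cube_kernel: "0 < s \<Longrightarrow> (\<lambda>_. 0) \<in> cube_kernels \<alpha> s x"
  by (simp add: cube_kernels_def)

lemma cube_kernels_cong: "y \<in> cube s x \<Longrightarrow> cube_kernels \<alpha> s y = cube_kernels \<alpha> s x"
  by (simp add: cube_kernels_def nbhd_eq)

lemma cube_sup_cong: "y \<in> cube s x \<Longrightarrow> cube_sup \<alpha> s y f = cube_sup \<alpha> s x f"
  by (simp add: cube_sup_def cube_kernels_cong)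

lemma borel_measurable_cube_sup [measurable]: "(\<lambda>x. cube_sup \<alpha> s x f) \<in> borel_measurable borel"
  by (rule measurable_constant_on_cubes[of s]) (simp_all add: cube_sup_cong)

lemma borel_measurable_cube_sup' [measurable]: "(\<lambda>x. cube_sup \<alpha> s x f) \<in> borel_measurable lebesgue"
  by (rule measurable_completion) simp

lemma borel_measurable_dyadic_sq [measurable]: "dyadic_sq \<alpha> s F \<in> borel_measurable lebesgue"
  unfolding dyadic_sq_def[abs_def] by measurable

lemma powr_le_max1: "0 \<le> x \<Longrightarrow> 0 < \<alpha> \<Longrightarrow> \<alpha> \<le> 1 \<Longrightarrow> 1 \<le> c \<Longrightarrow> x \<le> c \<Longrightarrow> x powr \<alpha> \<le> (c::real)"
proof -
  assume a: "0 \<le> x" "0 < \<alpha>" "\<alpha> \<le> 1" "1 \<le> c" "x \<le> c"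
  then have "x powr \<alpha> \<le> c powr \<alpha>" by (intro powr_mono2) auto
  also have "\<dots> \<le> c powr 1" using a by (intro powr_mono) auto
  finally show ?thesis using a by simp
qed

context
  fixes \<alpha> :: real assumes \<alpha>: "0 < \<alpha>" "\<alpha> \<le> 1"
begin

lemma cube_kernel_continuous:
  fixes x :: "'a::euclidean_space"
  assumes s: "0 < s" and \<psi>: "\<psi> \<in> cube_kernels \<alpha> s x"
  shows "continuous_on UNIV \<psi>"
proof -
  have "isCont \<psi> z" for z
  proof -
    have "((\<lambda>y. (norm (y - z) / s) powr \<alpha> / s ^ DIM('a)) \<longlongrightarrow> (norm (z - z) / s) powr \<alpha> / s ^ DIM('a)) (at z)"
      using \<alpha> s by (intro tendsto_intros tendsto_powr') auto
    then have "((\<lambda>y. (norm (y - z) / s) powr \<alpha> / s ^ DIM('a)) \<longlongrightarrow> 0) (at z)" using \<alpha> by simp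
    then have "((\<lambda>y. \<psi> y - \<psi> z) \<longlongrightarrow> 0) (at z)"
      by (rule Lim_null_comparison[rotated]) (use \<psi> in \<open>auto simp: cube_kernels_def\<close>)
    then show ?thesis unfolding isCont_def by (rule LIM_zero_cancel)
  qed
  then show ?thesis by (simp add: continuous_on_eq_continuous_at)
qed

lemma cube_kernel_measurable:
  assumes "0 < s" "\<psi> \<in> cube_kernels \<alpha> s x"
  shows "\<psi> \<in> borel_measurable borel" "\<psi> \<in> borel_measurable lebesgue"
proof -
  show "\<psi> \<in> borel_measurable borel"
    using cube_kernel_continuous[OF assms] by (rule borel_measurable_continuous_onI)
  then have "\<psi> \<in> borel_measurable lborel" by simp
  then show "\<psi> \<in> borel_measurable lebesgue" by (rule measurable_completion)
qed

lemma cube_kernel_bound: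
  fixes x :: "'a::euclidean_space"
  assumes s: "0 < s" and \<psi>: "\<psi> \<in> cube_kernels \<alpha> s x"
  shows "\<bar>\<psi> z\<bar> \<le> 2 * (real DIM('a) + 2) / s ^ DIM('a)"
proof (cases "z \<in> nbhd s x")
  case True
  let ?R = "(real DIM('a) + 2) * s"
  have z: "dist x z < ?R" using nbhd_subset_ball[OF s, of x] True by auto
  obtain b :: 'a where b: "b \<in> Basis" using nonempty_Basis by blast
  define y where "y = x + ?R *\<^sub>R b"
  have dy: "dist x y = ?R" using b s by (simp add: y_def dist_norm)
  then have "y \<notin> nbhd s x" using nbhd_subset_ball[OF s, of x] by auto
  then have "\<psi> y = 0" using \<psi> by (simp add: cube_kernels_def)
  then have "\<bar>\<psi> z\<bar> \<le> (norm (z - y) / s) powr \<alpha> / s ^ DIM('a)"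
    using \<psi> by (simp add: cube_kernels_def) (metis diff_zero)
  also have "\<dots> \<le> 2 * (real DIM('a) + 2) / s ^ DIM('a)"
  proof (intro divide_right_mono powr_le_max1)
    have "norm (z - y) \<le> dist x z + dist x y" using dist_triangle[of z y x] by (simp add: dist_norm[symmetric] dist_commute)
    then show "norm (z - y) / s \<le> 2 * (real DIM('a) + 2)" using s z dy by (simp add: field_simps)
  qed (use \<alpha> s in auto)
  finally show ?thesis .
qed (use \<psi> s in \<open>simp add: cube_kernels_def\<close>)

lemma cube_kernel_integrable:
  assumes s: "0 < s" and \<psi>: "\<psi> \<in> cube_kernels \<alpha> s x"
  shows "integrable lebesgue \<psi>"
proof (rule Bochner_Integration.integrable_bound)
  let ?c = "2 * (real DIM('a) + 2) / s ^ DIM('a)"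
  show "integrable lebesgue (\<lambda>z. ?c * indicator (nbhd s x) z)"
  proof (intro integrable_mult_right integrable_real_indicator)
    have "emeasure lebesgue (nbhd s x) \<le> emeasure lebesgue (ball x ((real DIM('a) + 2) * s))"
      by (intro emeasure_mono nbhd_subset_ball s) simp
    also have "\<dots> < \<infinity>"
      using s by (subst emeasure_lebesgue_ball) auto
    finally show "emeasure lebesgue (nbhd s x) < \<infinity>" .
  qed auto
  show "\<psi> \<in> borel_measurable lebesgue" using cube_kernel_measurable[OF assms] by simp
  show "AE z in lebesgue. norm (\<psi> z) \<le> norm (?c * indicator (nbhd s x) z)"
    using cube_kernel_bound[OF assms] \<psi> s by (intro AE_I2) (auto simp: cube_kernels_def indicator_def)
qed

lemma cube_sup_le:
  fixes x :: "'a::euclidean_space"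
  assumes s: "0 < s" and f: "f \<in> borel_measurable lebesgue"
  shows "cube_sup \<alpha> s x f \<le> ennreal (2 * (real DIM('a) + 2) / s ^ DIM('a)) * (\<integral>\<^sup>+z\<in>nbhd s x. ennreal (cmod (f z)) \<partial>lebesgue)"
  unfolding cube_sup_def
proof (rule SUP_least)
  fix \<psi> assume \<psi>: "\<psi> \<in> cube_kernels \<alpha> s x"
  let ?c = "2 * (real DIM('a) + 2) / s ^ DIM('a)"
  have "ennreal (cmod (LINT z|lebesgue. f z * complex_of_real (\<psi> z))) \<le> (\<integral>\<^sup>+z. ennreal (cmod (f z * complex_of_real (\<psi> z))) \<partial>lebesgue)"
    by (rule ennreal_norm_integral_le)
  also have "\<dots> \<le> (\<integral>\<^sup>+z. ennreal ?c * (ennreal (cmod (f z)) * indicator (nbhd s x) z) \<partial>lebesgue)"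
  proof (rule nn_integral_mono)
    fix z
    show "ennreal (cmod (f z * complex_of_real (\<psi> z))) \<le> ennreal ?c * (ennreal (cmod (f z)) * indicator (nbhd s x) z)"
    proof (cases "z \<in> nbhd s x")
      case True
      have "cmod (f z * complex_of_real (\<psi> z)) \<le> ?c * cmod (f z)"
        using mult_right_mono[OF cube_kernel_bound[OF s \<psi>, of z], of "cmod (f z)"]
        by (simp only: norm_mult norm_of_real mult.commute norm_ge_zero)
      then show ?thesis using True s by (simp add: ennreal_mult[symmetric] ennreal_leI)
    next
      case False
      then show ?thesis using \<psi> by (simp add: cube_kernels_def)
    qed
  qed
  also have "\<dots> = ennreal ?c * (\<integral>\<^sup>+z\<in>nbhd s x. ennreal (cmod (f z)) \<partial>lebesgue)"
    using f by (intro nn_integral_cmult borel_measurable_times borel_measurable_indicator) auto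
  finally show "ennreal (cmod (LINT z|lebesgue. f z * complex_of_real (\<psi> z))) \<le> \<dots>" .
qed

section \<open>Boundedness on unweighted \<open>L\<^sup>2\<close>\<close>

lemma cube_kernel_inner:
  fixes x y :: "'a::euclidean_space"
  assumes st: "0 < s" "s \<le> t" and \<psi>: "\<psi> \<in> cube_kernels \<alpha> t x" and \<eta>: "\<eta> \<in> cube_kernels \<alpha> s y"
  shows "integrable lebesgue (\<lambda>z. \<psi> z * \<eta> z)"
    and "\<bar>LINT z|lebesgue. \<psi> z * \<eta> z\<bar> \<le> 2 * (real DIM('a) + 2) * (real DIM('a) + 2) * unit_ball_vol (DIM('a)) * (real DIM('a) + 2) ^ DIM('a) * ((s/t) powr \<alpha> / t ^ DIM('a))"
proof -
  let ?n = "DIM('a)" let ?R = "real DIM('a) + 2"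
  have t: "0 < t" using st by simp
  note i\<eta> = cube_kernel_integrable[OF st(1) \<eta>]
  show i: "integrable lebesgue (\<lambda>z. \<psi> z * \<eta> z)"
  proof (rule Bochner_Integration.integrable_bound)
    show "integrable lebesgue (\<lambda>z. (2 * ?R / t ^ ?n) * \<eta> z)" using i\<eta> by simp
    show "(\<lambda>z. \<psi> z * \<eta> z) \<in> borel_measurable lebesgue"
      using cube_kernel_measurable(2)[OF t \<psi>] cube_kernel_measurable(2)[OF st(1) \<eta>] by simp
    show "AE z in lebesgue. norm (\<psi> z * \<eta> z) \<le> norm (2 * ?R / t ^ ?n * \<eta> z)"
    proof (intro AE_I2)
      fix z
      show "norm (\<psi> z * \<eta> z) \<le> norm (2 * ?R / t ^ ?n * \<eta> z)"
        using mult_right_mono[OF cube_kernel_bound[OF t \<psi>, of z], of "\<bar>\<eta> z\<bar>"] t by (simp add: abs_mult)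
    qed
  qed
  define B where "B = ball y (?R * s)"
  have "(LINT z|lebesgue. \<psi> z * \<eta> z) = (LINT z|lebesgue. \<psi> z * \<eta> z) - \<psi> y * (LINT z|lebesgue. \<eta> z)"
    using \<eta> by (simp add: cube_kernels_def)
  also have "\<dots> = (LINT z|lebesgue. (\<psi> z - \<psi> y) * \<eta> z)"
    using i i\<eta> by (simp add: left_diff_distrib)
  finally have "\<bar>LINT z|lebesgue. \<psi> z * \<eta> z\<bar> \<le> (LINT z|lebesgue. \<bar>(\<psi> z - \<psi> y) * \<eta> z\<bar>)"
    by (simp add: integral_abs_bound)
  also have "\<dots> \<le> (LINT z|lebesgue. ((?R * ((s/t) powr \<alpha>) / t ^ ?n) * (2 * ?R / s ^ ?n)) * indicator B z)"
  proof (rule integral_mono)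
    show "integrable lebesgue (\<lambda>z. \<bar>(\<psi> z - \<psi> y) * \<eta> z\<bar>)"
      using i i\<eta> by (intro integrable_abs) (simp add: left_diff_distrib)
    show "integrable lebesgue (\<lambda>z. ((?R * ((s/t) powr \<alpha>) / t ^ ?n) * (2 * ?R / s ^ ?n)) * indicator B z)"
      using st by (intro integrable_mult_right integrable_real_indicator) (auto simp: B_def)
    fix z
    show "\<bar>(\<psi> z - \<psi> y) * \<eta> z\<bar> \<le> ((?R * ((s/t) powr \<alpha>) / t ^ ?n) * (2 * ?R / s ^ ?n)) * indicator B z"
    proof (cases "z \<in> nbhd s y")
      case True
      then have zB: "z \<in> B" using nbhd_subset_ball[OF st(1), of y] by (auto simp: B_def)
      then have d: "norm (z - y) \<le> ?R * s" by (simp add: B_def dist_norm norm_minus_commute)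
      have "(norm (z - y) / t) powr \<alpha> \<le> (?R * (s/t)) powr \<alpha>"
        using d t \<alpha> by (intro powr_mono2) (auto simp: divide_right_mono)
      also have "\<dots> = ?R powr \<alpha> * (s/t) powr \<alpha>" using st t by (intro powr_mult)
      also have "\<dots> \<le> ?R * (s/t) powr \<alpha>" using \<alpha> by (intro mult_right_mono powr_le_max1) auto
      finally have "(norm (z - y) / t) powr \<alpha> / t ^ ?n \<le> ?R * ((s/t) powr \<alpha>) / t ^ ?n"
        using t by (intro divide_right_mono) auto
      moreover have "\<bar>\<psi> z - \<psi> y\<bar> \<le> (norm (z - y) / t) powr \<alpha> / t ^ ?n"
        using \<psi> by (simp add: cube_kernels_def)
      ultimately have "\<bar>\<psi> z - \<psi> y\<bar> \<le> ?R * ((s/t) powr \<alpha>) / t ^ ?n" by linarith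
      moreover have "\<bar>\<eta> z\<bar> \<le> 2 * ?R / s ^ ?n" by (rule cube_kernel_bound[OF st(1) \<eta>])
      ultimately have "\<bar>\<psi> z - \<psi> y\<bar> * \<bar>\<eta> z\<bar> \<le> (?R * ((s/t) powr \<alpha>) / t ^ ?n) * (2 * ?R / s ^ ?n)"
        using t by (intro mult_mono) auto
      then show ?thesis using zB by (simp add: abs_mult)
    next
      case False
      then show ?thesis using \<eta> st t by (simp add: cube_kernels_def)
    qed
  qed
  also have "\<dots> = ((?R * ((s/t) powr \<alpha>) / t ^ ?n) * (2 * ?R / s ^ ?n)) * (unit_ball_vol ?n * (?R * s) ^ ?n)"
    using st by (simp add: B_def measure_def emeasure_ball)
  also have "\<dots> = 2 * ?R * ?R * unit_ball_vol ?n * ?R ^ ?n * ((s/t) powr \<alpha> / t ^ ?n)"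
    using st t by (simp add: power_mult_distrib)
  finally show "\<bar>LINT z|lebesgue. \<psi> z * \<eta> z\<bar> \<le> \<dots>" .
qed

end

lemma Schur_finite:
  fixes \<kappa> :: "'q \<Rightarrow> 'q \<Rightarrow> real"
  assumes S: "finite S" and v: "\<And>q. q \<in> S \<Longrightarrow> 0 \<le> v q"
    and \<kappa>: "\<And>q r. q \<in> S \<Longrightarrow> r \<in> S \<Longrightarrow> 0 \<le> \<kappa> q r \<and> \<kappa> q r = \<kappa> r q"
    and M: "\<And>q. q \<in> S \<Longrightarrow> (\<Sum>r\<in>S. v r * \<kappa> q r) \<le> M"
  shows "(\<Sum>q\<in>S. \<Sum>r\<in>S. (v q * \<bar>c q\<bar>) * (v r * \<bar>c r\<bar>) * \<kappa> q r) \<le> M * (\<Sum>q\<in>S. v q * (c q)\<^sup>2)"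
proof -
  have am: "\<bar>a\<bar> * \<bar>b\<bar> \<le> (a\<^sup>2 + b\<^sup>2) / 2" for a b :: real
    using sum_squares_bound[of "\<bar>a\<bar>" "\<bar>b\<bar>"] by simp
  have "(\<Sum>q\<in>S. \<Sum>r\<in>S. (v q * \<bar>c q\<bar>) * (v r * \<bar>c r\<bar>) * \<kappa> q r)
     \<le> (\<Sum>q\<in>S. \<Sum>r\<in>S. v q * v r * \<kappa> q r * (((c q)\<^sup>2 + (c r)\<^sup>2) / 2))"
  proof (intro sum_mono)
    fix q r assume qr: "q \<in> S" "r \<in> S"
    have "(v q * v r * \<kappa> q r) * (\<bar>c q\<bar> * \<bar>c r\<bar>) \<le> (v q * v r * \<kappa> q r) * (((c q)\<^sup>2 + (c r)\<^sup>2) / 2)"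
      using qr v \<kappa> by (intro mult_left_mono am) auto
    then show "(v q * \<bar>c q\<bar>) * (v r * \<bar>c r\<bar>) * \<kappa> q r \<le> v q * v r * \<kappa> q r * (((c q)\<^sup>2 + (c r)\<^sup>2) / 2)"
      by (simp add: mult_ac)
  qed
  also have "\<dots> = (\<Sum>q\<in>S. \<Sum>r\<in>S. v q * v r * \<kappa> q r * (c q)\<^sup>2 / 2) + (\<Sum>q\<in>S. \<Sum>r\<in>S. v q * v r * \<kappa> q r * (c r)\<^sup>2 / 2)"
    by (simp add: sum.distrib[symmetric] algebra_simps add_divide_distrib)
  also have "(\<Sum>q\<in>S. \<Sum>r\<in>S. v q * v r * \<kappa> q r * (c r)\<^sup>2 / 2) = (\<Sum>q\<in>S. \<Sum>r\<in>S. v q * v r * \<kappa> q r * (c q)\<^sup>2 / 2)"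
  proof -
    have "(\<Sum>q\<in>S. \<Sum>r\<in>S. v q * v r * \<kappa> q r * (c r)\<^sup>2 / 2) = (\<Sum>r\<in>S. \<Sum>q\<in>S. v q * v r * \<kappa> q r * (c r)\<^sup>2 / 2)"
      by (rule sum.swap)
    also have "\<dots> = (\<Sum>q\<in>S. \<Sum>r\<in>S. v q * v r * \<kappa> q r * (c q)\<^sup>2 / 2)"
      using \<kappa> by (intro sum.cong refl) (simp add: mult_ac)
    finally show ?thesis .
  qed
  also have "(\<Sum>q\<in>S. \<Sum>r\<in>S. v q * v r * \<kappa> q r * (c q)\<^sup>2 / 2) + (\<Sum>q\<in>S. \<Sum>r\<in>S. v q * v r * \<kappa> q r * (c q)\<^sup>2 / 2)
     = (\<Sum>q\<in>S. v q * (c q)\<^sup>2 * (\<Sum>r\<in>S. v r * \<kappa> q r))"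
    by (simp add: sum.distrib[symmetric] sum_distrib_left mult_ac)
  also have "\<dots> \<le> (\<Sum>q\<in>S. v q * (c q)\<^sup>2 * M)"
    using v M by (intro sum_mono mult_left_mono) auto
  finally show ?thesis by (simp add: sum_distrib_left mult_ac)
qed

text \<open>All cubes of one generation.\<close>

lemma enumerate_cubes:
  fixes s :: real
  assumes s: "0 < s"
  shows "\<exists>(A :: nat \<Rightarrow> 'a::euclidean_space set) a. disjoint_family A \<and> (\<Union>n. A n) = UNIV \<and> (\<forall>n. A n = {} \<or> A n = cube s (a n))"
proof -
  interpret stopping s "\<lambda>i (x::'a). i = 0"
    using s by unfold_locales auto
  have Q: "Q x = cube s x" for x
    unfolding stop_cube_def first_level_def by simp
  from enumerate obtain A :: "nat \<Rightarrow> 'a set" where A: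
    "disjoint_family A \<and> (\<Union>n. A n) = \<Omega> \<and> (\<forall>n. A n = {} \<or> (\<exists>x\<in>\<Omega>. A n = Q x))" ..
  then have "\<forall>n. \<exists>x. A n = {} \<or> A n = cube s x" unfolding Q by blast
  then obtain a where "\<forall>n. A n = {} \<or> A n = cube s (a n)" by metis
  moreover have "disjoint_family A" "(\<Union>n. A n) = UNIV" using A by auto
  ultimately show ?thesis by blast
qed

lemma nn_integral_constant_on_cubes:
  fixes h :: "'a::euclidean_space \<Rightarrow> ennreal" and A :: "nat \<Rightarrow> 'a set"
  assumes h: "\<And>x y. y \<in> cube s x \<Longrightarrow> h y = h x"
    and dj: "disjoint_family A" and un: "(\<Union>n. A n) = UNIV" and A: "\<And>n. A n = {} \<or> A n = cube s (a n)"
  shows "(\<integral>\<^sup>+x. h x \<partial>lebesgue) = (\<Sum>n. emeasure lebesgue (A n) * h (a n))"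
proof -
  have sA: "A n \<in> sets lebesgue" for n using A[of n] by auto
  have hb: "h \<in> borel_measurable lebesgue"
    by (rule measurable_completion) (use measurable_constant_on_cubes[of s h borel] h in simp)
  have "(\<integral>\<^sup>+x. h x \<partial>lebesgue) = (\<integral>\<^sup>+x. (\<Sum>n. h x * indicator (A n) x) \<partial>lebesgue)"
    using dj by (intro nn_integral_cong) (simp add: suminf_indicator un)
  also have "\<dots> = (\<Sum>n. \<integral>\<^sup>+x. h x * indicator (A n) x \<partial>lebesgue)"
    using hb sA by (intro nn_integral_suminf borel_measurable_times_ennreal borel_measurable_indicator)
  also have "\<dots> = (\<Sum>n. emeasure lebesgue (A n) * h (a n))"
  proof (intro suminf_cong)
    fix n
    have "h x * indicator (A n) x = h (a n) * indicator (A n) x" for x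
      using A[of n] h[of x "a n"] by (auto simp: indicator_def)
    then have "(\<integral>\<^sup>+x. h x * indicator (A n) x \<partial>lebesgue) = (\<integral>\<^sup>+x. h (a n) * indicator (A n) x \<partial>lebesgue)"
      by simp
    also have "\<dots> = h (a n) * emeasure lebesgue (A n)" using sA[of n] by (rule nn_integral_cmult_indicator)
    finally show "(\<integral>\<^sup>+x. h x * indicator (A n) x \<partial>lebesgue) = emeasure lebesgue (A n) * h (a n)"
      by (simp add: mult.commute)
  qed
  finally show ?thesis .
qed

context
  fixes \<alpha> :: real assumes \<alpha>: "0 < \<alpha>" "\<alpha> \<le> 1"
begin

lemma almost_orthogonal_sum:
  fixes f :: "'a::euclidean_space \<Rightarrow> real" and \<psi> :: "'q \<Rightarrow> 'a \<Rightarrow> real"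
  assumes S: "finite S" and v: "\<And>q. q \<in> S \<Longrightarrow> 0 \<le> v q"
    and \<kappa>: "\<And>q r. q \<in> S \<Longrightarrow> r \<in> S \<Longrightarrow> 0 \<le> \<kappa> q r \<and> \<kappa> q r = \<kappa> r q"
    and M: "\<And>q. q \<in> S \<Longrightarrow> (\<Sum>r\<in>S. v r * \<kappa> q r) \<le> M" and M0: "0 \<le> M"
    and t: "\<And>q. q \<in> S \<Longrightarrow> 0 < t q" and \<psi>: "\<And>q. q \<in> S \<Longrightarrow> \<psi> q \<in> cube_kernels \<alpha> (t q) (x q)"
    and ip: "\<And>q r. q \<in> S \<Longrightarrow> r \<in> S \<Longrightarrow> integrable lebesgue (\<lambda>z. \<psi> q z * \<psi> r z) \<and> \<bar>LINT z|lebesgue. \<psi> q z * \<psi> r z\<bar> \<le> \<kappa> q r"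
    and f: "f \<in> borel_measurable lebesgue"
    and fi: "\<And>q. q \<in> S \<Longrightarrow> integrable lebesgue (\<lambda>z. f z * \<psi> q z)"
  shows "ennreal (\<Sum>q\<in>S. v q * (LINT z|lebesgue. f z * \<psi> q z)\<^sup>2) \<le> ennreal M * (\<integral>\<^sup>+z. ennreal ((f z)\<^sup>2) \<partial>lebesgue)"
proof -
  define c where "c q = (LINT z|lebesgue. f z * \<psi> q z)" for q
  define h where "h z = (\<Sum>q\<in>S. v q * c q * \<psi> q z)" for z
  define T where "T = (\<Sum>q\<in>S. v q * (c q)\<^sup>2)"
  have T0: "0 \<le> T" unfolding T_def using v by (intro sum_nonneg) auto
  have hm: "h \<in> borel_measurable lebesgue" unfolding h_def
    using cube_kernel_measurable(2)[OF \<alpha> t \<psi>] by (intro borel_measurable_sum borel_measurable_times) auto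
  have Tf: "T = (LINT z|lebesgue. f z * h z)"
  proof -
    have "T = (\<Sum>q\<in>S. LINT z|lebesgue. v q * c q * (f z * \<psi> q z))"
      unfolding T_def by (intro sum.cong) (auto simp: c_def power2_eq_square)
    also have "\<dots> = (LINT z|lebesgue. (\<Sum>q\<in>S. v q * c q * (f z * \<psi> q z)))"
      using fi by (intro Bochner_Integration.integral_sum[symmetric]) auto
    also have "\<dots> = (LINT z|lebesgue. f z * h z)"
      by (intro Bochner_Integration.integral_cong) (auto simp: h_def sum_distrib_left mult_ac)
    finally show ?thesis .
  qed
  have sqh: "(h z)\<^sup>2 = (\<Sum>q\<in>S. \<Sum>r\<in>S. (v q * c q) * (v r * c r) * (\<psi> q z * \<psi> r z))" for z
    unfolding h_def power2_eq_square sum_product by (intro sum.cong refl) (simp add: mult_ac)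
  have ih: "integrable lebesgue (\<lambda>z. (h z)\<^sup>2)"
    unfolding sqh using ip by (intro Bochner_Integration.integrable_sum integrable_mult_right) auto
  have "(LINT z|lebesgue. (h z)\<^sup>2) = (\<Sum>q\<in>S. \<Sum>r\<in>S. LINT z|lebesgue. (v q * c q) * (v r * c r) * (\<psi> q z * \<psi> r z))"
    unfolding sqh using ip
    by (subst Bochner_Integration.integral_sum, force intro!: Bochner_Integration.integrable_sum integrable_mult_right)
       (intro sum.cong refl Bochner_Integration.integral_sum integrable_mult_right, auto)
  also have "\<dots> = (\<Sum>q\<in>S. \<Sum>r\<in>S. (v q * c q) * (v r * c r) * (LINT z|lebesgue. \<psi> q z * \<psi> r z))"
    by simp
  also have "\<dots> \<le> (\<Sum>q\<in>S. \<Sum>r\<in>S. (v q * \<bar>c q\<bar>) * (v r * \<bar>c r\<bar>) * \<kappa> q r)"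
  proof (intro sum_mono)
    fix q r assume qr: "q \<in> S" "r \<in> S"
    have "(v q * c q) * (v r * c r) * (LINT z|lebesgue. \<psi> q z * \<psi> r z)
      \<le> \<bar>(v q * c q) * (v r * c r)\<bar> * \<bar>LINT z|lebesgue. \<psi> q z * \<psi> r z\<bar>"
      by (metis abs_ge_self abs_mult)
    also have "\<dots> \<le> \<bar>(v q * c q) * (v r * c r)\<bar> * \<kappa> q r"
      using ip qr by (intro mult_left_mono) auto
    finally show "(v q * c q) * (v r * c r) * (LINT z|lebesgue. \<psi> q z * \<psi> r z) \<le> (v q * \<bar>c q\<bar>) * (v r * \<bar>c r\<bar>) * \<kappa> q r"
      using v[OF qr(1)] v[OF qr(2)] by (simp add: abs_mult)
  qed
  also have "\<dots> \<le> M * T" unfolding T_def by (rule Schur_finite[OF S v \<kappa> M])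
  finally have hT: "(LINT z|lebesgue. (h z)\<^sup>2) \<le> M * T" .
  have "ennreal T \<le> (\<integral>\<^sup>+z. ennreal \<bar>f z\<bar> * ennreal \<bar>h z\<bar> \<partial>lebesgue)"
    using ennreal_norm_integral_le[of lebesgue "\<lambda>z. f z * h z"] T0 by (simp add: Tf[symmetric] abs_mult ennreal_mult)
  then have "(ennreal T)\<^sup>2 \<le> (\<integral>\<^sup>+z. ennreal \<bar>f z\<bar> * ennreal \<bar>h z\<bar> \<partial>lebesgue)\<^sup>2"
    by (intro power_mono) auto
  also have "\<dots> \<le> (\<integral>\<^sup>+z. (ennreal \<bar>f z\<bar>)\<^sup>2 \<partial>lebesgue) * (\<integral>\<^sup>+z. (ennreal \<bar>h z\<bar>)\<^sup>2 \<partial>lebesgue)"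
  proof -
    note [measurable] = f hm
    show ?thesis by (intro Cauchy_Schwarz_nn_integral) measurable
  qed
  also have "(\<integral>\<^sup>+z. (ennreal \<bar>h z\<bar>)\<^sup>2 \<partial>lebesgue) = ennreal (LINT z|lebesgue. (h z)\<^sup>2)"
    using ih by (subst nn_integral_eq_integral[symmetric]) (auto simp: ennreal_power)
  also have "\<dots> \<le> ennreal (M * T)" using hT by (rule ennreal_leI)
  finally have le: "(ennreal T)\<^sup>2 \<le> (\<integral>\<^sup>+z. (ennreal \<bar>f z\<bar>)\<^sup>2 \<partial>lebesgue) * ennreal (M * T)"
    by (simp add: mult_left_mono)
  have "ennreal T \<le> ennreal M * (\<integral>\<^sup>+z. ennreal ((f z)\<^sup>2) \<partial>lebesgue)"
  proof (cases "T = 0")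
    case False
    then have T: "0 < T" using T0 by simp
    have "ennreal T * ennreal T \<le> ennreal T * (ennreal M * (\<integral>\<^sup>+z. ennreal ((f z)\<^sup>2) \<partial>lebesgue))"
    proof -
      have "(\<integral>\<^sup>+z. (ennreal \<bar>f z\<bar>)\<^sup>2 \<partial>lebesgue) = (\<integral>\<^sup>+z. ennreal ((f z)\<^sup>2) \<partial>lebesgue)"
        by (simp add: ennreal_power)
      moreover have "ennreal (M * T) = ennreal M * ennreal T" using T M0 by (simp add: ennreal_mult)
      ultimately show ?thesis using le by (simp add: power2_eq_square mult_ac)
    qed
    then show ?thesis using T by (subst (asm) ennreal_mult_le_mult_iff) auto
  qed simp
  then show ?thesis by (simp add: T_def c_def)
qed

lemma cube_kernel_integrable_mult:
  fixes f :: "'a::euclidean_space \<Rightarrow> complex"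
  assumes s: "0 < s" and \<psi>: "\<psi> \<in> cube_kernels \<alpha> s x" and f: "f \<in> borel_measurable lebesgue"
    and fin: "(\<integral>\<^sup>+z\<in>nbhd s x. ennreal (cmod (f z)) \<partial>lebesgue) < \<infinity>"
  shows "integrable lebesgue (\<lambda>z. f z * complex_of_real (\<psi> z))"
proof (rule Bochner_Integration.integrable_bound)
  let ?c = "2 * (real DIM('a) + 2) / s ^ DIM('a)"
  show "integrable lebesgue (\<lambda>z. ?c *\<^sub>R (indicator (nbhd s x) z *\<^sub>R f z))"
  proof (intro integrable_scaleR_right integrableI_bounded)
    show "(\<lambda>z. indicator (nbhd s x) z *\<^sub>R f z) \<in> borel_measurable lebesgue"
      using f by (intro borel_measurable_scaleR borel_measurable_indicator) auto
    have "(\<integral>\<^sup>+z. ennreal (norm (indicator (nbhd s x) z *\<^sub>R f z)) \<partial>lebesgue) = (\<integral>\<^sup>+z\<in>nbhd s x. ennreal (cmod (f z)) \<partial>lebesgue)"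
      by (intro nn_integral_cong) (auto simp: indicator_def)
    then show "(\<integral>\<^sup>+z. ennreal (norm (indicator (nbhd s x) z *\<^sub>R f z)) \<partial>lebesgue) < \<infinity>" using fin by simp
  qed
  show "(\<lambda>z. f z * complex_of_real (\<psi> z)) \<in> borel_measurable lebesgue"
  proof -
    note [measurable] = f cube_kernel_measurable(2)[OF \<alpha> s \<psi>]
    show ?thesis by measurable
  qed
  show "AE z in lebesgue. norm (f z * complex_of_real (\<psi> z)) \<le> norm (?c *\<^sub>R (indicator (nbhd s x) z *\<^sub>R f z))"
  proof (intro AE_I2)
    fix z
    have "\<bar>\<psi> z\<bar> * cmod (f z) \<le> ?c * cmod (f z)"
      by (intro mult_right_mono cube_kernel_bound[OF \<alpha> s \<psi>]) auto
    then show "norm (f z * complex_of_real (\<psi> z)) \<le> norm (?c *\<^sub>R (indicator (nbhd s x) z *\<^sub>R f z))"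
      using \<psi> s by (cases "z \<in> nbhd s x") (simp_all add: norm_mult mult.commute cube_kernels_def)
  qed
qed

lemma sum_geometric_dist:
  fixes \<rho> :: real
  assumes "0 \<le> \<rho>" "\<rho> < 1"
  shows "(\<Sum>j<I. \<rho> ^ ((i - j) + (j - i))) \<le> 2 / (1 - \<rho>)"
proof -
  have geo: "(\<Sum>k<m. \<rho> ^ k) \<le> 1 / (1 - \<rho>)" for m
    using sum_le_suminf[of "\<lambda>k. \<rho> ^ k" "{..<m}"] assms by (simp add: summable_geometric suminf_geometric)
  have "(\<Sum>j<I. \<rho> ^ ((i - j) + (j - i))) \<le> (\<Sum>j\<in>{..<Suc i} \<union> {i..<i+I}. \<rho> ^ ((i - j) + (j - i)))"
    using assms by (intro sum_mono2) auto
  also have "\<dots> \<le> (\<Sum>j<Suc i. \<rho> ^ ((i - j) + (j - i))) + (\<Sum>j\<in>{i..<i+I}. \<rho> ^ ((i - j) + (j - i)))"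
    using assms by (subst sum.union_inter[symmetric]) (auto intro!: sum_nonneg)
  also have "(\<Sum>j<Suc i. \<rho> ^ ((i - j) + (j - i))) = (\<Sum>k<Suc i. \<rho> ^ k)"
    by (rule sum.reindex_bij_witness[of _ "\<lambda>k. i - k" "\<lambda>k. i - k"]) auto
  also have "(\<Sum>j\<in>{i..<i+I}. \<rho> ^ ((i - j) + (j - i))) = (\<Sum>k<I. \<rho> ^ k)"
    by (rule sum.reindex_bij_witness[of _ "\<lambda>k. i + k" "\<lambda>k. k - i"]) auto
  finally show ?thesis using geo[of "Suc i"] geo[of I] by simp
qed

lemma near_cubes_volume:
  fixes A :: "nat \<Rightarrow> 'a::euclidean_space set"
  assumes st: "0 < s" "0 < t" and dj: "disjoint_family A" and A: "\<And>n. A n = {} \<or> A n = cube s (a n)"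
  shows "(\<Sum>n<N. measure lebesgue (A n) * (if nbhd t x \<inter> nbhd s (a n) \<noteq> {} then 1 else 0))
    \<le> unit_ball_vol (DIM('a)) * (4 * (real DIM('a) + 2) * max s t) ^ DIM('a)"
proof -
  let ?near = "\<lambda>n. nbhd t x \<inter> nbhd s (a n) \<noteq> {}"
  let ?B = "ball x (4 * (real DIM('a) + 2) * max s t)"
  define J where "J = {n\<in>{..<N}. ?near n}"
  have sA: "A n \<in> sets lebesgue" for n using A[of n] by auto
  have fA: "emeasure lebesgue (A n) = ennreal (measure lebesgue (A n))" for n
    using A[of n] st by (intro emeasure_eq_ennreal_measure) (auto simp: emeasure_cube[simplified])
  have "ennreal (\<Sum>n\<in>J. measure lebesgue (A n)) = (\<Sum>n\<in>J. emeasure lebesgue (A n))"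
    by (simp add: fA[simplified] sum_ennreal)
  also have "\<dots> = emeasure lebesgue (\<Union>n\<in>J. A n)"
    using sA dj by (intro sum_emeasure) (auto simp: J_def disjoint_family_on_def)
  also have "\<dots> \<le> emeasure lebesgue ?B"
  proof (intro emeasure_mono UN_least)
    fix n assume n: "n \<in> J"
    show "A n \<subseteq> ?B"
    proof
      fix y assume "y \<in> A n"
      then have y: "dist (a n) y < real DIM('a) * s" using A[of n] cube_dist[OF st(1)] by auto
      obtain z where "z \<in> nbhd t x" "z \<in> nbhd s (a n)" using n by (auto simp: J_def)
      then have z: "dist x z < (real DIM('a) + 2) * t" "dist (a n) z < (real DIM('a) + 2) * s"
        using nbhd_subset_ball[OF st(2), of x] nbhd_subset_ball[OF st(1), of "a n"] by auto
      let ?d = "(real DIM('a) + 2) * max s t"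
      have "dist x y \<le> dist x z + dist (a n) z + dist (a n) y"
        using dist_triangle[of x y z] dist_triangle[of z y "a n"] by (simp add: dist_commute)
      moreover have "(real DIM('a) + 2) * t \<le> ?d" "(real DIM('a) + 2) * s \<le> ?d" "real DIM('a) * s \<le> ?d"
        using st by (auto intro!: mult_left_mono mult_mono)
      moreover have "0 < ?d" using st by (auto intro!: mult_pos_pos simp: max_def)
      ultimately have "dist x y < 4 * ?d" using z y by linarith
      then show "y \<in> ?B" by (simp add: mult_ac)
    qed
  qed simp
  also have "\<dots> = ennreal (unit_ball_vol (DIM('a)) * (4 * (real DIM('a) + 2) * max s t) ^ DIM('a))"
    using st by (intro emeasure_lebesgue_ball) (auto simp: max_def)
  finally have "(\<Sum>n\<in>J. measure lebesgue (A n)) \<le> unit_ball_vol (DIM('a)) * (4 * (real DIM('a) + 2) * max s t) ^ DIM('a)"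
    using st by (subst (asm) ennreal_le_iff) (auto simp: max_def intro!: mult_nonneg_nonneg)
  moreover have "(\<Sum>n<N. measure lebesgue (A n) * (if ?near n then 1 else 0)) = (\<Sum>n\<in>J. measure lebesgue (A n))"
    unfolding J_def by (subst sum.inter_filter) (auto intro!: sum.cong)
  ultimately show ?thesis by simp
qed

end

lemma suminf_swap_ennreal:
  fixes u :: "nat \<Rightarrow> nat \<Rightarrow> ennreal"
  shows "(\<Sum>i j. u i j) = (\<Sum>j i. u i j)"
  using nn_integral_suminf[of "\<lambda>j i. u i j" "count_space UNIV"] by (simp add: nn_integral_count_space_nat)

lemma l2norm_square: "(l2norm F x)\<^sup>2 = (\<Sum>j. (ennreal (cmod (F j x)))\<^sup>2)"
  by (simp add: l2norm_def modulus_complex_def)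

lemma norm_le_l2norm: "ennreal (cmod (F j x)) \<le> l2norm F x"
proof -
  have "(ennreal (cmod (F j x)))\<^sup>2 \<le> (\<Sum>j. (ennreal (cmod (F j x)))\<^sup>2)"
    using sum_le_suminf[of "\<lambda>j. (ennreal (cmod (F j x)))\<^sup>2" "{j}"] by simp
  then have "epowr ((ennreal (cmod (F j x)))\<^sup>2) (1/2) \<le> epowr (\<Sum>j. (ennreal (cmod (F j x)))\<^sup>2) (1/2)"
    by (rule epowr_mono[rotated]) simp
  then show ?thesis by (simp add: l2norm_def modulus_complex_def)
qed

lemma borel_measurable_l2norm [measurable]:
  fixes F :: "nat \<Rightarrow> 'a::euclidean_space \<Rightarrow> complex"
  assumes [measurable]: "\<And>j. F j \<in> borel_measurable M"
  shows "l2norm F \<in> borel_measurable M"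
  unfolding l2norm_def[abs_def] modulus_complex_def by measurable

definition "overlap_const (_ :: 'a::euclidean_space itself) =
  2 * (real DIM('a) + 2) * (real DIM('a) + 2) * unit_ball_vol (DIM('a)) * (real DIM('a) + 2) ^ DIM('a)"

context
  fixes \<alpha> :: real assumes \<alpha>: "0 < \<alpha>" "\<alpha> \<le> 1"
begin

lemma cube_sup_less_top:
  fixes f :: "'a::euclidean_space \<Rightarrow> complex"
  assumes s: "0 < s" and f: "f \<in> borel_measurable lebesgue"
    and fin: "(\<integral>\<^sup>+z\<in>nbhd s x. ennreal (cmod (f z)) \<partial>lebesgue) < \<infinity>"
  shows "cube_sup \<alpha> s x f < \<infinity>"
proof -
  have "ennreal (2 * (real DIM('a) + 2) / s ^ DIM('a)) * (\<integral>\<^sup>+z\<in>nbhd s x. ennreal (cmod (f z)) \<partial>lebesgue) < \<infinity>"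
    using fin by (simp add: ennreal_mult_less_top)
  with cube_sup_le[OF \<alpha> s f, of x] show ?thesis by (rule order.strict_trans1)
qed

lemma near_optimal_kernel:
  fixes f :: "'a::euclidean_space \<Rightarrow> complex"
  assumes s: "0 < s" and fin: "cube_sup \<alpha> s x f < \<infinity>"
  shows "\<exists>\<psi>\<in>cube_kernels \<alpha> s x. cube_sup \<alpha> s x f \<le> 2 * ennreal (cmod (LINT z|lebesgue. f z * complex_of_real (\<psi> z)))"
proof (cases "cube_sup \<alpha> s x f = 0")
  case True
  then show ?thesis using zero_cube_kernel[OF s] by force
next
  case False
  then obtain a where a: "cube_sup \<alpha> s x f = ennreal a" "0 < a"
    using fin by (cases "cube_sup \<alpha> s x f") (auto simp: less_le)
  then have "ennreal (a/2) < cube_sup \<alpha> s x f" by (simp add: ennreal_less_iff)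
  then obtain \<psi> where \<psi>: "\<psi> \<in> cube_kernels \<alpha> s x" "ennreal (a/2) < ennreal (cmod (LINT z|lebesgue. f z * complex_of_real (\<psi> z)))"
    unfolding cube_sup_def less_SUP_iff by blast
  have "ennreal a = 2 * ennreal (a/2)" using a by (simp flip: ennreal_numeral ennreal_mult')
  also have "\<dots> \<le> 2 * ennreal (cmod (LINT z|lebesgue. f z * complex_of_real (\<psi> z)))"
    using \<psi>(2) by (intro mult_left_mono less_imp_le) simp_all
  finally show ?thesis using \<psi>(1) a by auto
qed

lemma finite_cube_sum_L2:
  fixes f :: "'a::euclidean_space \<Rightarrow> complex" and A :: "nat \<Rightarrow> nat \<Rightarrow> 'a set"
  assumes s: "0 < s" and f: "f \<in> borel_measurable lebesgue"
    and fin: "\<And>t x. 0 < t \<Longrightarrow> (\<integral>\<^sup>+z\<in>nbhd t x. ennreal (cmod (f z)) \<partial>lebesgue) < \<infinity>"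
    and dj: "\<And>i. disjoint_family (A i)" and A: "\<And>i n. A i n = {} \<or> A i n = cube (s/2^i) (a i n)"
  shows "(\<Sum>i<I. \<Sum>n<N. emeasure lebesgue (A i n) * (cube_sup \<alpha> (s/2^i) (a i n) f)\<^sup>2)
    \<le> ennreal (8 * overlap_const TYPE('a) * (unit_ball_vol (DIM('a)) * (4 * (real DIM('a) + 2)) ^ DIM('a)) / (1 - (1/2) powr \<alpha>))
       * (\<integral>\<^sup>+z. (ennreal (cmod (f z)))\<^sup>2 \<partial>lebesgue)"
proof -
  define t where "t q = s / 2 ^ fst q" for q :: "nat \<times> nat"
  define x where "x q = a (fst q) (snd q)" for q
  define v where "v q = measure lebesgue (A (fst q) (snd q))" for q
  define S where "S = {..<I} \<times> {..<N}"
  define \<rho> where "\<rho> = (1/2::real) powr \<alpha>"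
  define K where "K = overlap_const TYPE('a)"
  define V where "V = unit_ball_vol (real DIM('a)) * (4 * (real DIM('a) + 2)) ^ DIM('a)"
  define near where "near q r \<longleftrightarrow> nbhd (t q) (x q) \<inter> nbhd (t r) (x r) \<noteq> {}" for q r
  define \<kappa> where "\<kappa> q r = (if near q r then K * (\<rho> ^ ((fst q - fst r) + (fst r - fst q)) / (max (t q) (t r)) ^ DIM('a)) else 0)" for q r
  define M where "M = 2 * K * V / (1 - \<rho>)"
  have \<rho>: "0 \<le> \<rho>" "\<rho> < 1" using \<alpha> powr_less_mono2[of \<alpha> "1/2" 1] by (auto simp: \<rho>_def)
  have K0: "0 \<le> K" by (simp add: K_def overlap_const_def)
  have V0: "0 \<le> V" by (simp add: V_def)
  have M0: "0 \<le> M" using \<rho> K0 V0 by (simp add: M_def)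
  have t: "0 < t q" for q using s by (simp add: t_def)
  have ratio: "(t r / t q) powr \<alpha> = \<rho> ^ (fst r - fst q)" if "fst q \<le> fst r" for q r
  proof -
    have "t r / t q = 2 ^ fst q / 2 ^ fst r" using s by (simp add: t_def)
    also have "\<dots> = (1/2) ^ (fst r - fst q)" using that by (simp add: power_diff power_one_over)
    finally show ?thesis by (simp add: \<rho>_def powr_power powr_realpow[symmetric] powr_powr mult.commute)
  qed
  have t_le: "t r \<le> t q" if "fst q \<le> fst r" for q r
    using that s unfolding t_def by (intro divide_left_mono) (auto simp: power_increasing)
  have "\<forall>q. \<exists>\<psi>\<in>cube_kernels \<alpha> (t q) (x q). cube_sup \<alpha> (t q) (x q) f \<le> 2 * ennreal (cmod (LINT z|lebesgue. f z * complex_of_real (\<psi> z)))"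
    using near_optimal_kernel[OF t cube_sup_less_top[OF t f fin[OF t]]] by blast
  then obtain \<psi> where \<psi>: "\<And>q. \<psi> q \<in> cube_kernels \<alpha> (t q) (x q)"
    and opt: "\<And>q. cube_sup \<alpha> (t q) (x q) f \<le> 2 * ennreal (cmod (LINT z|lebesgue. f z * complex_of_real (\<psi> q z)))"
    by metis
  have ip1: "integrable lebesgue (\<lambda>z. \<psi> q z * \<psi> r z) \<and> \<bar>LINT z|lebesgue. \<psi> q z * \<psi> r z\<bar> \<le> \<kappa> q r"
    if qr: "fst q \<le> fst r" for q r
  proof -
    note * = cube_kernel_inner[OF \<alpha> t t_le[OF qr] \<psi> \<psi>]
    show ?thesis
    proof (cases "near q r")
      case True
      then show ?thesis using * qr t_le[OF qr] unfolding \<kappa>_def ratio[OF qr] K_def overlap_const_def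
        by (simp add: max_def)
    next
      case False
      have "\<psi> q z * \<psi> r z = 0" for z
        using False \<psi>[of q] \<psi>[of r] unfolding near_def cube_kernels_def by auto
      then have "(\<lambda>z. \<psi> q z * \<psi> r z) = (\<lambda>_. 0)" by blast
      then show ?thesis using False by (simp add: \<kappa>_def)
    qed
  qed
  have \<kappa>: "0 \<le> \<kappa> q r \<and> \<kappa> q r = \<kappa> r q" for q r
    unfolding \<kappa>_def near_def using K0 \<rho> t[of q] t[of r] by (auto simp: max.commute add.commute Int_commute)
  have ip: "integrable lebesgue (\<lambda>z. \<psi> q z * \<psi> r z) \<and> \<bar>LINT z|lebesgue. \<psi> q z * \<psi> r z\<bar> \<le> \<kappa> q r" for q r
  proof (cases "fst q \<le> fst r")
    case False
    then have "fst r \<le> fst q" by simp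
    from ip1[OF this] show ?thesis using \<kappa>[of q r] by (simp add: mult.commute)
  qed (rule ip1)
  have v0: "0 \<le> v q" for q by (simp add: v_def)
  have M: "(\<Sum>r\<in>S. v r * \<kappa> q r) \<le> M" for q
  proof -
    have "(\<Sum>r\<in>S. v r * \<kappa> q r) = (\<Sum>j<I. \<Sum>n<N. v (j,n) * \<kappa> q (j,n))"
      unfolding S_def by (simp add: sum.cartesian_product)
    also have "\<dots> \<le> (\<Sum>j<I. (K * V) * \<rho> ^ ((fst q - j) + (j - fst q)))"
    proof (rule sum_mono)
      fix j
      define m where "m = max (t q) (s/2^j)"
      have m: "0 < m" using t[of q] by (simp add: m_def less_max_iff_disj)
      let ?e = "\<rho> ^ ((fst q - j) + (j - fst q))"
      have "(\<Sum>n<N. v (j,n) * \<kappa> q (j,n)) = (\<Sum>n<N. measure lebesgue (A j n) * (if nbhd (t q) (x q) \<inter> nbhd (s/2^j) (a j n) \<noteq> {} then 1 else 0)) * (K * (?e / m ^ DIM('a)))"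
        unfolding sum_distrib_right
        by (intro sum.cong refl) (simp add: v_def \<kappa>_def near_def t_def x_def m_def)
      also have "\<dots> \<le> (unit_ball_vol (DIM('a)) * (4 * (real DIM('a) + 2) * max (s/2^j) (t q)) ^ DIM('a)) * (K * (?e / m ^ DIM('a)))"
      proof (rule mult_right_mono)
        show "0 \<le> K * (?e / m ^ DIM('a))"
          using K0 \<rho>(1) m by (intro mult_nonneg_nonneg divide_nonneg_nonneg zero_le_power) auto
      qed (rule near_cubes_volume[OF \<alpha> _ t dj A], use s in simp)
      also have "\<dots> = (K * V) * ?e"
        using m by (simp add: V_def m_def max.commute power_mult_distrib)
      finally show "(\<Sum>n<N. v (j,n) * \<kappa> q (j,n)) \<le> (K * V) * ?e" .
    qed
    also have "\<dots> = (K * V) * (\<Sum>j<I. \<rho> ^ ((fst q - j) + (j - fst q)))"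
      by (simp add: sum_distrib_left)
    also have "\<dots> \<le> (K * V) * (2 / (1 - \<rho>))"
      using K0 V0 by (intro mult_left_mono sum_geometric_dist[OF \<alpha>] \<rho>) auto
    finally show ?thesis by (simp add: M_def mult_ac)
  qed
  have fint: "integrable lebesgue (\<lambda>z. f z * complex_of_real (\<psi> q z))" for q
    by (rule cube_kernel_integrable_mult[OF \<alpha> t \<psi> f fin[OF t]])
  define c where "c q = (LINT z|lebesgue. f z * complex_of_real (\<psi> q z))" for q
  have iRe: "integrable lebesgue (\<lambda>z. Re (f z) * \<psi> q z)" and cRe: "Re (c q) = (LINT z|lebesgue. Re (f z) * \<psi> q z)" for q
    using integrable_Re[OF fint[of q]] integral_Re[OF fint[of q]] by (simp_all add: c_def)
  have iIm: "integrable lebesgue (\<lambda>z. Im (f z) * \<psi> q z)" and cIm: "Im (c q) = (LINT z|lebesgue. Im (f z) * \<psi> q z)" for q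
    using integrable_Im[OF fint[of q]] integral_Im[OF fint[of q]] by (simp_all add: c_def)
  have mRe: "(\<lambda>z. Re (f z)) \<in> borel_measurable lebesgue" "(\<lambda>z. Im (f z)) \<in> borel_measurable lebesgue"
    using f by measurable
  have S: "finite S" by (simp add: S_def)
  have 1: "ennreal (\<Sum>q\<in>S. v q * (Re (c q))\<^sup>2) \<le> ennreal M * (\<integral>\<^sup>+z. ennreal ((Re (f z))\<^sup>2) \<partial>lebesgue)"
    unfolding cRe using almost_orthogonal_sum[OF \<alpha> S v0 \<kappa> M M0 t \<psi> ip mRe(1) iRe] by blast
  have 2: "ennreal (\<Sum>q\<in>S. v q * (Im (c q))\<^sup>2) \<le> ennreal M * (\<integral>\<^sup>+z. ennreal ((Im (f z))\<^sup>2) \<partial>lebesgue)"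
    unfolding cIm using almost_orthogonal_sum[OF \<alpha> S v0 \<kappa> M M0 t \<psi> ip mRe(2) iIm] by blast
  have "ennreal (\<Sum>q\<in>S. v q * (cmod (c q))\<^sup>2) = ennreal (\<Sum>q\<in>S. v q * (Re (c q))\<^sup>2) + ennreal (\<Sum>q\<in>S. v q * (Im (c q))\<^sup>2)"
    using v0 by (subst ennreal_plus[symmetric])
      (auto intro!: sum_nonneg simp: cmod_power2 distrib_left sum.distrib simp del: ennreal_plus)
  also have "\<dots> \<le> ennreal M * (\<integral>\<^sup>+z. ennreal ((Re (f z))\<^sup>2) \<partial>lebesgue) + ennreal M * (\<integral>\<^sup>+z. ennreal ((Im (f z))\<^sup>2) \<partial>lebesgue)"
    by (intro add_mono 1 2)
  also have "\<dots> = ennreal M * (\<integral>\<^sup>+z. ennreal ((Re (f z))\<^sup>2) + ennreal ((Im (f z))\<^sup>2) \<partial>lebesgue)"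
  proof -
    note [measurable] = mRe
    show ?thesis by (subst nn_integral_add) (auto simp: distrib_left)
  qed
  also have "(\<integral>\<^sup>+z. ennreal ((Re (f z))\<^sup>2) + ennreal ((Im (f z))\<^sup>2) \<partial>lebesgue) = (\<integral>\<^sup>+z. (ennreal (cmod (f z)))\<^sup>2 \<partial>lebesgue)"
    by (intro nn_integral_cong) (simp add: ennreal_power cmod_power2)
  finally have main: "ennreal (\<Sum>q\<in>S. v q * (cmod (c q))\<^sup>2) \<le> ennreal M * (\<integral>\<^sup>+z. (ennreal (cmod (f z)))\<^sup>2 \<partial>lebesgue)" .
  have em: "emeasure lebesgue (A i n) = ennreal (v (i,n))" for i n
    using A[of i n] s unfolding v_def fst_conv snd_conv
    by (intro emeasure_eq_ennreal_measure) (auto simp: emeasure_cube[simplified])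
  have "(\<Sum>i<I. \<Sum>n<N. emeasure lebesgue (A i n) * (cube_sup \<alpha> (s/2^i) (a i n) f)\<^sup>2)
     = (\<Sum>q\<in>S. ennreal (v q) * (cube_sup \<alpha> (t q) (x q) f)\<^sup>2)"
    unfolding S_def by (simp add: sum.cartesian_product em[simplified] t_def x_def split_beta')
  also have "\<dots> \<le> (\<Sum>q\<in>S. ennreal (v q) * (2 * ennreal (cmod (c q)))\<^sup>2)"
    using opt unfolding c_def by (intro sum_mono mult_left_mono power_mono) auto
  also have "\<dots> = ennreal (\<Sum>q\<in>S. 4 * (v q * (cmod (c q))\<^sup>2))"
    using v0 by (subst sum_ennreal[symmetric]) (auto simp: power_mult_distrib ennreal_power ennreal_mult mult_ac)
  also have "\<dots> = 4 * ennreal (\<Sum>q\<in>S. v q * (cmod (c q))\<^sup>2)"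
    using v0 by (simp add: sum_distrib_left[symmetric] ennreal_mult sum_nonneg)
  also have "\<dots> \<le> 4 * (ennreal M * (\<integral>\<^sup>+z. (ennreal (cmod (f z)))\<^sup>2 \<partial>lebesgue))"
    by (intro mult_left_mono main) simp
  also have "\<dots> = ennreal (4 * M) * (\<integral>\<^sup>+z. (ennreal (cmod (f z)))\<^sup>2 \<partial>lebesgue)"
    using M0 by (simp add: ennreal_mult mult.assoc)
  also have "4 * M = 8 * K * V / (1 - \<rho>)" by (simp add: M_def)
  finally show ?thesis by (simp only: K_def V_def \<rho>_def)
qed

lemma cube_sup_L2:
  fixes dummy :: "'a::euclidean_space itself"
  obtains C :: real where "0 \<le> C"
    "\<And>s (f :: 'a \<Rightarrow> complex). 0 < s \<Longrightarrow> f \<in> borel_measurable lebesgue \<Longrightarrow>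
      (\<Sum>i. \<integral>\<^sup>+x. (cube_sup \<alpha> (s/2^i) x f)\<^sup>2 \<partial>lebesgue) \<le> ennreal C * (\<integral>\<^sup>+z. (ennreal (cmod (f z)))\<^sup>2 \<partial>lebesgue)"
proof -
  define C where "C = max 1 (8 * overlap_const TYPE('a) * (unit_ball_vol (DIM('a)) * (4 * (real DIM('a) + 2)) ^ DIM('a)) / (1 - (1/2) powr \<alpha>))"
  have C: "1 \<le> C" by (simp add: C_def)
  show ?thesis
  proof (rule that[of C])
    fix s :: real and f :: "'a \<Rightarrow> complex"
    assume s: "0 < s" and f: "f \<in> borel_measurable lebesgue"
    let ?I = "\<integral>\<^sup>+z. (ennreal (cmod (f z)))\<^sup>2 \<partial>lebesgue"
    show "(\<Sum>i. \<integral>\<^sup>+x. (cube_sup \<alpha> (s/2^i) x f)\<^sup>2 \<partial>lebesgue) \<le> ennreal C * ?I"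
    proof (cases "?I = \<infinity>")
      case True
      then show ?thesis using C by (simp add: ennreal_mult_top)
    next
      case False
      note [measurable] = f
      have fin: "(\<integral>\<^sup>+z\<in>nbhd t x. ennreal (cmod (f z)) \<partial>lebesgue) < \<infinity>" if t: "0 < t" for t x
      proof -
        have [measurable]: "nbhd t x \<in> sets lebesgue" by simp
        have "(\<integral>\<^sup>+z. ennreal (cmod (f z)) * indicator (nbhd t x) z \<partial>lebesgue)\<^sup>2
            \<le> ?I * (\<integral>\<^sup>+z. (indicator (nbhd t x) z)\<^sup>2 \<partial>lebesgue)"
          by (rule Cauchy_Schwarz_nn_integral) measurable
        also have "(\<integral>\<^sup>+z. (indicator (nbhd t x) z)\<^sup>2 \<partial>lebesgue) = emeasure lebesgue (nbhd t x)"
          proof -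
          have "(indicator (nbhd t x) z)\<^sup>2 = (indicator (nbhd t x) z :: ennreal)" for z by (simp add: indicator_def)
          then show ?thesis by simp
        qed
        also have "?I * emeasure lebesgue (nbhd t x) \<le> ?I * emeasure lebesgue (ball x ((real DIM('a) + 2) * t))"
          by (intro mult_left_mono emeasure_mono nbhd_subset_ball t) auto
        also have "\<dots> < \<infinity>" using False by (simp add: ennreal_mult_less_top less_top)
        finally show ?thesis by (simp add: power_less_top_ennreal)
      qed
      have "\<forall>i. \<exists>A a. disjoint_family A \<and> (\<Union>n. A n) = (UNIV::'a set) \<and> (\<forall>n::nat. A n = {} \<or> A n = cube (s/2^i) (a n))"
        using enumerate_cubes s by (metis zero_less_divide_iff zero_less_numeral zero_less_power)
      then obtain A :: "nat \<Rightarrow> nat \<Rightarrow> 'a set" and a where A: "\<And>i. disjoint_family (A i)" "\<And>i. (\<Union>n. A i n) = UNIV"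
        "\<And>i n. A i n = {} \<or> A i n = cube (s/2^i) (a i n)"
        by metis
      let ?u = "\<lambda>i n. emeasure lebesgue (A i n) * (cube_sup \<alpha> (s/2^i) (a i n) f)\<^sup>2"
      have "(\<Sum>i. \<integral>\<^sup>+x. (cube_sup \<alpha> (s/2^i) x f)\<^sup>2 \<partial>lebesgue) = (\<Sum>i. \<Sum>n. ?u i n)"
        by (intro suminf_cong nn_integral_constant_on_cubes[OF _ A(1,2,3)]) (simp add: cube_sup_cong)
      also have "\<dots> \<le> ennreal C * ?I"
      proof (rule suminf_le_const[OF summableI])
        fix I
        have "(\<Sum>i<I. \<Sum>n. ?u i n) = (\<Sum>n. \<Sum>i<I. ?u i n)"
          by (rule suminf_sum[symmetric]) (rule summableI)
        also have "\<dots> \<le> ennreal C * ?I"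
        proof (rule suminf_le_const[OF summableI])
          fix N
          have "(\<Sum>n<N. \<Sum>i<I. ?u i n) = (\<Sum>i<I. \<Sum>n<N. ?u i n)" by (rule sum.swap)
          also have "\<dots> \<le> ennreal (8 * overlap_const TYPE('a) * (unit_ball_vol (DIM('a)) * (4 * (real DIM('a) + 2)) ^ DIM('a)) / (1 - (1/2) powr \<alpha>)) * ?I"
            by (rule finite_cube_sum_L2[OF s f fin A(1) A(3)])
          also have "\<dots> \<le> ennreal C * ?I"
            by (intro mult_right_mono ennreal_leI) (auto simp: C_def)
          finally show "(\<Sum>n<N. \<Sum>i<I. ?u i n) \<le> ennreal C * ?I" .
        qed
        finally show "(\<Sum>i<I. \<Sum>n. ?u i n) \<le> ennreal C * ?I" .
      qed
      finally show ?thesis .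
    qed
  qed (use C in simp)
qed

theorem dyadic_sq_L2:
  fixes dummy :: "'a::euclidean_space itself"
  obtains C :: real where "0 \<le> C"
    "\<And>s (F :: nat \<Rightarrow> 'a \<Rightarrow> complex). 0 < s \<Longrightarrow> (\<And>j. F j \<in> borel_measurable lebesgue) \<Longrightarrow>
      (\<integral>\<^sup>+x. dyadic_sq \<alpha> s F x \<partial>lebesgue) \<le> ennreal C * (\<integral>\<^sup>+z. (l2norm F z)\<^sup>2 \<partial>lebesgue)"
proof -
  obtain C where C: "0 \<le> C" "\<And>s (f :: 'a \<Rightarrow> complex). 0 < s \<Longrightarrow> f \<in> borel_measurable lebesgue \<Longrightarrow>
      (\<Sum>i. \<integral>\<^sup>+x. (cube_sup \<alpha> (s/2^i) x f)\<^sup>2 \<partial>lebesgue) \<le> ennreal C * (\<integral>\<^sup>+z. (ennreal (cmod (f z)))\<^sup>2 \<partial>lebesgue)"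
    by (rule cube_sup_L2[where 'a='a]) blast
  show ?thesis
  proof (rule that[OF C(1)])
    fix s :: real and F :: "nat \<Rightarrow> 'a \<Rightarrow> complex"
    assume s: "0 < s" and F[measurable]: "\<And>j. F j \<in> borel_measurable lebesgue"
    have "(\<integral>\<^sup>+x. dyadic_sq \<alpha> s F x \<partial>lebesgue) = (\<Sum>i j. \<integral>\<^sup>+x. (cube_sup \<alpha> (s/2^i) x (F j))\<^sup>2 \<partial>lebesgue)"
      unfolding dyadic_sq_def by (simp add: nn_integral_suminf)
    also have "\<dots> = (\<Sum>j i. \<integral>\<^sup>+x. (cube_sup \<alpha> (s/2^i) x (F j))\<^sup>2 \<partial>lebesgue)"
      by (rule suminf_swap_ennreal)
    also have "\<dots> \<le> (\<Sum>j. ennreal C * (\<integral>\<^sup>+z. (ennreal (cmod (F j z)))\<^sup>2 \<partial>lebesgue))"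
      by (intro suminf_le C(2) s F) auto
    also have "\<dots> = ennreal C * (\<integral>\<^sup>+z. (l2norm F z)\<^sup>2 \<partial>lebesgue)"
      unfolding l2norm_square by (simp add: nn_integral_suminf)
    finally show "(\<integral>\<^sup>+x. dyadic_sq \<alpha> s F x \<partial>lebesgue) \<le> ennreal C * (\<integral>\<^sup>+z. (l2norm F z)\<^sup>2 \<partial>lebesgue)" .
  qed
qed

end

section \<open>Calderon--Zygmund decomposition\<close>

lemma wmeas_eq_emeasure:
  "w \<in> borel_measurable lebesgue \<Longrightarrow> E \<in> sets lebesgue \<Longrightarrow> wmeas w E = emeasure (density lebesgue w) E"
  by (simp add: wmeas_def emeasure_density)

lemma nn_integral_subset_le:
  fixes u :: "'a \<Rightarrow> ennreal"
  shows "A \<subseteq> B \<Longrightarrow> (\<integral>\<^sup>+x\<in>A. u x \<partial>M) \<le> (\<integral>\<^sup>+x\<in>B. u x \<partial>M)"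
  by (intro nn_integral_mono mult_left_mono) (auto simp: indicator_def)

lemma wmeas_mono: "E \<subseteq> E' \<Longrightarrow> wmeas w E \<le> wmeas w E'"
  unfolding wmeas_def by (intro nn_integral_mono mult_left_mono) (auto simp: indicator_def)

lemma wmeas_Un_le:
  assumes [measurable]: "w \<in> borel_measurable lebesgue" "A \<in> sets lebesgue" "B \<in> sets lebesgue"
  shows "wmeas w (A \<union> B) \<le> wmeas w A + wmeas w B"
proof -
  have "wmeas w (A \<union> B) \<le> (\<integral>\<^sup>+x. w x * indicator A x + w x * indicator B x \<partial>lebesgue)"
    unfolding wmeas_def by (intro nn_integral_mono) (auto simp: indicator_def)
  also have "\<dots> = wmeas w A + wmeas w B"
    unfolding wmeas_def by (rule nn_integral_add) measurable
  finally show ?thesis .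
qed

lemma wmeas_level_set:
  assumes [measurable]: "w \<in> borel_measurable lebesgue" "h \<in> borel_measurable lebesgue" and c: "0 < c"
  shows "wmeas w {x. ennreal c < h x} \<le> ennreal (1/c) * (\<integral>\<^sup>+x. h x * w x \<partial>lebesgue)"
proof -
  have "wmeas w {x. ennreal c < h x} \<le> (\<integral>\<^sup>+x. ennreal (1/c) * (h x * w x) \<partial>lebesgue)"
    unfolding wmeas_def
  proof (intro nn_integral_mono)
    fix x
    show "w x * indicator {x. ennreal c < h x} x \<le> ennreal (1/c) * (h x * w x)"
    proof (cases "ennreal c < h x")
      case True
      have "1 = ennreal (1/c) * ennreal c" using c by (simp flip: ennreal_mult')
      also have "\<dots> \<le> ennreal (1/c) * h x" using True by (intro mult_left_mono) auto
      finally have "1 * w x \<le> (ennreal (1/c) * h x) * w x" by (rule mult_right_mono) simp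
      then show ?thesis using True by (simp add: mult.assoc)
    qed simp
  qed
  also have "\<dots> = ennreal (1/c) * (\<integral>\<^sup>+x. h x * w x \<partial>lebesgue)"
    by (rule nn_integral_cmult) measurable
  finally show ?thesis .
qed

locale CZ =
  fixes s \<theta> :: real and F :: "nat \<Rightarrow> 'a::euclidean_space \<Rightarrow> complex"
  assumes s: "0 < s" and \<theta>: "0 < \<theta>" and F [measurable]: "\<And>j. F j \<in> borel_measurable lebesgue"
    and total: "(\<integral>\<^sup>+x. l2norm F x \<partial>lebesgue) \<le> ennreal (\<theta> * s ^ DIM('a))"
begin

definition heavy :: "nat \<Rightarrow> 'a \<Rightarrow> bool" where
  "heavy i x \<longleftrightarrow> ennreal (\<theta> * (s/2^i) ^ DIM('a)) < (\<integral>\<^sup>+y\<in>cube (s/2^i) x. l2norm F y \<partial>lebesgue)"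

sublocale stopping s heavy
  by unfold_locales (auto simp: heavy_def cube_eq s)

definition side :: "'a \<Rightarrow> real" where "side x = s / 2 ^ \<tau> x"

lemma side_pos: "0 < side x" by (simp add: side_def s)

lemma Q_side: "Q x = cube (side x) x" by (simp add: stop_cube_def side_def)

lemma in_Q_side: "x \<in> \<Omega> \<Longrightarrow> y \<in> Q x \<Longrightarrow> side y = side x"
  using in_Q(2)[of x y] by (simp add: side_def)

lemma Q_dist: "y \<in> Q x \<Longrightarrow> dist x y < real DIM('a) * side x"
  using cube_dist[OF side_pos] by (simp add: Q_side)

lemma stop_mass_lower: "x \<in> \<Omega> \<Longrightarrow> ennreal (\<theta> * side x ^ DIM('a)) \<le> (\<integral>\<^sup>+y\<in>Q x. l2norm F y \<partial>lebesgue)"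
  using at_first[of x] by (simp add: heavy_def Q_side side_def less_imp_le)

lemma stop_mass_upper:
  assumes x: "x \<in> \<Omega>"
  shows "(\<integral>\<^sup>+y\<in>Q x. l2norm F y \<partial>lebesgue) \<le> ennreal (2 ^ DIM('a) * \<theta> * side x ^ DIM('a))"
proof -
  have "\<not> heavy 0 x"
  proof -
    have "(\<integral>\<^sup>+y\<in>cube s x. l2norm F y \<partial>lebesgue) \<le> (\<integral>\<^sup>+y. l2norm F y \<partial>lebesgue)"
      by (intro nn_integral_mono) (auto simp: indicator_def)
    from order_trans[OF this total] show ?thesis by (simp add: heavy_def not_less)
  qed
  moreover have "heavy (\<tau> x) x" by (rule at_first[OF x])
  ultimately have "\<tau> x \<noteq> 0" by metis
  then obtain l where l: "\<tau> x = Suc l" by (cases "\<tau> x") auto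
  have "\<not> heavy l x" using before_first[of l x] l by simp
  then have A: "(\<integral>\<^sup>+y\<in>cube (s/2^l) x. l2norm F y \<partial>lebesgue) \<le> ennreal (\<theta> * (s/2^l) ^ DIM('a))"
    by (simp add: heavy_def not_less)
  have B: "(\<integral>\<^sup>+y\<in>Q x. l2norm F y \<partial>lebesgue) \<le> (\<integral>\<^sup>+y\<in>cube (s/2^l) x. l2norm F y \<partial>lebesgue)"
    unfolding stop_cube_def l by (intro nn_integral_subset_le cube_antimono) simp
  have C: "\<theta> * (s/2^l) ^ DIM('a) = 2 ^ DIM('a) * \<theta> * side x ^ DIM('a)"
    by (simp add: side_def l power_mult_distrib power_divide)
  show ?thesis using order_trans[OF B A] unfolding C .
qed

lemma small_off_\<Omega>: "AE z in lebesgue. z \<notin> \<Omega> \<longrightarrow> l2norm F z \<le> ennreal \<theta>"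
proof -
  have step: "AE z in lebesgue. z \<notin> \<Omega> \<longrightarrow> l2norm F z \<le> ennreal \<mu>" if \<mu>: "\<theta> < \<mu>" for \<mu>
  proof -
    define E where "E = {z. z \<notin> \<Omega> \<and> ennreal \<mu> < l2norm F z}"
    have E [measurable]: "E \<in> sets lebesgue"
    proof -
      have "E = (space lebesgue - \<Omega>) \<inter> {z \<in> space lebesgue. ennreal \<mu> < l2norm F z}" by (auto simp: E_def)
      moreover have "{z \<in> space lebesgue. ennreal \<mu> < l2norm F z} \<in> sets lebesgue" by measurable
      ultimately show ?thesis using sets.compl_sets[OF sets_\<Omega>(2)] by (simp only: sets.Int)
    qed
    have "ennreal \<mu> * emeasure lebesgue E \<le> (\<integral>\<^sup>+z. l2norm F z \<partial>lebesgue)"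
      by (subst nn_integral_cmult_indicator[symmetric, OF E], intro nn_integral_mono) (auto simp: E_def indicator_def)
    also have "\<dots> < \<infinity>" using total by (rule order.strict_trans1) simp
    finally have "emeasure lebesgue E < \<infinity>" using \<mu> \<theta> by (auto simp: ennreal_mult_less_top)
    then obtain m where m: "emeasure lebesgue E = ennreal m" "0 \<le> m"
      by (cases "emeasure lebesgue E") auto
    have "\<mu> * m \<le> \<theta> * m + e" if e: "0 < e" for e
    proof -
      have "0 < e / \<theta>" using e \<theta> by simp
      then obtain U where U: "open U" "E \<subseteq> U" "emeasure lebesgue (U - E) < ennreal (e / \<theta>)"
        by (rule sets_lebesgue_outer_open[OF E])
      interpret U: stopping s "\<lambda>i x. cube (s/2^i) x \<subseteq> U"
        by unfold_locales (auto simp: s cube_eq)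
      have U\<Omega>: "U.\<Omega> = U"
      proof
        show "U.\<Omega> \<subseteq> U" using cube_self by blast
        show "U \<subseteq> U.\<Omega>"
        proof
          fix x assume "x \<in> U"
          then obtain r where r: "0 < r" "ball x r \<subseteq> U" by (rule openE[OF U(1)])
          obtain i where i: "real DIM('a) * s / r < 2 ^ i" using real_arch_pow[of 2] by auto
          have "cube (s/2^i) x \<subseteq> ball x (real DIM('a) * (s/2^i))" using s by (intro cube_subset_ball) simp
          also have "\<dots> \<subseteq> ball x r" using i r by (intro subset_ball) (simp add: field_simps)
          finally show "x \<in> U.\<Omega>" using r by blast
        qed
      qed
      have "(\<integral>\<^sup>+z\<in>U.\<Omega>. ennreal \<mu> * indicator E z \<partial>lebesgue) \<le> (\<integral>\<^sup>+z\<in>U.\<Omega>. ennreal \<theta> \<partial>lebesgue)"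
      proof (rule U.nn_integral_stop_le)
        fix x assume "x \<in> U.\<Omega>"
        show "(\<integral>\<^sup>+z\<in>U.Q x. ennreal \<mu> * indicator E z \<partial>lebesgue) \<le> (\<integral>\<^sup>+z\<in>U.Q x. ennreal \<theta> \<partial>lebesgue)"
        proof (cases "U.Q x \<inter> E = {}")
          case True
          then have "ennreal \<mu> * indicator E z * indicator (U.Q x) z = 0" for z by (auto simp: indicator_def)
          then have "(\<integral>\<^sup>+z\<in>U.Q x. ennreal \<mu> * indicator E z \<partial>lebesgue) = 0" by (simp only:) simp
          then show ?thesis by (simp only: zero_le)
        next
          case False
          then obtain y where y: "y \<in> U.Q x" "y \<in> E" by blast
          have "\<not> heavy (U.\<tau> x) y" using y(2) by (auto simp: E_def)
          then have "(\<integral>\<^sup>+z\<in>U.Q x. l2norm F z \<partial>lebesgue) \<le> ennreal (\<theta> * (s/2^U.\<tau> x) ^ DIM('a))"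
            using cube_eq[OF y(1)[unfolded stop_cube_def]] unfolding heavy_def stop_cube_def by (simp add: not_less)
          moreover have "(\<integral>\<^sup>+z\<in>U.Q x. ennreal \<mu> * indicator E z \<partial>lebesgue) \<le> (\<integral>\<^sup>+z\<in>U.Q x. l2norm F z \<partial>lebesgue)"
            by (intro nn_integral_mono) (auto simp: indicator_def E_def)
          moreover have "(\<integral>\<^sup>+z\<in>U.Q x. ennreal \<theta> \<partial>lebesgue) = ennreal (\<theta> * (s/2^U.\<tau> x) ^ DIM('a))"
          proof -
            have "(\<integral>\<^sup>+z\<in>U.Q x. ennreal \<theta> \<partial>lebesgue) = ennreal \<theta> * emeasure lebesgue (U.Q x)"
              by (rule nn_integral_cmult_indicator) simp
            also have "emeasure lebesgue (U.Q x) = ennreal ((s/2^U.\<tau> x) ^ DIM('a))"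
              unfolding stop_cube_def using s by (intro emeasure_cube) simp
            finally show ?thesis using \<theta> s by (simp add: ennreal_mult)
          qed
          ultimately show ?thesis by (simp only:)
        qed
      qed measurable
      moreover have "(\<integral>\<^sup>+z\<in>U. ennreal \<mu> * indicator E z \<partial>lebesgue) = ennreal (\<mu> * m)"
      proof -
        have "ennreal \<mu> * indicator E z * indicator U z = ennreal \<mu> * indicator E z" for z
          using U(2) by (auto simp: indicator_def)
        then show ?thesis using \<mu> \<theta> m(2) nn_integral_cmult_indicator[OF E, of "ennreal \<mu>"]
          by (simp add: m(1)[simplified] ennreal_mult)
      qed
      moreover have "(\<integral>\<^sup>+z\<in>U. ennreal \<theta> \<partial>lebesgue) \<le> ennreal (\<theta> * m + e)"
      proof -
        have Us: "U \<in> sets lebesgue" using U(1) by (simp add: borel_open sets_completionI_sets)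
        have "(\<integral>\<^sup>+z\<in>U. ennreal \<theta> \<partial>lebesgue) = ennreal \<theta> * emeasure lebesgue U"
          by (rule nn_integral_cmult_indicator[OF Us])
        also have "emeasure lebesgue U \<le> emeasure lebesgue E + emeasure lebesgue (U - E)"
          using emeasure_subadditive[OF E, of "U - E"] Us E U(2) by (simp add: Un_absorb1)
        also have "\<dots> \<le> ennreal m + ennreal (e/\<theta>)"
          using U(3) m(1) by (intro add_mono) auto
        also have "\<dots> = ennreal (m + e/\<theta>)" using m e \<theta> by (simp add: ennreal_plus)
        finally have "(\<integral>\<^sup>+z\<in>U. ennreal \<theta> \<partial>lebesgue) \<le> ennreal \<theta> * ennreal (m + e/\<theta>)"
          by (simp add: mult_left_mono)
        also have "\<dots> = ennreal (\<theta> * m + e)"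
          using \<theta> m(2) e by (simp add: ennreal_mult[symmetric] distrib_left)
        finally show ?thesis .
      qed
      ultimately have "ennreal (\<mu> * m) \<le> ennreal (\<theta> * m + e)" unfolding U\<Omega> by simp
      moreover have "0 \<le> \<theta> * m + e" using \<theta> m(2) e by simp
      ultimately show ?thesis by (simp only: ennreal_le_iff)
    qed
    then have "\<mu> * m \<le> \<theta> * m" by (rule field_le_epsilon)
    then have "(\<mu> - \<theta>) * m \<le> 0" by (simp add: left_diff_distrib)
    then have "m = 0" using \<mu> m(2) by (simp add: mult_le_0_iff)
    then have "E \<in> null_sets lebesgue" using m(1) E by (intro null_setsI) simp
    then show ?thesis by (rule AE_I') (auto simp: E_def not_le)
  qed
  have "AE z in lebesgue. \<forall>k. z \<notin> \<Omega> \<longrightarrow> l2norm F z \<le> ennreal (\<theta> + 1 / Suc k)"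
    unfolding AE_all_countable by (intro allI step) simp
  then show ?thesis
  proof (eventually_elim, intro impI)
    fix z assume z: "\<forall>k. z \<notin> \<Omega> \<longrightarrow> l2norm F z \<le> ennreal (\<theta> + 1 / Suc k)" "z \<notin> \<Omega>"
    show "l2norm F z \<le> ennreal \<theta>"
    proof (rule ennreal_le_epsilon)
      fix e :: real assume "0 < e"
      then obtain k where "inverse (real (Suc k)) < e" using reals_Archimedean by blast
      then have "\<theta> + 1 / Suc k \<le> \<theta> + e" by (simp add: inverse_eq_divide)
      then have "ennreal (\<theta> + 1 / Suc k) \<le> ennreal (\<theta> + e)" by (rule ennreal_leI)
      moreover have "l2norm F z \<le> ennreal (\<theta> + 1 / Suc k)" using z by blast
      ultimately have "l2norm F z \<le> ennreal (\<theta> + e)" by (rule order_trans[rotated])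
      then show "l2norm F z \<le> ennreal \<theta> + ennreal e"
        using \<theta> \<open>0 < e\<close> by (simp add: ennreal_plus[symmetric] del: ennreal_plus)
    qed
  qed
qed

lemma F_integrable: "integrable lebesgue (F j)"
proof (rule integrableI_bounded)
  have "(\<integral>\<^sup>+x. ennreal (norm (F j x)) \<partial>lebesgue) \<le> (\<integral>\<^sup>+x. l2norm F x \<partial>lebesgue)"
    by (intro nn_integral_mono norm_le_l2norm)
  also have "\<dots> < \<infinity>" using total by (rule order.strict_trans1) simp
  finally show "(\<integral>\<^sup>+x. ennreal (norm (F j x)) \<partial>lebesgue) < \<infinity>" .
qed (rule F)

definition good :: "nat \<Rightarrow> 'a \<Rightarrow> complex" where
  "good j x = (if x \<in> \<Omega> then (LINT y:Q x|lebesgue. F j y) / complex_of_real (side x ^ DIM('a)) else F j x)"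

lemma good_in_Q: "x \<in> \<Omega> \<Longrightarrow> y \<in> Q x \<Longrightarrow> good j y = good j x"
  using in_Q[of x y] in_Q_side[of x y] by (simp add: good_def)

lemma borel_measurable_good [measurable]: "good j \<in> borel_measurable lebesgue"
proof -
  have 1: "(\<lambda>x. (LINT y:cube (s/2^\<tau> x) x|lebesgue. F j y) / complex_of_real ((s/2^\<tau> x) ^ DIM('a))) \<in> borel_measurable borel"
    by (rule borel_measurable_stop[of "\<lambda>i x. (LINT y:cube (s/2^i) x|lebesgue. F j y) / complex_of_real ((s/2^i) ^ DIM('a))"])
       (simp_all add: cube_eq)
  have 2: "(\<lambda>x. (LINT y:Q x|lebesgue. F j y) / complex_of_real (side x ^ DIM('a))) \<in> borel_measurable lebesgue"
    using 1 unfolding stop_cube_def side_def by (intro measurable_completion) simp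
  have 3: "{x \<in> space lebesgue. x \<in> \<Omega>} \<in> sets lebesgue" using sets_\<Omega>(2) by simp
  show ?thesis unfolding good_def[abs_def] by (rule measurable_If[OF 2 F 3])
qed

lemma good_le_average:
  assumes x: "x \<in> \<Omega>"
  shows "ennreal (side x ^ DIM('a)) * l2norm good x \<le> (\<integral>\<^sup>+y\<in>Q x. l2norm F y \<partial>lebesgue)"
proof -
  let ?S = "side x ^ DIM('a)"
  have S: "0 < ?S" using side_pos by simp
  have [measurable]: "Q x \<in> sets lebesgue" by simp
  have e: "ennreal ?S * ennreal (cmod (good j x)) \<le> (\<integral>\<^sup>+y. ennreal (cmod (F j y)) * indicator (Q x) y \<partial>lebesgue)" for j
  proof -
    have "ennreal ?S * ennreal (cmod (good j x)) = ennreal (cmod (LINT y:Q x|lebesgue. F j y))"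
      using side_pos[of x] x by (simp add: good_def norm_divide norm_power ennreal_mult[symmetric])
    also have "\<dots> \<le> (\<integral>\<^sup>+y. ennreal (norm (indicator (Q x) y *\<^sub>R F j y)) \<partial>lebesgue)"
      unfolding set_lebesgue_integral_def by (rule ennreal_norm_integral_le)
    also have "\<dots> = (\<integral>\<^sup>+y. ennreal (cmod (F j y)) * indicator (Q x) y \<partial>lebesgue)"
      by (intro nn_integral_cong) (auto simp: indicator_def)
    finally show ?thesis .
  qed
  have "(ennreal ?S * l2norm good x)\<^sup>2 = (\<Sum>j. (ennreal ?S * ennreal (cmod (good j x)))\<^sup>2)"
    by (simp add: power_mult_distrib l2norm_square)
  also have "\<dots> \<le> (\<Sum>j. (\<integral>\<^sup>+y. ennreal (cmod (F j y)) * indicator (Q x) y \<partial>lebesgue)\<^sup>2)"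
    by (intro suminf_le power_mono e summableI) simp
  also have "\<dots> \<le> (\<integral>\<^sup>+y. epowr (\<Sum>j. (ennreal (cmod (F j y)))\<^sup>2) (1/2) * indicator (Q x) y \<partial>lebesgue)\<^sup>2"
    by (rule Minkowski_l2_integral) measurable
  also have "\<dots> = (\<integral>\<^sup>+y\<in>Q x. l2norm F y \<partial>lebesgue)\<^sup>2"
    by (simp add: l2norm_def modulus_complex_def)
  finally have "epowr ((ennreal ?S * l2norm good x)\<^sup>2) (1/2) \<le> epowr ((\<integral>\<^sup>+y\<in>Q x. l2norm F y \<partial>lebesgue)\<^sup>2) (1/2)"
    by (rule epowr_mono[rotated]) simp
  then show ?thesis by (simp only: epowr_square_half)
qed

lemma good_bounded_\<Omega>:
  assumes x: "x \<in> \<Omega>" shows "l2norm good x \<le> ennreal (2 ^ DIM('a) * \<theta>)"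
proof -
  have S: "0 < side x ^ DIM('a)" using side_pos by simp
  have "ennreal (side x ^ DIM('a)) * l2norm good x \<le> ennreal (side x ^ DIM('a)) * ennreal (2 ^ DIM('a) * \<theta>)"
    using order_trans[OF good_le_average[OF x] stop_mass_upper[OF x]] side_pos[of x] \<theta>
    by (simp add: ennreal_mult[symmetric] mult_ac)
  then show ?thesis using side_pos[of x] by (subst (asm) ennreal_mult_le_mult_iff) auto
qed

lemma good_bounded: "AE x in lebesgue. l2norm good x \<le> ennreal (2 ^ DIM('a) * \<theta>)"
  using small_off_\<Omega>
proof eventually_elim
  case (elim x)
  show ?case
  proof (cases "x \<in> \<Omega>")
    case False
    then have "l2norm good x = l2norm F x" by (simp add: l2norm_def good_def)
    also have "\<dots> \<le> ennreal (1 * \<theta>)" using elim False by simp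
    also have "\<dots> \<le> ennreal (2 ^ DIM('a) * \<theta>)" using \<theta> by (intro ennreal_leI mult_right_mono) auto
    finally show ?thesis .
  qed (rule good_bounded_\<Omega>)
qed

end

context CZ
begin

definition dilated :: "'a set" where
  "dilated = (\<Union>z\<in>\<Omega>. ball z ((2 * real DIM('a) + 2) * side z))"

lemma sets_dilated [measurable, simp]: "dilated \<in> sets lebesgue"
proof -
  have "open dilated" by (auto simp: dilated_def)
  then show ?thesis by (simp add: borel_open sets_completionI_sets)
qed

context
  fixes v :: "'a \<Rightarrow> ennreal" and C1 :: real
  assumes v [measurable]: "v \<in> borel_measurable lebesgue" and C1: "0 \<le> C1"
    and A1: "AE z in lebesgue. \<forall>r>0. wmeas v (ball z r) \<le> ennreal (C1 * r ^ DIM('a)) * v z"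
begin

lemma l2norm_F_measurable [measurable]: "l2norm F \<in> borel_measurable lebesgue"
  by measurable

lemma mass_transfer:
  assumes x: "x \<in> \<Omega>" and R: "0 < R" and B: "\<And>z. z \<in> Q x \<Longrightarrow> B \<subseteq> ball z (R * side x)"
  shows "(\<integral>\<^sup>+y\<in>Q x. l2norm F y \<partial>lebesgue) * wmeas v B
    \<le> ennreal (side x ^ DIM('a)) * (ennreal (C1 * R ^ DIM('a)) * (\<integral>\<^sup>+y\<in>Q x. (l2norm F y * v y) \<partial>lebesgue))"
proof -
  have [measurable]: "Q x \<in> sets lebesgue" by simp
  let ?c = "C1 * (R * side x) ^ DIM('a)"
  have "(\<integral>\<^sup>+y\<in>Q x. l2norm F y \<partial>lebesgue) * wmeas v B = (\<integral>\<^sup>+y. l2norm F y * indicator (Q x) y * wmeas v B \<partial>lebesgue)"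
    by (rule nn_integral_multc[symmetric]) measurable
  also have "\<dots> \<le> (\<integral>\<^sup>+y. ennreal ?c * (l2norm F y * v y * indicator (Q x) y) \<partial>lebesgue)"
  proof (rule nn_integral_mono_AE)
    show "AE y in lebesgue. l2norm F y * indicator (Q x) y * wmeas v B \<le> ennreal ?c * (l2norm F y * v y * indicator (Q x) y)"
      using A1
    proof eventually_elim
      case (elim y)
      show ?case
      proof (cases "y \<in> Q x")
        case True
        have "0 < R * side x" using R side_pos[of x] by simp
        have "wmeas v B \<le> wmeas v (ball y (R * side x))" by (rule wmeas_mono[OF B[OF True]])
        also have "\<dots> \<le> ennreal ?c * v y" using elim \<open>0 < R * side x\<close> by blast
        finally have "l2norm F y * wmeas v B \<le> l2norm F y * (ennreal ?c * v y)" by (rule mult_left_mono) simp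
        then show ?thesis using True by (simp add: mult_ac)
      qed simp
    qed
  qed
  also have "\<dots> = ennreal ?c * (\<integral>\<^sup>+y\<in>Q x. (l2norm F y * v y) \<partial>lebesgue)"
    by (rule nn_integral_cmult) measurable
  also have "ennreal ?c = ennreal (side x ^ DIM('a)) * ennreal (C1 * R ^ DIM('a))"
    using side_pos[of x] C1 R by (simp add: ennreal_mult[symmetric] power_mult_distrib mult_ac)
  finally show ?thesis by (simp add: mult.assoc)
qed

lemma nn_integral_\<Omega>_le: "(\<integral>\<^sup>+y\<in>\<Omega>. u y \<partial>lebesgue) \<le> (\<integral>\<^sup>+y. u y \<partial>lebesgue)"
  by (intro nn_integral_mono) (auto simp: indicator_def)

lemma good_weighted:
  "(\<integral>\<^sup>+x. l2norm good x * v x \<partial>lebesgue) \<le> ennreal (C1 * real DIM('a) ^ DIM('a) + 1) * (\<integral>\<^sup>+x. l2norm F x * v x \<partial>lebesgue)"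
proof -
  let ?c = "C1 * real DIM('a) ^ DIM('a)"
  have c: "0 \<le> ?c" using C1 by simp
  have [measurable]: "\<Omega> \<in> sets lebesgue" by (rule sets_\<Omega>)
  have "(\<integral>\<^sup>+x\<in>\<Omega>. (l2norm good x * v x) \<partial>lebesgue) \<le> (\<integral>\<^sup>+x\<in>\<Omega>. (ennreal ?c * (l2norm F x * v x)) \<partial>lebesgue)"
  proof (rule nn_integral_stop_le)
    fix x assume x: "x \<in> \<Omega>"
    have [measurable]: "Q x \<in> sets lebesgue" by simp
    let ?S = "ennreal (side x ^ DIM('a))"
    have S: "?S \<noteq> 0" "?S \<noteq> \<infinity>" using side_pos[of x] by auto
    have Qb: "Q x \<subseteq> ball z (real DIM('a) * side x)" if z: "z \<in> Q x" for z
    proof -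
      have "Q x = cube (side x) z" using in_Q(3)[OF x z] in_Q_side[OF x z] Q_side[of z] by simp
      then show ?thesis using cube_subset_ball[OF side_pos] by simp
    qed
    have "(\<integral>\<^sup>+y\<in>Q x. (l2norm good y * v y) \<partial>lebesgue) = (\<integral>\<^sup>+y. l2norm good x * (v y * indicator (Q x) y) \<partial>lebesgue)"
    proof (intro nn_integral_cong)
      fix y show "l2norm good y * v y * indicator (Q x) y = l2norm good x * (v y * indicator (Q x) y)"
        using good_in_Q[OF x, of y] by (cases "y \<in> Q x") (simp_all add: l2norm_def)
    qed
    also have "\<dots> = l2norm good x * wmeas v (Q x)"
      unfolding wmeas_def by (rule nn_integral_cmult) measurable
    finally have e: "(\<integral>\<^sup>+y\<in>Q x. (l2norm good y * v y) \<partial>lebesgue) = l2norm good x * wmeas v (Q x)" .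
    have "?S * (l2norm good x * wmeas v (Q x)) = (?S * l2norm good x) * wmeas v (Q x)" by (simp add: mult.assoc)
    also have "\<dots> \<le> (\<integral>\<^sup>+y\<in>Q x. l2norm F y \<partial>lebesgue) * wmeas v (Q x)"
      by (rule mult_right_mono[OF good_le_average[OF x]]) simp
    also have "\<dots> \<le> ?S * (ennreal ?c * (\<integral>\<^sup>+y\<in>Q x. (l2norm F y * v y) \<partial>lebesgue))"
      using Qb by (intro mass_transfer[OF x]) auto
    finally have "l2norm good x * wmeas v (Q x) \<le> ennreal ?c * (\<integral>\<^sup>+y\<in>Q x. (l2norm F y * v y) \<partial>lebesgue)"
      using S by (subst (asm) ennreal_mult_le_mult_iff) auto
    also have "\<dots> = (\<integral>\<^sup>+y\<in>Q x. (ennreal ?c * (l2norm F y * v y)) \<partial>lebesgue)"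
      by (subst nn_integral_cmult[symmetric]) (auto simp: mult.assoc)
    finally show "(\<integral>\<^sup>+y\<in>Q x. (l2norm good y * v y) \<partial>lebesgue) \<le> \<dots>" unfolding e .
  qed measurable
  also have "\<dots> \<le> (\<integral>\<^sup>+x. ennreal ?c * (l2norm F x * v x) \<partial>lebesgue)" by (rule nn_integral_\<Omega>_le)
  also have "\<dots> = ennreal ?c * (\<integral>\<^sup>+x. l2norm F x * v x \<partial>lebesgue)" by (rule nn_integral_cmult) measurable
  finally have 1: "(\<integral>\<^sup>+x\<in>\<Omega>. (l2norm good x * v x) \<partial>lebesgue) \<le> ennreal ?c * (\<integral>\<^sup>+x. l2norm F x * v x \<partial>lebesgue)" .
  have "(\<integral>\<^sup>+x. l2norm good x * v x \<partial>lebesgue) \<le> (\<integral>\<^sup>+x. l2norm good x * v x * indicator \<Omega> x + l2norm F x * v x \<partial>lebesgue)"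
  proof (intro nn_integral_mono)
    fix x show "l2norm good x * v x \<le> l2norm good x * v x * indicator \<Omega> x + l2norm F x * v x"
      by (cases "x \<in> \<Omega>") (simp_all add: l2norm_def good_def)
  qed
  also have "\<dots> = (\<integral>\<^sup>+x\<in>\<Omega>. (l2norm good x * v x) \<partial>lebesgue) + (\<integral>\<^sup>+x. l2norm F x * v x \<partial>lebesgue)"
    by (rule nn_integral_add) measurable
  also have "\<dots> \<le> ennreal ?c * (\<integral>\<^sup>+x. l2norm F x * v x \<partial>lebesgue) + (\<integral>\<^sup>+x. l2norm F x * v x \<partial>lebesgue)"
    by (intro add_right_mono 1)
  also have "\<dots> = ennreal (?c + 1) * (\<integral>\<^sup>+x. l2norm F x * v x \<partial>lebesgue)"
    using c by (simp add: ennreal_plus distrib_right)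
  finally show ?thesis .
qed

lemma good_weighted_sq:
  "(\<integral>\<^sup>+x. (l2norm good x)\<^sup>2 * v x \<partial>lebesgue)
    \<le> ennreal (2 ^ DIM('a) * \<theta> * (C1 * real DIM('a) ^ DIM('a) + 1)) * (\<integral>\<^sup>+x. l2norm F x * v x \<partial>lebesgue)"
proof -
  let ?b = "2 ^ DIM('a) * \<theta>"
  have "(\<integral>\<^sup>+x. (l2norm good x)\<^sup>2 * v x \<partial>lebesgue) \<le> (\<integral>\<^sup>+x. ennreal ?b * (l2norm good x * v x) \<partial>lebesgue)"
  proof (rule nn_integral_mono_AE)
    show "AE x in lebesgue. (l2norm good x)\<^sup>2 * v x \<le> ennreal ?b * (l2norm good x * v x)"
      using good_bounded
    proof eventually_elim
      case (elim x)
      then have "l2norm good x * (l2norm good x * v x) \<le> ennreal ?b * (l2norm good x * v x)" by (rule mult_right_mono) simp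
      then show ?case by (simp add: power2_eq_square mult.assoc)
    qed
  qed
  also have "\<dots> = ennreal ?b * (\<integral>\<^sup>+x. l2norm good x * v x \<partial>lebesgue)" by (rule nn_integral_cmult) measurable
  also have "\<dots> \<le> ennreal ?b * (ennreal (C1 * real DIM('a) ^ DIM('a) + 1) * (\<integral>\<^sup>+x. l2norm F x * v x \<partial>lebesgue))"
    by (rule mult_left_mono[OF good_weighted]) simp
  also have "\<dots> = ennreal (?b * (C1 * real DIM('a) ^ DIM('a) + 1)) * (\<integral>\<^sup>+x. l2norm F x * v x \<partial>lebesgue)"
    using \<theta> C1 by (simp add: ennreal_mult mult.assoc)
  finally show ?thesis .
qed

lemma dilated_weight:
  "ennreal \<theta> * wmeas v dilated \<le> ennreal (C1 * (4 * real DIM('a) + 2) ^ DIM('a)) * (\<integral>\<^sup>+x. l2norm F x * v x \<partial>lebesgue)"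
proof -
  let ?n = "real DIM('a)" let ?C = "C1 * (4 * ?n + 2) ^ DIM('a)"
  from enumerate obtain A :: "nat \<Rightarrow> 'a set" where
    "disjoint_family A \<and> (\<Union>n. A n) = \<Omega> \<and> (\<forall>n. A n = {} \<or> (\<exists>x\<in>\<Omega>. A n = Q x))" ..
  then have A: "disjoint_family A" "(\<Union>n. A n) = \<Omega>" and A3: "A n = {} \<or> (\<exists>x\<in>\<Omega>. A n = Q x)" for n
    by simp_all
  have "\<forall>n. \<exists>x. A n = {} \<or> (x \<in> \<Omega> \<and> A n = Q x)" using A3 by blast
  then obtain a where a: "\<And>n. A n = {} \<or> (a n \<in> \<Omega> \<and> A n = Q (a n))" by metis
  have sA [measurable]: "A n \<in> sets lebesgue" for n
  proof (cases "A n = {}")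
    case False
    then have "A n = Q (a n)" using a[of n] by blast
    then show ?thesis by simp
  qed simp
  define B where "B n = (if A n = {} then {} else ball (a n) ((3 * ?n + 2) * side (a n)))" for n
  have sB: "B n \<in> sets lebesgue" for n by (simp add: B_def)
  have sub: "dilated \<subseteq> (\<Union>n. B n)"
  proof
    fix y assume "y \<in> dilated"
    then obtain z where z: "z \<in> \<Omega>" "dist z y < (2 * ?n + 2) * side z" by (auto simp: dilated_def)
    then obtain n where n: "z \<in> A n" using A(2) by blast
    then have n': "a n \<in> \<Omega>" "A n = Q (a n)" using a[of n] by auto
    have zQ: "z \<in> Q (a n)" using n n' by simp
    have "dist (a n) y \<le> dist (a n) z + dist z y" by (rule dist_triangle)
    also have "\<dots> < ?n * side (a n) + (2 * ?n + 2) * side (a n)"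
      using Q_dist[OF zQ] z(2) in_Q_side[OF n'(1) zQ] by simp
    also have "\<dots> = (3 * ?n + 2) * side (a n)" by (simp add: algebra_simps)
    finally show "y \<in> (\<Union>n. B n)" using n by (auto simp: B_def)
  qed
  have per: "ennreal \<theta> * wmeas v (B n) \<le> ennreal ?C * (\<integral>\<^sup>+y\<in>A n. (l2norm F y * v y) \<partial>lebesgue)" for n
  proof (cases "A n = {}")
    case True
    then show ?thesis by (simp add: B_def wmeas_def)
  next
    case False
    then have x: "a n \<in> \<Omega>" "A n = Q (a n)" using a[of n] by auto
    let ?S = "ennreal (side (a n) ^ DIM('a))"
    have S: "?S \<noteq> 0" "?S \<noteq> \<infinity>" using side_pos[of "a n"] by auto
    have "?S * (ennreal \<theta> * wmeas v (B n)) = ennreal (\<theta> * side (a n) ^ DIM('a)) * wmeas v (B n)"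
      using \<theta> side_pos[of "a n"] by (simp add: ennreal_mult mult_ac)
    also have "\<dots> \<le> (\<integral>\<^sup>+y\<in>Q (a n). l2norm F y \<partial>lebesgue) * wmeas v (B n)"
      by (rule mult_right_mono[OF stop_mass_lower[OF x(1)]]) simp
    also have "\<dots> \<le> ?S * (ennreal ?C * (\<integral>\<^sup>+y\<in>Q (a n). (l2norm F y * v y) \<partial>lebesgue))"
    proof (rule mass_transfer[OF x(1)])
      fix z assume z: "z \<in> Q (a n)"
      show "B n \<subseteq> ball z ((4 * ?n + 2) * side (a n))"
      proof
        fix y assume "y \<in> B n"
        then have y: "dist (a n) y < (3 * ?n + 2) * side (a n)" using False by (simp add: B_def)
        have "dist z y \<le> dist (a n) z + dist (a n) y" using dist_triangle[of z y "a n"] by (simp add: dist_commute)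
        also have "\<dots> < ?n * side (a n) + (3 * ?n + 2) * side (a n)" using Q_dist[OF z] y by simp
        also have "\<dots> = (4 * ?n + 2) * side (a n)" by (simp add: algebra_simps)
        finally show "y \<in> ball z ((4 * ?n + 2) * side (a n))" by simp
      qed
    qed simp
    finally show ?thesis using S unfolding x(2) by (subst (asm) ennreal_mult_le_mult_iff) auto
  qed
  have "wmeas v dilated \<le> wmeas v (\<Union>n. B n)" by (rule wmeas_mono[OF sub])
  also have "\<dots> = emeasure (density lebesgue v) (\<Union>n. B n)"
    using sB by (intro wmeas_eq_emeasure[OF v]) blast
  also have "\<dots> \<le> (\<Sum>n. emeasure (density lebesgue v) (B n))"
    using sB by (intro emeasure_subadditive_countably) auto
  also have "\<dots> = (\<Sum>n. wmeas v (B n))" using sB by (simp add: wmeas_eq_emeasure[OF v])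
  finally have "ennreal \<theta> * wmeas v dilated \<le> ennreal \<theta> * (\<Sum>n. wmeas v (B n))" by (rule mult_left_mono) simp
  also have "\<dots> = (\<Sum>n. ennreal \<theta> * wmeas v (B n))" by simp
  also have "\<dots> \<le> (\<Sum>n. ennreal ?C * (\<integral>\<^sup>+y\<in>A n. (l2norm F y * v y) \<partial>lebesgue))"
    by (intro suminf_le per summableI)
  also have "\<dots> = ennreal ?C * (\<Sum>n. \<integral>\<^sup>+y\<in>A n. (l2norm F y * v y) \<partial>lebesgue)" by simp
  also have "(\<Sum>n. \<integral>\<^sup>+y\<in>A n. (l2norm F y * v y) \<partial>lebesgue) = (\<integral>\<^sup>+y. (\<Sum>n. l2norm F y * v y * indicator (A n) y) \<partial>lebesgue)"
    by (rule nn_integral_suminf[symmetric]) measurable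
  also have "\<dots> = (\<integral>\<^sup>+y\<in>\<Omega>. (l2norm F y * v y) \<partial>lebesgue)"
    using A(1) by (intro nn_integral_cong) (simp add: A(2)[symmetric] suminf_indicator)
  finally have "ennreal \<theta> * wmeas v dilated \<le> ennreal ?C * (\<integral>\<^sup>+y\<in>\<Omega>. (l2norm F y * v y) \<partial>lebesgue)" .
  also have "\<dots> \<le> ennreal ?C * (\<integral>\<^sup>+y. (l2norm F y * v y) \<partial>lebesgue)"
    by (rule mult_left_mono[OF nn_integral_\<Omega>_le]) simp
  finally show ?thesis .
qed

end

end

lemma measurable_borel_lebesgue: "f \<in> borel \<rightarrow>\<^sub>M N \<Longrightarrow> f \<in> lebesgue \<rightarrow>\<^sub>M N"
  by (rule measurable_completion) simp

context CZ
begin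

context
  fixes \<alpha> :: real assumes \<alpha>: "0 < \<alpha>" "\<alpha> \<le> 1"
begin

definition tail_coeff :: "nat \<Rightarrow> 'a \<Rightarrow> real" where
  "tail_coeff k z = (if z \<in> \<Omega> \<and> k \<le> \<tau> z then real DIM('a) * ((1/2) powr \<alpha>) ^ (\<tau> z - k) / (s/2^k) ^ DIM('a) else 0)"

definition tail_kernel :: "nat \<Rightarrow> 'a \<Rightarrow> 'a \<Rightarrow> ennreal" where
  "tail_kernel k x z = ennreal (tail_coeff k z) * indicator (ball z ((2 * real DIM('a) + 2) * (s/2^k))) x"

lemma tail_coeff_nonneg: "0 \<le> tail_coeff k z"
  using s by (simp add: tail_coeff_def)

lemma borel_measurable_tail_coeff [measurable]: "tail_coeff k \<in> borel_measurable lebesgue"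
proof -
  have 1: "(\<lambda>z. if k \<le> \<tau> z then real DIM('a) * ((1/2) powr \<alpha>) ^ (\<tau> z - k) / (s/2^k) ^ DIM('a) else 0) \<in> borel_measurable borel"
    by (rule borel_measurable_stop[of "\<lambda>i z. if k \<le> i then real DIM('a) * ((1/2) powr \<alpha>) ^ (i - k) / (s/2^k) ^ DIM('a) else 0"]) simp_all
  have 2: "(\<lambda>z. if k \<le> \<tau> z then real DIM('a) * ((1/2) powr \<alpha>) ^ (\<tau> z - k) / (s/2^k) ^ DIM('a) else 0) \<in> borel_measurable lebesgue"
    by (rule measurable_borel_lebesgue[OF 1])
  have 3: "{x \<in> space lebesgue. x \<in> \<Omega>} \<in> sets lebesgue" using sets_\<Omega>(2) by simp
  have "tail_coeff k = (\<lambda>z. if z \<in> \<Omega> then (if k \<le> \<tau> z then real DIM('a) * ((1/2) powr \<alpha>) ^ (\<tau> z - k) / (s/2^k) ^ DIM('a) else 0) else 0)"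
    by (simp add: tail_coeff_def fun_eq_iff)
  then show ?thesis by (simp only:) (rule measurable_If[OF 2 measurable_const 3], simp)
qed

lemma borel_measurable_tail_kernel [measurable]: "tail_kernel k x \<in> borel_measurable lebesgue"
proof -
  have "(\<lambda>z. indicator (ball z ((2 * real DIM('a) + 2) * (s/2^k))) x :: ennreal) = indicator (ball x ((2 * real DIM('a) + 2) * (s/2^k)))"
    by (auto simp: indicator_def dist_commute fun_eq_iff)
  moreover have "(indicator (ball x ((2 * real DIM('a) + 2) * (s/2^k))) :: 'a \<Rightarrow> ennreal) \<in> borel_measurable lebesgue"
    by (intro borel_measurable_indicator) simp
  ultimately have [measurable]: "(\<lambda>z. indicator (ball z ((2 * real DIM('a) + 2) * (s/2^k))) x :: ennreal) \<in> borel_measurable lebesgue"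
    by simp
  show ?thesis unfolding tail_kernel_def[abs_def] by measurable
qed

definition kernel_average :: "('a \<Rightarrow> real) \<Rightarrow> 'a \<Rightarrow> real" where
  "kernel_average \<psi> z = (LINT y:Q z|lebesgue. \<psi> y) / side z ^ DIM('a)"

lemma kernel_average_in_Q: "x \<in> \<Omega> \<Longrightarrow> y \<in> Q x \<Longrightarrow> kernel_average \<psi> y = kernel_average \<psi> x"
  using in_Q(3)[of x y] in_Q_side[of x y] by (simp add: kernel_average_def)

lemma borel_measurable_kernel_average: "kernel_average \<psi> \<in> borel_measurable lebesgue"
proof -
  have 1: "(\<lambda>x. (LINT y:cube (s/2^\<tau> x) x|lebesgue. \<psi> y) / ((s/2^\<tau> x) ^ DIM('a))) \<in> borel_measurable borel"
    by (rule borel_measurable_stop[of "\<lambda>i x. (LINT y:cube (s/2^i) x|lebesgue. \<psi> y) / ((s/2^i) ^ DIM('a))"])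
       (simp_all add: cube_eq)
  show ?thesis unfolding kernel_average_def[abs_def] stop_cube_def side_def by (rule measurable_borel_lebesgue[OF 1])
qed

lemma measure_Q: "measure lebesgue (Q z) = side z ^ DIM('a)"
  unfolding Q_side measure_def using side_pos[of z] by (subst emeasure_cube) auto

lemma Q_integrable_indicator: "integrable lebesgue (indicator (Q z) :: 'a \<Rightarrow> real)"
  unfolding Q_side using side_pos[of z] by (intro integrable_real_indicator) (auto simp: emeasure_cube[simplified])

lemma kernel_average_diff:
  assumes \<psi>: "integrable lebesgue \<psi>" and b: "\<And>y. y \<in> Q z \<Longrightarrow> \<bar>c - \<psi> y\<bar> \<le> e"
  shows "\<bar>c - kernel_average \<psi> z\<bar> \<le> e"
proof -
  let ?S = "side z ^ DIM('a)"
  have S: "0 < ?S" using side_pos[of z] by simp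
  have iQ: "integrable lebesgue (\<lambda>y. indicator (Q z) y * \<psi> y)"
    using integrable_mult_indicator[OF sets_Q(2) \<psi>, of z] by simp
  have "c * ?S - (LINT y:Q z|lebesgue. \<psi> y) = (LINT y|lebesgue. c * indicator (Q z) y) - (LINT y|lebesgue. indicator (Q z) y * \<psi> y)"
    using measure_Q[of z] by (simp add: set_lebesgue_integral_def)
  also have "\<dots> = (LINT y|lebesgue. c * indicator (Q z) y - indicator (Q z) y * \<psi> y)"
    using Q_integrable_indicator iQ by (intro Bochner_Integration.integral_diff[symmetric] integrable_mult_right)
  finally have "\<bar>c * ?S - (LINT y:Q z|lebesgue. \<psi> y)\<bar> \<le> (LINT y|lebesgue. \<bar>c * indicator (Q z) y - indicator (Q z) y * \<psi> y\<bar>)"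
    by (simp only: integral_abs_bound)
  also have "\<dots> \<le> (LINT y|lebesgue. e * indicator (Q z) y)"
  proof (rule integral_mono)
    show "integrable lebesgue (\<lambda>y. \<bar>c * indicator (Q z) y - indicator (Q z) y * \<psi> y\<bar>)"
      using Q_integrable_indicator iQ by (intro integrable_abs Bochner_Integration.integrable_diff integrable_mult_right)
    show "integrable lebesgue (\<lambda>y. e * indicator (Q z) y)"
      using Q_integrable_indicator by (intro integrable_mult_right)
    show "\<bar>c * indicator (Q z) y - indicator (Q z) y * \<psi> y\<bar> \<le> e * indicator (Q z) y" for y
      using b[of y] by (cases "y \<in> Q z") simp_all
  qed
  also have "\<dots> = e * ?S" using measure_Q[of z] by simp
  finally have "\<bar>c * ?S - (LINT y:Q z|lebesgue. \<psi> y)\<bar> \<le> e * ?S" .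
  moreover have "c * ?S - (LINT y:Q z|lebesgue. \<psi> y) = (c - kernel_average \<psi> z) * ?S"
    using side_pos[of z] by (simp add: kernel_average_def left_diff_distrib)
  ultimately have "\<bar>c - kernel_average \<psi> z\<bar> * ?S \<le> e * ?S" using S by (simp add: abs_mult)
  then show ?thesis using S by (rule mult_right_le_imp_le)
qed

lemma kernel_average_tail:
  assumes x: "x \<notin> dilated" and \<psi>: "\<psi> \<in> cube_kernels \<alpha> (s/2^k) x" and z: "z \<in> \<Omega>"
  shows "ennreal \<bar>\<psi> z - kernel_average \<psi> z\<bar> \<le> tail_kernel k x z"
proof -
  let ?n = "real DIM('a)" let ?t = "s/2^k"
  have t: "0 < ?t" using s by simp
  note i = cube_kernel_integrable[OF \<alpha> t \<psi>]
  show ?thesis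
  proof (cases "\<exists>y\<in>Q z. y \<in> nbhd ?t x")
    case False
    have "z \<in> Q z" by simp
    then have "\<psi> z = 0" using False \<psi> by (auto simp: cube_kernels_def)
    moreover have "\<bar>0 - kernel_average \<psi> z\<bar> \<le> 0"
      using False \<psi> by (intro kernel_average_diff[OF i]) (auto simp: cube_kernels_def)
    ultimately show ?thesis by simp
  next
    case True
    then obtain y where y: "y \<in> Q z" "y \<in> nbhd ?t x" by blast
    have d1: "dist x y < (?n + 2) * ?t" using nbhd_subset_ball[OF t, of x] y(2) by auto
    have d2: "dist z y < ?n * side z" by (rule Q_dist[OF y(1)])
    have "x \<notin> ball z ((2 * ?n + 2) * side z)" using x z unfolding dilated_def by blast
    then have d3: "(2 * ?n + 2) * side z \<le> dist z x" by simp
    have d4: "dist z x < ?n * side z + (?n + 2) * ?t" using d1 d2 dist_triangle[of z x y] by (simp add: dist_commute)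
    have "(?n + 2) * side z < (?n + 2) * ?t" using d3 d4 by (simp add: algebra_simps)
    then have sl: "side z < ?t" by (subst (asm) mult_less_cancel_left_pos) auto
    then have "?n * side z \<le> ?n * ?t" by (intro mult_left_mono) auto
    moreover have "D < (2 * a + 2) * b" if "D < a * c + (a + 2) * b" "a * c \<le> a * b" for a b c D :: real
      using that unfolding distrib_right mult.assoc by linarith
    ultimately have d: "dist z x < (2 * ?n + 2) * ?t" using d4 by blast
    have k: "k \<le> \<tau> z"
    proof (rule ccontr)
      assume "\<not> k \<le> \<tau> z"
      then have "s / 2 ^ k \<le> s / 2 ^ \<tau> z" using s by (intro divide_left_mono) (auto simp: power_increasing)
      then show False using sl by (simp add: side_def)
    qed
    let ?e = "?n * ((1/2) powr \<alpha>) ^ (\<tau> z - k) / ?t ^ DIM('a)"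
    have "\<bar>\<psi> z - kernel_average \<psi> z\<bar> \<le> ?e"
    proof (rule kernel_average_diff[OF i])
      fix u assume u: "u \<in> Q z"
      have "norm (z - u) \<le> ?n * side z" using Q_dist[OF u] by (simp add: dist_norm)
      from divide_right_mono[OF this less_imp_le[OF t]]
      have "norm (z - u) / ?t \<le> ?n * (side z / ?t)" by (simp only: times_divide_eq_right)
      then have "(norm (z - u) / ?t) powr \<alpha> \<le> (?n * (side z / ?t)) powr \<alpha>"
        using \<alpha> s by (intro powr_mono2) auto
      also have "\<dots> = ?n powr \<alpha> * (side z / ?t) powr \<alpha>" by (rule powr_mult)
      also have "\<dots> \<le> ?n * (side z / ?t) powr \<alpha>"
        using \<alpha> DIM_positive[where 'a='a] by (intro mult_right_mono powr_le_max1) (auto simp: Suc_le_eq)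
      also have "(side z / ?t) powr \<alpha> = ((1/2) powr \<alpha>) ^ (\<tau> z - k)"
      proof -
        have "side z / ?t = 2 ^ k / 2 ^ \<tau> z" using s by (simp add: side_def)
        also have "\<dots> = (1/2) ^ (\<tau> z - k)" using k by (simp add: power_diff power_one_over)
        finally show ?thesis by (simp add: powr_power powr_realpow[symmetric] powr_powr mult.commute)
      qed
      finally have "(norm (z - u) / ?t) powr \<alpha> / ?t ^ DIM('a) \<le> ?e" using s by (intro divide_right_mono) auto
      moreover have "\<bar>\<psi> z - \<psi> u\<bar> \<le> (norm (z - u) / ?t) powr \<alpha> / ?t ^ DIM('a)"
        using \<psi> by (simp add: cube_kernels_def)
      ultimately show "\<bar>\<psi> z - \<psi> u\<bar> \<le> ?e" by linarith
    qed
    moreover have "tail_coeff k z = ?e" using z k by (simp add: tail_coeff_def)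
    ultimately show ?thesis using d by (simp add: tail_kernel_def ennreal_leI)
  qed
qed

lemma good_pairing:
  assumes x: "x \<notin> dilated" and \<psi>: "\<psi> \<in> cube_kernels \<alpha> (s/2^k) x"
  shows "ennreal (cmod (LINT z|lebesgue. F j z * complex_of_real (\<psi> z)))
    \<le> ennreal (cmod (LINT z|lebesgue. good j z * complex_of_real (\<psi> z))) + (\<integral>\<^sup>+z. ennreal (cmod (F j z)) * tail_kernel k x z \<partial>lebesgue)"
proof -
  let ?t = "s/2^k"
  have t: "0 < ?t" using s by simp
  let ?K = "2 * (real DIM('a) + 2) / ?t ^ DIM('a)"
  note i\<psi> = cube_kernel_integrable[OF \<alpha> t \<psi>] and m\<psi> [measurable] = cube_kernel_measurable(2)[OF \<alpha> t \<psi>]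
  note [measurable] = borel_measurable_kernel_average[of \<psi>]
  have [measurable]: "\<Omega> \<in> sets lebesgue" by (rule sets_\<Omega>)
  have K0: "0 \<le> ?K" using t by simp
  have ib: "integrable lebesgue (\<lambda>z. h z * complex_of_real (g z))"
    if h: "integrable lebesgue h" and [measurable]: "g \<in> borel_measurable lebesgue" and g: "\<And>z. \<bar>g z\<bar> \<le> c" for h g and c :: real
  proof (rule Bochner_Integration.integrable_bound)
    show "integrable lebesgue (\<lambda>z. c *\<^sub>R h z)" using h by simp
    have [measurable]: "h \<in> borel_measurable lebesgue" using h by simp
    show "(\<lambda>z. h z * complex_of_real (g z)) \<in> borel_measurable lebesgue" by measurable
    have "cmod (h z) * \<bar>g z\<bar> \<le> cmod (h z) * \<bar>c\<bar>" for z using g[of z] by (intro mult_left_mono) auto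
    then show "AE z in lebesgue. norm (h z * complex_of_real (g z)) \<le> norm (c *\<^sub>R h z)"
      by (intro AE_I2) (simp add: norm_mult mult.commute)
  qed
  have iF\<psi>: "integrable lebesgue (\<lambda>z. F j z * complex_of_real (\<psi> z))"
    by (rule ib[OF F_integrable m\<psi> cube_kernel_bound[OF \<alpha> t \<psi>]])
  have avg_le: "\<bar>kernel_average \<psi> z\<bar> \<le> ?K" for z
    using kernel_average_diff[OF i\<psi>, of z 0 ?K] cube_kernel_bound[OF \<alpha> t \<psi>] by simp
  have iFa: "integrable lebesgue (\<lambda>z. F j z * complex_of_real (kernel_average \<psi> z))"
    by (rule ib[OF F_integrable borel_measurable_kernel_average avg_le])
  have ig\<psi>: "integrable lebesgue (\<lambda>z. good j z * complex_of_real (\<psi> z))"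
  proof (rule Bochner_Integration.integrable_bound)
    show "integrable lebesgue (\<lambda>z. (2 ^ DIM('a) * \<theta>) * \<psi> z)" using i\<psi> by simp
    show "(\<lambda>z. good j z * complex_of_real (\<psi> z)) \<in> borel_measurable lebesgue" by measurable
    show "AE z in lebesgue. norm (good j z * complex_of_real (\<psi> z)) \<le> norm ((2 ^ DIM('a) * \<theta>) * \<psi> z)"
      using good_bounded
    proof eventually_elim
      case (elim z)
      have "ennreal (cmod (good j z)) \<le> ennreal (2 ^ DIM('a) * \<theta>)"
        by (rule order_trans[OF norm_le_l2norm elim])
      then have "cmod (good j z) \<le> 2 ^ DIM('a) * \<theta>" using \<theta> by (simp add: ennreal_le_iff)
      then have "cmod (good j z) * \<bar>\<psi> z\<bar> \<le> (2 ^ DIM('a) * \<theta>) * \<bar>\<psi> z\<bar>" by (rule mult_right_mono) simp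
      then show ?case using \<theta> by (simp add: norm_mult abs_mult)
    qed
  qed
  have seq: "(LINT z:\<Omega>|lebesgue. good j z * complex_of_real (\<psi> z)) = (LINT z:\<Omega>|lebesgue. F j z * complex_of_real (kernel_average \<psi> z))"
  proof (rule integral_stop_eq)
    show "set_integrable lebesgue \<Omega> (\<lambda>z. good j z * complex_of_real (\<psi> z))"
      unfolding set_integrable_def by (rule integrable_mult_indicator[OF sets_\<Omega>(2) ig\<psi>])
    show "set_integrable lebesgue \<Omega> (\<lambda>z. F j z * complex_of_real (kernel_average \<psi> z))"
      unfolding set_integrable_def by (rule integrable_mult_indicator[OF sets_\<Omega>(2) iFa])
    fix y assume y: "y \<in> \<Omega>"
    have "(LINT z:Q y|lebesgue. good j z * complex_of_real (\<psi> z)) = (LINT z|lebesgue. good j y * complex_of_real (indicator (Q y) z * \<psi> z))"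
      unfolding set_lebesgue_integral_def
    proof (intro Bochner_Integration.integral_cong refl)
      fix z show "indicator (Q y) z *\<^sub>R (good j z * complex_of_real (\<psi> z)) = good j y * complex_of_real (indicator (Q y) z * \<psi> z)"
        using good_in_Q[OF y, of z j] by (cases "z \<in> Q y") simp_all
    qed
    also have "\<dots> = good j y * complex_of_real (LINT z:Q y|lebesgue. \<psi> z)"
      by (simp add: set_lebesgue_integral_def del: of_real_mult)
    also have "\<dots> = (LINT z:Q y|lebesgue. F j z) * complex_of_real (kernel_average \<psi> y)"
      using y by (simp add: good_def kernel_average_def)
    also have "\<dots> = (LINT z|lebesgue. (indicator (Q y) z *\<^sub>R F j z) * complex_of_real (kernel_average \<psi> y))"
      unfolding set_lebesgue_integral_def by (rule integral_mult_left_zero[symmetric])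
    also have "\<dots> = (LINT z:Q y|lebesgue. F j z * complex_of_real (kernel_average \<psi> z))"
      unfolding set_lebesgue_integral_def
    proof (intro Bochner_Integration.integral_cong refl)
      fix z show "(indicator (Q y) z *\<^sub>R F j z) * complex_of_real (kernel_average \<psi> y) = indicator (Q y) z *\<^sub>R (F j z * complex_of_real (kernel_average \<psi> z))"
        using kernel_average_in_Q[OF y, of z \<psi>] by (cases "z \<in> Q y") simp_all
    qed
    finally show "(LINT z:Q y|lebesgue. good j z * complex_of_real (\<psi> z)) = (LINT z:Q y|lebesgue. F j z * complex_of_real (kernel_average \<psi> z))" .
  qed
  let ?D = "\<lambda>z. indicator \<Omega> z *\<^sub>R (F j z * complex_of_real (\<psi> z - kernel_average \<psi> z))"
  have "(LINT z|lebesgue. F j z * complex_of_real (\<psi> z)) - (LINT z|lebesgue. good j z * complex_of_real (\<psi> z))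
    = (LINT z|lebesgue. F j z * complex_of_real (\<psi> z) - good j z * complex_of_real (\<psi> z))"
    by (rule Bochner_Integration.integral_diff[OF iF\<psi> ig\<psi>, symmetric])
  also have "\<dots> = (LINT z|lebesgue. indicator \<Omega> z *\<^sub>R (F j z * complex_of_real (\<psi> z)) - indicator \<Omega> z *\<^sub>R (good j z * complex_of_real (\<psi> z)))"
  proof (intro Bochner_Integration.integral_cong refl)
    fix z show "F j z * complex_of_real (\<psi> z) - good j z * complex_of_real (\<psi> z)
      = indicator \<Omega> z *\<^sub>R (F j z * complex_of_real (\<psi> z)) - indicator \<Omega> z *\<^sub>R (good j z * complex_of_real (\<psi> z))"
      by (cases "z \<in> \<Omega>") (simp_all add: good_def)
  qed
  also have "\<dots> = (LINT z:\<Omega>|lebesgue. F j z * complex_of_real (\<psi> z)) - (LINT z:\<Omega>|lebesgue. good j z * complex_of_real (\<psi> z))"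
    unfolding set_lebesgue_integral_def
    by (rule Bochner_Integration.integral_diff[OF integrable_mult_indicator[OF sets_\<Omega>(2) iF\<psi>] integrable_mult_indicator[OF sets_\<Omega>(2) ig\<psi>]])
  also have "\<dots> = (LINT z:\<Omega>|lebesgue. F j z * complex_of_real (\<psi> z)) - (LINT z:\<Omega>|lebesgue. F j z * complex_of_real (kernel_average \<psi> z))"
    by (simp only: seq)
  also have "\<dots> = (LINT z|lebesgue. indicator \<Omega> z *\<^sub>R (F j z * complex_of_real (\<psi> z)) - indicator \<Omega> z *\<^sub>R (F j z * complex_of_real (kernel_average \<psi> z)))"
    unfolding set_lebesgue_integral_def
    by (rule Bochner_Integration.integral_diff[OF integrable_mult_indicator[OF sets_\<Omega>(2) iF\<psi>] integrable_mult_indicator[OF sets_\<Omega>(2) iFa], symmetric])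
  also have "\<dots> = (LINT z|lebesgue. ?D z)"
    by (intro Bochner_Integration.integral_cong refl) (simp add: right_diff_distrib scaleR_diff_right)
  finally have diff: "(LINT z|lebesgue. F j z * complex_of_real (\<psi> z)) = (LINT z|lebesgue. good j z * complex_of_real (\<psi> z)) + (LINT z|lebesgue. ?D z)"
    by (simp add: algebra_simps)
  have "ennreal (cmod (LINT z|lebesgue. ?D z)) \<le> (\<integral>\<^sup>+z. ennreal (norm (?D z)) \<partial>lebesgue)"
    by (rule ennreal_norm_integral_le)
  also have "\<dots> \<le> (\<integral>\<^sup>+z. ennreal (cmod (F j z)) * tail_kernel k x z \<partial>lebesgue)"
  proof (rule nn_integral_mono)
    fix z
    show "ennreal (norm (?D z)) \<le> ennreal (cmod (F j z)) * tail_kernel k x z"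
    proof (cases "z \<in> \<Omega>")
      case True
      have "ennreal (norm (?D z)) = ennreal (cmod (F j z)) * ennreal \<bar>\<psi> z - kernel_average \<psi> z\<bar>"
        using True by (simp add: norm_mult ennreal_mult flip: of_real_diff)
      also have "\<dots> \<le> ennreal (cmod (F j z)) * tail_kernel k x z"
        by (rule mult_left_mono[OF kernel_average_tail[OF x \<psi> True]]) simp
      finally show ?thesis .
    qed simp
  qed
  finally have D: "ennreal (cmod (LINT z|lebesgue. ?D z)) \<le> (\<integral>\<^sup>+z. ennreal (cmod (F j z)) * tail_kernel k x z \<partial>lebesgue)" .
  have "ennreal (cmod (LINT z|lebesgue. F j z * complex_of_real (\<psi> z)))
    \<le> ennreal (cmod (LINT z|lebesgue. good j z * complex_of_real (\<psi> z)) + cmod (LINT z|lebesgue. ?D z))"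
    unfolding diff by (rule ennreal_leI[OF norm_triangle_ineq])
  also have "\<dots> = ennreal (cmod (LINT z|lebesgue. good j z * complex_of_real (\<psi> z))) + ennreal (cmod (LINT z|lebesgue. ?D z))"
    by (simp add: ennreal_plus)
  also have "\<dots> \<le> ennreal (cmod (LINT z|lebesgue. good j z * complex_of_real (\<psi> z))) + (\<integral>\<^sup>+z. ennreal (cmod (F j z)) * tail_kernel k x z \<partial>lebesgue)"
    by (rule add_left_mono[OF D])
  finally show ?thesis .
qed

definition bad_majorant :: "'a \<Rightarrow> ennreal" where
  "bad_majorant x = (\<Sum>k. \<integral>\<^sup>+z. l2norm F z * tail_kernel k x z \<partial>lebesgue)"

lemma square_sum_le: "((a::ennreal) + b)\<^sup>2 \<le> 2 * a\<^sup>2 + 2 * b\<^sup>2"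
proof (cases "a = \<infinity> \<or> b = \<infinity>")
  case False
  then obtain r t where "a = ennreal r" "b = ennreal t" "0 \<le> r" "0 \<le> t" by (cases a; cases b) auto
  moreover have "(r + t)\<^sup>2 \<le> 2 * r\<^sup>2 + 2 * t\<^sup>2" using sum_squares_bound[of r t] by (simp add: power2_sum)
  then have "ennreal ((r + t)\<^sup>2) \<le> ennreal (2 * r\<^sup>2 + 2 * t\<^sup>2)" by (rule ennreal_leI)
  ultimately show ?thesis
    by (simp add: ennreal_power[symmetric] ennreal_plus ennreal_mult)
qed (auto simp: ennreal_mult_top)

lemma dyadic_sq_good_bad:
  assumes x: "x \<notin> dilated"
  shows "dyadic_sq \<alpha> s F x \<le> 2 * dyadic_sq \<alpha> s good x + 2 * (bad_majorant x)\<^sup>2"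
proof -
  let ?b = "\<lambda>k j. \<integral>\<^sup>+z. ennreal (cmod (F j z)) * tail_kernel k x z \<partial>lebesgue"
  let ?B = "\<lambda>k. \<integral>\<^sup>+z. l2norm F z * tail_kernel k x z \<partial>lebesgue"
  have 1: "cube_sup \<alpha> (s/2^k) x (F j) \<le> cube_sup \<alpha> (s/2^k) x (good j) + ?b k j" for k j
    unfolding cube_sup_def[of _ _ _ "F j"]
  proof (rule SUP_least)
    fix \<psi> assume \<psi>: "\<psi> \<in> cube_kernels \<alpha> (s/2^k) x"
    have "ennreal (cmod (LINT z|lebesgue. good j z * complex_of_real (\<psi> z))) \<le> cube_sup \<alpha> (s/2^k) x (good j)"
      unfolding cube_sup_def by (rule SUP_upper[OF \<psi>])
    then show "ennreal (cmod (LINT z|lebesgue. F j z * complex_of_real (\<psi> z))) \<le> cube_sup \<alpha> (s/2^k) x (good j) + ?b k j"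
      using good_pairing[OF x \<psi>, of j] add_right_mono order_trans by blast
  qed
  have "dyadic_sq \<alpha> s F x \<le> (\<Sum>k j. 2 * (cube_sup \<alpha> (s/2^k) x (good j))\<^sup>2 + 2 * (?b k j)\<^sup>2)"
    unfolding dyadic_sq_def
    by (intro suminf_le summableI order_trans[OF power_mono[OF 1] square_sum_le]) simp
  also have "\<dots> = 2 * dyadic_sq \<alpha> s good x + 2 * (\<Sum>k j. (?b k j)\<^sup>2)"
    by (simp add: dyadic_sq_def suminf_add[symmetric] summableI)
  also have "(\<Sum>k j. (?b k j)\<^sup>2) \<le> (\<Sum>k. (?B k)\<^sup>2)"
  proof (intro suminf_le summableI)
    fix k
    have "(\<Sum>j. (?b k j)\<^sup>2) \<le> (\<integral>\<^sup>+z. epowr (\<Sum>j. (ennreal (cmod (F j z)))\<^sup>2) (1/2) * tail_kernel k x z \<partial>lebesgue)\<^sup>2"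
      by (rule Minkowski_l2_integral) measurable
    then show "(\<Sum>j. (?b k j)\<^sup>2) \<le> (?B k)\<^sup>2" by (simp add: l2norm_def modulus_complex_def)
  qed
  also have "\<dots> \<le> (\<Sum>k. ?B k * bad_majorant x)"
  proof (intro suminf_le summableI)
    fix k
    have "?B k \<le> bad_majorant x" unfolding bad_majorant_def using sum_le_suminf[of ?B "{k}"] by simp
    then show "(?B k)\<^sup>2 \<le> ?B k * bad_majorant x" unfolding power2_eq_square by (rule mult_left_mono) simp
  qed
  also have "\<dots> = (bad_majorant x)\<^sup>2" by (simp add: bad_majorant_def power2_eq_square)
  finally show ?thesis by (simp add: add_left_mono mult_left_mono)
qed

end

end

context CZ
begin

lemma bad_majorant_weighted:
  fixes \<alpha> :: real and v :: "'a \<Rightarrow> ennreal" and C1 :: real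
  assumes \<alpha>: "0 < \<alpha>" "\<alpha> \<le> 1"
    and v [measurable]: "v \<in> borel_measurable lebesgue" and C1: "0 \<le> C1"
    and A1: "AE z in lebesgue. \<forall>r>0. wmeas v (ball z r) \<le> ennreal (C1 * r ^ DIM('a)) * v z"
  shows "bad_majorant \<alpha> \<in> borel_measurable lebesgue"
    and "(\<integral>\<^sup>+x. bad_majorant \<alpha> x * v x \<partial>lebesgue)
      \<le> ennreal (real DIM('a) * (C1 * (2 * real DIM('a) + 2) ^ DIM('a)) / (1 - (1/2) powr \<alpha>)) * (\<integral>\<^sup>+x. l2norm F x * v x \<partial>lebesgue)"
proof -
  let ?n = "real DIM('a)" let ?\<rho> = "(1/2::real) powr \<alpha>" let ?R = "2 * real DIM('a) + 2"
  let ?L = "lebesgue :: 'a measure"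
  interpret P: pair_sigma_finite ?L ?L ..
  have \<rho>: "0 \<le> ?\<rho>" "?\<rho> < 1" using \<alpha> powr_less_mono2[of \<alpha> "1/2" 1] by auto
  note [measurable] = borel_measurable_tail_coeff[OF \<alpha>] borel_measurable_tail_kernel[OF \<alpha>]
  have lF [measurable]: "l2norm F \<in> borel_measurable lebesgue" by measurable
  have idm [measurable]: "(\<lambda>x. x) \<in> ?L \<rightarrow>\<^sub>M borel" by (rule measurable_borel_lebesgue) simp
  have fs [measurable]: "fst \<in> ?L \<Otimes>\<^sub>M ?L \<rightarrow>\<^sub>M borel" "snd \<in> ?L \<Otimes>\<^sub>M ?L \<rightarrow>\<^sub>M borel"
    using measurable_compose[OF measurable_fst idm] measurable_compose[OF measurable_snd idm] by auto
  have ind: "(\<lambda>p. indicator (ball (snd p) c) (fst p) :: ennreal) \<in> borel_measurable (?L \<Otimes>\<^sub>M ?L)" for c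
  proof -
    have "(\<lambda>p. dist (snd p) (fst p)) \<in> borel_measurable (?L \<Otimes>\<^sub>M ?L)"
      by (rule borel_measurable_dist[OF fs(2) fs(1)])
    then have "{p \<in> space (?L \<Otimes>\<^sub>M ?L). dist (snd p) (fst p) < c} \<in> sets (?L \<Otimes>\<^sub>M ?L)" by measurable
    then have "(indicator {p \<in> space (?L \<Otimes>\<^sub>M ?L). dist (snd p) (fst p) < c} :: _ \<Rightarrow> ennreal) \<in> borel_measurable (?L \<Otimes>\<^sub>M ?L)"
      by (rule borel_measurable_indicator)
    moreover have "indicator {p \<in> space (?L \<Otimes>\<^sub>M ?L). dist (snd p) (fst p) < c} = (\<lambda>p. indicator (ball (snd p) c) (fst p) :: ennreal)"
      by (auto simp: fun_eq_iff indicator_def space_pair_measure)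
    ultimately show ?thesis by simp
  qed
  have joint: "(\<lambda>(x, z). l2norm F z * tail_kernel \<alpha> k x z) \<in> borel_measurable (?L \<Otimes>\<^sub>M ?L)" for k
    unfolding tail_kernel_def[OF \<alpha>] split_beta'
    by (intro borel_measurable_times_ennreal ind measurable_compose[OF measurable_snd lF]
        measurable_compose[OF measurable_snd measurable_compose[OF borel_measurable_tail_coeff[OF \<alpha>] measurable_ennreal]])
  have mk: "(\<lambda>x. \<integral>\<^sup>+z. l2norm F z * tail_kernel \<alpha> k x z \<partial>?L) \<in> borel_measurable ?L" for k
    by (rule lebesgue.borel_measurable_nn_integral[OF joint])
  show "bad_majorant \<alpha> \<in> borel_measurable lebesgue"
    unfolding bad_majorant_def[OF \<alpha>, abs_def] using mk by (rule borel_measurable_suminf_order)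
  have slice: "(\<integral>\<^sup>+x. tail_kernel \<alpha> k x z * v x \<partial>?L) = ennreal (tail_coeff \<alpha> k z) * wmeas v (ball z (?R * (s/2^k)))" for k z
  proof -
    have [measurable]: "ball z (?R * (s/2^k)) \<in> sets lebesgue" by simp
    have "(\<integral>\<^sup>+x. tail_kernel \<alpha> k x z * v x \<partial>?L) = (\<integral>\<^sup>+x. ennreal (tail_coeff \<alpha> k z) * (v x * indicator (ball z (?R * (s/2^k))) x) \<partial>?L)"
      by (intro nn_integral_cong) (simp add: tail_kernel_def[OF \<alpha>] mult_ac)
    also have "\<dots> = ennreal (tail_coeff \<alpha> k z) * wmeas v (ball z (?R * (s/2^k)))"
      unfolding wmeas_def by (rule nn_integral_cmult) measurable
    finally show ?thesis .
  qed
  have sumle: "(\<Sum>k. ennreal (tail_coeff \<alpha> k z) * wmeas v (ball z (?R * (s/2^k)))) \<le> ennreal (?n * (C1 * ?R ^ DIM('a)) / (1 - ?\<rho>)) * v z"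
    if z: "\<forall>r>0. wmeas v (ball z r) \<le> ennreal (C1 * r ^ DIM('a)) * v z" for z
  proof -
    let ?M = "?n * (C1 * ?R ^ DIM('a))"
    have M: "0 \<le> ?M" using C1 by simp
    have k: "ennreal (tail_coeff \<alpha> k z) * wmeas v (ball z (?R * (s/2^k))) \<le> ennreal (if k \<le> \<tau> z then ?M * ?\<rho> ^ (\<tau> z - k) else 0) * v z" for k
    proof (cases "z \<in> \<Omega> \<and> k \<le> \<tau> z")
      case False
      then have "tail_coeff \<alpha> k z = 0" unfolding tail_coeff_def[OF \<alpha>] by (rule if_not_P)
      then show ?thesis by simp
    next
      case True
      have t: "0 < s/2^k" using s by simp
      have "ennreal (tail_coeff \<alpha> k z) * wmeas v (ball z (?R * (s/2^k))) \<le> ennreal (tail_coeff \<alpha> k z) * (ennreal (C1 * (?R * (s/2^k)) ^ DIM('a)) * v z)"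
        by (intro mult_left_mono z[rule_format] mult_pos_pos t) auto
      also have "\<dots> = ennreal (tail_coeff \<alpha> k z * (C1 * (?R * (s/2^k)) ^ DIM('a))) * v z"
        using tail_coeff_nonneg[OF \<alpha>] by (simp add: ennreal_mult' mult.assoc)
      also have "tail_coeff \<alpha> k z * (C1 * (?R * (s/2^k)) ^ DIM('a)) = ?M * ?\<rho> ^ (\<tau> z - k)"
      proof -
        have "tail_coeff \<alpha> k z = ?n * ?\<rho> ^ (\<tau> z - k) / (s/2^k) ^ DIM('a)"
          unfolding tail_coeff_def[OF \<alpha>] using True by simp
        moreover have "(s/2^k) ^ DIM('a) \<noteq> 0" using s by simp
        ultimately show ?thesis by (simp only: power_mult_distrib[of ?R]) (simp add: field_simps)
      qed
      finally show ?thesis using True by simp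
    qed
    have "(\<Sum>k. ennreal (tail_coeff \<alpha> k z) * wmeas v (ball z (?R * (s/2^k)))) \<le> (\<Sum>k. ennreal (if k \<le> \<tau> z then ?M * ?\<rho> ^ (\<tau> z - k) else 0) * v z)"
      by (intro suminf_le k summableI)
    also have "\<dots> = (\<Sum>k. ennreal (if k \<le> \<tau> z then ?M * ?\<rho> ^ (\<tau> z - k) else 0)) * v z" by simp
    also have "(\<Sum>k. ennreal (if k \<le> \<tau> z then ?M * ?\<rho> ^ (\<tau> z - k) else 0)) \<le> ennreal (?M / (1 - ?\<rho>))"
    proof (rule suminf_le_const[OF summableI])
      fix N
      have "(\<Sum>k<N. ennreal (if k \<le> \<tau> z then ?M * ?\<rho> ^ (\<tau> z - k) else 0)) = ennreal (\<Sum>k<N. if k \<le> \<tau> z then ?M * ?\<rho> ^ (\<tau> z - k) else 0)"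
        using M by (intro sum_ennreal) auto
      also have "\<dots> \<le> ennreal (?M / (1 - ?\<rho>))"
      proof (rule ennreal_leI)
        have "(\<Sum>k<N. if k \<le> \<tau> z then ?M * ?\<rho> ^ (\<tau> z - k) else 0) = (\<Sum>k\<in>{k\<in>{..<N}. k \<le> \<tau> z}. ?M * ?\<rho> ^ (\<tau> z - k))"
          by (rule sum.inter_filter[symmetric]) simp
        also have "\<dots> \<le> (\<Sum>k<Suc (\<tau> z). ?M * ?\<rho> ^ (\<tau> z - k))"
          using M by (intro sum_mono2) auto
        also have "\<dots> = ?M * (\<Sum>k<Suc (\<tau> z). ?\<rho> ^ k)"
          unfolding sum_distrib_left by (rule sum.reindex_bij_witness[of _ "\<lambda>k. \<tau> z - k" "\<lambda>k. \<tau> z - k"]) auto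
        also have "(\<Sum>k<Suc (\<tau> z). ?\<rho> ^ k) \<le> 1 / (1 - ?\<rho>)"
        proof -
          have "(\<Sum>k<Suc (\<tau> z). ?\<rho> ^ k) \<le> (\<Sum>k. ?\<rho> ^ k)"
            using \<rho> by (intro sum_le_suminf summable_geometric) auto
          also have "\<dots> = 1 / (1 - ?\<rho>)" using \<rho> by (intro suminf_geometric) simp
          finally show ?thesis .
        qed
        finally show "(\<Sum>k<N. if k \<le> \<tau> z then ?M * ?\<rho> ^ (\<tau> z - k) else 0) \<le> ?M / (1 - ?\<rho>)"
          using M by (simp add: mult_left_mono)
      qed
      finally show "(\<Sum>k<N. ennreal (if k \<le> \<tau> z then ?M * ?\<rho> ^ (\<tau> z - k) else 0)) \<le> ennreal (?M / (1 - ?\<rho>))" .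
    qed
    finally show ?thesis by (simp add: mult_right_mono)
  qed
  have "(\<integral>\<^sup>+x. bad_majorant \<alpha> x * v x \<partial>?L) = (\<integral>\<^sup>+x. (\<Sum>k. (\<integral>\<^sup>+z. l2norm F z * tail_kernel \<alpha> k x z \<partial>?L) * v x) \<partial>?L)"
    unfolding bad_majorant_def[OF \<alpha>] by simp
  also have "\<dots> = (\<Sum>k. \<integral>\<^sup>+x. (\<integral>\<^sup>+z. l2norm F z * tail_kernel \<alpha> k x z \<partial>?L) * v x \<partial>?L)"
    using mk by (intro nn_integral_suminf borel_measurable_times_ennreal v)
  also have "\<dots> = (\<Sum>k. \<integral>\<^sup>+x. (\<integral>\<^sup>+z. l2norm F z * tail_kernel \<alpha> k x z * v x \<partial>?L) \<partial>?L)"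
    by (intro suminf_cong nn_integral_cong nn_integral_multc[symmetric]) measurable
  also have "\<dots> = (\<Sum>k. \<integral>\<^sup>+z. (\<integral>\<^sup>+x. l2norm F z * tail_kernel \<alpha> k x z * v x \<partial>?L) \<partial>?L)"
  proof (intro suminf_cong)
    fix k
    have "(\<lambda>(x, z). l2norm F z * tail_kernel \<alpha> k x z * v x) \<in> borel_measurable (?L \<Otimes>\<^sub>M ?L)"
      using borel_measurable_times_ennreal[OF joint measurable_compose[OF measurable_fst v]] by (simp only: split_beta')
    from P.Fubini'[OF this, symmetric]
    show "(\<integral>\<^sup>+x. (\<integral>\<^sup>+z. l2norm F z * tail_kernel \<alpha> k x z * v x \<partial>?L) \<partial>?L) = (\<integral>\<^sup>+z. (\<integral>\<^sup>+x. l2norm F z * tail_kernel \<alpha> k x z * v x \<partial>?L) \<partial>?L)" .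
  qed
  also have "\<dots> = (\<Sum>k. \<integral>\<^sup>+z. l2norm F z * (ennreal (tail_coeff \<alpha> k z) * wmeas v (ball z (?R * (s/2^k)))) \<partial>?L)"
  proof (intro suminf_cong nn_integral_cong)
    fix k z
    have m: "(\<lambda>x. tail_kernel \<alpha> k x z * v x) \<in> borel_measurable ?L"
    proof -
      have [measurable]: "ball z (?R * (s/2^k)) \<in> sets lebesgue" by simp
      show ?thesis unfolding tail_kernel_def[OF \<alpha>] by measurable
    qed
    have "(\<integral>\<^sup>+x. l2norm F z * tail_kernel \<alpha> k x z * v x \<partial>?L) = (\<integral>\<^sup>+x. l2norm F z * (tail_kernel \<alpha> k x z * v x) \<partial>?L)"
      by (simp only: mult.assoc)
    also have "\<dots> = l2norm F z * (\<integral>\<^sup>+x. tail_kernel \<alpha> k x z * v x \<partial>?L)"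
      by (rule nn_integral_cmult[OF m])
    finally show "(\<integral>\<^sup>+x. l2norm F z * tail_kernel \<alpha> k x z * v x \<partial>?L) = l2norm F z * (ennreal (tail_coeff \<alpha> k z) * wmeas v (ball z (?R * (s/2^k))))"
      by (simp only: slice)
  qed
  also have "\<dots> = (\<integral>\<^sup>+z. (\<Sum>k. l2norm F z * (ennreal (tail_coeff \<alpha> k z) * wmeas v (ball z (?R * (s/2^k))))) \<partial>?L)"
  proof (rule nn_integral_suminf[symmetric])
    fix k
    have "(\<lambda>z. \<integral>\<^sup>+x. indicator (ball z (?R * (s/2^k))) x * v x \<partial>?L) \<in> borel_measurable ?L"
    proof (rule lebesgue.borel_measurable_nn_integral)
      have "(\<lambda>p :: 'a \<times> 'a. indicator (ball (fst p) (?R * (s/2^k))) (snd p) :: ennreal) = (\<lambda>p. indicator (ball (snd p) (?R * (s/2^k))) (fst p))"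
        by (auto simp: fun_eq_iff indicator_def dist_commute)
      then have "(\<lambda>p. indicator (ball (fst p) (?R * (s/2^k))) (snd p) :: ennreal) \<in> borel_measurable (?L \<Otimes>\<^sub>M ?L)"
        by (simp only: ind)
      then show "(\<lambda>(z, x). indicator (ball z (?R * (s/2^k))) x * v x) \<in> borel_measurable (?L \<Otimes>\<^sub>M ?L)"
        unfolding split_beta' by (intro borel_measurable_times_ennreal measurable_compose[OF measurable_snd v])
    qed
    then have [measurable]: "(\<lambda>z. wmeas v (ball z (?R * (s/2^k)))) \<in> borel_measurable ?L"
      unfolding wmeas_def by (simp add: mult.commute)
    show "(\<lambda>z. l2norm F z * (ennreal (tail_coeff \<alpha> k z) * wmeas v (ball z (?R * (s/2^k))))) \<in> borel_measurable ?L"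
      by measurable
  qed
  also have "\<dots> = (\<integral>\<^sup>+z. l2norm F z * (\<Sum>k. ennreal (tail_coeff \<alpha> k z) * wmeas v (ball z (?R * (s/2^k)))) \<partial>?L)" by simp
  also have "\<dots> \<le> (\<integral>\<^sup>+z. ennreal (?n * (C1 * ?R ^ DIM('a)) / (1 - ?\<rho>)) * (l2norm F z * v z) \<partial>?L)"
  proof (rule nn_integral_mono_AE)
    show "AE z in ?L. l2norm F z * (\<Sum>k. ennreal (tail_coeff \<alpha> k z) * wmeas v (ball z (?R * (s/2^k))))
        \<le> ennreal (?n * (C1 * ?R ^ DIM('a)) / (1 - ?\<rho>)) * (l2norm F z * v z)"
      using A1
    proof eventually_elim
      case (elim z)
      from mult_left_mono[OF sumle[OF elim], of "l2norm F z"] show ?case by (simp add: mult_ac)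
    qed
  qed
  also have "\<dots> = ennreal (?n * (C1 * ?R ^ DIM('a)) / (1 - ?\<rho>)) * (\<integral>\<^sup>+z. l2norm F z * v z \<partial>?L)"
    by (rule nn_integral_cmult) measurable
  finally show "(\<integral>\<^sup>+x. bad_majorant \<alpha> x * v x \<partial>?L) \<le> \<dots>" .
qed

lemma weak_type_at_level:
  fixes \<alpha> :: real and v :: "'a \<Rightarrow> ennreal" and C1 C2 :: real
  assumes \<alpha>: "0 < \<alpha>" "\<alpha> \<le> 1"
    and v [measurable]: "v \<in> borel_measurable lebesgue" and C1: "0 \<le> C1"
    and A1: "AE z in lebesgue. \<forall>r>0. wmeas v (ball z r) \<le> ennreal (C1 * r ^ DIM('a)) * v z"
    and C2: "0 \<le> C2" and L2: "(\<integral>\<^sup>+x. dyadic_sq \<alpha> s good x * v x \<partial>lebesgue) \<le> ennreal C2 * (\<integral>\<^sup>+x. (l2norm good x)\<^sup>2 * v x \<partial>lebesgue)"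
  shows "wmeas v {x. ennreal (\<theta>\<^sup>2) < dyadic_sq \<alpha> s F x} \<le>
     ennreal ((C1 * (4 * real DIM('a) + 2) ^ DIM('a) + 4 * (C2 * (2 ^ DIM('a) * (C1 * real DIM('a) ^ DIM('a) + 1)))
       + 2 * (real DIM('a) * (C1 * (2 * real DIM('a) + 2) ^ DIM('a)) / (1 - (1/2) powr \<alpha>))) / \<theta>) * (\<integral>\<^sup>+x. l2norm F x * v x \<partial>lebesgue)"
proof -
  let ?n = "real DIM('a)"
  define I where "I = (\<integral>\<^sup>+x. l2norm F x * v x \<partial>lebesgue)"
  define K1 where "K1 = C1 * (4 * ?n + 2) ^ DIM('a)"
  define K2 where "K2 = C2 * (2 ^ DIM('a) * (C1 * ?n ^ DIM('a) + 1))"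
  define K3 where "K3 = ?n * (C1 * (2 * ?n + 2) ^ DIM('a)) / (1 - (1/2) powr \<alpha>)"
  have \<rho>: "(1/2::real) powr \<alpha> < 1" using \<alpha> powr_less_mono2[of \<alpha> "1/2" 1] by auto
  have K: "0 \<le> K1" "0 \<le> K2" "0 \<le> K3" using C1 C2 \<rho> by (auto simp: K1_def K2_def K3_def)
  note bm [measurable] = bad_majorant_weighted(1)[OF \<alpha> v C1 A1]
  define E2 where "E2 = {x. ennreal (\<theta>\<^sup>2/4) < dyadic_sq \<alpha> s good x}"
  define E3 where "E3 = {x. ennreal (\<theta>/2) < bad_majorant \<alpha> x}"
  have sE: "E2 \<in> sets lebesgue" "E3 \<in> sets lebesgue"
  proof -
    have "{x \<in> space lebesgue. ennreal (\<theta>\<^sup>2/4) < dyadic_sq \<alpha> s good x} \<in> sets lebesgue" by measurable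
    then show "E2 \<in> sets lebesgue" by (simp add: E2_def)
    have "{x \<in> space lebesgue. ennreal (\<theta>/2) < bad_majorant \<alpha> x} \<in> sets lebesgue" by measurable
    then show "E3 \<in> sets lebesgue" by (simp add: E3_def)
  qed
  have "{x. ennreal (\<theta>\<^sup>2) < dyadic_sq \<alpha> s F x} \<subseteq> dilated \<union> (E2 \<union> E3)"
  proof
    fix x assume "x \<in> {x. ennreal (\<theta>\<^sup>2) < dyadic_sq \<alpha> s F x}"
    then have x: "ennreal (\<theta>\<^sup>2) < dyadic_sq \<alpha> s F x" by simp
    show "x \<in> dilated \<union> (E2 \<union> E3)"
    proof (rule ccontr)
      assume "x \<notin> dilated \<union> (E2 \<union> E3)"
      then have n: "x \<notin> dilated" "dyadic_sq \<alpha> s good x \<le> ennreal (\<theta>\<^sup>2/4)" "bad_majorant \<alpha> x \<le> ennreal (\<theta>/2)"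
        by (simp_all add: E2_def E3_def not_less)
      have "dyadic_sq \<alpha> s F x \<le> 2 * dyadic_sq \<alpha> s good x + 2 * (bad_majorant \<alpha> x)\<^sup>2"
        by (rule dyadic_sq_good_bad[OF \<alpha> n(1)])
      also have "\<dots> \<le> 2 * ennreal (\<theta>\<^sup>2/4) + 2 * (ennreal (\<theta>/2))\<^sup>2"
        by (intro add_mono mult_left_mono power_mono n) auto
      also have "\<dots> = ennreal (2 * (\<theta>\<^sup>2/4) + 2 * (\<theta>/2)\<^sup>2)"
      proof -
        have "2 * ennreal a + 2 * (ennreal b)\<^sup>2 = ennreal (2 * a + 2 * b\<^sup>2)" if "0 \<le> a" "0 \<le> b" for a b
          using that by (simp add: ennreal_plus ennreal_mult ennreal_power)
        then show ?thesis using \<theta> by simp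
      qed
      also have "2 * (\<theta>\<^sup>2/4) + 2 * (\<theta>/2)\<^sup>2 = \<theta>\<^sup>2" by (simp add: power2_eq_square)
      finally show False using x by simp
    qed
  qed
  then have "wmeas v {x. ennreal (\<theta>\<^sup>2) < dyadic_sq \<alpha> s F x} \<le> wmeas v (dilated \<union> (E2 \<union> E3))"
    by (rule wmeas_mono)
  also have "\<dots> \<le> wmeas v dilated + wmeas v (E2 \<union> E3)"
    using sE by (intro wmeas_Un_le v sets_dilated) auto
  also have "\<dots> \<le> wmeas v dilated + (wmeas v E2 + wmeas v E3)"
    using sE by (intro add_left_mono wmeas_Un_le v)
  also have "\<dots> \<le> ennreal (K1/\<theta>) * I + (ennreal (4 * K2/\<theta>) * I + ennreal (2 * K3/\<theta>) * I)"
  proof (intro add_mono)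
    have "wmeas v dilated = ennreal (1/\<theta>) * (ennreal \<theta> * wmeas v dilated)"
      using \<theta> by (simp add: mult.assoc[symmetric] ennreal_mult[symmetric])
    also have "\<dots> \<le> ennreal (1/\<theta>) * (ennreal K1 * I)"
      unfolding K1_def I_def by (rule mult_left_mono[OF dilated_weight[OF v C1 A1]]) simp
    also have "\<dots> = ennreal (K1/\<theta>) * I"
      using \<theta> K by (simp add: mult.assoc[symmetric] ennreal_mult[symmetric])
    finally show "wmeas v dilated \<le> ennreal (K1/\<theta>) * I" .
    have "wmeas v E2 \<le> ennreal (1/(\<theta>\<^sup>2/4)) * (\<integral>\<^sup>+x. dyadic_sq \<alpha> s good x * v x \<partial>lebesgue)"
      unfolding E2_def using \<theta> by (intro wmeas_level_set v borel_measurable_dyadic_sq) simp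
    also have "\<dots> \<le> ennreal (1/(\<theta>\<^sup>2/4)) * (ennreal C2 * (ennreal (2 ^ DIM('a) * \<theta> * (C1 * ?n ^ DIM('a) + 1)) * I))"
      unfolding I_def by (intro mult_left_mono order_trans[OF L2] good_weighted_sq[OF v C1 A1]) auto
    also have "\<dots> = ennreal (1/(\<theta>\<^sup>2/4) * (C2 * (2 ^ DIM('a) * \<theta> * (C1 * ?n ^ DIM('a) + 1)))) * I"
    proof -
      have "ennreal a * (ennreal C2 * (ennreal b * I)) = ennreal (a * (C2 * b)) * I" if "0 \<le> a" "0 \<le> b" for a b
        using that C2 by (simp add: ennreal_mult mult.assoc)
      then show ?thesis using \<theta> C1 by simp
    qed
    also have "1/(\<theta>\<^sup>2/4) * (C2 * (2 ^ DIM('a) * \<theta> * (C1 * ?n ^ DIM('a) + 1))) = 4 * K2/\<theta>"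
      using \<theta> by (simp add: K2_def power2_eq_square)
    finally show "wmeas v E2 \<le> ennreal (4 * K2/\<theta>) * I" .
    have "wmeas v E3 \<le> ennreal (1/(\<theta>/2)) * (\<integral>\<^sup>+x. bad_majorant \<alpha> x * v x \<partial>lebesgue)"
      unfolding E3_def using \<theta> by (intro wmeas_level_set v bm) simp
    also have "\<dots> \<le> ennreal (1/(\<theta>/2)) * (ennreal K3 * I)"
      unfolding I_def K3_def by (rule mult_left_mono[OF bad_majorant_weighted(2)[OF \<alpha> v C1 A1]]) simp
    also have "\<dots> = ennreal (2 * K3/\<theta>) * I"
      using \<theta> K by (simp add: mult.assoc[symmetric] ennreal_mult[symmetric])
    finally show "wmeas v E3 \<le> ennreal (2 * K3/\<theta>) * I" .
  qed
  also have "\<dots> = (ennreal (K1/\<theta>) + (ennreal (4 * K2/\<theta>) + ennreal (2 * K3/\<theta>))) * I"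
    by (simp only: distrib_right)
  also have "ennreal (K1/\<theta>) + (ennreal (4 * K2/\<theta>) + ennreal (2 * K3/\<theta>)) = ennreal ((K1 + 4 * K2 + 2 * K3)/\<theta>)"
    using \<theta> K by (simp add: ennreal_plus[symmetric] add_divide_distrib del: ennreal_plus)
  finally show ?thesis by (simp only: I_def K1_def K2_def K3_def)
qed

end

lemma dyadic_sq_le_doubled:
  assumes "0 < s" shows "dyadic_sq \<alpha> s F x \<le> dyadic_sq \<alpha> (2 ^ m * s) F x"
proof -
  let ?u = "\<lambda>i. \<Sum>j. (cube_sup \<alpha> (2 ^ m * s/2^i) x (F j))\<^sup>2"
  have e: "2 ^ m * s/2^(i + m) = s/2^i" for i by (simp add: power_add)
  have "dyadic_sq \<alpha> s F x = (\<Sum>i. ?u (i + m))" unfolding dyadic_sq_def e ..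
  also have "\<dots> \<le> (\<Sum>i. ?u i)"
  proof (rule suminf_le_const[OF summableI])
    fix N
    have "(\<Sum>i<N. ?u (i + m)) = sum ?u {m..<N+m}"
      using sum.shift_bounds_nat_ivl[of ?u 0 m N] by (simp add: atLeast0LessThan)
    also have "\<dots> \<le> (\<Sum>i. ?u i)" by (rule sum_le_suminf) auto
    finally show "(\<Sum>i<N. ?u (i + m)) \<le> (\<Sum>i. ?u i)" .
  qed
  finally show ?thesis unfolding dyadic_sq_def .
qed

theorem dyadic_sq_weak_type:
  fixes \<alpha> :: real and v :: "'a::euclidean_space \<Rightarrow> ennreal" and C1 C2 :: real
  assumes \<alpha>: "0 < \<alpha>" "\<alpha> \<le> 1"
    and v [measurable]: "v \<in> borel_measurable lebesgue" and C1: "0 \<le> C1"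
    and A1: "AE z in lebesgue. \<forall>r>0. wmeas v (ball z r) \<le> ennreal (C1 * r ^ DIM('a)) * v z"
    and C2: "0 \<le> C2" and L2: "\<And>s (H :: nat \<Rightarrow> 'a \<Rightarrow> complex). 0 < s \<Longrightarrow> (\<And>j. H j \<in> borel_measurable lebesgue) \<Longrightarrow>
      (\<integral>\<^sup>+x. dyadic_sq \<alpha> s H x * v x \<partial>lebesgue) \<le> ennreal C2 * (\<integral>\<^sup>+x. (l2norm H x)\<^sup>2 * v x \<partial>lebesgue)"
  shows "\<exists>C::real. 0 \<le> C \<and> (\<forall>s>0. \<forall>\<theta>>0. \<forall>F :: nat \<Rightarrow> 'a \<Rightarrow> complex.
    (\<forall>j. F j \<in> borel_measurable lebesgue) \<longrightarrow> (\<integral>\<^sup>+x. l2norm F x \<partial>lebesgue) < \<infinity> \<longrightarrow>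
    wmeas v {x. ennreal (\<theta>\<^sup>2) < dyadic_sq \<alpha> s F x} \<le> ennreal (C/\<theta>) * (\<integral>\<^sup>+x. l2norm F x * v x \<partial>lebesgue))"
proof -
  define C where "C = C1 * (4 * real DIM('a) + 2) ^ DIM('a) + 4 * (C2 * (2 ^ DIM('a) * (C1 * real DIM('a) ^ DIM('a) + 1)))
       + 2 * (real DIM('a) * (C1 * (2 * real DIM('a) + 2) ^ DIM('a)) / (1 - (1/2) powr \<alpha>))"
  have \<rho>: "(1/2::real) powr \<alpha> < 1" using \<alpha> powr_less_mono2[of \<alpha> "1/2" 1] by auto
  have C: "0 \<le> C" using C1 C2 \<rho> by (auto simp: C_def intro!: add_nonneg_nonneg)
  have "wmeas v {x. ennreal (\<theta>\<^sup>2) < dyadic_sq \<alpha> s F x} \<le> ennreal (C/\<theta>) * (\<integral>\<^sup>+x. l2norm F x * v x \<partial>lebesgue)"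
    if s: "0 < s" and \<theta>: "0 < \<theta>" and F: "\<And>j. F j \<in> borel_measurable lebesgue" and fin: "(\<integral>\<^sup>+x. l2norm F x \<partial>lebesgue) < \<infinity>"
    for s \<theta> and F :: "nat \<Rightarrow> 'a \<Rightarrow> complex"
  proof -
    obtain i where i: "(\<integral>\<^sup>+x. l2norm F x \<partial>lebesgue) = ennreal i" "0 \<le> i"
      using fin by (cases "\<integral>\<^sup>+x. l2norm F x \<partial>lebesgue") auto
    obtain m where m: "max (1/s) (i/(\<theta> * s)) < 2 ^ m" using real_arch_pow[of 2 "max (1/s) (i/(\<theta> * s))"] by auto
    let ?t = "2 ^ m * s"
    have t1: "1 \<le> ?t" "i \<le> \<theta> * ?t" using m s \<theta> by (simp_all add: field_simps)
    have "?t \<le> ?t ^ DIM('a)" using t1(1) DIM_positive[where 'a='a] by (simp add: self_le_power)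
    then have "\<theta> * ?t \<le> \<theta> * ?t ^ DIM('a)" using \<theta> by (intro mult_left_mono) auto
    then have tot: "i \<le> \<theta> * ?t ^ DIM('a)" using t1(2) by linarith
    have sup: "dyadic_sq \<alpha> s F x \<le> dyadic_sq \<alpha> ?t F x" for x by (rule dyadic_sq_le_doubled[OF s])
    interpret CZ ?t \<theta> F
      using s \<theta> F tot by unfold_locales (auto simp: i(1) intro!: ennreal_leI)
    have "wmeas v {x. ennreal (\<theta>\<^sup>2) < dyadic_sq \<alpha> s F x} \<le> wmeas v {x. ennreal (\<theta>\<^sup>2) < dyadic_sq \<alpha> ?t F x}"
      by (intro wmeas_mono Collect_mono impI) (erule less_le_trans, rule sup)
    also have "\<dots> \<le> ennreal (C/\<theta>) * (\<integral>\<^sup>+x. l2norm F x * v x \<partial>lebesgue)"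
      unfolding C_def using s by (intro weak_type_at_level \<alpha> v C1 A1 C2 L2 borel_measurable_good) auto
    finally show ?thesis .
  qed
  then show ?thesis using C by blast
qed

section \<open>Maximal functions of doubling weights\<close>

definition uncentred_max :: "real \<Rightarrow> ('a::euclidean_space \<Rightarrow> ennreal) \<Rightarrow> ('a \<Rightarrow> ennreal) \<Rightarrow> 'a \<Rightarrow> ennreal" where
  "uncentred_max R u h x = (SUP (y, r)\<in>{(y, r). 0 < r \<and> r \<le> R \<and> x \<in> ball y r}.
     (\<integral>\<^sup>+z\<in>ball y r. (h z * u z) \<partial>lebesgue) / wmeas u (ball y r))"

lemma uncentred_max_upper:
  "0 < r \<Longrightarrow> r \<le> R \<Longrightarrow> x \<in> ball y r \<Longrightarrow> (\<integral>\<^sup>+z\<in>ball y r. (h z * u z) \<partial>lebesgue) / wmeas u (ball y r) \<le> uncentred_max R u h x"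
  unfolding uncentred_max_def by (rule SUP_upper2[of "(y, r)"]) auto

lemma uncentred_max_level:
  "{x. c < uncentred_max R u h x} = (\<Union>(y, r)\<in>{(y, r). 0 < r \<and> r \<le> R \<and>
     c < (\<integral>\<^sup>+z\<in>ball y r. (h z * u z) \<partial>lebesgue) / wmeas u (ball y r)}. ball y r)"
  unfolding uncentred_max_def less_SUP_iff by fastforce

lemma borel_measurable_uncentred_max [measurable]: "uncentred_max R u h \<in> borel_measurable lebesgue"
proof (rule measurable_borel_lebesgue, rule borel_measurableI_greater)
  fix c
  have "open {x. c < uncentred_max R u h x}"
    unfolding uncentred_max_level by (intro open_UN) auto
  then show "{x \<in> space borel. c < uncentred_max R u h x} \<in> sets borel" by (simp add: borel_open)
qed

lemma countable_enumeration:
  assumes "countable C"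
  shows "\<exists>e :: nat \<Rightarrow> 'b option. (\<forall>c\<in>C. \<exists>n. e n = Some c) \<and> (\<forall>n c. e n = Some c \<longrightarrow> c \<in> C)
    \<and> (\<forall>m n c. e m = Some c \<longrightarrow> e n = Some c \<longrightarrow> m = n)"
proof (intro exI conjI)
  let ?e = "\<lambda>n. if n \<in> to_nat_on C ` C then Some (from_nat_into C n) else None"
  have f: "from_nat_into C (to_nat_on C c) = c" if "c \<in> C" for c using assms that by simp
  show "\<forall>c\<in>C. \<exists>n. ?e n = Some c"
  proof
    fix c assume "c \<in> C" then show "\<exists>n. ?e n = Some c" by (intro exI[of _ "to_nat_on C c"]) (simp add: f)
  qed
  show "\<forall>n c. ?e n = Some c \<longrightarrow> c \<in> C" by (auto simp: f split: if_splits)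
  show "\<forall>m n c. ?e m = Some c \<longrightarrow> ?e n = Some c \<longrightarrow> m = n" by (auto simp: f split: if_splits)
qed

definition doubling_weight :: "real \<Rightarrow> ('a::euclidean_space \<Rightarrow> ennreal) \<Rightarrow> bool" where
  "doubling_weight D u \<longleftrightarrow> 0 \<le> D \<and> u \<in> borel_measurable lebesgue \<and>
     (\<forall>y. \<forall>r>0. 0 < wmeas u (ball y r) \<and> wmeas u (ball y r) < \<infinity> \<and> wmeas u (ball y (5 * r)) \<le> ennreal D * wmeas u (ball y r))"

lemma uncentred_max_weak_type:
  fixes u h :: "'a::euclidean_space \<Rightarrow> ennreal"
  assumes u: "doubling_weight D u" and h [measurable]: "h \<in> borel_measurable lebesgue" and t: "0 < t"
  shows "ennreal t * wmeas u {x. ennreal t < uncentred_max R u h x} \<le> ennreal D * (\<integral>\<^sup>+x. h x * u x \<partial>lebesgue)"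
proof -
  have [measurable]: "u \<in> borel_measurable lebesgue" using u by (simp add: doubling_weight_def)
  have ub: "0 < wmeas u (ball y r)" "wmeas u (ball y r) < \<infinity>" "wmeas u (ball y (5 * r)) \<le> ennreal D * wmeas u (ball y r)"
    if "0 < r" for y r using u that by (auto simp: doubling_weight_def)
  have D: "0 \<le> D" using u by (simp add: doubling_weight_def)
  define I where "I y r = (\<integral>\<^sup>+z\<in>ball y r. (h z * u z) \<partial>lebesgue)" for y :: 'a and r :: real
  define K where "K = {(y, r). 0 < r \<and> r \<le> R \<and> ennreal t < I y r / wmeas u (ball y r)}"
  have bd: "0 < snd i \<and> snd i \<le> R" if "i \<in> K" for i using that by (auto simp: K_def)
  have "\<exists>C. countable C \<and> C \<subseteq> K \<and> pairwise (\<lambda>i j. disjnt (cball (fst i) (snd i)) (cball (fst j) (snd j))) C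
      \<and> (\<forall>i\<in>K. \<exists>j\<in>C. cball (fst i) (snd i) \<subseteq> ball (fst j) (5 * snd j))"
  proof (rule Vitali_covering_lemma_cballs_balls[of K snd R fst, OF bd])
    fix C assume C: "countable C" "C \<subseteq> K" "pairwise (\<lambda>i j. disjnt (cball (fst i) (snd i)) (cball (fst j) (snd j))) C"
      "\<And>i. i \<in> K \<Longrightarrow> \<exists>j. j \<in> C \<and> \<not> disjnt (cball (fst i) (snd i)) (cball (fst j) (snd j)) \<and> cball (fst i) (snd i) \<subseteq> ball (fst j) (5 * snd j)"
    have "\<forall>i\<in>K. \<exists>j\<in>C. cball (fst i) (snd i) \<subseteq> ball (fst j) (5 * snd j)"
    proof
      fix i assume "i \<in> K"
      from C(4)[OF this] show "\<exists>j\<in>C. cball (fst i) (snd i) \<subseteq> ball (fst j) (5 * snd j)" by blast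
    qed
    with C(1-3) show ?thesis by (intro exI[of _ C] conjI)
  qed
  then obtain C where C: "countable C" "C \<subseteq> K" "pairwise (\<lambda>i j. disjnt (cball (fst i) (snd i)) (cball (fst j) (snd j))) C"
    and C4: "\<forall>i\<in>K. \<exists>j\<in>C. cball (fst i) (snd i) \<subseteq> ball (fst j) (5 * snd j)" by (elim exE conjE)
  obtain e :: "nat \<Rightarrow> ('a \<times> real) option" where e: "\<forall>c\<in>C. \<exists>n. e n = Some c" "\<forall>n c. e n = Some c \<longrightarrow> c \<in> C"
    "\<forall>m n c. e m = Some c \<longrightarrow> e n = Some c \<longrightarrow> m = n"
    using countable_enumeration[OF C(1)] by (elim exE conjE)
  define B where "B k n = (case e n of None \<Rightarrow> {} | Some c \<Rightarrow> ball (fst c) (k * snd c))" for k n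
  have sB [measurable]: "B k n \<in> sets lebesgue" for k n by (simp add: B_def split: option.split)
  have dj: "disjoint_family (B 1)"
  proof (unfold disjoint_family_on_def, intro ballI impI)
    fix m n :: nat assume mn: "m \<noteq> n"
    show "B 1 m \<inter> B 1 n = {}"
    proof (cases "e m = None \<or> e n = None")
      case False
      then obtain c d where cd: "e m = Some c" "e n = Some d" by auto
      then have "c \<noteq> d" "c \<in> C" "d \<in> C" using e mn by metis+
      then have "disjnt (cball (fst c) (snd c)) (cball (fst d) (snd d))" using C(3) by (simp add: pairwise_def)
      moreover have "B 1 m \<subseteq> cball (fst c) (snd c)" "B 1 n \<subseteq> cball (fst d) (snd d)"
        using cd by (simp_all add: B_def ball_subset_cball)
      ultimately show ?thesis unfolding disjnt_def by blast
    qed (auto simp: B_def)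
  qed
  have "{x. ennreal t < uncentred_max R u h x} \<subseteq> (\<Union>n. B 5 n)"
  proof
    fix x assume "x \<in> {x. ennreal t < uncentred_max R u h x}"
    then obtain i where i: "i \<in> K" "x \<in> ball (fst i) (snd i)"
      unfolding uncentred_max_level K_def I_def by force
    then obtain j where j: "j \<in> C" "cball (fst i) (snd i) \<subseteq> ball (fst j) (5 * snd j)" using C4 by blast
    obtain n where "e n = Some j" using e(1) j(1) by blast
    moreover have "x \<in> cball (fst i) (snd i)" using i(2) by simp
    ultimately have "x \<in> B 5 n" using j(2) by (auto simp: B_def)
    then show "x \<in> (\<Union>n. B 5 n)" by blast
  qed
  then have "wmeas u {x. ennreal t < uncentred_max R u h x} \<le> wmeas u (\<Union>n. B 5 n)" by (rule wmeas_mono)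
  also have "\<dots> = emeasure (density lebesgue u) (\<Union>n. B 5 n)" by (intro wmeas_eq_emeasure) auto
  also have "\<dots> \<le> (\<Sum>n. emeasure (density lebesgue u) (B 5 n))" by (intro emeasure_subadditive_countably) auto
  also have "\<dots> = (\<Sum>n. wmeas u (B 5 n))" by (simp add: wmeas_eq_emeasure)
  finally have "ennreal t * wmeas u {x. ennreal t < uncentred_max R u h x} \<le> (\<Sum>n. ennreal t * wmeas u (B 5 n))"
    by (simp add: mult_left_mono)
  also have "\<dots> \<le> (\<Sum>n. ennreal D * (\<integral>\<^sup>+z. h z * u z * indicator (B 1 n) z \<partial>lebesgue))"
  proof (intro suminf_le summableI)
    fix n
    show "ennreal t * wmeas u (B 5 n) \<le> ennreal D * (\<integral>\<^sup>+z. h z * u z * indicator (B 1 n) z \<partial>lebesgue)"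
    proof (cases "e n")
      case None then show ?thesis by (simp add: B_def wmeas_def)
    next
      case (Some c)
      then have "c \<in> K" using e(2) C(2) by blast
      then have c: "0 < snd c" "ennreal t < I (fst c) (snd c) / wmeas u (ball (fst c) (snd c))" by (auto simp: K_def)
      let ?b = "wmeas u (ball (fst c) (snd c))"
      have b: "0 < ?b" "?b < \<infinity>" using ub c(1) by auto
      have "ennreal t * ?b \<le> (I (fst c) (snd c) / ?b) * ?b" using c(2) by (intro mult_right_mono) auto
      also have "\<dots> = I (fst c) (snd c)" using b by (simp add: ennreal_divide_times)
      finally have *: "ennreal t * ?b \<le> I (fst c) (snd c)" .
      have "ennreal t * wmeas u (B 5 n) \<le> ennreal t * (ennreal D * ?b)"
        using ub(3)[OF c(1)] Some by (intro mult_left_mono) (auto simp: B_def)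
      also have "\<dots> = ennreal D * (ennreal t * ?b)" by (simp add: mult_ac)
      also have "\<dots> \<le> ennreal D * I (fst c) (snd c)" by (rule mult_left_mono[OF *]) simp
      finally show ?thesis using Some by (simp add: B_def I_def)
    qed
  qed
  also have "\<dots> = ennreal D * (\<integral>\<^sup>+z. (\<Sum>n. h z * u z * indicator (B 1 n) z) \<partial>lebesgue)"
  proof -
    have "(\<integral>\<^sup>+z. (\<Sum>n. h z * u z * indicator (B 1 n) z) \<partial>lebesgue) = (\<Sum>n. \<integral>\<^sup>+z. h z * u z * indicator (B 1 n) z \<partial>lebesgue)"
      by (rule nn_integral_suminf) measurable
    then show ?thesis by (simp only: ennreal_suminf_cmult)
  qed
  also have "(\<integral>\<^sup>+z. (\<Sum>n. h z * u z * indicator (B 1 n) z) \<partial>lebesgue) = (\<integral>\<^sup>+z. h z * u z * indicator (\<Union>n. B 1 n) z \<partial>lebesgue)"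
    using dj by (intro nn_integral_cong) (simp add: suminf_indicator)
  also have "\<dots> \<le> (\<integral>\<^sup>+z. h z * u z \<partial>lebesgue)" by (intro nn_integral_mono) (auto simp: indicator_def)
  finally show ?thesis by (simp add: mult_left_mono)
qed

lemma uncentred_max_truncate:
  fixes h u :: "'a::euclidean_space \<Rightarrow> ennreal"
  assumes u: "doubling_weight D u" and h [measurable]: "h \<in> borel_measurable lebesgue" and t: "0 < t"
  shows "uncentred_max R u h x \<le> uncentred_max R u (\<lambda>z. h z * indicator {z. ennreal t < h z} z) x + ennreal t"
  unfolding uncentred_max_def[of R u h]
proof (rule SUP_least, clarify)
  fix y r assume r: "0 < r" "r \<le> R" "x \<in> ball y r"
  have [measurable]: "u \<in> borel_measurable lebesgue" using u by (simp add: doubling_weight_def)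
  have ub: "0 < wmeas u (ball y r)" "wmeas u (ball y r) < \<infinity>" using u r(1) by (auto simp: doubling_weight_def)
  have [measurable]: "ball y r \<in> sets lebesgue" by simp
  have "{z \<in> space lebesgue. ennreal t < h z} \<in> sets lebesgue" by measurable
  then have [measurable]: "{z. ennreal t < h z} \<in> sets lebesgue" by simp
  let ?g = "\<lambda>z. h z * indicator {z. ennreal t < h z} z"
  have "(\<integral>\<^sup>+z\<in>ball y r. (h z * u z) \<partial>lebesgue) \<le> (\<integral>\<^sup>+z. (?g z * u z * indicator (ball y r) z + ennreal t * (u z * indicator (ball y r) z)) \<partial>lebesgue)"
  proof (rule nn_integral_mono)
    fix z
    show "h z * u z * indicator (ball y r) z \<le> ?g z * u z * indicator (ball y r) z + ennreal t * (u z * indicator (ball y r) z)"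
    proof (cases "ennreal t < h z")
      case False
      then have "h z * (u z * indicator (ball y r) z) \<le> ennreal t * (u z * indicator (ball y r) z)" by (intro mult_right_mono) auto
      then show ?thesis using False by (simp add: mult.assoc)
    qed simp
  qed
  also have "\<dots> = (\<integral>\<^sup>+z\<in>ball y r. (?g z * u z) \<partial>lebesgue) + ennreal t * wmeas u (ball y r)"
    unfolding wmeas_def by (subst nn_integral_add) (auto simp: nn_integral_cmult)
  finally have "(\<integral>\<^sup>+z\<in>ball y r. (h z * u z) \<partial>lebesgue) / wmeas u (ball y r)
    \<le> ((\<integral>\<^sup>+z\<in>ball y r. (?g z * u z) \<partial>lebesgue) + ennreal t * wmeas u (ball y r)) / wmeas u (ball y r)"
    by (rule divide_right_mono_ennreal)
  also have "\<dots> = (\<integral>\<^sup>+z\<in>ball y r. (?g z * u z) \<partial>lebesgue) / wmeas u (ball y r) + ennreal t * (wmeas u (ball y r) / wmeas u (ball y r))"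
    by (simp add: add_divide_distrib_ennreal ennreal_times_divide)
  also have "wmeas u (ball y r) / wmeas u (ball y r) = 1" using ub by (simp add: ennreal_divide_self)
  also have "(\<integral>\<^sup>+z\<in>ball y r. (?g z * u z) \<partial>lebesgue) / wmeas u (ball y r) \<le> uncentred_max R u ?g x"
    by (rule uncentred_max_upper[OF r])
  finally show "(\<integral>\<^sup>+z\<in>ball y r. (h z * u z) \<partial>lebesgue) / wmeas u (ball y r) \<le> uncentred_max R u ?g x + ennreal t"
    by (simp add: add_right_mono)
qed

theorem uncentred_max_Lp:
  fixes h u :: "'a::euclidean_space \<Rightarrow> ennreal"
  assumes u: "doubling_weight D u" and h [measurable]: "h \<in> borel_measurable lebesgue" and q: "1 < q"
  shows "(\<integral>\<^sup>+x. epowr (uncentred_max R u h x) q * u x \<partial>lebesgue)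
    \<le> ennreal (2 * D * q / (q-1) * 2 powr (q-1)) * (\<integral>\<^sup>+x. epowr (h x) q * u x \<partial>lebesgue)"
proof -
  let ?L = "lebesgue :: 'a measure"
  have u' [measurable]: "u \<in> borel_measurable ?L" and D: "0 \<le> D" using u by (simp_all add: doubling_weight_def)
  interpret P: pair_sigma_finite lborel ?L ..
  let ?c = "2 * D * q / (q-1)"
  have c: "0 \<le> ?c" using q D by simp
  let ?k = "\<lambda>t. ennreal ((q-1) * t powr (q - 1 - 1))"
  have [measurable]: "{z. ennreal t < h z} \<in> sets lebesgue" for t
  proof -
    have "{z \<in> space lebesgue. ennreal t < h z} \<in> sets lebesgue" by measurable
    then show ?thesis by simp
  qed
  have "(\<integral>\<^sup>+x. epowr (uncentred_max R u h x) q * u x \<partial>?L)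
    = (\<integral>\<^sup>+t. ennreal (q * t powr (q - 1)) * indicator {0<..} t * (\<integral>\<^sup>+x. indicator {x. ennreal t < uncentred_max R u h x} x * u x \<partial>?L) \<partial>lborel)"
    using q by (intro layer_cake sigma_finite_lebesgue) auto
  also have "\<dots> \<le> (\<integral>\<^sup>+t. \<integral>\<^sup>+x. ennreal ?c * (?k t * indicator {t. 0 < t \<and> ennreal t < 2 * h x} t * (h x * u x)) \<partial>?L \<partial>lborel)"
  proof (rule nn_integral_mono)
    fix t :: real
    show "ennreal (q * t powr (q - 1)) * indicator {0<..} t * (\<integral>\<^sup>+x. indicator {x. ennreal t < uncentred_max R u h x} x * u x \<partial>?L)
      \<le> (\<integral>\<^sup>+x. ennreal ?c * (?k t * indicator {t. 0 < t \<and> ennreal t < 2 * h x} t * (h x * u x)) \<partial>?L)"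
    proof (cases "0 < t")
      case True
      let ?g = "\<lambda>z. h z * indicator {z. ennreal (t/2) < h z} z"
      have sub: "{x. ennreal t < uncentred_max R u h x} \<subseteq> {x. ennreal (t/2) < uncentred_max R u ?g x}"
      proof (intro Collect_mono impI)
        fix x assume x: "ennreal t < uncentred_max R u h x"
        show "ennreal (t/2) < uncentred_max R u ?g x"
        proof (rule ccontr)
          assume "\<not> ennreal (t/2) < uncentred_max R u ?g x"
          then have "uncentred_max R u ?g x + ennreal (t/2) \<le> ennreal (t/2) + ennreal (t/2)" by (intro add_right_mono) (simp add: not_less)
          also have "\<dots> = ennreal t" using True by (subst ennreal_plus[symmetric]) auto
          finally show False using uncentred_max_truncate[OF u h, of "t/2" R x] x True by simp
        qed
      qed
      have "ennreal (t/2) * wmeas u {x. ennreal t < uncentred_max R u h x} \<le> ennreal (t/2) * wmeas u {x. ennreal (t/2) < uncentred_max R u ?g x}"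
        by (intro mult_left_mono wmeas_mono sub) simp
      also have "\<dots> \<le> ennreal D * (\<integral>\<^sup>+x. ?g x * u x \<partial>?L)"
        using True by (intro uncentred_max_weak_type[OF u]) auto
      finally have w: "ennreal (t/2) * wmeas u {x. ennreal t < uncentred_max R u h x} \<le> ennreal D * (\<integral>\<^sup>+x. ?g x * u x \<partial>?L)" .
      have e: "q * t powr (q-1) = 2 * q * t powr (q-1-1) * (t/2)" proof -
        have "t powr (q-1) = t powr (q-1-1) * t" using True powr_add[of t "q-1-1" 1] by simp
        then show ?thesis by simp
      qed
      have "ennreal (q * t powr (q - 1)) * wmeas u {x. ennreal t < uncentred_max R u h x}
        = ennreal (2 * q * t powr (q-1-1)) * (ennreal (t/2) * wmeas u {x. ennreal t < uncentred_max R u h x})"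
        unfolding e using q True by (subst ennreal_mult) (auto simp: mult.assoc)
      also have "\<dots> \<le> ennreal (2 * q * t powr (q-1-1)) * (ennreal D * (\<integral>\<^sup>+x. ?g x * u x \<partial>?L))"
        by (rule mult_left_mono[OF w]) simp
      also have "\<dots> = ennreal (2 * q * t powr (q-1-1) * D) * (\<integral>\<^sup>+x. ?g x * u x \<partial>?L)"
        using D q by (subst ennreal_mult) (auto simp: mult.assoc)
      also have "2 * q * t powr (q-1-1) * D = ?c * ((q-1) * t powr (q-1-1))" using q by simp
      also have "ennreal (?c * ((q-1) * t powr (q-1-1))) * (\<integral>\<^sup>+x. ?g x * u x \<partial>?L) = (\<integral>\<^sup>+x. ennreal (?c * ((q-1) * t powr (q-1-1))) * (?g x * u x) \<partial>?L)"
        by (rule nn_integral_cmult[symmetric]) measurable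
      also have "\<dots> = (\<integral>\<^sup>+x. ennreal ?c * (?k t * indicator {t. 0 < t \<and> ennreal t < 2 * h x} t * (h x * u x)) \<partial>?L)"
      proof (rule nn_integral_cong)
        fix x
        have iff: "ennreal (t/2) < h x \<longleftrightarrow> ennreal t < 2 * h x"
        proof (cases "h x")
          case (real a)
          have "2 * h x = ennreal (2 * a)" using real by (simp add: ennreal_mult)
          then show ?thesis using real True by (auto simp: ennreal_less_iff)
        qed (simp add: ennreal_mult_top)
        have "ennreal (?c * ((q-1) * t powr (q-1-1))) = ennreal ?c * ?k t" using c by (rule ennreal_mult')
        then show "ennreal (?c * ((q-1) * t powr (q-1-1))) * (?g x * u x) = ennreal ?c * (?k t * indicator {t. 0 < t \<and> ennreal t < 2 * h x} t * (h x * u x))"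
          using True iff by (simp add: indicator_def mult.assoc)
      qed
      finally show ?thesis using True by (simp add: wmeas_def mult.commute)
    qed simp
  qed
  also have "\<dots> = (\<integral>\<^sup>+x. \<integral>\<^sup>+t. ennreal ?c * (?k t * indicator {t. 0 < t \<and> ennreal t < 2 * h x} t * (h x * u x)) \<partial>lborel \<partial>?L)"
  proof (rule P.Fubini'[symmetric])
    have [measurable]: "Measurable.pred (lborel \<Otimes>\<^sub>M ?L) (\<lambda>z. ennreal (fst z) < 2 * h (snd z))" by measurable
    show "(\<lambda>(t, x). ennreal ?c * (?k t * indicator {t. 0 < t \<and> ennreal t < 2 * h x} t * (h x * u x))) \<in> borel_measurable (lborel \<Otimes>\<^sub>M ?L)"
      unfolding indicator_def mem_Collect_eq split_beta' by measurable
  qed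
  also have "\<dots> = (\<integral>\<^sup>+x. ennreal (?c * 2 powr (q-1)) * (epowr (h x) q * u x) \<partial>?L)"
  proof (rule nn_integral_cong)
    fix x
    have "(\<integral>\<^sup>+t. ennreal ?c * (?k t * indicator {t. 0 < t \<and> ennreal t < 2 * h x} t * (h x * u x)) \<partial>lborel)
      = ennreal ?c * ((\<integral>\<^sup>+t. ?k t * indicator {t. 0 < t \<and> ennreal t < 2 * h x} t \<partial>lborel) * (h x * u x))"
      by (subst nn_integral_cmult, measurable, subst nn_integral_multc, measurable)
    also have "(\<integral>\<^sup>+t. ?k t * indicator {t. 0 < t \<and> ennreal t < 2 * h x} t \<partial>lborel) = epowr (2 * h x) (q-1)"
      using q by (intro nn_integral_power_below) simp
    also have "epowr (2 * h x) (q-1) = ennreal (2 powr (q-1)) * epowr (h x) (q-1)"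
      using q epowr_ennreal[of "q-1" 2] by (simp add: epowr_mult)
    also have "ennreal ?c * (ennreal (2 powr (q-1)) * epowr (h x) (q-1) * (h x * u x)) = ennreal (?c * 2 powr (q-1)) * ((epowr (h x) (q-1) * epowr (h x) 1) * u x)"
    proof -
      have "ennreal a * (ennreal b * X * (Y * Z)) = ennreal (a * b) * ((X * Y) * Z)" if "0 \<le> a" "0 \<le> b" for a b X Y Z
        using that by (simp add: ennreal_mult mult_ac)
      then show ?thesis using c by (simp only: epowr_one powr_ge_zero)
    qed
    also have "epowr (h x) (q-1) * epowr (h x) 1 = epowr (h x) q" using q epowr_add[of "q-1" 1 "h x"] by simp
    finally show "(\<integral>\<^sup>+t. ennreal ?c * (?k t * indicator {t. 0 < t \<and> ennreal t < 2 * h x} t * (h x * u x)) \<partial>lborel)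
      = ennreal (?c * 2 powr (q-1)) * (epowr (h x) q * u x)" .
  qed
  also have "\<dots> = ennreal (?c * 2 powr (q-1)) * (\<integral>\<^sup>+x. epowr (h x) q * u x \<partial>?L)"
    by (rule nn_integral_cmult) measurable
  finally show ?thesis .
qed

section \<open>Muckenhoupt weights\<close>

lemma wmeas_ball_pos:
  fixes w :: "'a::euclidean_space \<Rightarrow> ennreal"
  assumes [measurable]: "w \<in> borel_measurable lebesgue" and w: "AE x in lebesgue. 0 < w x" and r: "0 < r"
  shows "0 < wmeas w (ball y r)"
proof (rule ccontr)
  assume "\<not> 0 < wmeas w (ball y r)"
  then have z: "(\<integral>\<^sup>+x\<in>ball y r. w x \<partial>lebesgue) = 0" by (simp add: wmeas_def not_less)
  have [measurable]: "ball y r \<in> sets lebesgue" by simp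
  have "AE x in lebesgue. w x * indicator (ball y r) x = 0"
    using z by (subst (asm) nn_integral_0_iff_AE) auto
  with w have "AE x in lebesgue. x \<notin> ball y r"
  proof eventually_elim
    case (elim x)
    then show ?case by (cases "x \<in> ball y r") auto
  qed
  then have "emeasure lebesgue (ball y r) = 0" by (subst (asm) AE_iff_measurable[of "ball y r"]) auto
  then show False using r unit_ball_vol_pos[of "real DIM('a)"] by (simp add: emeasure_lebesgue_ball[simplified])
qed

lemma Holder_on_set:
  fixes w :: "'a::euclidean_space \<Rightarrow> ennreal"
  assumes p: "1 < p" and u: "u \<in> borel_measurable lebesgue" and w: "w \<in> borel_measurable lebesgue"
    and wp: "AE x in lebesgue. 0 < w x \<and> w x < \<infinity>" and E: "E \<in> sets lebesgue"
  shows "epowr (\<integral>\<^sup>+x\<in>E. u x \<partial>lebesgue) p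
     \<le> (\<integral>\<^sup>+x\<in>E. (epowr (u x) p * w x) \<partial>lebesgue) * epowr (wmeas (\<lambda>x. epowr (w x) (-1/(p-1))) E) (p-1)"
proof -
  have E': "E \<inter> space lebesgue \<in> sets lebesgue" using E by simp
  have "AE x in restrict_space lebesgue E. 0 < w x \<and> w x < \<infinity>"
    using wp by (subst AE_restrict_space_iff[OF E']) auto
  from epowr_integral_Holder[OF p measurable_restrict_space1[OF u] measurable_restrict_space1[OF w] this]
  show ?thesis by (simp only: nn_integral_restrict_space[OF E'] wmeas_def)
qed

definition averaging_weight :: "real \<Rightarrow> real \<Rightarrow> ('a::euclidean_space \<Rightarrow> ennreal) \<Rightarrow> bool" where
  "averaging_weight p A w \<longleftrightarrow> 0 \<le> A \<and> w \<in> borel_measurable lebesgue \<and>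
     (\<forall>y. \<forall>r>0. 0 < wmeas w (ball y r) \<and> wmeas w (ball y r) < \<infinity>) \<and>
     (\<forall>y. \<forall>r>0. \<forall>u\<in>borel_measurable lebesgue.
        epowr (\<integral>\<^sup>+z\<in>ball y r. u z \<partial>lebesgue) p * wmeas w (ball y r)
        \<le> ennreal A * epowr (emeasure lebesgue (ball y r)) p * (\<integral>\<^sup>+z\<in>ball y r. (epowr (u z) p * w z) \<partial>lebesgue))"

definition Ap_weight :: "real \<Rightarrow> real \<Rightarrow> ('a::euclidean_space \<Rightarrow> ennreal) \<Rightarrow> bool" where
  "Ap_weight p A w \<longleftrightarrow> 1 < p \<and> 0 \<le> A \<and> w \<in> borel_measurable lebesgue \<and> (AE x in lebesgue. 0 < w x \<and> w x < \<infinity>) \<and>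
     (\<forall>y. \<forall>r>0. wmeas w (ball y r) < \<infinity>) \<and>
     (\<forall>y. \<forall>r>0. wmeas w (ball y r) * epowr (wmeas (\<lambda>x. epowr (w x) (-1/(p-1))) (ball y r)) (p-1)
        \<le> ennreal A * epowr (emeasure lebesgue (ball y r)) p)"

lemma emeasure_ball_scale:
  fixes y :: "'a::euclidean_space"
  assumes "0 < c" "0 < r"
  shows "emeasure lebesgue (ball y (c * r)) = ennreal (c ^ DIM('a)) * emeasure lebesgue (ball y r)"
  using assms by (simp add: emeasure_lebesgue_ball[simplified] ennreal_mult[symmetric] power_mult_distrib mult_ac)

lemma epowr_ball:
  fixes y :: "'a::euclidean_space"
  assumes "0 < r" "0 < p"
  shows "epowr (emeasure lebesgue (ball y r)) p \<noteq> 0" "epowr (emeasure lebesgue (ball y r)) p \<noteq> \<infinity>"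
proof -
  have "0 < emeasure lebesgue (ball y r)" using assms by (simp add: emeasure_lebesgue_ball[simplified])
  then show "epowr (emeasure lebesgue (ball y r)) p \<noteq> 0" using epowr_gt_zero[OF assms(2)] by (metis less_numeral_extra(3))
  have "emeasure lebesgue (ball y r) < \<infinity>" by simp
  then show "epowr (emeasure lebesgue (ball y r)) p \<noteq> \<infinity>" using epowr_less_top[OF assms(2)] by (metis less_irrefl)
qed

lemma averaging_subset:
  fixes w :: "'a::euclidean_space \<Rightarrow> ennreal"
  assumes w: "averaging_weight p A w" and p: "0 < p" and r: "0 < r" and E: "E \<in> sets lebesgue" "E \<subseteq> ball y r"
  shows "epowr (emeasure lebesgue E) p * wmeas w (ball y r) \<le> ennreal A * epowr (emeasure lebesgue (ball y r)) p * wmeas w E"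
proof -
  have "(\<integral>\<^sup>+z\<in>ball y r. indicator E z \<partial>lebesgue) = (\<integral>\<^sup>+z. indicator E z \<partial>lebesgue)"
    using E(2) by (intro nn_integral_cong) (auto simp: indicator_def)
  also have "\<dots> = emeasure lebesgue E" using E(1) by (rule nn_integral_indicator)
  finally have 1: "(\<integral>\<^sup>+z\<in>ball y r. indicator E z \<partial>lebesgue) = emeasure lebesgue E" .
  have 2: "(\<integral>\<^sup>+z\<in>ball y r. (epowr (indicator E z) p * w z) \<partial>lebesgue) = wmeas w E"
    unfolding wmeas_def using E(2) p by (intro nn_integral_cong) (auto simp: indicator_def)
  have "indicator E \<in> borel_measurable lebesgue" using E(1) by (rule borel_measurable_indicator)
  then show ?thesis using w r unfolding averaging_weight_def 1[symmetric] 2[symmetric] by blast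
qed

lemma averaging_dilate:
  fixes w :: "'a::euclidean_space \<Rightarrow> ennreal"
  assumes w: "averaging_weight p A w" and p: "0 < p" and r: "0 < r" and c: "1 \<le> c"
  shows "wmeas w (ball y (c * r)) \<le> ennreal (A * (c ^ DIM('a)) powr p) * wmeas w (ball y r)"
proof -
  let ?b = "epowr (emeasure lebesgue (ball y r)) p"
  have "ball y r \<subseteq> ball y (c * r)" using c r by (intro subset_ball) simp
  moreover have "0 < c * r" using c r by simp
  ultimately have "?b * wmeas w (ball y (c * r)) \<le> ennreal A * epowr (emeasure lebesgue (ball y (c * r))) p * wmeas w (ball y r)"
    by (intro averaging_subset[OF w p]) auto
  also have "epowr (emeasure lebesgue (ball y (c * r))) p = ennreal ((c ^ DIM('a)) powr p) * ?b"
  proof -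
    have "0 < c" using c by simp
    then show ?thesis unfolding emeasure_ball_scale[OF \<open>0 < c\<close> r] epowr_mult[OF p] using p by (simp add: epowr_ennreal)
  qed
  also have "ennreal A * (ennreal ((c ^ DIM('a)) powr p) * ?b) * wmeas w (ball y r) = ?b * (ennreal (A * (c ^ DIM('a)) powr p) * wmeas w (ball y r))"
    using w by (simp add: averaging_weight_def ennreal_mult mult_ac)
  finally show ?thesis using epowr_ball[OF r p, of y] by (subst (asm) ennreal_mult_le_mult_iff) auto
qed

lemma averaging_doubling:
  fixes w :: "'a::euclidean_space \<Rightarrow> ennreal"
  assumes w: "averaging_weight p A w" and p: "0 < p"
  shows "doubling_weight (A * (5 ^ DIM('a)) powr p) w"
  using w averaging_dilate[OF w p, of _ 5] unfolding doubling_weight_def averaging_weight_def by simp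

lemma Ap_averaging:
  fixes w :: "'a::euclidean_space \<Rightarrow> ennreal"
  assumes w: "Ap_weight p A w"
  shows "averaging_weight p A w"
  unfolding averaging_weight_def
proof (intro conjI allI impI ballI)
  have w': "1 < p" "w \<in> borel_measurable lebesgue" "AE x in lebesgue. 0 < w x \<and> w x < \<infinity>"
    using w by (simp_all add: Ap_weight_def)
  show "0 \<le> A" "w \<in> borel_measurable lebesgue" using w by (simp_all add: Ap_weight_def)
  fix y :: 'a and r :: real assume r: "0 < r"
  show "0 < wmeas w (ball y r)" using w'(3) by (intro wmeas_ball_pos w'(2) r) (auto elim: eventually_mono)
  show "wmeas w (ball y r) < \<infinity>" using w r by (simp add: Ap_weight_def)
  fix u :: "'a \<Rightarrow> ennreal" assume u: "u \<in> borel_measurable lebesgue"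
  let ?I = "\<integral>\<^sup>+z\<in>ball y r. (epowr (u z) p * w z) \<partial>lebesgue" let ?S = "epowr (wmeas (\<lambda>x. epowr (w x) (-1/(p-1))) (ball y r)) (p-1)"
  have "epowr (\<integral>\<^sup>+z\<in>ball y r. u z \<partial>lebesgue) p * wmeas w (ball y r) \<le> (?I * ?S) * wmeas w (ball y r)"
    by (intro mult_right_mono Holder_on_set w' u) auto
  also have "\<dots> = (wmeas w (ball y r) * ?S) * ?I" by (simp only: mult_ac)
  also have "\<dots> \<le> (ennreal A * epowr (emeasure lebesgue (ball y r)) p) * ?I"
    using w r by (intro mult_right_mono) (auto simp: Ap_weight_def)
  finally show "epowr (\<integral>\<^sup>+z\<in>ball y r. u z \<partial>lebesgue) p * wmeas w (ball y r) \<le> ennreal A * epowr (emeasure lebesgue (ball y r)) p * ?I" .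
qed

lemma Ap_dual_doubling:
  fixes w :: "'a::euclidean_space \<Rightarrow> ennreal"
  assumes w: "Ap_weight p A w"
  shows "doubling_weight ((A * (5 ^ DIM('a)) powr p) powr (1/(p-1))) (\<lambda>x. epowr (w x) (-1/(p-1)))"
  unfolding doubling_weight_def
proof (intro conjI allI impI)
  let ?\<sigma> = "\<lambda>x. epowr (w x) (-1/(p-1))"
  have p: "1 < p" and A: "0 \<le> A" and m [measurable]: "w \<in> borel_measurable lebesgue" and wp: "AE x in lebesgue. 0 < w x \<and> w x < \<infinity>"
    using w by (simp_all add: Ap_weight_def)
  show m\<sigma>: "?\<sigma> \<in> borel_measurable lebesgue" by measurable
  have \<sigma>p: "AE x in lebesgue. 0 < ?\<sigma> x" using wp
  proof eventually_elim
    case (elim x)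
    then show ?case by (cases "w x") (auto simp: epowr_pos_ennreal)
  qed
  have fin: "wmeas ?\<sigma> (ball y r) < \<infinity>" if r: "0 < r" for y :: 'a and r
  proof (rule ccontr)
    assume "\<not> wmeas ?\<sigma> (ball y r) < \<infinity>"
    then have "epowr (wmeas ?\<sigma> (ball y r)) (p-1) = \<infinity>" using p by (simp add: less_top[symmetric])
    moreover have "0 < wmeas w (ball y r)" using Ap_averaging[OF w] r by (simp add: averaging_weight_def)
    ultimately have "wmeas w (ball y r) * epowr (wmeas ?\<sigma> (ball y r)) (p-1) = \<infinity>" by (simp add: ennreal_mult_top)
    moreover have "ennreal A * epowr (emeasure lebesgue (ball y r)) p < \<infinity>"
      using epowr_ball[OF r, of p y] p by (simp add: ennreal_mult_less_top less_top)
    moreover have "wmeas w (ball y r) * epowr (wmeas ?\<sigma> (ball y r)) (p-1) \<le> ennreal A * epowr (emeasure lebesgue (ball y r)) p"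
      using w r by (simp add: Ap_weight_def)
    ultimately show False by simp
  qed
  show "0 \<le> (A * (5 ^ DIM('a)) powr p) powr (1/(p-1))" by simp
  fix y :: 'a and r :: real assume r: "0 < r"
  show "0 < wmeas ?\<sigma> (ball y r)" by (rule wmeas_ball_pos[OF m\<sigma> \<sigma>p r])
  show "wmeas ?\<sigma> (ball y r) < \<infinity>" by (rule fin[OF r])
  let ?B = "ball y (5 * r)" let ?E = "ball y r" let ?b = "epowr (emeasure lebesgue ?E) p"
  have r5: "0 < 5 * r" using r by simp
  have "(\<integral>\<^sup>+x\<in>?E. 1 \<partial>lebesgue) = emeasure lebesgue ?E" by simp
  then have "?b = epowr (\<integral>\<^sup>+x\<in>?E. 1 \<partial>lebesgue) p" by simp
  also have "\<dots> \<le> (\<integral>\<^sup>+x\<in>?E. (epowr 1 p * w x) \<partial>lebesgue) * epowr (wmeas ?\<sigma> ?E) (p-1)"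
    by (rule Holder_on_set[OF p _ m wp]) auto
  also have "(\<integral>\<^sup>+x\<in>?E. (epowr 1 p * w x) \<partial>lebesgue) = wmeas w ?E" by (simp add: wmeas_def)
  also have "wmeas w ?E * epowr (wmeas ?\<sigma> ?E) (p-1) \<le> wmeas w ?B * epowr (wmeas ?\<sigma> ?E) (p-1)"
    using r by (intro mult_right_mono wmeas_mono subset_ball) auto
  finally have "?b * epowr (wmeas ?\<sigma> ?B) (p-1) \<le> wmeas w ?B * epowr (wmeas ?\<sigma> ?E) (p-1) * epowr (wmeas ?\<sigma> ?B) (p-1)"
    by (rule mult_right_mono) simp
  also have "\<dots> = (wmeas w ?B * epowr (wmeas ?\<sigma> ?B) (p-1)) * epowr (wmeas ?\<sigma> ?E) (p-1)" by (simp only: mult_ac)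
  also have "\<dots> \<le> (ennreal A * epowr (emeasure lebesgue ?B) p) * epowr (wmeas ?\<sigma> ?E) (p-1)"
    using w r5 by (intro mult_right_mono) (auto simp: Ap_weight_def)
  also have "epowr (emeasure lebesgue ?B) p = ennreal ((5 ^ DIM('a)) powr p) * ?b"
  proof -
    have p0: "0 < p" using p by simp
    have five: "0 < (5::real)" by simp
    show ?thesis unfolding emeasure_ball_scale[OF five r] epowr_mult[OF p0]
      by (subst epowr_ennreal[OF p0]) simp_all
  qed
  also have "ennreal A * (ennreal ((5 ^ DIM('a)) powr p) * ?b) * epowr (wmeas ?\<sigma> ?E) (p-1) = ?b * (ennreal (A * (5 ^ DIM('a)) powr p) * epowr (wmeas ?\<sigma> ?E) (p-1))"
    using A by (simp add: ennreal_mult mult_ac)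
  finally have "epowr (wmeas ?\<sigma> ?B) (p-1) \<le> ennreal (A * (5 ^ DIM('a)) powr p) * epowr (wmeas ?\<sigma> ?E) (p-1)"
    using epowr_ball[OF r, of p y] p by (subst (asm) ennreal_mult_le_mult_iff) auto
  then have "epowr (epowr (wmeas ?\<sigma> ?B) (p-1)) (1/(p-1)) \<le> epowr (ennreal (A * (5 ^ DIM('a)) powr p) * epowr (wmeas ?\<sigma> ?E) (p-1)) (1/(p-1))"
    using p by (intro epowr_mono) auto
  then show "wmeas ?\<sigma> ?B \<le> ennreal ((A * (5 ^ DIM('a)) powr p) powr (1/(p-1))) * wmeas ?\<sigma> ?E"
    using p A by (simp add: epowr_mult epowr_epowr epowr_ennreal)
qed

theorem Muckenhoupt_maximal:
  fixes w :: "'a::euclidean_space \<Rightarrow> ennreal"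
  assumes w: "Ap_weight p A w"
  shows "\<exists>K::real. 0 \<le> K \<and> (\<forall>R. \<forall>f\<in>borel_measurable lebesgue.
    (\<integral>\<^sup>+x. epowr (uncentred_max R (\<lambda>_. 1) f x) p * w x \<partial>lebesgue) \<le> ennreal K * (\<integral>\<^sup>+x. epowr (f x) p * w x \<partial>lebesgue))"
proof -
  let ?\<sigma> = "\<lambda>x. epowr (w x) (-1/(p-1))"
  define D1 where "D1 = A * (5 ^ DIM('a)) powr p"
  define D2 where "D2 = (A * (5 ^ DIM('a)) powr p) powr (1/(p-1))"
  have p: "1 < p" and A: "0 \<le> A" and m [measurable]: "w \<in> borel_measurable lebesgue" and wp: "AE x in lebesgue. 0 < w x \<and> w x < \<infinity>"
    using w by (simp_all add: Ap_weight_def)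
  have d1: "doubling_weight D1 w" unfolding D1_def using p by (intro averaging_doubling Ap_averaging w) simp
  have d2: "doubling_weight D2 ?\<sigma>" unfolding D2_def by (rule Ap_dual_doubling[OF w])
  define q where "q = p/(p-1)"
  have q: "1 < q" "(p-1) * q = p" "0 < q" using p by (simp_all add: q_def)
  define K1 where "K1 = 2 * D1 * q / (q-1) * 2 powr (q-1)"
  define K2 where "K2 = 2 * D2 * p / (p-1) * 2 powr (p-1)"
  have K0: "0 \<le> K1" "0 \<le> K2" using d1 d2 q p by (auto simp: K1_def K2_def doubling_weight_def)
  have "(\<integral>\<^sup>+x. epowr (uncentred_max R (\<lambda>_. 1) f x) p * w x \<partial>lebesgue) \<le> ennreal (A powr q * (K1 * K2)) * (\<integral>\<^sup>+x. epowr (f x) p * w x \<partial>lebesgue)"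
    if f [measurable]: "f \<in> borel_measurable lebesgue" for R and f :: "'a \<Rightarrow> ennreal"
  proof -
    define g where "g x = f x / ?\<sigma> x" for x
    define N where "N = uncentred_max R ?\<sigma> g"
    define h where "h x = epowr (N x) (p-1) / w x" for x
    define T where "T = uncentred_max R w h"
    have [measurable]: "g \<in> borel_measurable lebesgue" "N \<in> borel_measurable lebesgue" "h \<in> borel_measurable lebesgue" "T \<in> borel_measurable lebesgue"
      unfolding g_def[abs_def] N_def h_def[abs_def] T_def by measurable
    have ae: "AE x in lebesgue. g x * ?\<sigma> x = f x \<and> h x * w x = epowr (N x) (p-1)
       \<and> epowr (g x) p * ?\<sigma> x = epowr (f x) p * w x \<and> epowr (h x) q * w x = epowr (N x) p * ?\<sigma> x"
      using wp
    proof eventually_elim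
      case (elim x)
      then obtain a where a: "w x = ennreal a" "0 < a" by (cases "w x") auto
      have \<sigma>: "?\<sigma> x = ennreal (a powr (-1/(p-1)))" using a by (simp add: epowr_pos_ennreal)
      have div: "y / ennreal b = y * ennreal (1/b)" if "0 < b" for y b
        using that by (simp add: divide_ennreal_def inverse_ennreal inverse_eq_divide)
      have cancel: "y * ennreal (1/b) * ennreal b = y" if "0 < b" for y b
        using that by (simp add: mult.assoc ennreal_mult[symmetric])
      have ep: "epowr (y * ennreal b) c = epowr y c * ennreal (b powr c)" if "0 < b" "0 < c" for y b c
        using that by (simp add: epowr_mult epowr_pos_ennreal)
      let ?s = "a powr (-1/(p-1))"
      have s: "0 < ?s" using a by simp
      have 1: "g x * ?\<sigma> x = f x" unfolding g_def \<sigma> div[OF s] by (rule cancel[OF s])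
      have 2: "h x * w x = epowr (N x) (p-1)" unfolding h_def a(1) div[OF a(2)] by (rule cancel[OF a(2)])
      have "(1/?s) powr p * ?s = a"
      proof -
        have "(1/?s) powr p * ?s = a powr (p/(p-1)) * a powr (-1/(p-1))"
          using a by (simp add: powr_divide powr_powr powr_minus field_simps)
        also have "\<dots> = a powr (p/(p-1) + -1/(p-1))" by (rule powr_add[symmetric])
        also have "p/(p-1) + -1/(p-1) = (p + -1)/(p-1)" by (rule add_divide_distrib[symmetric])
        also have "p + -1 = p - 1" by simp
        also have "(p-1)/(p-1) = 1" using p by simp
        finally show ?thesis using a by simp
      qed
      then have 3: "epowr (g x) p * ?\<sigma> x = epowr (f x) p * w x"
        unfolding g_def \<sigma> div[OF s] unfolding a(1) using s p by (subst ep) (auto simp: mult.assoc ennreal_mult[symmetric])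
      have "(1/a) powr q * a = ?s"
      proof -
        have "(1/a) powr q * a = a powr (-q) * a powr 1" using a by (simp add: powr_divide powr_minus field_simps)
        also have "\<dots> = a powr (-q + 1)" by (rule powr_add[symmetric])
        also have "-q + 1 = -1/(p-1)" using p by (simp add: q_def field_simps)
        finally show ?thesis .
      qed
      then have 4: "epowr (h x) q * w x = epowr (N x) p * ?\<sigma> x"
        unfolding h_def \<sigma> unfolding a(1) div[OF a(2)] using a q p by (subst ep) (auto simp: mult.assoc ennreal_mult[symmetric] epowr_epowr)
      show ?case using 1 2 3 4 by blast
    qed
    have pt: "epowr (uncentred_max R (\<lambda>_. 1) f x) (p-1) \<le> ennreal A * T x" for x
    proof -
      have step: "(\<integral>\<^sup>+z\<in>ball y r. (f z * 1) \<partial>lebesgue) / wmeas (\<lambda>_. 1) (ball y r) \<le> epowr (ennreal A * T x) (1/(p-1))"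
        if r: "0 < r" "r \<le> R" "x \<in> ball y r" for y r
      proof -
        let ?B = "ball y r"
        have [measurable]: "?B \<in> sets lebesgue" by simp
        define S where "S = wmeas ?\<sigma> ?B" define W where "W = wmeas w ?B" define V where "V = emeasure lebesgue ?B"
        define J where "J = (\<integral>\<^sup>+z\<in>?B. f z \<partial>lebesgue)"
        have S: "0 < S" "S < \<infinity>" using d2 r(1) by (auto simp: S_def doubling_weight_def)
        have W: "0 < W" "W < \<infinity>" using d1 r(1) by (auto simp: W_def doubling_weight_def)
        have V: "0 < V" "V < \<infinity>" using r(1) by (simp_all add: V_def emeasure_lebesgue_ball[simplified])
        have wV: "wmeas (\<lambda>_. 1) ?B = V" by (simp add: wmeas_def V_def)
        have J': "(\<integral>\<^sup>+z\<in>?B. (g z * ?\<sigma> z) \<partial>lebesgue) = J"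
          unfolding J_def by (intro nn_integral_cong_AE eventually_mono[OF ae]) (simp only:)
        have Ny: "J / S \<le> N z" if "z \<in> ?B" for z
          unfolding J'[symmetric] S_def N_def by (rule uncentred_max_upper[OF r(1,2) that])
        have "epowr (J/S) (p-1) * V = (\<integral>\<^sup>+z\<in>?B. epowr (J/S) (p-1) \<partial>lebesgue)"
          unfolding V_def by (rule nn_integral_cmult_indicator[symmetric]) simp
        also have "\<dots> \<le> (\<integral>\<^sup>+z\<in>?B. epowr (N z) (p-1) \<partial>lebesgue)"
          using Ny p by (intro nn_integral_mono) (auto simp: indicator_def intro!: epowr_mono)
        also have "\<dots> = (\<integral>\<^sup>+z\<in>?B. (h z * w z) \<partial>lebesgue)"
          by (intro nn_integral_cong_AE eventually_mono[OF ae]) (simp only:)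
        also have "\<dots> = ((\<integral>\<^sup>+z\<in>?B. (h z * w z) \<partial>lebesgue) / W) * W" using W by (simp add: ennreal_divide_times)
        also have "\<dots> \<le> T x * W" unfolding T_def W_def by (intro mult_right_mono uncentred_max_upper r) simp
        finally have i: "epowr (J/S) (p-1) * V \<le> T x * W" .
        have Apb: "W * epowr S (p-1) \<le> ennreal A * epowr V p" using w r(1) by (simp add: Ap_weight_def W_def S_def V_def)
        have JS: "J = (J/S) * S" using S by (simp add: ennreal_divide_times)
        have "epowr J (p-1) * (V * W) = (epowr (J/S) (p-1) * V) * (W * epowr S (p-1))"
          using p by (subst JS) (simp add: epowr_mult mult_ac)
        also have "\<dots> \<le> (T x * W) * (ennreal A * epowr V p)" by (intro mult_mono i Apb) auto
        also have "epowr V p = epowr V (p-1) * V" using epowr_add[of "p-1" 1 V] p by simp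
        finally have "(V * W) * epowr J (p-1) \<le> (V * W) * (ennreal A * T x * epowr V (p-1))" by (simp add: mult_ac)
        then have "epowr J (p-1) \<le> ennreal A * T x * epowr V (p-1)"
          using V W by (subst (asm) ennreal_mult_le_mult_iff) (auto simp: ennreal_mult_eq_top_iff)
        then have "epowr (epowr J (p-1)) (1/(p-1)) \<le> epowr (ennreal A * T x * epowr V (p-1)) (1/(p-1))"
          using p by (intro epowr_mono) auto
        then have "J \<le> epowr (ennreal A * T x) (1/(p-1)) * V"
          using p by (simp add: epowr_mult epowr_epowr)
        then have "J / V \<le> epowr (ennreal A * T x) (1/(p-1)) * V / V" by (rule divide_right_mono_ennreal)
        also have "\<dots> = epowr (ennreal A * T x) (1/(p-1))" using V by (intro ennreal_mult_divide_eq) auto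
        finally show ?thesis by (simp add: wV J_def)
      qed
      have "uncentred_max R (\<lambda>_. 1) f x \<le> epowr (ennreal A * T x) (1/(p-1))"
        unfolding uncentred_max_def by (rule SUP_least, clarify) (rule step)
      then have "epowr (uncentred_max R (\<lambda>_. 1) f x) (p-1) \<le> epowr (epowr (ennreal A * T x) (1/(p-1))) (p-1)"
        using p by (intro epowr_mono) auto
      then show ?thesis using p by (simp add: epowr_epowr)
    qed
    have "(\<integral>\<^sup>+x. epowr (uncentred_max R (\<lambda>_. 1) f x) p * w x \<partial>lebesgue) \<le> (\<integral>\<^sup>+x. ennreal (A powr q) * (epowr (T x) q * w x) \<partial>lebesgue)"
    proof (rule nn_integral_mono)
      fix x
      have "epowr (uncentred_max R (\<lambda>_. 1) f x) p = epowr (epowr (uncentred_max R (\<lambda>_. 1) f x) (p-1)) q"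
        using p q by (simp add: epowr_epowr)
      also have "\<dots> \<le> epowr (ennreal A * T x) q" using q(3) by (rule epowr_mono[OF _ pt])
      also have "\<dots> = ennreal (A powr q) * epowr (T x) q" using q A by (simp add: epowr_mult epowr_ennreal)
      finally have "epowr (uncentred_max R (\<lambda>_. 1) f x) p * w x \<le> ennreal (A powr q) * epowr (T x) q * w x" by (rule mult_right_mono) simp
      then show "epowr (uncentred_max R (\<lambda>_. 1) f x) p * w x \<le> ennreal (A powr q) * (epowr (T x) q * w x)" by (simp only: mult.assoc)
    qed
    also have "\<dots> = ennreal (A powr q) * (\<integral>\<^sup>+x. epowr (T x) q * w x \<partial>lebesgue)" by (rule nn_integral_cmult) measurable
    also have "\<dots> \<le> ennreal (A powr q) * (ennreal K1 * (\<integral>\<^sup>+x. epowr (h x) q * w x \<partial>lebesgue))"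
      unfolding T_def K1_def by (intro mult_left_mono uncentred_max_Lp d1 q) auto
    also have "(\<integral>\<^sup>+x. epowr (h x) q * w x \<partial>lebesgue) = (\<integral>\<^sup>+x. epowr (N x) p * ?\<sigma> x \<partial>lebesgue)"
      by (intro nn_integral_cong_AE eventually_mono[OF ae]) (simp only:)
    also have "ennreal (A powr q) * (ennreal K1 * \<dots>) \<le> ennreal (A powr q) * (ennreal K1 * (ennreal K2 * (\<integral>\<^sup>+x. epowr (g x) p * ?\<sigma> x \<partial>lebesgue)))"
      unfolding N_def K2_def by (intro mult_left_mono uncentred_max_Lp d2 p) auto
    also have "(\<integral>\<^sup>+x. epowr (g x) p * ?\<sigma> x \<partial>lebesgue) = (\<integral>\<^sup>+x. epowr (f x) p * w x \<partial>lebesgue)"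
      by (intro nn_integral_cong_AE eventually_mono[OF ae]) (simp only:)
    also have "ennreal (A powr q) * (ennreal K1 * (ennreal K2 * (\<integral>\<^sup>+x. epowr (f x) p * w x \<partial>lebesgue))) = ennreal (A powr q * (K1 * K2)) * (\<integral>\<^sup>+x. epowr (f x) p * w x \<partial>lebesgue)"
      using K0 by (simp add: ennreal_mult mult.assoc)
    finally show ?thesis .
  qed
  moreover have "0 \<le> A powr q * (K1 * K2)" using K0 by simp
  ultimately show ?thesis by blast
qed

section \<open>The good-lambda inequality\<close>

definition local_max :: "real \<Rightarrow> (nat \<Rightarrow> 'a::euclidean_space \<Rightarrow> complex) \<Rightarrow> 'a \<Rightarrow> ennreal" where
  "local_max s F x = (SUP i. ennreal (1 / (s/2^i) ^ DIM('a)) * (\<integral>\<^sup>+z\<in>nbhd (s/2^i) x. l2norm F z \<partial>lebesgue))"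

lemma borel_measurable_local_max [measurable]: "local_max s F \<in> borel_measurable lebesgue"
proof -
  have "(\<lambda>x. ennreal (1 / (s/2^i) ^ DIM('a)) * (\<integral>\<^sup>+z\<in>nbhd (s/2^i) x. l2norm F z \<partial>lebesgue)) \<in> borel_measurable lebesgue" for i
    by (rule measurable_borel_lebesgue, rule measurable_constant_on_cubes[of "s/2^i"]) (simp_all add: nbhd_eq)
  then show ?thesis unfolding local_max_def[abs_def] by (intro borel_measurable_SUP) auto
qed

lemma nbhd_mass_le_local_max:
  fixes x :: "'a::euclidean_space"
  assumes s: "0 < s"
  shows "(\<integral>\<^sup>+z\<in>nbhd (s/2^i) x. l2norm F z \<partial>lebesgue) \<le> ennreal ((s/2^i) ^ DIM('a)) * local_max s F x"
proof -
  let ?v = "(s/2^i) ^ DIM('a)"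
  have v: "0 < ?v" using s by simp
  have "(\<integral>\<^sup>+z\<in>nbhd (s/2^i) x. l2norm F z \<partial>lebesgue) = ennreal ?v * (ennreal (1 / ?v) * (\<integral>\<^sup>+z\<in>nbhd (s/2^i) x. l2norm F z \<partial>lebesgue))"
    using s by (simp add: mult.assoc[symmetric] ennreal_mult[symmetric])
  also have "\<dots> \<le> ennreal ?v * local_max s F x"
    unfolding local_max_def by (intro mult_left_mono SUP_upper) auto
  finally show ?thesis .
qed

lemma local_max_le_uncentred:
  fixes x :: "'a::euclidean_space"
  assumes s: "0 < s"
  shows "local_max s F x \<le> ennreal (unit_ball_vol (DIM('a)) * (real DIM('a) + 2) ^ DIM('a)) * uncentred_max ((real DIM('a) + 2) * s) (\<lambda>_. 1) (l2norm F) x"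
  unfolding local_max_def
proof (rule SUP_least)
  fix i :: nat
  let ?t = "s/2^i" let ?r = "(real DIM('a) + 2) * (s/2^i)" let ?M = "uncentred_max ((real DIM('a) + 2) * s) (\<lambda>_. 1) (l2norm F) x"
  let ?b = "unit_ball_vol (DIM('a)) * (real DIM('a) + 2) ^ DIM('a)"
  have t: "0 < ?t" and r: "0 < ?r" using s by simp_all
  have ts: "?t \<le> s" using s by (simp add: field_simps)
  have W: "wmeas (\<lambda>_. 1) (ball x ?r) = ennreal (?b * ?t ^ DIM('a))"
    unfolding wmeas_def using r by (simp add: emeasure_lebesgue_ball[simplified] power_mult_distrib power_divide mult_ac)
  have Wp: "0 < ?b * ?t ^ DIM('a)" using t by (intro mult_pos_pos zero_less_power) auto
  have rs: "?r \<le> (real DIM('a) + 2) * s" using ts by (rule mult_left_mono) simp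
  have "(\<integral>\<^sup>+z\<in>nbhd ?t x. l2norm F z \<partial>lebesgue) \<le> (\<integral>\<^sup>+z\<in>ball x ?r. (l2norm F z * 1) \<partial>lebesgue)"
    using nn_integral_subset_le[OF nbhd_subset_ball[OF t, of x], where u="l2norm F" and M=lebesgue] by simp
  also have "\<dots> = ((\<integral>\<^sup>+z\<in>ball x ?r. (l2norm F z * 1) \<partial>lebesgue) / wmeas (\<lambda>_. 1) (ball x ?r)) * wmeas (\<lambda>_. 1) (ball x ?r)"
  proof -
    have "X = X / ennreal c * ennreal c" if "0 < c" for X c using that by (simp add: ennreal_divide_times)
    from this[OF Wp] show ?thesis unfolding W .
  qed
  also have "\<dots> \<le> ?M * wmeas (\<lambda>_. 1) (ball x ?r)"
    by (intro mult_right_mono uncentred_max_upper r rs) (use r in auto)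
  finally have "ennreal (1 / ?t ^ DIM('a)) * (\<integral>\<^sup>+z\<in>nbhd ?t x. l2norm F z \<partial>lebesgue) \<le> ennreal (1 / ?t ^ DIM('a)) * (?M * ennreal (?b * ?t ^ DIM('a)))"
    unfolding W by (rule mult_left_mono) simp
  also have "\<dots> = ennreal (1 / ?t ^ DIM('a) * (?b * ?t ^ DIM('a))) * ?M"
  proof -
    have "ennreal a * (X * ennreal b) = ennreal (a * b) * X" if "0 \<le> a" for a b X
      using ennreal_mult'[OF that, of b] by (simp add: mult_ac)
    moreover have "0 \<le> 1 / ?t ^ DIM('a)" using s by simp
    ultimately show ?thesis by blast
  qed
  also have "1 / ?t ^ DIM('a) * (?b * ?t ^ DIM('a)) = ?b" using s by simp
  finally show "ennreal (1 / ?t ^ DIM('a)) * (\<integral>\<^sup>+z\<in>nbhd ?t x. l2norm F z \<partial>lebesgue) \<le> ennreal ?b * ?M" .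
qed

lemma generation_le_local_max:
  fixes F :: "nat \<Rightarrow> 'a::euclidean_space \<Rightarrow> complex"
  assumes \<alpha>: "0 < \<alpha>" "\<alpha> \<le> 1" and s: "0 < s" and F [measurable]: "\<And>j. F j \<in> borel_measurable lebesgue"
  shows "(\<Sum>j. (cube_sup \<alpha> (s/2^i) x (F j))\<^sup>2) \<le> (ennreal (2 * (real DIM('a) + 2)) * local_max s F x)\<^sup>2"
proof -
  let ?t = "s/2^i" let ?c = "2 * (real DIM('a) + 2) / ?t ^ DIM('a)" let ?N = "nbhd ?t x"
  have t: "0 < ?t" using s by simp
  have [measurable]: "?N \<in> sets lebesgue" by simp
  have "(\<Sum>j. (cube_sup \<alpha> ?t x (F j))\<^sup>2) \<le> (\<Sum>j. (ennreal ?c * (\<integral>\<^sup>+z\<in>?N. ennreal (cmod (F j z)) \<partial>lebesgue))\<^sup>2)"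
    by (intro suminf_le power_mono cube_sup_le[OF \<alpha> t F] summableI) simp
  also have "\<dots> = (ennreal ?c)\<^sup>2 * (\<Sum>j. (\<integral>\<^sup>+z\<in>?N. ennreal (cmod (F j z)) \<partial>lebesgue)\<^sup>2)"
    by (simp add: power_mult_distrib)
  also have "\<dots> \<le> (ennreal ?c)\<^sup>2 * (\<integral>\<^sup>+z. epowr (\<Sum>j. (ennreal (cmod (F j z)))\<^sup>2) (1/2) * indicator ?N z \<partial>lebesgue)\<^sup>2"
    by (intro mult_left_mono Minkowski_l2_integral) auto
  also have "\<dots> = (ennreal ?c * (\<integral>\<^sup>+z\<in>?N. l2norm F z \<partial>lebesgue))\<^sup>2"
    by (simp add: l2norm_def modulus_complex_def power_mult_distrib)
  also have "\<dots> \<le> (ennreal ?c * (ennreal (?t ^ DIM('a)) * local_max s F x))\<^sup>2"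
    by (intro power_mono mult_left_mono nbhd_mass_le_local_max s) auto
  also have "ennreal ?c * (ennreal (?t ^ DIM('a)) * local_max s F x) = ennreal (2 * (real DIM('a) + 2)) * local_max s F x"
    using t s by (simp add: mult.assoc[symmetric] ennreal_mult[symmetric])
  finally show ?thesis .
qed

lemma dyadic_sq_localize:
  assumes s: "0 < s"
  shows "dyadic_sq \<alpha> s F x = dyadic_sq \<alpha> s (\<lambda>j z. indicator (nbhd s x) z *\<^sub>R F j z) x"
proof -
  have "cube_sup \<alpha> (s/2^i) x (F j) = cube_sup \<alpha> (s/2^i) x (\<lambda>z. indicator (nbhd s x) z *\<^sub>R F j z)" for i j
    unfolding cube_sup_def
  proof (rule SUP_cong[OF refl])
    fix \<psi> assume \<psi>: "\<psi> \<in> cube_kernels \<alpha> (s/2^i) x"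
    have sub: "nbhd (s/2^i) x \<subseteq> nbhd s x" using nbhd_antimono[OF s, of 0 i x] by simp
    have "F j z * complex_of_real (\<psi> z) = indicator (nbhd s x) z *\<^sub>R F j z * complex_of_real (\<psi> z)" for z
    proof (cases "z \<in> nbhd s x")
      case False
      then have "\<psi> z = 0" using \<psi> sub by (auto simp: cube_kernels_def)
      then show ?thesis by simp
    qed simp
    then show "ennreal (cmod (LINT z|lebesgue. F j z * complex_of_real (\<psi> z))) = ennreal (cmod (LINT z|lebesgue. indicator (nbhd s x) z *\<^sub>R F j z * complex_of_real (\<psi> z)))"
      by (simp only:)
  qed
  then show ?thesis by (simp only: dyadic_sq_def)
qed

lemma dyadic_sq_split:
  "dyadic_sq \<alpha> s F x = (\<Sum>k<i. \<Sum>j. (cube_sup \<alpha> (s/2^k) x (F j))\<^sup>2) + (\<Sum>j. (cube_sup \<alpha> (s/2^i) x (F j))\<^sup>2) + dyadic_sq \<alpha> (s/2^Suc i) F x"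
proof -
  let ?u = "\<lambda>k. \<Sum>j. (cube_sup \<alpha> (s/2^k) x (F j))\<^sup>2"
  have "dyadic_sq \<alpha> s F x = sum ?u {..<Suc i} + (\<Sum>k. ?u (k + Suc i))"
    unfolding dyadic_sq_def by (subst suminf_offset[of _ "Suc i"]) (simp_all only: summableI add.commute)
  moreover have "(\<Sum>k. ?u (k + Suc i)) = dyadic_sq \<alpha> (s/2^Suc i) F x"
  proof -
    have e: "s/2^Suc i/2^k = s/2^(k + Suc i)" for k by (simp add: power_add)
    show ?thesis unfolding dyadic_sq_def e ..
  qed
  ultimately show ?thesis by (simp only: sum.lessThan_Suc)
qed

lemma nn_integral_l2norm_restrict:
  fixes F :: "nat \<Rightarrow> 'a::euclidean_space \<Rightarrow> complex"
  shows "(\<integral>\<^sup>+z. l2norm (\<lambda>j z. indicator N z *\<^sub>R F j z) z \<partial>lebesgue) = (\<integral>\<^sup>+z\<in>N. l2norm F z \<partial>lebesgue)"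
proof (rule nn_integral_cong)
  fix z show "l2norm (\<lambda>j z. indicator N z *\<^sub>R F j z) z = l2norm F z * indicator N z"
    by (cases "z \<in> N") (simp_all add: l2norm_def modulus_complex_def)
qed

definition weak_type_const :: "real \<Rightarrow> 'a::euclidean_space itself \<Rightarrow> real \<Rightarrow> bool" where
  "weak_type_const \<alpha> _ C \<longleftrightarrow> 0 < C \<and> (\<forall>s>0. \<forall>\<theta>>0. \<forall>F :: nat \<Rightarrow> 'a \<Rightarrow> complex.
     (\<forall>j. F j \<in> borel_measurable lebesgue) \<longrightarrow> (\<integral>\<^sup>+x. l2norm F x \<partial>lebesgue) < \<infinity> \<longrightarrow>
     emeasure lebesgue {x. ennreal (\<theta>\<^sup>2) < dyadic_sq \<alpha> s F x} \<le> ennreal (C/\<theta>) * (\<integral>\<^sup>+x. l2norm F x \<partial>lebesgue))"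

lemma averaging_ball_finite: "averaging_weight p A w \<Longrightarrow> 0 < r \<Longrightarrow> wmeas w (ball y r) < \<infinity>"
  unfolding averaging_weight_def by blast

lemma good_lambda:
  fixes F :: "nat \<Rightarrow> 'a::euclidean_space \<Rightarrow> complex" and w :: "'a \<Rightarrow> ennreal"
  assumes \<alpha>: "0 < \<alpha>" "\<alpha> \<le> 1" and wt: "weak_type_const \<alpha> TYPE('a) C"
    and w: "averaging_weight p A w" and p: "0 < p"
    and s: "0 < s" and F [measurable]: "\<And>j. F j \<in> borel_measurable lebesgue"
    and \<beta>: "1 < \<beta>" and d: "0 < d" "d\<^sup>2 \<le> (\<beta>\<^sup>2 - 1)/2"
    and \<gamma>: "0 < \<gamma>" "(2 * (real DIM('a) + 2) * \<gamma>)\<^sup>2 \<le> (\<beta>\<^sup>2 - 1)/2" "C * \<gamma> / d \<le> 1/2"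
    and K: "1 \<le> K" "A * (2 * unit_ball_vol (DIM('a)) * real DIM('a) ^ DIM('a)) powr p \<le> K"
    and l: "0 < l"
  shows "wmeas w {x\<in>cube s x0. ennreal ((\<beta> * l)\<^sup>2) < dyadic_sq \<alpha> s F x}
    \<le> ennreal (1 - 1/K) * wmeas w {x\<in>cube s x0. ennreal (l\<^sup>2) < dyadic_sq \<alpha> s F x} + wmeas w {x\<in>cube s x0. ennreal (\<gamma> * l) < local_max s F x}"
proof -
  let ?n = "real DIM('a)" let ?c = "2 * (real DIM('a) + 2)"
  have wm [measurable]: "w \<in> borel_measurable lebesgue" and A: "0 \<le> A" using w by (simp_all add: averaging_weight_def)
  have Cpos: "0 < C" using wt by (simp add: weak_type_const_def)
  define a where "a k x = (\<Sum>j. (cube_sup \<alpha> (s/2^k) x (F j))\<^sup>2)" for k x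
  define P where "P i x \<longleftrightarrow> x \<in> cube s x0 \<and> ennreal (l\<^sup>2) < (\<Sum>k<Suc i. a k x)" for i x
  have a_cong: "a k y = a k x" if "y \<in> cube (s/2^i) x" "k \<le> i" for k i x y
  proof -
    have "y \<in> cube (s/2^k) x" using cube_antimono[OF that(2), of s x] that(1) by blast
    then show ?thesis by (simp add: a_def cube_sup_cong)
  qed
  interpret stopping s P
  proof
    show "0 < s" by (rule s)
    fix i x y assume y: "y \<in> cube (s/2^i) x" and P: "P i x"
    have "y \<in> cube s x" using cube_antimono[of 0 i s x] y by auto
    then have "cube s y = cube s x" by (rule cube_eq)
    moreover have "cube s x = cube s x0" using P cube_eq by (auto simp: P_def)
    ultimately have "y \<in> cube s x0" using cube_self by blast
    moreover have "(\<Sum>k<Suc i. a k y) = (\<Sum>k<Suc i. a k x)" using y by (intro sum.cong refl a_cong) auto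
    ultimately show "P i y" using P by (simp only: P_def)
  qed
  have sq: "dyadic_sq \<alpha> s F x = (SUP i. \<Sum>k<Suc i. a k x)" for x
  proof -
    have "dyadic_sq \<alpha> s F x = (SUP i. \<Sum>k<i. a k x)" unfolding dyadic_sq_def a_def by (rule suminf_eq_SUP)
    also have "\<dots> = (SUP i. \<Sum>k<Suc i. a k x)"
    proof (rule antisym)
      show "(SUP i. \<Sum>k<i. a k x) \<le> (SUP i. \<Sum>k<Suc i. a k x)" 
      proof (rule SUP_mono)
        fix i :: nat
        have "(\<Sum>k<i. a k x) \<le> (\<Sum>k<Suc i. a k x)" by simp
        then show "\<exists>m\<in>UNIV. (\<Sum>k<i. a k x) \<le> (\<Sum>k<Suc m. a k x)" by blast
      qed
      show "(SUP i. \<Sum>k<Suc i. a k x) \<le> (SUP i. \<Sum>k<i. a k x)" 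
        by (rule SUP_mono) blast
    qed
    finally show ?thesis .
  qed
  have \<Omega>: "\<Omega> = {x\<in>cube s x0. ennreal (l\<^sup>2) < dyadic_sq \<alpha> s F x}"
    unfolding sq less_SUP_iff P_def by auto
  define E where "E = {x. ennreal ((\<beta> * l)\<^sup>2) < dyadic_sq \<alpha> s F x \<and> local_max s F x \<le> ennreal (\<gamma> * l)}"
  have E [measurable]: "E \<in> sets lebesgue"
  proof -
    have "{x \<in> space lebesgue. ennreal ((\<beta> * l)\<^sup>2) < dyadic_sq \<alpha> s F x \<and> local_max s F x \<le> ennreal (\<gamma> * l)} \<in> sets lebesgue" by measurable
    then show ?thesis by (simp add: E_def)
  qed
  have small: "emeasure lebesgue (E \<inter> Q x) \<le> ennreal ((s / 2 ^ \<tau> x) ^ DIM('a) / 2)" if x: "x \<in> \<Omega>" for x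
  proof (cases "E \<inter> Q x = {}")
    case True then show ?thesis by simp
  next
    case False
    then obtain y0 where y0: "y0 \<in> E" "y0 \<in> Q x" by blast
    define \<sigma> where "\<sigma> = s / 2 ^ \<tau> x"
    have \<sigma>: "0 < \<sigma>" using s by (simp add: \<sigma>_def)
    define N where "N = nbhd \<sigma> x"
    have [measurable]: "N \<in> sets lebesgue" by (simp add: N_def)
    have Qc: "Q x = cube \<sigma> x" by (simp add: stop_cube_def \<sigma>_def)
    let ?G = "\<lambda>j z. indicator N z *\<^sub>R F j z"
    have mass: "(\<integral>\<^sup>+z\<in>N. l2norm F z \<partial>lebesgue) \<le> ennreal (\<sigma> ^ DIM('a) * (\<gamma> * l))"
    proof -
      have "N = nbhd \<sigma> y0" unfolding N_def using y0(2) nbhd_eq[of y0 \<sigma> x] by (simp add: Qc)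
      then have "(\<integral>\<^sup>+z\<in>N. l2norm F z \<partial>lebesgue) \<le> ennreal (\<sigma> ^ DIM('a)) * local_max s F y0"
        using nbhd_mass_le_local_max[OF s, where i="\<tau> x" and x=y0 and F=F] by (simp add: \<sigma>_def)
      also have "\<dots> \<le> ennreal (\<sigma> ^ DIM('a)) * ennreal (\<gamma> * l)" using y0(1) by (intro mult_left_mono) (auto simp: E_def)
      also have "\<dots> = ennreal (\<sigma> ^ DIM('a) * (\<gamma> * l))" using \<gamma>(1) l \<sigma> by (intro ennreal_mult[symmetric]) auto
      finally show ?thesis .
    qed
    have sub: "E \<inter> Q x \<subseteq> {y. ennreal ((d * l)\<^sup>2) < dyadic_sq \<alpha> (\<sigma>/2) ?G y}"
    proof
      fix y assume y: "y \<in> E \<inter> Q x"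
      have yQ: "y \<in> cube \<sigma> x" using y Qc by simp
      have y\<Omega>: "y \<in> \<Omega>" "\<tau> y = \<tau> x" using in_Q[OF x, of y] y by auto
      have b: "(\<Sum>k<\<tau> x. a k y) \<le> ennreal (l\<^sup>2)"
      proof (cases "\<tau> x")
        case (Suc i)
        have "\<not> P i y" using before_first[of i y] y\<Omega>(2) Suc by simp
        then show ?thesis using y\<Omega>(1) by (simp add: P_def Suc not_less)
      qed simp
      have c: "a (\<tau> x) y \<le> ennreal ((?c * \<gamma> * l)\<^sup>2)"
      proof -
        have "a (\<tau> x) y \<le> (ennreal ?c * local_max s F y)\<^sup>2"
          unfolding a_def by (rule generation_le_local_max[OF \<alpha> s F])
        also have "\<dots> \<le> (ennreal ?c * ennreal (\<gamma> * l))\<^sup>2" using y by (intro power_mono mult_left_mono) (auto simp: E_def)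
        also have "ennreal ?c * ennreal (\<gamma> * l) = ennreal (?c * (\<gamma> * l))" by (rule ennreal_mult'[symmetric]) simp
        also have "?c * (\<gamma> * l) = ?c * \<gamma> * l" by (rule mult.assoc[symmetric])
        also have "(ennreal (?c * \<gamma> * l))\<^sup>2 = ennreal ((?c * \<gamma> * l)\<^sup>2)"
          using \<gamma>(1) l by (intro ennreal_power mult_nonneg_nonneg) simp_all
        finally show ?thesis .
      qed
      have tail: "dyadic_sq \<alpha> (s/2^Suc (\<tau> x)) F y = dyadic_sq \<alpha> (\<sigma>/2) ?G y"
      proof -
        have s2: "s/2^Suc (\<tau> x) = \<sigma>/2" by (simp add: \<sigma>_def)
        have "nbhd (\<sigma>/2) y \<subseteq> N"
          using nbhd_antimono[OF \<sigma>, of 0 1 y] nbhd_eq[OF yQ] by (simp add: N_def)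
        then have eq: "(\<lambda>j z. indicator (nbhd (\<sigma>/2) y) z *\<^sub>R F j z) = (\<lambda>j z. indicator (nbhd (\<sigma>/2) y) z *\<^sub>R ?G j z)"
          by (auto simp: fun_eq_iff indicator_def)
        have \<sigma>2: "0 < \<sigma>/2" using \<sigma> by simp
        have 1: "dyadic_sq \<alpha> (\<sigma>/2) F y = dyadic_sq \<alpha> (\<sigma>/2) (\<lambda>j z. indicator (nbhd (\<sigma>/2) y) z *\<^sub>R F j z) y"
          by (rule dyadic_sq_localize[OF \<sigma>2])
        have 2: "dyadic_sq \<alpha> (\<sigma>/2) ?G y = dyadic_sq \<alpha> (\<sigma>/2) (\<lambda>j z. indicator (nbhd (\<sigma>/2) y) z *\<^sub>R ?G j z) y"
          by (rule dyadic_sq_localize[OF \<sigma>2])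
        show ?thesis unfolding s2 using 1 2 by (simp only: eq)
      qed
      have "ennreal ((d * l)\<^sup>2) < dyadic_sq \<alpha> (\<sigma>/2) ?G y"
      proof (rule ccontr)
        assume "\<not> ennreal ((d * l)\<^sup>2) < dyadic_sq \<alpha> (\<sigma>/2) ?G y"
        then have "dyadic_sq \<alpha> s F y \<le> ennreal (l\<^sup>2) + ennreal ((?c * \<gamma> * l)\<^sup>2) + ennreal ((d * l)\<^sup>2)"
          unfolding dyadic_sq_split[where \<alpha>=\<alpha> and s=s and i="\<tau> x" and x=y and F=F] tail using b c unfolding a_def by (intro add_mono) (auto simp: not_less)
        also have "\<dots> = ennreal (l\<^sup>2 + (?c * \<gamma> * l)\<^sup>2 + (d * l)\<^sup>2)" by (simp add: ennreal_plus)
        also have "\<dots> \<le> ennreal ((\<beta> * l)\<^sup>2)"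
        proof (rule ennreal_leI)
          have "l\<^sup>2 + (?c * \<gamma> * l)\<^sup>2 + (d * l)\<^sup>2 = (1 + (?c * \<gamma>)\<^sup>2 + d\<^sup>2) * l\<^sup>2" by (simp only: power_mult_distrib distrib_right mult_1)
          also have "\<dots> \<le> \<beta>\<^sup>2 * l\<^sup>2" using \<gamma>(2) d(2) by (intro mult_right_mono) auto
          finally show "l\<^sup>2 + (?c * \<gamma> * l)\<^sup>2 + (d * l)\<^sup>2 \<le> (\<beta> * l)\<^sup>2" by (simp only: power_mult_distrib)
        qed
        finally show False using y by (auto simp: E_def)
      qed
      then show "y \<in> {y. ennreal ((d * l)\<^sup>2) < dyadic_sq \<alpha> (\<sigma>/2) ?G y}" by simp
    qed
    have Gm: "?G j \<in> borel_measurable lebesgue" for j by measurable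
    have lev: "{y. ennreal ((d * l)\<^sup>2) < dyadic_sq \<alpha> (\<sigma>/2) ?G y} \<in> sets lebesgue"
    proof -
      have "{y \<in> space lebesgue. ennreal ((d * l)\<^sup>2) < dyadic_sq \<alpha> (\<sigma>/2) ?G y} \<in> sets lebesgue" by measurable
      then show ?thesis by simp
    qed
    have "emeasure lebesgue (E \<inter> Q x) \<le> emeasure lebesgue {y. ennreal ((d * l)\<^sup>2) < dyadic_sq \<alpha> (\<sigma>/2) ?G y}"
      by (rule emeasure_mono[OF sub lev])
    also have "\<dots> \<le> ennreal (C/(d * l)) * (\<integral>\<^sup>+z. l2norm ?G z \<partial>lebesgue)"
    proof -
      have f: "(\<integral>\<^sup>+z. l2norm ?G z \<partial>lebesgue) < \<infinity>"
        unfolding nn_integral_l2norm_restrict using mass by (rule order.strict_trans1) simp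
      have "0 < \<sigma>/2" "0 < d * l" using \<sigma> d(1) l by simp_all
      from wt[unfolded weak_type_const_def, THEN conjunct2, rule_format, OF this Gm f] show ?thesis .
    qed
    also have "\<dots> \<le> ennreal (C/(d * l)) * ennreal (\<sigma> ^ DIM('a) * (\<gamma> * l))"
      unfolding nn_integral_l2norm_restrict by (rule mult_left_mono[OF mass]) simp
    also have "\<dots> = ennreal ((C * \<gamma> / d) * \<sigma> ^ DIM('a))"
      using Cpos d(1) l \<gamma>(1) \<sigma> by (subst ennreal_mult[symmetric]) (simp_all add: field_simps)
    also have "\<dots> \<le> ennreal ((1/2) * \<sigma> ^ DIM('a))" using \<gamma>(3) \<sigma> by (intro ennreal_leI mult_right_mono) auto
    finally show ?thesis by (simp add: \<sigma>_def)
  qed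
  have Qfin: "wmeas w (Q x) < \<infinity>" for x
  proof -
    have q: "0 < s / 2 ^ \<tau> x" using s by simp
    have "wmeas w (Q x) \<le> wmeas w (ball x (?n * (s / 2 ^ \<tau> x)))" unfolding stop_cube_def by (intro wmeas_mono cube_subset_ball q)
    also have "\<dots> < \<infinity>" using q by (intro averaging_ball_finite[OF w] mult_pos_pos) simp_all
    finally show ?thesis .
  qed
  have wsmall: "wmeas w (E \<inter> Q x) \<le> ennreal (1 - 1/K) * wmeas w (Q x)" if x: "x \<in> \<Omega>" for x
  proof -
    define \<sigma> where "\<sigma> = s / 2 ^ \<tau> x"
    have \<sigma>: "0 < \<sigma>" using s by (simp add: \<sigma>_def)
    define v where "v = \<sigma> ^ DIM('a)"
    have v: "0 < v" using \<sigma> by (simp add: v_def)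
    let ?B = "ball x (?n * \<sigma>)" let ?D = "Q x - E"
    have [measurable]: "Q x \<in> sets lebesgue" by simp
    have QB: "Q x \<subseteq> ?B" unfolding stop_cube_def \<sigma>_def[symmetric] by (rule cube_subset_ball[OF \<sigma>])
    have "ennreal v = emeasure lebesgue (Q x)" unfolding stop_cube_def \<sigma>_def[symmetric] v_def using \<sigma> by (rule emeasure_cube[symmetric])
    also have "\<dots> = emeasure lebesgue ((E \<inter> Q x) \<union> ?D)" by (rule arg_cong[of _ _ "emeasure lebesgue"]) blast
    also have "\<dots> \<le> emeasure lebesgue (E \<inter> Q x) + emeasure lebesgue ?D" by (intro emeasure_subadditive) measurable
    also have "\<dots> \<le> ennreal (v/2) + emeasure lebesgue ?D" using small[OF x] by (intro add_right_mono) (simp add: v_def \<sigma>_def)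
    finally have "ennreal v \<le> ennreal (v/2) + emeasure lebesgue ?D" .
    moreover have "ennreal v = ennreal (v/2) + ennreal (v/2)" using v by (subst ennreal_plus[symmetric]) auto
    ultimately have D: "ennreal (v/2) \<le> emeasure lebesgue ?D" by (simp only: ennreal_add_left_cancel_le) auto
    have nr: "0 < ?n * \<sigma>" using \<sigma> by simp
    have "ennreal ((v/2) powr p) * wmeas w (Q x) \<le> epowr (emeasure lebesgue ?D) p * wmeas w ?B"
    proof (intro mult_mono wmeas_mono QB)
      have "ennreal ((v/2) powr p) = epowr (ennreal (v/2)) p" using v p by (simp add: epowr_ennreal)
      also have "\<dots> \<le> epowr (emeasure lebesgue ?D) p" by (rule epowr_mono[OF p D])
      finally show "ennreal ((v/2) powr p) \<le> epowr (emeasure lebesgue ?D) p" .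
    qed auto
    also have "\<dots> \<le> ennreal A * epowr (emeasure lebesgue ?B) p * wmeas w ?D"
      using QB by (intro averaging_subset[OF w p nr]) auto
    also have "epowr (emeasure lebesgue ?B) p = ennreal ((2 * unit_ball_vol ?n * ?n ^ DIM('a)) powr p * (v/2) powr p)"
    proof -
      have e: "unit_ball_vol ?n * (?n * \<sigma>) ^ DIM('a) = (2 * unit_ball_vol ?n * ?n ^ DIM('a)) * (v/2)" by (simp add: v_def power_mult_distrib)
      have "emeasure lebesgue ?B = ennreal ((2 * unit_ball_vol ?n * ?n ^ DIM('a)) * (v/2))"
        unfolding e[symmetric] using nr by (intro emeasure_lebesgue_ball) simp
      moreover have "0 \<le> (2 * unit_ball_vol ?n * ?n ^ DIM('a)) * (v/2)" using v by simp
      ultimately show ?thesis using p by (simp only: epowr_ennreal powr_mult)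
    qed
    also have "ennreal A * ennreal ((2 * unit_ball_vol ?n * ?n ^ DIM('a)) powr p * (v/2) powr p) * wmeas w ?D
      = ennreal ((v/2) powr p) * (ennreal (A * (2 * unit_ball_vol ?n * ?n ^ DIM('a)) powr p) * wmeas w ?D)"
    proof -
      have "ennreal A * ennreal (b * c) * X = ennreal c * (ennreal (A * b) * X)" if "0 \<le> b" "0 \<le> c" for b c X
        using that A by (simp add: ennreal_mult mult_ac)
      then show ?thesis by simp
    qed
    finally have "wmeas w (Q x) \<le> ennreal (A * (2 * unit_ball_vol ?n * ?n ^ DIM('a)) powr p) * wmeas w ?D"
      using v by (subst (asm) ennreal_mult_le_mult_iff) auto
    also have "\<dots> \<le> ennreal K * wmeas w ?D" by (intro mult_right_mono ennreal_leI K) simp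
    finally have le: "wmeas w (Q x) \<le> ennreal K * wmeas w ?D" .
    have "Q x = (E \<inter> Q x) \<union> ?D" "(E \<inter> Q x) \<inter> ?D = {}" by blast+
    then have add: "wmeas w (Q x) = wmeas w (E \<inter> Q x) + wmeas w ?D"
      using plus_emeasure[of "E \<inter> Q x" "density lebesgue w" ?D] by (simp add: wmeas_eq_emeasure)
    obtain b where b: "wmeas w ?D = ennreal b" "0 \<le> b" using Qfin[of x] wmeas_mono[of ?D "Q x" w] by (cases "wmeas w ?D") (auto simp: top_unique)
    obtain c where c: "wmeas w (E \<inter> Q x) = ennreal c" "0 \<le> c" using Qfin[of x] wmeas_mono[of "E \<inter> Q x" "Q x" w] by (cases "wmeas w (E \<inter> Q x)") (auto simp: top_unique)
    have q: "wmeas w (Q x) = ennreal (c + b)" using add b c by (simp add: ennreal_plus)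
    have "ennreal (c + b) \<le> ennreal (K * b)" using le K(1) b unfolding q by (simp add: ennreal_mult)
    then have "c + b \<le> K * b" using K(1) b by (subst (asm) ennreal_le_iff) auto
    then have "(c + b) / K \<le> b" using K(1) by (simp add: divide_le_eq mult.commute)
    moreover have "(1 - 1/K) * (c + b) = (c + b) - (c + b) / K" by (simp add: left_diff_distrib)
    ultimately have "c \<le> (1 - 1/K) * (c + b)" by linarith
    then have "ennreal c \<le> ennreal ((1 - 1/K) * (c + b))" by (rule ennreal_leI)
    also have "\<dots> = ennreal (1 - 1/K) * ennreal (c + b)" using K(1) b c by (intro ennreal_mult) auto
    finally show ?thesis unfolding q c(1) .
  qed
  have "(\<integral>\<^sup>+y\<in>\<Omega>. (w y * indicator E y) \<partial>lebesgue) \<le> (\<integral>\<^sup>+y\<in>\<Omega>. (ennreal (1 - 1/K) * w y) \<partial>lebesgue)"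
  proof (rule nn_integral_stop_le)
    fix x assume x: "x \<in> \<Omega>"
    have [measurable]: "Q x \<in> sets lebesgue" by simp
    have "(\<integral>\<^sup>+y\<in>Q x. (w y * indicator E y) \<partial>lebesgue) = wmeas w (E \<inter> Q x)"
      unfolding wmeas_def by (intro nn_integral_cong) (auto simp: indicator_def)
    also have "\<dots> \<le> ennreal (1 - 1/K) * wmeas w (Q x)" by (rule wsmall[OF x])
    also have "\<dots> = (\<integral>\<^sup>+y. ennreal (1 - 1/K) * (w y * indicator (Q x) y) \<partial>lebesgue)"
      unfolding wmeas_def by (rule nn_integral_cmult[symmetric]) measurable
    finally show "(\<integral>\<^sup>+y\<in>Q x. (w y * indicator E y) \<partial>lebesgue) \<le> (\<integral>\<^sup>+y\<in>Q x. (ennreal (1 - 1/K) * w y) \<partial>lebesgue)"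
      by (simp only: mult.assoc)
  qed measurable
  also have "\<dots> = ennreal (1 - 1/K) * wmeas w \<Omega>"
  proof -
    have [measurable]: "\<Omega> \<in> sets lebesgue" by (rule sets_\<Omega>)
    show ?thesis unfolding wmeas_def mult.assoc by (rule nn_integral_cmult) measurable
  qed
  also have "(\<integral>\<^sup>+y\<in>\<Omega>. (w y * indicator E y) \<partial>lebesgue) = wmeas w (E \<inter> \<Omega>)"
    unfolding wmeas_def by (intro nn_integral_cong) (auto simp: indicator_def)
  finally have main: "wmeas w (E \<inter> \<Omega>) \<le> ennreal (1 - 1/K) * wmeas w \<Omega>" .
  let ?M = "{x\<in>cube s x0. ennreal (\<gamma> * l) < local_max s F x}"
  have M: "?M \<in> sets lebesgue"
  proof -
    have "{x \<in> space lebesgue. ennreal (\<gamma> * l) < local_max s F x} \<in> sets lebesgue" by measurable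
    then have "cube s x0 \<inter> {x \<in> space lebesgue. ennreal (\<gamma> * l) < local_max s F x} \<in> sets lebesgue" by (rule sets.Int[OF sets_lebesgue_cube])
    moreover have "cube s x0 \<inter> {x \<in> space lebesgue. ennreal (\<gamma> * l) < local_max s F x} = ?M" by auto
    ultimately show ?thesis by simp
  qed
  have "{x\<in>cube s x0. ennreal ((\<beta> * l)\<^sup>2) < dyadic_sq \<alpha> s F x} \<subseteq> (E \<inter> \<Omega>) \<union> ?M"
  proof
    fix x assume "x \<in> {x\<in>cube s x0. ennreal ((\<beta> * l)\<^sup>2) < dyadic_sq \<alpha> s F x}"
    then have x: "x \<in> cube s x0" "ennreal ((\<beta> * l)\<^sup>2) < dyadic_sq \<alpha> s F x" by auto
    have "l * 1 \<le> l * \<beta>" using \<beta> l by (intro mult_left_mono) auto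
    then have "l\<^sup>2 \<le> (\<beta> * l)\<^sup>2" using l by (intro power_mono) (auto simp: mult.commute)
    then have "ennreal (l\<^sup>2) \<le> ennreal ((\<beta> * l)\<^sup>2)" by (rule ennreal_leI)
    then have "ennreal (l\<^sup>2) < dyadic_sq \<alpha> s F x" by (rule le_less_trans[OF _ x(2)])
    then have "x \<in> \<Omega>" unfolding \<Omega> using x(1) by simp
    then show "x \<in> (E \<inter> \<Omega>) \<union> ?M" using x by (auto simp: E_def not_le)
  qed
  then have "wmeas w {x\<in>cube s x0. ennreal ((\<beta> * l)\<^sup>2) < dyadic_sq \<alpha> s F x} \<le> wmeas w ((E \<inter> \<Omega>) \<union> ?M)" by (rule wmeas_mono)
  also have "\<dots> \<le> wmeas w (E \<inter> \<Omega>) + wmeas w ?M" using M sets_\<Omega>(2) E by (intro wmeas_Un_le wm sets.Int) auto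
  also have "\<dots> \<le> ennreal (1 - 1/K) * wmeas w \<Omega> + wmeas w ?M" by (rule add_right_mono[OF main])
  finally show ?thesis unfolding \<Omega> .
qed

lemma ennreal_less_scaled_iff:
  assumes "0 < c" "0 \<le> t" shows "ennreal t < ennreal (1/c) * y \<longleftrightarrow> ennreal (c * t) < y"
proof (cases y)
  case (real r)
  have "ennreal (1/c) * y = ennreal (r/c)" using real assms by (simp add: ennreal_mult[symmetric])
  then show ?thesis using real assms by (simp add: ennreal_less_iff field_simps)
qed (use assms in \<open>simp add: ennreal_mult_top\<close>)

lemma ennreal_less_root_iff: "0 \<le> t \<Longrightarrow> ennreal t < epowr y (1/2) \<longleftrightarrow> ennreal (t\<^sup>2) < y"
  using epowr_less_iff[of 2 "ennreal t" "epowr y (1/2)"] by (simp add: epowr_two ennreal_power)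

lemma epowr_min_SUP:
  assumes p: "0 < p"
  shows "epowr y p = (SUP N::nat. epowr (min y (ennreal (real N))) p)"
proof (rule antisym)
  show "(SUP N::nat. epowr (min y (ennreal (real N))) p) \<le> epowr y p"
    using p by (intro SUP_least epowr_mono) auto
  show "epowr y p \<le> (SUP N::nat. epowr (min y (ennreal (real N))) p)"
  proof (cases y)
    case (real r)
    obtain N :: nat where "r \<le> real N" using real_arch_simple by blast
    then have "min y (ennreal (real N)) = y" using real by (simp add: min_def ennreal_leI)
    then have "epowr y p = epowr (min y (ennreal (real N))) p" by (simp only:)
    also have "\<dots> \<le> (SUP N::nat. epowr (min y (ennreal (real N))) p)" by (rule SUP_upper) simp
    finally show ?thesis .
  next
    case top
    have "(SUP N::nat. epowr (min y (ennreal (real N))) p) = \<infinity>"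
    proof (rule ccontr)
      assume "(SUP N::nat. epowr (min y (ennreal (real N))) p) \<noteq> \<infinity>"
      then obtain b where b: "(SUP N::nat. epowr (min y (ennreal (real N))) p) = ennreal b" "0 \<le> b"
        by (cases "(SUP N::nat. epowr (min y (ennreal (real N))) p)") auto
      obtain N :: nat where N: "(b + 1) powr (1/p) \<le> real N" using real_arch_simple by blast
      have "b + 1 = ((b + 1) powr (1/p)) powr p" using b p by (simp add: powr_powr)
      also have "\<dots> \<le> real N powr p" using N p by (intro powr_mono2) auto
      finally have "ennreal (b + 1) \<le> epowr (min y (ennreal (real N))) p" using p top by (simp add: epowr_ennreal ennreal_leI)
      also have "\<dots> \<le> ennreal b" unfolding b(1)[symmetric] by (rule SUP_upper) simp
      finally show False using b by (simp add: ennreal_le_iff)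
    qed
    then show ?thesis by (simp only: infinity_ennreal_def top_greatest)
  qed
qed

theorem dyadic_sq_le_local_max:
  fixes w :: "'a::euclidean_space \<Rightarrow> ennreal"
  assumes \<alpha>: "0 < \<alpha>" "\<alpha> \<le> 1" and wt: "weak_type_const \<alpha> TYPE('a) C"
    and w: "averaging_weight p A w" and p: "0 < p"
  shows "\<exists>K0::real. 0 \<le> K0 \<and> (\<forall>s>0. \<forall>F :: nat \<Rightarrow> 'a \<Rightarrow> complex. (\<forall>j. F j \<in> borel_measurable lebesgue) \<longrightarrow>
    (\<integral>\<^sup>+x. epowr (dyadic_sq \<alpha> s F x) (p/2) * w x \<partial>lebesgue) \<le> ennreal K0 * (\<integral>\<^sup>+x. epowr (local_max s F x) p * w x \<partial>lebesgue))"
proof -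
  have wm [measurable]: "w \<in> borel_measurable lebesgue" using w by (simp add: averaging_weight_def)
  have Cpos: "0 < C" using wt by (simp add: weak_type_const_def)
  let ?c = "2 * (real DIM('a) + 2)"
  define K where "K = max 2 (A * (2 * unit_ball_vol (DIM('a)) * real DIM('a) ^ DIM('a)) powr p)"
  have K: "1 \<le> K" "A * (2 * unit_ball_vol (DIM('a)) * real DIM('a) ^ DIM('a)) powr p \<le> K" "2 \<le> K"
    by (simp_all add: K_def)
  define \<kappa> where "\<kappa> = 1 - 1/K"
  have \<kappa>: "0 < \<kappa>" "\<kappa> < 1" using K(3) by (simp_all add: \<kappa>_def)
  define \<beta> where "\<beta> = \<kappa> powr (-1/(2*p))"
  have \<beta>: "1 < \<beta>"
  proof -
    have "0 < (-1/(2*p)) * ln \<kappa>" using \<kappa> p by (intro mult_neg_neg) auto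
    then have "1 < exp ((-1/(2*p)) * ln \<kappa>)" by simp
    then show ?thesis using \<kappa> by (simp add: \<beta>_def powr_def)
  qed
  have \<beta>p: "(1/\<beta>) powr p = \<kappa> powr (1/2)"
    using \<kappa> p by (simp add: \<beta>_def powr_divide powr_powr powr_minus field_simps)
  define e where "e = \<kappa> powr (1/2) - \<kappa>"
  have e: "0 < e"
  proof -
    have "sqrt \<kappa> * sqrt \<kappa> < sqrt \<kappa> * 1" using \<kappa> by (intro mult_strict_left_mono) auto
    then show ?thesis using \<kappa> by (simp add: e_def powr_half_sqrt)
  qed
  define d where "d = sqrt ((\<beta>\<^sup>2 - 1)/2)"
  have b2: "0 < (\<beta>\<^sup>2 - 1)/2" using \<beta> by (simp add: power2_eq_square) (metis less_1_mult)
  have d: "0 < d" "d\<^sup>2 = (\<beta>\<^sup>2 - 1)/2" using b2 by (simp_all add: d_def)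
  define \<gamma> where "\<gamma> = min (d / ?c) (d / (2 * C))"
  have \<gamma>0: "0 < \<gamma>" using d(1) Cpos by (simp add: \<gamma>_def)
  have \<gamma>1: "(?c * \<gamma>)\<^sup>2 \<le> (\<beta>\<^sup>2 - 1)/2"
  proof -
    have "?c * \<gamma> \<le> ?c * (d / ?c)" unfolding \<gamma>_def by (intro mult_left_mono) auto
    then have "?c * \<gamma> \<le> d" by simp
    then have "(?c * \<gamma>)\<^sup>2 \<le> d\<^sup>2" using \<gamma>0 by (intro power_mono) auto
    then show ?thesis by (simp only: d(2))
  qed
  have \<gamma>2: "C * \<gamma> / d \<le> 1/2"
  proof -
    have "C * \<gamma> \<le> C * (d / (2 * C))" unfolding \<gamma>_def using Cpos by (intro mult_left_mono) auto
    then have "C * \<gamma> \<le> d / 2" using Cpos by simp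
    then show ?thesis using d(1) by (simp add: divide_le_eq)
  qed
  define K0 where "K0 = (1/\<gamma>) powr p / e"
  have K0: "0 \<le> K0" using e by (simp add: K0_def)
  have main: "(\<integral>\<^sup>+x. epowr (dyadic_sq \<alpha> s F x) (p/2) * w x \<partial>lebesgue) \<le> ennreal K0 * (\<integral>\<^sup>+x. epowr (local_max s F x) p * w x \<partial>lebesgue)"
    if s: "0 < s" and F [measurable]: "\<And>j. F j \<in> borel_measurable lebesgue" for s and F :: "nat \<Rightarrow> 'a \<Rightarrow> complex"
  proof -
    define G where "G x = epowr (dyadic_sq \<alpha> s F x) (1/2)" for x
    define m where "m = local_max s F"
    have [measurable]: "G \<in> borel_measurable lebesgue" "m \<in> borel_measurable lebesgue"
      unfolding G_def[abs_def] m_def by measurable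
    have trunc: "(\<integral>\<^sup>+x. epowr (min (G x) (ennreal N)) p * (w x * indicator (cube s x0) x) \<partial>lebesgue)
        \<le> ennreal K0 * (\<integral>\<^sup>+x. epowr (m x) p * (w x * indicator (cube s x0) x) \<partial>lebesgue)" if N: "0 \<le> N" for N x0
    proof -
      define w0 where "w0 x = w x * indicator (cube s x0) x" for x
      define h where "h x = min (G x) (ennreal N)" for x
      have [measurable]: "w0 \<in> borel_measurable lebesgue" "h \<in> borel_measurable lebesgue"
        unfolding w0_def[abs_def] h_def[abs_def] by measurable
      define I where "I = (\<integral>\<^sup>+x. epowr (h x) p * w0 x \<partial>lebesgue)"
      define Y where "Y = (\<integral>\<^sup>+x. epowr (m x) p * w0 x \<partial>lebesgue)"
      have lev: "(\<integral>\<^sup>+x. indicator {x. ennreal t < u x} x * w0 x \<partial>lebesgue) = wmeas w {x\<in>cube s x0. ennreal t < u x}" for u t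
        unfolding wmeas_def w0_def by (intro nn_integral_cong) (auto simp: indicator_def)
      have level: "(\<integral>\<^sup>+x. indicator {x. ennreal t < ennreal (1/\<beta>) * h x} x * w0 x \<partial>lebesgue)
         \<le> ennreal \<kappa> * (\<integral>\<^sup>+x. indicator {x. ennreal t < h x} x * w0 x \<partial>lebesgue) + (\<integral>\<^sup>+x. indicator {x. ennreal t < ennreal (1/\<gamma>) * m x} x * w0 x \<partial>lebesgue)"
        if t: "0 < t" for t
      proof (cases "\<beta> * t < N")
        case False
        have "\<not> ennreal t < ennreal (1/\<beta>) * h x" for x
        proof -
          have "h x \<le> ennreal N" by (simp add: h_def)
          also have "\<dots> \<le> ennreal (\<beta> * t)" using False by (intro ennreal_leI) simp
          finally show ?thesis using \<beta> t by (subst ennreal_less_scaled_iff) (auto simp: not_less)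
        qed
        then show ?thesis by simp
      next
        case True
        have "t * 1 \<le> t * \<beta>" using \<beta> t by (intro mult_left_mono) auto
        then have tN: "t < N" using True by (simp add: mult.commute)
        have bt: "0 \<le> \<beta> * t" using \<beta> t by simp
        have 1: "ennreal t < ennreal (1/\<beta>) * h x \<longleftrightarrow> ennreal ((\<beta> * t)\<^sup>2) < dyadic_sq \<alpha> s F x" for x
        proof -
          have "ennreal t < ennreal (1/\<beta>) * h x \<longleftrightarrow> ennreal (\<beta> * t) < h x" using \<beta> t by (intro ennreal_less_scaled_iff) auto
          also have "\<dots> \<longleftrightarrow> ennreal (\<beta> * t) < G x" using True bt by (simp add: h_def ennreal_less_iff)
          also have "\<dots> \<longleftrightarrow> ennreal ((\<beta> * t)\<^sup>2) < dyadic_sq \<alpha> s F x" unfolding G_def by (rule ennreal_less_root_iff[OF bt])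
          finally show ?thesis .
        qed
        have 2: "ennreal t < h x \<longleftrightarrow> ennreal (t\<^sup>2) < dyadic_sq \<alpha> s F x" for x
        proof -
          have "ennreal t < h x \<longleftrightarrow> ennreal t < G x" using tN t by (simp add: h_def ennreal_less_iff)
          also have "\<dots> \<longleftrightarrow> ennreal (t\<^sup>2) < dyadic_sq \<alpha> s F x" unfolding G_def using t by (intro ennreal_less_root_iff) simp
          finally show ?thesis .
        qed
        have 3: "ennreal t < ennreal (1/\<gamma>) * m x \<longleftrightarrow> ennreal (\<gamma> * t) < local_max s F x" for x
          unfolding m_def using \<gamma>0 t by (intro ennreal_less_scaled_iff) auto
        show ?thesis unfolding lev 1 2 3 \<kappa>_def
          by (rule good_lambda[OF \<alpha> wt w p s F \<beta> d(1) eq_refl[OF d(2)] \<gamma>0 \<gamma>1 \<gamma>2 K(1,2) t])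
      qed
      let ?k = "\<lambda>t. ennreal (p * t powr (p - 1)) * indicator {0<..} t"
      let ?J = "\<lambda>u t. \<integral>\<^sup>+x. indicator {x. ennreal t < u x} x * w0 x \<partial>lebesgue"
      have lc: "(\<integral>\<^sup>+x. epowr (u x) p * w0 x \<partial>lebesgue) = (\<integral>\<^sup>+t. ?k t * ?J u t \<partial>lborel)" if "u \<in> borel_measurable lebesgue" for u
        using that by (intro layer_cake sigma_finite_lebesgue p) auto
      have Jm: "(\<lambda>t. ?J u t) \<in> borel_measurable lborel" if [measurable]: "u \<in> borel_measurable lebesgue" for u :: "'a \<Rightarrow> ennreal"
      proof (rule lebesgue.borel_measurable_nn_integral)
        have [measurable]: "Measurable.pred (lborel \<Otimes>\<^sub>M lebesgue) (\<lambda>z. ennreal (fst z) < u (snd z))" by measurable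
        show "(\<lambda>(t, x). indicator {x. ennreal t < u x} x * w0 x) \<in> borel_measurable (lborel \<Otimes>\<^sub>M lebesgue)"
          unfolding indicator_def mem_Collect_eq split_beta' by measurable
      qed
      have hm: "h \<in> borel_measurable lebesgue" "(\<lambda>x. ennreal (1/\<beta>) * h x) \<in> borel_measurable lebesgue" "(\<lambda>x. ennreal (1/\<gamma>) * m x) \<in> borel_measurable lebesgue"
        by measurable
      note [measurable] = Jm[OF hm(1)] Jm[OF hm(3)]
      have "(\<integral>\<^sup>+x. epowr (ennreal (1/\<beta>) * h x) p * w0 x \<partial>lebesgue) \<le> (\<integral>\<^sup>+t. ennreal \<kappa> * (?k t * ?J h t) + ?k t * ?J (\<lambda>x. ennreal (1/\<gamma>) * m x) t \<partial>lborel)"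
        unfolding lc[OF hm(2)]
      proof (rule nn_integral_mono)
        fix t :: real
        show "?k t * ?J (\<lambda>x. ennreal (1/\<beta>) * h x) t \<le> ennreal \<kappa> * (?k t * ?J h t) + ?k t * ?J (\<lambda>x. ennreal (1/\<gamma>) * m x) t"
        proof (cases "0 < t")
          case True
          from mult_left_mono[OF level[OF True], of "?k t"] show ?thesis by (simp only: distrib_left mult_ac zero_le)
        qed simp
      qed
      also have "\<dots> = (\<integral>\<^sup>+t. ennreal \<kappa> * (?k t * ?J h t) \<partial>lborel) + (\<integral>\<^sup>+t. ?k t * ?J (\<lambda>x. ennreal (1/\<gamma>) * m x) t \<partial>lborel)"
        by (rule nn_integral_add) measurable
      also have "(\<integral>\<^sup>+t. ennreal \<kappa> * (?k t * ?J h t) \<partial>lborel) = ennreal \<kappa> * (\<integral>\<^sup>+t. ?k t * ?J h t \<partial>lborel)"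
        by (rule nn_integral_cmult) measurable
      also have "(\<integral>\<^sup>+t. ?k t * ?J h t \<partial>lborel) = I" unfolding I_def by (rule lc[OF hm(1), symmetric])
      also have "(\<integral>\<^sup>+t. ?k t * ?J (\<lambda>x. ennreal (1/\<gamma>) * m x) t \<partial>lborel) = (\<integral>\<^sup>+x. epowr (ennreal (1/\<gamma>) * m x) p * w0 x \<partial>lebesgue)"
        by (rule lc[OF hm(3), symmetric])
      finally have 1: "(\<integral>\<^sup>+x. epowr (ennreal (1/\<beta>) * h x) p * w0 x \<partial>lebesgue) \<le> ennreal \<kappa> * I + (\<integral>\<^sup>+x. epowr (ennreal (1/\<gamma>) * m x) p * w0 x \<partial>lebesgue)" .
      have sc: "(\<integral>\<^sup>+x. epowr (ennreal c * u x) p * w0 x \<partial>lebesgue) = ennreal (c powr p) * (\<integral>\<^sup>+x. epowr (u x) p * w0 x \<partial>lebesgue)"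
        if c: "0 \<le> c" and [measurable]: "u \<in> borel_measurable lebesgue" for c u
      proof -
        have "(\<integral>\<^sup>+x. epowr (ennreal c * u x) p * w0 x \<partial>lebesgue) = (\<integral>\<^sup>+x. ennreal (c powr p) * (epowr (u x) p * w0 x) \<partial>lebesgue)"
          using p c by (simp add: epowr_mult epowr_ennreal mult.assoc)
        also have "\<dots> = ennreal (c powr p) * (\<integral>\<^sup>+x. epowr (u x) p * w0 x \<partial>lebesgue)" by (rule nn_integral_cmult) measurable
        finally show ?thesis .
      qed
      have 2: "ennreal (\<kappa> powr (1/2)) * I \<le> ennreal \<kappa> * I + ennreal ((1/\<gamma>) powr p) * Y"
        using 1 \<beta> \<gamma>0 unfolding I_def Y_def \<beta>p[symmetric] by (simp add: sc)
      have "I \<le> (\<integral>\<^sup>+x. ennreal (N powr p) * w0 x \<partial>lebesgue)" unfolding I_def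
      proof (intro nn_integral_mono mult_right_mono)
        fix x have "epowr (h x) p \<le> epowr (ennreal N) p" using p by (intro epowr_mono) (auto simp: h_def)
        then show "epowr (h x) p \<le> ennreal (N powr p)" using p N by (simp add: epowr_ennreal)
      qed simp
      also have "\<dots> = ennreal (N powr p) * wmeas w (cube s x0)" unfolding wmeas_def w0_def by (rule nn_integral_cmult) measurable
      also have "\<dots> < \<infinity>"
      proof -
        have "wmeas w (cube s x0) \<le> wmeas w (ball x0 (real DIM('a) * s))" by (intro wmeas_mono cube_subset_ball s)
        also have "\<dots> < \<infinity>" using s by (intro averaging_ball_finite[OF w] mult_pos_pos) simp_all
        finally show ?thesis by (simp add: ennreal_mult_less_top)
      qed
      finally obtain i where i: "I = ennreal i" "0 \<le> i" by (cases I) auto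
      have "I \<le> ennreal K0 * Y"
      proof (cases Y)
        case (real y)
        have "ennreal (\<kappa> powr (1/2) * i) \<le> ennreal (\<kappa> * i + (1/\<gamma>) powr p * y)"
          using 2 i real \<kappa> by (simp add: ennreal_mult ennreal_plus)
        then have "\<kappa> powr (1/2) * i \<le> \<kappa> * i + (1/\<gamma>) powr p * y"
          using i real \<kappa> by (subst (asm) ennreal_le_iff) auto
        then have "e * i \<le> (1/\<gamma>) powr p * y" by (simp add: e_def left_diff_distrib)
        then have "i \<le> K0 * y" using e by (simp add: K0_def pos_le_divide_eq mult.commute)
        then show ?thesis using i real K0 by (simp add: ennreal_mult[symmetric] ennreal_leI)
      next
        case top
        have "0 < K0" using e \<gamma>0 by (simp add: K0_def)
        then show ?thesis using top by (simp add: ennreal_mult_top)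
      qed
      then show ?thesis unfolding I_def Y_def h_def w0_def .
    qed
    have cubes: "(\<integral>\<^sup>+x. epowr (G x) p * (w x * indicator (cube s x0) x) \<partial>lebesgue)
        \<le> ennreal K0 * (\<integral>\<^sup>+x. epowr (m x) p * (w x * indicator (cube s x0) x) \<partial>lebesgue)" for x0
    proof -
      have "(\<integral>\<^sup>+x. epowr (G x) p * (w x * indicator (cube s x0) x) \<partial>lebesgue)
        = (\<integral>\<^sup>+x. (SUP N::nat. epowr (min (G x) (ennreal (real N))) p * (w x * indicator (cube s x0) x)) \<partial>lebesgue)"
        by (intro nn_integral_cong) (subst epowr_min_SUP[OF p], rule SUP_mult_right_ennreal)
      also have "\<dots> = (SUP N::nat. \<integral>\<^sup>+x. epowr (min (G x) (ennreal (real N))) p * (w x * indicator (cube s x0) x) \<partial>lebesgue)"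
      proof (rule nn_integral_monotone_convergence_SUP)
        show "incseq (\<lambda>N x. epowr (min (G x) (ennreal (real N))) p * (w x * indicator (cube s x0) x))"
          using p by (auto simp: incseq_def le_fun_def intro!: mult_right_mono epowr_mono min.mono ennreal_leI)
      qed measurable
      also have "\<dots> \<le> ennreal K0 * (\<integral>\<^sup>+x. epowr (m x) p * (w x * indicator (cube s x0) x) \<partial>lebesgue)"
        by (intro SUP_least trunc) simp
      finally show ?thesis .
    qed
    interpret T: stopping s "\<lambda>i (x::'a). i = 0" using s by unfold_locales auto
    have TQ: "T.Q x = cube s x" for x unfolding stop_cube_def first_level_def by simp
    have "(\<integral>\<^sup>+x\<in>T.\<Omega>. (epowr (G x) p * w x) \<partial>lebesgue) \<le> (\<integral>\<^sup>+x\<in>T.\<Omega>. (ennreal K0 * (epowr (m x) p * w x)) \<partial>lebesgue)"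
    proof (rule T.nn_integral_stop_le)
      fix x0 :: 'a
      have [measurable]: "cube s x0 \<in> sets lebesgue" by simp
      have "(\<integral>\<^sup>+x\<in>cube s x0. (epowr (G x) p * w x) \<partial>lebesgue) \<le> ennreal K0 * (\<integral>\<^sup>+x\<in>cube s x0. (epowr (m x) p * w x) \<partial>lebesgue)"
        using cubes[of x0] by (simp only: mult.assoc)
      also have "\<dots> = (\<integral>\<^sup>+x. ennreal K0 * (epowr (m x) p * w x * indicator (cube s x0) x) \<partial>lebesgue)"
        by (rule nn_integral_cmult[symmetric]) measurable
      finally show "(\<integral>\<^sup>+x\<in>T.Q x0. (epowr (G x) p * w x) \<partial>lebesgue) \<le> (\<integral>\<^sup>+x\<in>T.Q x0. (ennreal K0 * (epowr (m x) p * w x)) \<partial>lebesgue)"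
        unfolding TQ by (simp only: mult.assoc)
    qed measurable
    then have "(\<integral>\<^sup>+x. epowr (G x) p * w x \<partial>lebesgue) \<le> (\<integral>\<^sup>+x. ennreal K0 * (epowr (m x) p * w x) \<partial>lebesgue)" by simp
    also have "\<dots> = ennreal K0 * (\<integral>\<^sup>+x. epowr (m x) p * w x \<partial>lebesgue)" by (rule nn_integral_cmult) measurable
    finally show ?thesis unfolding m_def G_def by (simp add: epowr_epowr)
  qed
  then show ?thesis using K0 by blast
qed

theorem dyadic_sq_Ap:
  fixes w :: "'a::euclidean_space \<Rightarrow> ennreal"
  assumes \<alpha>: "0 < \<alpha>" "\<alpha> \<le> 1" and w: "Ap_weight p A w"
  shows "\<exists>K::real. 0 \<le> K \<and> (\<forall>s>0. \<forall>F :: nat \<Rightarrow> 'a \<Rightarrow> complex. (\<forall>j. F j \<in> borel_measurable lebesgue) \<longrightarrow>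
    (\<integral>\<^sup>+x. epowr (dyadic_sq \<alpha> s F x) (p/2) * w x \<partial>lebesgue) \<le> ennreal K * (\<integral>\<^sup>+x. epowr (l2norm F x) p * w x \<partial>lebesgue))"
proof -
  have p: "1 < p" and wm [measurable]: "w \<in> borel_measurable lebesgue" using w by (simp_all add: Ap_weight_def)
  obtain C2 where C2: "0 \<le> C2" "\<And>s (F :: nat \<Rightarrow> 'a \<Rightarrow> complex). 0 < s \<Longrightarrow> (\<And>j. F j \<in> borel_measurable lebesgue) \<Longrightarrow>
      (\<integral>\<^sup>+x. dyadic_sq \<alpha> s F x \<partial>lebesgue) \<le> ennreal C2 * (\<integral>\<^sup>+z. (l2norm F z)\<^sup>2 \<partial>lebesgue)"
    by (rule dyadic_sq_L2[OF \<alpha>, where 'a='a]) blast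
  let ?u = "unit_ball_vol (real DIM('a))"
  have "\<exists>C::real. 0 \<le> C \<and> (\<forall>s>0. \<forall>\<theta>>0. \<forall>F :: nat \<Rightarrow> 'a \<Rightarrow> complex.
    (\<forall>j. F j \<in> borel_measurable lebesgue) \<longrightarrow> (\<integral>\<^sup>+x. l2norm F x \<partial>lebesgue) < \<infinity> \<longrightarrow>
    wmeas (\<lambda>_::'a. 1) {x. ennreal (\<theta>\<^sup>2) < dyadic_sq \<alpha> s F x} \<le> ennreal (C/\<theta>) * (\<integral>\<^sup>+x. l2norm F x * 1 \<partial>lebesgue))"
  proof (rule dyadic_sq_weak_type[OF \<alpha>, where ?C1.0="?u" and ?C2.0=C2])
    show "AE z::'a in lebesgue. \<forall>r>0. wmeas (\<lambda>_. 1) (ball z r) \<le> ennreal (?u * r ^ DIM('a)) * 1"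
      by (intro AE_I2 allI impI) (simp add: wmeas_def emeasure_lebesgue_ball[simplified])
    show "(\<integral>\<^sup>+x. dyadic_sq \<alpha> s H x * 1 \<partial>lebesgue) \<le> ennreal C2 * (\<integral>\<^sup>+x. (l2norm H x)\<^sup>2 * 1 \<partial>lebesgue)"
      if "0 < s" "\<And>j. H j \<in> borel_measurable lebesgue" for s and H :: "nat \<Rightarrow> 'a \<Rightarrow> complex"
      using C2(2)[OF that] by simp
  qed (simp_all add: C2(1))
  then obtain C where C: "0 \<le> C" and CW: "\<forall>s>0. \<forall>\<theta>>0. \<forall>F :: nat \<Rightarrow> 'a \<Rightarrow> complex.
    (\<forall>j. F j \<in> borel_measurable lebesgue) \<longrightarrow> (\<integral>\<^sup>+x. l2norm F x \<partial>lebesgue) < \<infinity> \<longrightarrow>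
    wmeas (\<lambda>_::'a. 1) {x. ennreal (\<theta>\<^sup>2) < dyadic_sq \<alpha> s F x} \<le> ennreal (C/\<theta>) * (\<integral>\<^sup>+x. l2norm F x * 1 \<partial>lebesgue)"
    by (elim exE conjE)
  have wt: "weak_type_const \<alpha> TYPE('a) (C + 1)"
    unfolding weak_type_const_def
  proof (intro conjI allI impI)
    show "0 < C + 1" using C by simp
    fix s \<theta> :: real and F :: "nat \<Rightarrow> 'a \<Rightarrow> complex"
    assume a: "0 < s" "0 < \<theta>" "\<forall>j. F j \<in> borel_measurable lebesgue" "(\<integral>\<^sup>+x. l2norm F x \<partial>lebesgue) < \<infinity>"
    have [measurable]: "F j \<in> borel_measurable lebesgue" for j using a(3) by blast
    have "{x \<in> space lebesgue. ennreal (\<theta>\<^sup>2) < dyadic_sq \<alpha> s F x} \<in> sets lebesgue" by measurable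
    then have m: "{x. ennreal (\<theta>\<^sup>2) < dyadic_sq \<alpha> s F x} \<in> sets lebesgue" by simp
    have "emeasure lebesgue {x. ennreal (\<theta>\<^sup>2) < dyadic_sq \<alpha> s F x} = wmeas (\<lambda>_. 1) {x. ennreal (\<theta>\<^sup>2) < dyadic_sq \<alpha> s F x}"
      unfolding wmeas_def mult_1 by (rule nn_integral_indicator[OF m, symmetric])
    also have "\<dots> \<le> ennreal (C/\<theta>) * (\<integral>\<^sup>+x. l2norm F x * 1 \<partial>lebesgue)"
      using CW[rule_format, OF a(1,2) _ a(4)] a(3) by blast
    also have "\<dots> \<le> ennreal ((C+1)/\<theta>) * (\<integral>\<^sup>+x. l2norm F x * 1 \<partial>lebesgue)"
      using a(2) by (intro mult_right_mono ennreal_leI divide_right_mono) auto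
    finally show "emeasure lebesgue {x. ennreal (\<theta>\<^sup>2) < dyadic_sq \<alpha> s F x} \<le> ennreal ((C+1)/\<theta>) * (\<integral>\<^sup>+x. l2norm F x \<partial>lebesgue)"
      by (simp only: mult_1_right)
  qed
  have p0: "0 < p" using p by simp
  obtain K0 where K0: "0 \<le> K0" and K0W: "\<forall>s>0. \<forall>F :: nat \<Rightarrow> 'a \<Rightarrow> complex. (\<forall>j. F j \<in> borel_measurable lebesgue) \<longrightarrow>
    (\<integral>\<^sup>+x. epowr (dyadic_sq \<alpha> s F x) (p/2) * w x \<partial>lebesgue) \<le> ennreal K0 * (\<integral>\<^sup>+x. epowr (local_max s F x) p * w x \<partial>lebesgue)"
    using dyadic_sq_le_local_max[OF \<alpha> wt Ap_averaging[OF w] p0] by (elim exE conjE)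
  obtain K1 where K1: "0 \<le> K1" and K1W: "\<forall>R. \<forall>f\<in>borel_measurable lebesgue.
    (\<integral>\<^sup>+x. epowr (uncentred_max R (\<lambda>_. 1) f x) p * w x \<partial>lebesgue) \<le> ennreal K1 * (\<integral>\<^sup>+x. epowr (f x) p * w x \<partial>lebesgue)"
    using Muckenhoupt_maximal[OF w] by (elim exE conjE)
  let ?b = "?u * (real DIM('a) + 2) ^ DIM('a)"
  have "(\<integral>\<^sup>+x. epowr (dyadic_sq \<alpha> s F x) (p/2) * w x \<partial>lebesgue) \<le> ennreal (K0 * (?b powr p * K1)) * (\<integral>\<^sup>+x. epowr (l2norm F x) p * w x \<partial>lebesgue)"
    if s: "0 < s" and F [measurable]: "\<And>j. F j \<in> borel_measurable lebesgue" for s and F :: "nat \<Rightarrow> 'a \<Rightarrow> complex"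
  proof -
    let ?R = "(real DIM('a) + 2) * s"
    have lF: "l2norm F \<in> borel_measurable lebesgue" by measurable
    have "(\<integral>\<^sup>+x. epowr (dyadic_sq \<alpha> s F x) (p/2) * w x \<partial>lebesgue) \<le> ennreal K0 * (\<integral>\<^sup>+x. epowr (local_max s F x) p * w x \<partial>lebesgue)"
      using K0W s F by blast
    also have "(\<integral>\<^sup>+x. epowr (local_max s F x) p * w x \<partial>lebesgue) \<le> (\<integral>\<^sup>+x. ennreal (?b powr p) * (epowr (uncentred_max ?R (\<lambda>_. 1) (l2norm F) x) p * w x) \<partial>lebesgue)"
    proof (rule nn_integral_mono)
      fix x
      have "epowr (local_max s F x) p \<le> epowr (ennreal ?b * uncentred_max ?R (\<lambda>_. 1) (l2norm F) x) p"
        by (rule epowr_mono[OF p0 local_max_le_uncentred[OF s]])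
      also have "\<dots> = ennreal (?b powr p) * epowr (uncentred_max ?R (\<lambda>_. 1) (l2norm F) x) p"
        by (simp only: epowr_mult[OF p0]) (subst epowr_ennreal[OF p0], simp_all)
      finally have "epowr (local_max s F x) p * w x \<le> ennreal (?b powr p) * epowr (uncentred_max ?R (\<lambda>_. 1) (l2norm F) x) p * w x"
        by (rule mult_right_mono) simp
      then show "epowr (local_max s F x) p * w x \<le> ennreal (?b powr p) * (epowr (uncentred_max ?R (\<lambda>_. 1) (l2norm F) x) p * w x)"
        by (simp only: mult.assoc)
    qed
    also have "\<dots> = ennreal (?b powr p) * (\<integral>\<^sup>+x. epowr (uncentred_max ?R (\<lambda>_. 1) (l2norm F) x) p * w x \<partial>lebesgue)"
      by (rule nn_integral_cmult) measurable
    also have "\<dots> \<le> ennreal (?b powr p) * (ennreal K1 * (\<integral>\<^sup>+x. epowr (l2norm F x) p * w x \<partial>lebesgue))"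
      using K1W[rule_format, OF lF] by (rule mult_left_mono) simp
    also have "ennreal K0 * (ennreal (?b powr p) * (ennreal K1 * (\<integral>\<^sup>+x. epowr (l2norm F x) p * w x \<partial>lebesgue))) = ennreal (K0 * (?b powr p * K1)) * (\<integral>\<^sup>+x. epowr (l2norm F x) p * w x \<partial>lebesgue)"
      using K0 K1 by (simp add: ennreal_mult mult.assoc)
    finally show ?thesis by (simp add: mult_left_mono)
  qed
  moreover have "0 \<le> K0 * (?b powr p * K1)" using K0 K1 by simp
  ultimately show ?thesis by blast
qed

section \<open>The intrinsic square function\<close>

lemma C_family_continuous:
  fixes \<phi> :: "'a::euclidean_space \<Rightarrow> real"
  assumes \<alpha>: "0 < \<alpha>" and \<phi>: "\<phi> \<in> C_family \<alpha>"
  shows "continuous_on UNIV \<phi>"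
proof -
  have "isCont \<phi> z" for z
  proof -
    have "((\<lambda>y. norm (y - z) powr \<alpha>) \<longlongrightarrow> norm (z - z) powr \<alpha>) (at z)"
      using \<alpha> by (intro tendsto_intros tendsto_powr') auto
    then have "((\<lambda>y. norm (y - z) powr \<alpha>) \<longlongrightarrow> 0) (at z)" using \<alpha> by simp
    then have "((\<lambda>y. \<phi> y - \<phi> z) \<longlongrightarrow> 0) (at z)"
      by (rule Lim_null_comparison[rotated]) (use \<phi> in \<open>simp add: C_family_def\<close>)
    then show ?thesis unfolding isCont_def by (rule LIM_zero_cancel)
  qed
  then show ?thesis by (simp add: continuous_on_eq_continuous_at)
qed

lemma C_family_bound:
  fixes \<phi> :: "'a::euclidean_space \<Rightarrow> real"
  assumes \<alpha>: "0 < \<alpha>" "\<alpha> \<le> 1" and \<phi>: "\<phi> \<in> C_family \<alpha>"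
  shows "\<bar>\<phi> x\<bar> \<le> 3"
proof (cases "norm x \<le> 1")
  case True
  obtain b :: 'a where b: "b \<in> Basis" using nonempty_Basis by blast
  have n: "norm (2 *\<^sub>R b) = 2" using b by simp
  have "\<phi> (2 *\<^sub>R b) = 0" using \<phi> n by (simp add: C_family_def)
  moreover have "\<bar>\<phi> x - \<phi> (2 *\<^sub>R b)\<bar> \<le> norm (x - 2 *\<^sub>R b) powr \<alpha>" using \<phi> by (simp add: C_family_def)
  moreover have "norm (x - 2 *\<^sub>R b) powr \<alpha> \<le> 3"
    using norm_triangle_ineq4[of x "2 *\<^sub>R b"] True n by (intro powr_le_max1 \<alpha>) auto
  ultimately show ?thesis by simp
qed (use \<phi> in \<open>simp add: C_family_def\<close>)

lemma integral_reflect_scale: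
  fixes \<phi> :: "'a::euclidean_space \<Rightarrow> real"
  assumes \<phi>: "\<phi> \<in> borel_measurable borel" and t: "0 < t"
  shows "(LINT z|lebesgue. \<phi> ((y - z) /\<^sub>R t)) = t ^ DIM('a) * (LINT z|lebesgue. \<phi> z)"
proof -
  let ?T = "\<lambda>z. y /\<^sub>R t + (- (1/t)) *\<^sub>R z"
  have T: "?T \<in> lborel \<rightarrow>\<^sub>M borel" by measurable
  have e: "?T z = (y - z) /\<^sub>R t" for z by (simp add: scaleR_diff_right divide_inverse)
  have "(LINT z|lborel. \<phi> z) = (LINT z|density (distr lborel borel ?T) (\<lambda>_. ennreal (\<bar>- (1/t)\<bar> ^ DIM('a))). \<phi> z)"
    using lborel_affine[of "- (1/t)" "y /\<^sub>R t"] t by simp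
  also have "\<dots> = (LINT z|distr lborel borel ?T. \<bar>- (1/t)\<bar> ^ DIM('a) *\<^sub>R \<phi> z)"
    using \<phi> by (intro integral_density) auto
  also have "\<dots> = (LINT z|lborel. \<bar>- (1/t)\<bar> ^ DIM('a) *\<^sub>R \<phi> (?T z))"
    using \<phi> by (intro integral_distr T) simp
  also have "\<dots> = (1/t) ^ DIM('a) * (LINT z|lborel. \<phi> ((y - z) /\<^sub>R t))"
    unfolding e using t by simp
  finally have 1: "(LINT z|lborel. \<phi> ((y - z) /\<^sub>R t)) = t ^ DIM('a) * (LINT z|lborel. \<phi> z)"
    using t by (simp add: power_one_over)
  have "(\<lambda>z. \<phi> ((y - z) /\<^sub>R t)) \<in> borel_measurable lborel"
    using \<phi> by (intro measurable_compose[OF _ \<phi>]) simp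
  moreover have "\<phi> \<in> borel_measurable lborel" using \<phi> by simp
  ultimately show ?thesis using 1 by (simp add: integral_completion)
qed

lemma A_sup_le_cube_sup:
  fixes y :: "'a::euclidean_space"
  assumes \<alpha>: "0 < \<alpha>" "\<alpha> \<le> 1" and t: "0 < t" "s < 2 * t" "t \<le> s"
  shows "A_sup \<alpha> f t y \<le> ennreal (2 ^ (DIM('a) + 1)) * cube_sup \<alpha> s y f"
  unfolding A_sup_def
proof (rule SUP_least)
  fix \<phi> :: "'a \<Rightarrow> real" assume \<phi>: "\<phi> \<in> C_family \<alpha>"
  let ?n = "DIM('a)" let ?c = "2 ^ (?n + 1) :: real"
  have s: "0 < s" using t by simp
  define \<psi> where "\<psi> z = dilate t \<phi> (y - z) / ?c" for z
  have \<psi>: "\<psi> \<in> cube_kernels \<alpha> s y"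
    unfolding cube_kernels_def mem_Collect_eq
  proof (intro conjI allI impI)
    fix z assume "z \<notin> nbhd s y"
    then have "z \<notin> ball y (2 * s)" using ball_subset_nbhd[of y s] by blast
    then have "t < norm (y - z)" using t by (simp add: dist_norm)
    moreover have "norm ((y - z) /\<^sub>R t) = norm (y - z) / t" using t(1) by (simp add: divide_inverse mult.commute)
    ultimately have "1 < norm ((y - z) /\<^sub>R t)" using t(1) by (simp only: less_divide_eq) simp
    then have "\<phi> ((y - z) /\<^sub>R t) = 0" using \<phi> by (simp add: C_family_def)
    then show "\<psi> z = 0" by (simp add: \<psi>_def dilate_def)
  next
    have "\<phi> \<in> borel_measurable borel" by (rule borel_measurable_continuous_onI[OF C_family_continuous[OF \<alpha>(1) \<phi>]])
    then have "(LINT z|lebesgue. \<phi> ((y - z) /\<^sub>R t)) = 0" using integral_reflect_scale[of \<phi> t y] t(1) \<phi> by (simp add: C_family_def)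
    then show "(LINT z|lebesgue. \<psi> z) = 0" by (simp add: \<psi>_def dilate_def)
  next
    fix z z' :: 'a
    let ?u = "norm (z - z')"
    have "\<bar>\<phi> ((y - z) /\<^sub>R t) - \<phi> ((y - z') /\<^sub>R t)\<bar> \<le> norm ((y - z) /\<^sub>R t - (y - z') /\<^sub>R t) powr \<alpha>"
      using \<phi> by (simp add: C_family_def)
    also have "(y - z) /\<^sub>R t - (y - z') /\<^sub>R t = (z' - z) /\<^sub>R t" by (simp add: scaleR_diff_right)
    also have "norm ((z' - z) /\<^sub>R t) = (s/t) * (?u / s)" using t(1) s by (simp add: norm_minus_commute divide_inverse)
    also have "((s/t) * (?u / s)) powr \<alpha> = (s/t) powr \<alpha> * (?u / s) powr \<alpha>" by (rule powr_mult)
    also have "\<dots> \<le> 2 * (?u / s) powr \<alpha>"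
      using t s by (intro mult_right_mono powr_le_max1 \<alpha>) (simp_all add: divide_le_eq)
    finally have 1: "\<bar>\<phi> ((y - z) /\<^sub>R t) - \<phi> ((y - z') /\<^sub>R t)\<bar> \<le> 2 * (?u / s) powr \<alpha>" .
    have 2: "1 / t ^ ?n \<le> 2 ^ ?n / s ^ ?n"
    proof -
      have "s ^ ?n \<le> (2 * t) ^ ?n" using s t by (intro power_mono) auto
      then show ?thesis using s t(1) by (simp add: divide_simps power_mult_distrib)
    qed
    have "\<bar>\<psi> z - \<psi> z'\<bar> = \<bar>\<phi> ((y - z) /\<^sub>R t) - \<phi> ((y - z') /\<^sub>R t)\<bar> * (1 / t ^ ?n) / ?c"
    proof -
      have "\<psi> z - \<psi> z' = (\<phi> ((y - z) /\<^sub>R t) - \<phi> ((y - z') /\<^sub>R t)) * (1 / t ^ ?n) / ?c"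
        by (simp add: \<psi>_def dilate_def diff_divide_distrib)
      then show ?thesis using t(1) by (simp add: abs_mult)
    qed
    also have "\<dots> \<le> (2 * (?u / s) powr \<alpha>) * (2 ^ ?n / s ^ ?n) / ?c"
      using 1 2 t(1) by (intro divide_right_mono mult_mono) simp_all
    also have "\<dots> = (?u / s) powr \<alpha> / s ^ ?n" by simp
    finally show "\<bar>\<psi> z - \<psi> z'\<bar> \<le> (?u / s) powr \<alpha> / s ^ ?n" .
  qed
  have "convolve f (dilate t \<phi>) y = (LINT z|lebesgue. complex_of_real ?c * (f z * complex_of_real (\<psi> z)))"
    unfolding convolve_def \<psi>_def by (intro Bochner_Integration.integral_cong) (simp_all add: mult_ac)
  also have "\<dots> = complex_of_real ?c * (LINT z|lebesgue. f z * complex_of_real (\<psi> z))"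
    by (rule integral_mult_right_zero)
  finally have "ennreal (cmod (convolve f (dilate t \<phi>) y)) = ennreal ?c * ennreal (cmod (LINT z|lebesgue. f z * complex_of_real (\<psi> z)))"
    by (simp only: norm_mult norm_of_real) (simp add: ennreal_mult')
  also have "\<dots> \<le> ennreal ?c * cube_sup \<alpha> s y f"
    unfolding cube_sup_def by (intro mult_left_mono SUP_upper \<psi>) simp
  finally show "ennreal (cmod (convolve f (dilate t \<phi>) y)) \<le> ennreal ?c * cube_sup \<alpha> s y f" .
qed

lemma nn_integral_dyadic_block:
  assumes a: "0 < a"
  shows "(\<integral>\<^sup>+t. (1 / ennreal t) * indicator {a<..2*a} t \<partial>lebesgue) \<le> 1"
proof -
  have "(\<integral>\<^sup>+t. (1 / ennreal t) * indicator {a<..2*a} t \<partial>lebesgue) \<le> (\<integral>\<^sup>+t. ennreal (1/a) * indicator {a<..2*a} t \<partial>lebesgue)"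
  proof (rule nn_integral_mono)
    fix t
    show "(1 / ennreal t) * indicator {a<..2*a} t \<le> ennreal (1/a) * indicator {a<..2*a} t"
    proof (cases "t \<in> {a<..2*a}")
      case True
      then have "1 / ennreal t = ennreal (1/t)" using a by (simp add: divide_ennreal[symmetric])
      moreover have "1/t \<le> 1/a" using True a by (simp add: frac_le)
      ultimately show ?thesis using True by (simp add: ennreal_leI)
    qed simp
  qed
  also have "\<dots> = ennreal (1/a) * emeasure lebesgue {a<..2*a}" by (rule nn_integral_cmult_indicator) simp
  also have "\<dots> = 1" using a by (simp add: ennreal_mult[symmetric])
  finally show ?thesis .
qed

lemma dyadic_level_exists:
  fixes t s :: real
  assumes t: "0 < t" "t \<le> s"
  shows "\<exists>i::nat. s/2^Suc i < t \<and> t \<le> s/2^i"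
proof -
  obtain k where k: "s/t < 2^k" using real_arch_pow[of 2 "s/t"] by auto
  define P where "P i \<longleftrightarrow> s/2^i < t" for i :: nat
  have "P k" using k t by (simp add: P_def field_simps)
  moreover have "\<not> P 0" using t by (simp add: P_def)
  ultimately obtain i where "\<not> P i" "P (Suc i)" using ex_least_nat_less[of P k] by blast
  then show ?thesis by (auto simp: P_def not_less)
qed

lemma dyadic_block_exists:
  fixes t r :: real
  assumes r: "0 < r" "r < t"
  shows "\<exists>k::nat. 2^k * r < t \<and> t \<le> 2^Suc k * r"
proof -
  obtain k where k: "t/r < 2^k" using real_arch_pow[of 2 "t/r"] by auto
  define P where "P i \<longleftrightarrow> t \<le> 2^i * r" for i :: nat
  have "P k" using k r by (simp add: P_def field_simps)
  moreover have "\<not> P 0" using r by (simp add: P_def)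
  ultimately obtain i where "\<not> P i" "P (Suc i)" using ex_least_nat_less[of P k] by blast
  then show ?thesis by (auto simp: P_def not_le)
qed

lemma g_function_square_le:
  fixes f :: "'a::euclidean_space \<Rightarrow> complex"
  assumes \<alpha>: "0 < \<alpha>" "\<alpha> \<le> 1" and r: "0 < r"
  shows "(g_function \<alpha> f x)\<^sup>2 \<le> (\<Sum>i. (ennreal (2 ^ (DIM('a) + 1)) * cube_sup \<alpha> (r/2^i) x f)\<^sup>2)
     + (\<Sum>k. (ennreal (2 ^ (DIM('a) + 1)) * cube_sup \<alpha> (2^Suc k * r) x f)\<^sup>2)"
proof -
  let ?C = "ennreal (2 ^ (DIM('a) + 1))"
  let ?a = "\<lambda>i. (?C * cube_sup \<alpha> (r/2^i) x f)\<^sup>2" let ?b = "\<lambda>k. (?C * cube_sup \<alpha> (2^Suc k * r) x f)\<^sup>2"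
  let ?I = "\<lambda>i. indicator {r/2^Suc i<..2*(r/2^Suc i)} :: real \<Rightarrow> ennreal" let ?J = "\<lambda>k. indicator {2^k * r<..2*(2^k * r)} :: real \<Rightarrow> ennreal"
  have "(g_function \<alpha> f x)\<^sup>2 = (\<integral>\<^sup>+t\<in>{0<..}. ((A_sup \<alpha> f t x)\<^sup>2 / ennreal t) \<partial>lebesgue)"
    by (simp add: g_function_def)
  also have "\<dots> \<le> (\<integral>\<^sup>+t. (\<Sum>i. ?a i * ((1 / ennreal t) * ?I i t)) + (\<Sum>k. ?b k * ((1 / ennreal t) * ?J k t)) \<partial>lebesgue)"
  proof (rule nn_integral_mono)
    fix t :: real
    let ?S = "(\<Sum>i. ?a i * ((1 / ennreal t) * ?I i t)) + (\<Sum>k. ?b k * ((1 / ennreal t) * ?J k t))"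
    have d: "(A_sup \<alpha> f t x)\<^sup>2 / ennreal t = (A_sup \<alpha> f t x)\<^sup>2 * (1 / ennreal t)" by (simp add: ennreal_times_divide)
    consider "t \<le> 0" | "0 < t" "t \<le> r" | "r < t" by linarith
    then show "(A_sup \<alpha> f t x)\<^sup>2 / ennreal t * indicator {0<..} t \<le> ?S"
    proof cases
      case 2
      then obtain i where i: "r/2^Suc i < t" "t \<le> r/2^i" using dyadic_level_exists by blast
      have "(A_sup \<alpha> f t x)\<^sup>2 * (1 / ennreal t) \<le> ?a i * (1 / ennreal t)"
        using 2 i by (intro mult_right_mono power_mono A_sup_le_cube_sup \<alpha>) auto
      also have "\<dots> = (\<Sum>i\<in>{i}. ?a i * ((1 / ennreal t) * ?I i t))" using i by simp
      also have "\<dots> \<le> (\<Sum>i. ?a i * ((1 / ennreal t) * ?I i t))" by (rule sum_le_suminf[OF summableI]) simp_all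
      also have "\<dots> \<le> ?S" by simp
      finally show ?thesis using 2 by (simp add: d)
    next
      case 3
      then obtain k where k: "2^k * r < t" "t \<le> 2^Suc k * r" using dyadic_block_exists[OF r] by blast
      have t0: "0 < t" using 3 r by simp
      have "(A_sup \<alpha> f t x)\<^sup>2 * (1 / ennreal t) \<le> ?b k * (1 / ennreal t)"
        using t0 k by (intro mult_right_mono power_mono A_sup_le_cube_sup \<alpha>) auto
      also have "\<dots> = (\<Sum>k\<in>{k}. ?b k * ((1 / ennreal t) * ?J k t))" using k by simp
      also have "\<dots> \<le> (\<Sum>k. ?b k * ((1 / ennreal t) * ?J k t))" by (rule sum_le_suminf[OF summableI]) simp_all
      also have "\<dots> \<le> ?S" by simp
      finally show ?thesis using t0 by (simp add: d)
    qed simp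
  qed
  also have "\<dots> = (\<Sum>i. ?a i * (\<integral>\<^sup>+t. (1 / ennreal t) * ?I i t \<partial>lebesgue)) + (\<Sum>k. ?b k * (\<integral>\<^sup>+t. (1 / ennreal t) * ?J k t \<partial>lebesgue))"
  proof -
    have m: "(\<lambda>t. (1 / ennreal t) * indicator {a<..2*a} t) \<in> borel_measurable lebesgue" for a :: real
      by (rule measurable_borel_lebesgue) measurable
    have e: "(\<integral>\<^sup>+t. (\<Sum>i. c i * ((1 / ennreal t) * indicator {a i<..2*a i} t)) \<partial>lebesgue) = (\<Sum>i. c i * (\<integral>\<^sup>+t. (1 / ennreal t) * indicator {a i<..2*a i} t \<partial>lebesgue))"
      for c :: "nat \<Rightarrow> ennreal" and a :: "nat \<Rightarrow> real"
    proof -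
      have "(\<integral>\<^sup>+t. (\<Sum>i. c i * ((1 / ennreal t) * indicator {a i<..2*a i} t)) \<partial>lebesgue) = (\<Sum>i. \<integral>\<^sup>+t. c i * ((1 / ennreal t) * indicator {a i<..2*a i} t) \<partial>lebesgue)"
        by (intro nn_integral_suminf borel_measurable_times_ennreal m measurable_const) simp
      also have "\<dots> = (\<Sum>i. c i * (\<integral>\<^sup>+t. (1 / ennreal t) * indicator {a i<..2*a i} t \<partial>lebesgue))"
        by (intro suminf_cong nn_integral_cmult m)
      finally show ?thesis .
    qed
    have ms: "(\<lambda>t. \<Sum>i. c i * ((1 / ennreal t) * indicator {a i<..2*a i} t)) \<in> borel_measurable lebesgue"
      for c :: "nat \<Rightarrow> ennreal" and a :: "nat \<Rightarrow> real"
      by (rule borel_measurable_suminf_order) (intro borel_measurable_times_ennreal m measurable_const, simp)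
    show ?thesis by (subst nn_integral_add[OF ms ms]) (simp only: e)
  qed
  also have "\<dots> \<le> (\<Sum>i. ?a i * 1) + (\<Sum>k. ?b k * 1)"
    using r by (intro add_mono suminf_le summableI mult_left_mono nn_integral_dyadic_block) simp_all
  finally show ?thesis by simp
qed

text \<open>Measurability.\<close>

lemma convolve_continuous:
  fixes f :: "'a::euclidean_space \<Rightarrow> complex"
  assumes \<alpha>: "0 < \<alpha>" "\<alpha> \<le> 1" and \<phi>: "\<phi> \<in> C_family \<alpha>" and f [measurable]: "f \<in> borel_measurable lebesgue"
    and fin: "\<And>R. (\<integral>\<^sup>+z\<in>cball 0 R. ennreal (cmod (f z)) \<partial>lebesgue) < \<infinity>"
  shows "continuous_on ({0<..} \<times> UNIV) (\<lambda>p. convolve f (dilate (fst p) \<phi>) (snd p))"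
  unfolding continuous_on_sequentially
proof (intro allI ballI impI)
  fix u :: "nat \<Rightarrow> real \<times> 'a" and a
  assume a: "a \<in> {0<..} \<times> UNIV" and u: "(\<forall>n. u n \<in> {0<..} \<times> UNIV) \<and> u \<longlonglongrightarrow> a"
  let ?t = "\<lambda>n. fst (u n)" let ?x = "\<lambda>n. snd (u n)"
  have t0: "0 < fst a" using a by auto
  have tn: "0 < ?t n" for n using u by (auto simp: mem_Times_iff)
  have tl: "?t \<longlonglongrightarrow> fst a" and xl: "?x \<longlonglongrightarrow> snd a" using u by (auto intro: tendsto_fst tendsto_snd)
  have il: "(\<lambda>n. inverse (?t n)) \<longlonglongrightarrow> inverse (fst a)" using tl t0 by (intro tendsto_inverse) auto
  obtain T where T: "0 < T" "\<And>n. norm (?t n) \<le> T" using convergent_imp_Bseq[OF convergentI[OF tl]] by (rule BseqE) blast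
  obtain X where X: "0 < X" "\<And>n. norm (?x n) \<le> X" using convergent_imp_Bseq[OF convergentI[OF xl]] by (rule BseqE) blast
  obtain L where L: "0 < L" "\<And>n. norm (inverse (?t n)) \<le> L" using convergent_imp_Bseq[OF convergentI[OF il]] by (rule BseqE) blast
  have c\<phi>: "isCont \<phi> z" for z using C_family_continuous[OF \<alpha>(1) \<phi>] by (simp add: continuous_on_eq_continuous_at)
  have [measurable]: "\<phi> \<in> borel_measurable borel" by (rule borel_measurable_continuous_onI[OF C_family_continuous[OF \<alpha>(1) \<phi>]])
  have dm: "(\<lambda>z. dilate t \<phi> (x - z)) \<in> borel_measurable lebesgue" for t x
    unfolding dilate_def by (rule measurable_borel_lebesgue) measurable
  let ?B = "cball 0 (X + T) :: 'a set"
  let ?w = "\<lambda>z. 3 * L ^ DIM('a) * (indicator ?B z * cmod (f z))"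
  show "((\<lambda>p. convolve f (dilate (fst p) \<phi>) (snd p)) \<circ> u) \<longlonglongrightarrow> convolve f (dilate (fst a) \<phi>) (snd a)"
    unfolding o_def convolve_def
  proof (rule integral_dominated_convergence[where w="?w"])
    show "(\<lambda>z. f z * complex_of_real (dilate (fst a) \<phi> (snd a - z))) \<in> borel_measurable lebesgue"
      using dm[of "fst a" "snd a"] by measurable
    show "(\<lambda>z. f z * complex_of_real (dilate (?t n) \<phi> (?x n - z))) \<in> borel_measurable lebesgue" for n
      using dm[of "?t n" "?x n"] by measurable
    show "integrable lebesgue ?w"
    proof (intro integrable_mult_right integrableI_bounded)
      have [measurable]: "?B \<in> sets lebesgue" by simp
      show "(\<lambda>z. indicator ?B z * cmod (f z)) \<in> borel_measurable lebesgue" by measurable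
      have "(\<integral>\<^sup>+z. ennreal (norm (indicator ?B z * cmod (f z))) \<partial>lebesgue) = (\<integral>\<^sup>+z\<in>?B. ennreal (cmod (f z)) \<partial>lebesgue)"
        by (intro nn_integral_cong) (simp add: indicator_def)
      then show "(\<integral>\<^sup>+z. ennreal (norm (indicator ?B z * cmod (f z))) \<partial>lebesgue) < \<infinity>" using fin by simp
    qed
    show "AE z in lebesgue. (\<lambda>n. f z * complex_of_real (dilate (?t n) \<phi> (?x n - z))) \<longlonglongrightarrow> f z * complex_of_real (dilate (fst a) \<phi> (snd a - z))"
    proof (intro AE_I2 tendsto_mult tendsto_const tendsto_of_real)
      fix z
      have "(\<lambda>n. (?x n - z) /\<^sub>R ?t n) \<longlonglongrightarrow> (snd a - z) /\<^sub>R fst a"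
        using t0 by (intro tendsto_intros tl xl) simp
      then have "(\<lambda>n. \<phi> ((?x n - z) /\<^sub>R ?t n)) \<longlonglongrightarrow> \<phi> ((snd a - z) /\<^sub>R fst a)" by (rule isCont_tendsto_compose[OF c\<phi>])
      then show "(\<lambda>n. dilate (?t n) \<phi> (?x n - z)) \<longlonglongrightarrow> dilate (fst a) \<phi> (snd a - z)"
        unfolding dilate_def using t0 by (intro tendsto_divide tendsto_power tl) simp_all
    qed
    show "AE z in lebesgue. norm (f z * complex_of_real (dilate (?t n) \<phi> (?x n - z))) \<le> ?w z" for n
    proof (intro AE_I2)
      fix z
      show "norm (f z * complex_of_real (dilate (?t n) \<phi> (?x n - z))) \<le> ?w z"
      proof (cases "z \<in> ?B")
        case True
        have "\<bar>dilate (?t n) \<phi> (?x n - z)\<bar> = \<bar>\<phi> ((?x n - z) /\<^sub>R ?t n)\<bar> * inverse (?t n) ^ DIM('a)"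
          using tn[of n] by (simp add: dilate_def abs_divide divide_inverse power_inverse abs_mult)
        also have "\<dots> \<le> 3 * L ^ DIM('a)"
          using L(2)[of n] tn[of n] by (intro mult_mono C_family_bound[OF \<alpha> \<phi>] power_mono) simp_all
        finally have "cmod (f z) * \<bar>dilate (?t n) \<phi> (?x n - z)\<bar> \<le> cmod (f z) * (3 * L ^ DIM('a))" by (rule mult_left_mono) simp
        then show ?thesis using True by (simp add: norm_mult mult_ac)
      next
        case False
        have "norm z \<le> norm (?x n) + norm (?x n - z)" using norm_triangle_ineq2[of z "?x n"] by (simp add: norm_minus_commute)
        then have "?t n < norm (?x n - z)" using False X(2)[of n] T(2)[of n] tn[of n] by simp
        moreover have "norm ((?x n - z) /\<^sub>R ?t n) = norm (?x n - z) / ?t n" using tn[of n] by (simp add: divide_inverse mult.commute)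
        ultimately have "1 < norm ((?x n - z) /\<^sub>R ?t n)" using tn[of n] by (simp only: less_divide_eq) simp
        then have "\<phi> ((?x n - z) /\<^sub>R ?t n) = 0" using \<phi> by (simp add: C_family_def)
        then show ?thesis using False by (simp add: dilate_def)
      qed
    qed
  qed
qed

lemma borel_measurable_g_function:
  fixes f :: "'a::euclidean_space \<Rightarrow> complex"
  assumes \<alpha>: "0 < \<alpha>" "\<alpha> \<le> 1" and f: "f \<in> borel_measurable lebesgue"
    and fin: "\<And>R. (\<integral>\<^sup>+z\<in>cball 0 R. ennreal (cmod (f z)) \<partial>lebesgue) < \<infinity>"
  shows "g_function \<alpha> f \<in> borel_measurable lebesgue"
proof -
  define B where "B p = (if 0 < fst p then A_sup \<alpha> f (fst p) (snd p) else 0)" for p :: "real \<times> 'a"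
  have B: "B \<in> borel_measurable borel"
  proof (rule borel_measurableI_greater)
    fix c :: ennreal
    let ?U = "\<lambda>\<phi>. {p \<in> {0<..} \<times> UNIV. c < ennreal (cmod (convolve f (dilate (fst p) \<phi>) (snd p)))}"
    have "open (?U \<phi>)" if "\<phi> \<in> C_family \<alpha>" for \<phi>
    proof -
      have "continuous_on ({0<..} \<times> UNIV) (\<lambda>p. ennreal (cmod (convolve f (dilate (fst p) \<phi>) (snd p))))"
        by (intro continuous_intros continuous_on_ennreal convolve_continuous[OF \<alpha> that f fin])
      moreover have "open ({0<..} \<times> (UNIV :: 'a set) :: (real \<times> 'a) set)" by (intro open_Times) simp_all
      ultimately have "open ((\<lambda>p. ennreal (cmod (convolve f (dilate (fst p) \<phi>) (snd p)))) -` {c<..} \<inter> ({0<..} \<times> UNIV))"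
        using continuous_on_open_vimage[of "{0<..} \<times> UNIV"] open_greaterThan by blast
      moreover have "(\<lambda>p. ennreal (cmod (convolve f (dilate (fst p) \<phi>) (snd p)))) -` {c<..} \<inter> ({0<..} \<times> UNIV) = ?U \<phi>" by blast
      ultimately show ?thesis by (simp only:)
    qed
    then have "open (\<Union>\<phi>\<in>C_family \<alpha>. ?U \<phi>)" by (intro open_UN) blast
    moreover have "{p \<in> space borel. c < B p} = (\<Union>\<phi>\<in>C_family \<alpha>. ?U \<phi>)"
      unfolding B_def A_sup_def by (auto simp: less_SUP_iff split: if_splits)
    ultimately show "{p \<in> space borel. c < B p} \<in> sets borel" by (simp add: borel_open)
  qed
  have "(\<lambda>p :: 'a \<times> real. (snd p, fst p)) \<in> borel \<Otimes>\<^sub>M lborel \<rightarrow>\<^sub>M borel"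
    unfolding borel_prod[symmetric] by measurable
  then have Bs: "(\<lambda>p :: 'a \<times> real. B (snd p, fst p)) \<in> borel_measurable (borel \<Otimes>\<^sub>M lborel)" by (rule measurable_compose[OF _ B])
  have "(\<lambda>x. \<integral>\<^sup>+t. (B (t, x))\<^sup>2 / ennreal t * indicator {0<..} t \<partial>lborel) \<in> borel_measurable borel"
  proof (rule lborel.borel_measurable_nn_integral)
    note [measurable] = Bs
    show "(\<lambda>(x, t). (B (t, x))\<^sup>2 / ennreal t * indicator {0<..} t) \<in> borel_measurable (borel \<Otimes>\<^sub>M lborel)"
      unfolding split_beta' by measurable
  qed
  moreover have "(\<integral>\<^sup>+t. (B (t, x))\<^sup>2 / ennreal t * indicator {0<..} t \<partial>lborel) = (\<integral>\<^sup>+t\<in>{0<..}. ((A_sup \<alpha> f t x)\<^sup>2 / ennreal t) \<partial>lebesgue)" for x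
    unfolding nn_integral_completion by (intro nn_integral_cong) (simp add: B_def indicator_def)
  ultimately have "(\<lambda>x. \<integral>\<^sup>+t\<in>{0<..}. ((A_sup \<alpha> f t x)\<^sup>2 / ennreal t) \<partial>lebesgue) \<in> borel_measurable borel" by (simp only:)
  then have "(\<lambda>x. epowr (\<integral>\<^sup>+t\<in>{0<..}. ((A_sup \<alpha> f t x)\<^sup>2 / ennreal t) \<partial>lebesgue) (1/2)) \<in> borel_measurable borel" by (rule measurable_epowr)
  then show ?thesis unfolding g_function_def[abs_def] by (rule measurable_borel_lebesgue)
qed

section \<open>Muckenhoupt weights\<close>

lemma ball_average_times:
  fixes u :: "'a::euclidean_space \<Rightarrow> ennreal"
  assumes r: "0 < r"
  shows "ball_average u x r * emeasure lebesgue (ball x r) = wmeas u (ball x r)"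
proof -
  have "emeasure lebesgue (ball x r) \<noteq> 0" "emeasure lebesgue (ball x r) \<noteq> \<infinity>"
    using epowr_ball[OF r, where p=1 and y=x] by simp_all
  moreover have "a / b * b = a" if "b \<noteq> 0" "b \<noteq> \<infinity>" for a b :: ennreal
    using that by (subst mult.commute) (simp add: ennreal_times_divide mult.commute[of b a] mult_divide_eq_ennreal)
  ultimately show ?thesis unfolding ball_average_def wmeas_def by blast
qed

lemma Ap_weight_of_muckenhoupt:
  fixes w :: "'a::euclidean_space \<Rightarrow> ennreal"
  assumes p: "1 < p" and w: "w \<in> muckenhoupt p"
  shows "\<exists>A. Ap_weight p A w"
proof -
  let ?v = "\<lambda>x. epowr (w x) (-1/(p-1))"
  have e: "1 - conj_exponent p = -1/(p-1)" using p by (simp add: conj_exponent_def field_simps)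
  define S where "S = (SUP x. SUP r\<in>{0<..}. ball_average w x r * epowr (ball_average ?v x r) (p - 1))"
  have iw: "is_weight w" and S: "S < \<infinity>" using w p by (simp_all add: muckenhoupt_def S_def e)
  have SA: "S = ennreal (enn2real S)" using S by simp
  have "wmeas w (ball y r) * epowr (wmeas ?v (ball y r)) (p-1) \<le> ennreal (enn2real S) * epowr (emeasure lebesgue (ball y r)) p"
    if r: "0 < r" for y r
  proof -
    let ?b = "emeasure lebesgue (ball y r)"
    have "wmeas w (ball y r) * epowr (wmeas ?v (ball y r)) (p-1)
        = (ball_average w y r * ?b) * epowr (ball_average ?v y r * ?b) (p-1)"
      by (simp only: ball_average_times[OF r])
    also have "\<dots> = (ball_average w y r * epowr (ball_average ?v y r) (p-1)) * (epowr ?b 1 * epowr ?b (p-1))"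
      using p by (simp add: epowr_mult mult_ac)
    also have "epowr ?b 1 * epowr ?b (p-1) = epowr ?b p" using p epowr_add[of 1 "p-1" ?b] by simp
    also have "(ball_average w y r * epowr (ball_average ?v y r) (p-1)) * epowr ?b p \<le> S * epowr ?b p"
      unfolding S_def using r by (intro mult_right_mono SUP_upper2[of y] SUP_upper2[of r]) auto
    finally show ?thesis using SA by simp
  qed
  then show ?thesis using p iw unfolding Ap_weight_def is_weight_def by (intro exI[of _ "enn2real S"]) auto
qed

lemma A1_ball_bound:
  fixes w :: "'a::euclidean_space \<Rightarrow> ennreal"
  assumes w: "w \<in> muckenhoupt 1"
  shows "\<exists>C::real. 0 \<le> C \<and> (AE z in lebesgue. \<forall>r>0. wmeas w (ball z r) \<le> ennreal (C * r ^ DIM('a)) * w z)"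
proof -
  let ?u = "unit_ball_vol (real DIM('a))"
  obtain C :: real where C: "AE x in lebesgue. hardy_littlewood w x \<le> ennreal C * w x"
    using w by (auto simp: muckenhoupt_def)
  have "AE z in lebesgue. \<forall>r>0. wmeas w (ball z r) \<le> ennreal ((max C 0 * ?u) * r ^ DIM('a)) * w z"
    using C
  proof eventually_elim
    fix z assume z: "hardy_littlewood w z \<le> ennreal C * w z"
    show "\<forall>r>0. wmeas w (ball z r) \<le> ennreal ((max C 0 * ?u) * r ^ DIM('a)) * w z"
    proof (intro allI impI)
      fix r :: real assume r: "0 < r"
      have "ball_average w z r \<le> hardy_littlewood w z" unfolding hardy_littlewood_def using r by (intro SUP_upper) simp
      also have "\<dots> \<le> ennreal (max C 0) * w z" using z by (rule order_trans) (intro mult_right_mono ennreal_leI, simp_all)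
      finally have "ball_average w z r * emeasure lebesgue (ball z r) \<le> ennreal (max C 0) * w z * ennreal (?u * r ^ DIM('a))"
        using r by (simp only: emeasure_lebesgue_ball less_imp_le) (rule mult_right_mono, simp_all)
      then have "wmeas w (ball z r) \<le> ennreal (max C 0) * w z * ennreal (?u * r ^ DIM('a))" by (simp only: ball_average_times[OF r])
      also have "\<dots> = ennreal ((max C 0 * ?u) * r ^ DIM('a)) * w z"
        using r by (simp add: mult_ac ennreal_mult'[symmetric])
      finally show "wmeas w (ball z r) \<le> ennreal ((max C 0 * ?u) * r ^ DIM('a)) * w z" .
    qed
  qed
  then show ?thesis by (intro exI[of _ "max C 0 * ?u"]) simp
qed

text \<open>For \<open>z\<close> in a ball \<open>B\<close> the ball about \<open>z\<close> of twice the radius contains \<open>B\<close>, so the pointwise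
  bound of \<open>A\<^sub>1\<close> gives \<open>w(B) \<le> C |B| w(z)\<close> at almost every point of \<open>B\<close>.\<close>

lemma A1_inner_bound:
  fixes w :: "'a::euclidean_space \<Rightarrow> ennreal"
  assumes C: "0 \<le> C" and AE: "AE z in lebesgue. \<forall>r>0. wmeas w (ball z r) \<le> ennreal (C * r ^ DIM('a)) * w z" and r: "0 < r"
  shows "AE z in lebesgue. z \<in> ball y r \<longrightarrow>
    wmeas w (ball y r) \<le> ennreal (C * 2 ^ DIM('a) / unit_ball_vol (real DIM('a))) * emeasure lebesgue (ball y r) * w z"
  using AE
proof eventually_elim
  fix z assume z: "\<forall>r>0. wmeas w (ball z r) \<le> ennreal (C * r ^ DIM('a)) * w z"
  show "z \<in> ball y r \<longrightarrow>
    wmeas w (ball y r) \<le> ennreal (C * 2 ^ DIM('a) / unit_ball_vol (real DIM('a))) * emeasure lebesgue (ball y r) * w z"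
  proof
    let ?n = "DIM('a)" let ?u = "unit_ball_vol (real ?n)"
    assume "z \<in> ball y r"
    then have "ball y r \<subseteq> ball z (2*r)" by (simp add: ball_subset_ball_iff dist_commute)
    then have "wmeas w (ball y r) \<le> wmeas w (ball z (2*r))" by (rule wmeas_mono)
    also have "\<dots> \<le> ennreal (C * (2*r) ^ ?n) * w z" by (rule z[rule_format]) (use r in simp)
    also have "C * (2*r) ^ ?n = (C * 2 ^ ?n / ?u) * (?u * r ^ ?n)" by (simp add: power_mult_distrib less_imp_neq[OF unit_ball_vol_pos, THEN not_sym])
    also have "ennreal \<dots> = ennreal (C * 2 ^ ?n / ?u) * emeasure lebesgue (ball y r)"
      unfolding emeasure_lebesgue_ball[OF less_imp_le[OF r]] by (rule ennreal_mult') (simp add: C less_imp_le)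
    finally show "wmeas w (ball y r) \<le> ennreal (C * 2 ^ ?n / ?u) * emeasure lebesgue (ball y r) * w z" .
  qed
qed

lemma A1_averaging:
  fixes w :: "'a::euclidean_space \<Rightarrow> ennreal"
  assumes w: "is_weight w" and C: "0 \<le> C"
    and AE: "AE z in lebesgue. \<forall>r>0. wmeas w (ball z r) \<le> ennreal (C * r ^ DIM('a)) * w z"
  shows "averaging_weight 1 (C * 2 ^ DIM('a) / unit_ball_vol (real DIM('a))) w"
proof -
  let ?A = "C * 2 ^ DIM('a) / unit_ball_vol (real DIM('a))"
  have wm [measurable]: "w \<in> borel_measurable lebesgue" and w0: "AE x in lebesgue. 0 < w x"
    using w by (auto simp: is_weight_def)
  have "(\<integral>\<^sup>+z\<in>ball y r. u z \<partial>lebesgue) * wmeas w (ball y r) \<le> ennreal ?A * emeasure lebesgue (ball y r) * (\<integral>\<^sup>+z\<in>ball y r. (u z * w z) \<partial>lebesgue)"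
    if r: "0 < r" and um [measurable]: "u \<in> borel_measurable lebesgue" for y r u
  proof -
    have [measurable]: "ball y r \<in> sets lebesgue" by simp
    let ?b = "ennreal ?A * emeasure lebesgue (ball y r)"
    have "(\<integral>\<^sup>+z\<in>ball y r. u z \<partial>lebesgue) * wmeas w (ball y r) = (\<integral>\<^sup>+z. u z * indicator (ball y r) z * wmeas w (ball y r) \<partial>lebesgue)"
      by (rule nn_integral_multc[symmetric]) (intro borel_measurable_times_ennreal um borel_measurable_indicator, simp)
    also have "\<dots> \<le> (\<integral>\<^sup>+z. ?b * (u z * w z * indicator (ball y r) z) \<partial>lebesgue)"
    proof (rule nn_integral_mono_AE, use A1_inner_bound[OF C AE r, of y] in eventually_elim)
      fix z assume z: "z \<in> ball y r \<longrightarrow> wmeas w (ball y r) \<le> ?b * w z"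
      show "u z * indicator (ball y r) z * wmeas w (ball y r) \<le> ?b * (u z * w z * indicator (ball y r) z)"
      proof (cases "z \<in> ball y r")
        case True
        then have "u z * wmeas w (ball y r) \<le> u z * (?b * w z)" by (intro mult_left_mono mp[OF z]) simp_all
        then show ?thesis using True by (simp add: mult_ac)
      qed simp
    qed
    also have "\<dots> = ?b * (\<integral>\<^sup>+z\<in>ball y r. (u z * w z) \<partial>lebesgue)"
      by (rule nn_integral_cmult) (intro borel_measurable_times_ennreal um wm borel_measurable_indicator, simp)
    finally show ?thesis .
  qed
  moreover have "0 \<le> ?A" using C by (simp add: less_imp_le)
  moreover have "0 < wmeas w (ball y r)" if "0 < r" for y r by (rule wmeas_ball_pos[OF wm w0 that])
  moreover have "wmeas w (ball y r) < \<infinity>" if "0 < r" for y r using w that by (simp add: is_weight_def)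
  ultimately show ?thesis unfolding averaging_weight_def epowr_one using wm by blast
qed

lemma A1_Ap2:
  fixes w :: "'a::euclidean_space \<Rightarrow> ennreal"
  assumes w: "is_weight w" and C: "0 \<le> C"
    and AE: "AE z in lebesgue. \<forall>r>0. wmeas w (ball z r) \<le> ennreal (C * r ^ DIM('a)) * w z"
  shows "Ap_weight 2 (C * 2 ^ DIM('a) / unit_ball_vol (real DIM('a))) w"
proof -
  let ?A = "C * 2 ^ DIM('a) / unit_ball_vol (real DIM('a))"
  have wm [measurable]: "w \<in> borel_measurable lebesgue" and w0: "AE x in lebesgue. 0 < w x \<and> w x < \<infinity>"
    using w by (auto simp: is_weight_def)
  have im: "(\<lambda>x. inverse (w x)) \<in> borel_measurable lebesgue" by measurable
  have e1: "epowr a (-1) = inverse a" for a using epowr_minus[of 1 a] by simp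
  have "wmeas w (ball y r) * wmeas (\<lambda>x. inverse (w x)) (ball y r) \<le> ennreal ?A * (emeasure lebesgue (ball y r))\<^sup>2"
    if r: "0 < r" for y r
  proof -
    have [measurable]: "ball y r \<in> sets lebesgue" by simp
    let ?b = "ennreal ?A * emeasure lebesgue (ball y r)"
    have "wmeas w (ball y r) * wmeas (\<lambda>x. inverse (w x)) (ball y r) = (\<integral>\<^sup>+z. wmeas w (ball y r) * (inverse (w z) * indicator (ball y r) z) \<partial>lebesgue)"
      unfolding wmeas_def[of "\<lambda>x. inverse (w x)"]
      by (rule nn_integral_cmult[symmetric]) (intro borel_measurable_times_ennreal im borel_measurable_indicator, simp)
    also have "\<dots> \<le> (\<integral>\<^sup>+z. ?b * indicator (ball y r) z \<partial>lebesgue)"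
    proof (rule nn_integral_mono_AE, use A1_inner_bound[OF C AE r, of y] w0 in eventually_elim)
      fix z assume z: "z \<in> ball y r \<longrightarrow> wmeas w (ball y r) \<le> ?b * w z" and w0: "0 < w z \<and> w z < \<infinity>"
      show "wmeas w (ball y r) * (inverse (w z) * indicator (ball y r) z) \<le> ?b * indicator (ball y r) z"
      proof (cases "z \<in> ball y r")
        case True
        then have "wmeas w (ball y r) * inverse (w z) \<le> ?b * w z * inverse (w z)" by (intro mult_right_mono mp[OF z]) simp_all
        also have "\<dots> = ?b * (w z * inverse (w z))" by (rule mult.assoc)
        also have "w z * inverse (w z) = 1" using w0 by (subst divide_ennreal_def[symmetric]) (rule ennreal_divide_self, auto)
        finally show ?thesis using True by simp
      qed simp
    qed
    also have "\<dots> = ?b * emeasure lebesgue (ball y r)" by (rule nn_integral_cmult_indicator) simp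
    finally show ?thesis by (simp add: power2_eq_square mult.assoc)
  qed
  moreover have "0 \<le> ?A" using C by (simp add: less_imp_le)
  moreover have "wmeas w (ball y r) < \<infinity>" if "0 < r" for y r using w that by (simp add: is_weight_def)
  ultimately show ?thesis unfolding Ap_weight_def using wm w0 by (simp add: e1 epowr_two)
qed

lemma dyadic_sq_A1_weak:
  fixes w :: "'a::euclidean_space \<Rightarrow> ennreal"
  assumes \<alpha>: "0 < \<alpha>" "\<alpha> \<le> 1" and w: "w \<in> muckenhoupt 1"
  shows "\<exists>C::real. 0 \<le> C \<and> (\<forall>s>0. \<forall>\<theta>>0. \<forall>F :: nat \<Rightarrow> 'a \<Rightarrow> complex.
    (\<forall>j. F j \<in> borel_measurable lebesgue) \<longrightarrow> (\<integral>\<^sup>+x. l2norm F x \<partial>lebesgue) < \<infinity> \<longrightarrow>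
    wmeas w {x. ennreal (\<theta>\<^sup>2) < dyadic_sq \<alpha> s F x} \<le> ennreal (C/\<theta>) * (\<integral>\<^sup>+x. l2norm F x * w x \<partial>lebesgue))"
proof -
  have iw: "is_weight w" using w by (simp add: muckenhoupt_def)
  obtain C where C: "0 \<le> C" "AE z in lebesgue. \<forall>r>0. wmeas w (ball z r) \<le> ennreal (C * r ^ DIM('a)) * w z"
    using A1_ball_bound[OF w] by blast
  obtain K where K: "0 \<le> K" "\<And>s (F :: nat \<Rightarrow> 'a \<Rightarrow> complex). 0 < s \<Longrightarrow> (\<And>j. F j \<in> borel_measurable lebesgue) \<Longrightarrow>
    (\<integral>\<^sup>+x. epowr (dyadic_sq \<alpha> s F x) (2/2) * w x \<partial>lebesgue) \<le> ennreal K * (\<integral>\<^sup>+x. epowr (l2norm F x) 2 * w x \<partial>lebesgue)"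
    using dyadic_sq_Ap[OF \<alpha> A1_Ap2[OF iw C]] by blast
  have wm: "w \<in> borel_measurable lebesgue" using iw by (simp add: is_weight_def)
  show ?thesis
  proof (rule dyadic_sq_weak_type[OF \<alpha> wm C K(1)])
    fix s :: real and H :: "nat \<Rightarrow> 'a \<Rightarrow> complex" assume s: "0 < s" and H: "\<And>j. H j \<in> borel_measurable lebesgue"
    show "(\<integral>\<^sup>+x. dyadic_sq \<alpha> s H x * w x \<partial>lebesgue) \<le> ennreal K * (\<integral>\<^sup>+x. (l2norm H x)\<^sup>2 * w x \<partial>lebesgue)"
      using K(2)[OF s H] by (simp add: epowr_two)
  qed
qed

section \<open>The pointwise bound\<close>

lemma suminf_square_le:
  fixes e :: "nat \<Rightarrow> ennreal"
  shows "(\<Sum>k. (e k)\<^sup>2) \<le> (\<Sum>k. e k)\<^sup>2"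
proof -
  have le: "e k \<le> (\<Sum>k. e k)" for k using sum_le_suminf[OF summableI, of "{k}" e] by simp
  have "(\<Sum>k. (e k)\<^sup>2) \<le> (\<Sum>k. (\<Sum>k. e k) * e k)"
    unfolding power2_eq_square by (intro suminf_le summableI mult_right_mono le) simp
  also have "\<dots> = (\<Sum>k. e k)\<^sup>2" unfolding power2_eq_square by (rule ennreal_suminf_cmult)
  finally show ?thesis .
qed

text \<open>The scales below \<open>r\<close> form the dyadic square function. At a scale \<open>s > r\<close> nothing is gained from
  cancellation: the kernel is bounded by \<open>s\<^sup>-\<^sup>n\<close>, its neighbourhood lies in a ball about \<open>x0\<close>, and
  Minkowski's inequality moves the \<open>l\<^sub>2\<close> norm inside the integral.\<close>

lemma l2norm_g_seq_le:
  fixes F :: "nat \<Rightarrow> 'a::euclidean_space \<Rightarrow> complex"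
  assumes \<alpha>: "0 < \<alpha>" "\<alpha> \<le> 1" and F: "\<And>j. F j \<in> borel_measurable lebesgue" and r: "0 < r" and x: "x \<in> ball x0 r"
  defines "c \<equiv> 2 ^ (DIM('a) + 1) :: real" and "s \<equiv> \<lambda>k::nat. 2 ^ Suc k * r"
  shows "l2norm (g_seq \<alpha> F) x \<le> ennreal c * epowr (dyadic_sq \<alpha> r F x) (1/2)
    + (\<Sum>k. ennreal (c * (2 * (real DIM('a) + 2)) / s k ^ DIM('a)) * (\<integral>\<^sup>+z\<in>ball x0 ((real DIM('a) + 3) * s k). l2norm F z \<partial>lebesgue))"
    (is "_ \<le> ?N + (\<Sum>k. ?E k)")
proof -
  let ?n = "DIM('a)"
  have c0: "0 \<le> c" by (simp add: c_def)
  have s0: "0 < s k" and rs: "r \<le> s k" for k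
  proof -
    show "0 < s k" using r by (simp add: s_def)
    have "1 * r \<le> 2 ^ Suc k * r" using r by (intro mult_right_mono one_le_power) simp_all
    then show "r \<le> s k" by (simp add: s_def)
  qed
  have far: "(\<Sum>j. (ennreal c * cube_sup \<alpha> (s k) x (F j))\<^sup>2) \<le> (?E k)\<^sup>2" for k
  proof -
    let ?B = "ball x0 ((real ?n + 3) * s k)"
    let ?d = "ennreal (c * (2 * (real ?n + 2)) / s k ^ ?n)"
    have sub: "nbhd (s k) x \<subseteq> ?B"
    proof -
      have "nbhd (s k) x \<subseteq> ball x ((real ?n + 2) * s k)" by (rule nbhd_subset_ball[OF s0])
      also have "\<dots> \<subseteq> ?B"
        using x rs[of k] by (simp add: ball_subset_ball_iff dist_commute algebra_simps)
      finally show ?thesis .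
    qed
    have 1: "ennreal c * cube_sup \<alpha> (s k) x (F j) \<le> ?d * (\<integral>\<^sup>+z. ennreal (cmod (F j z)) * indicator ?B z \<partial>lebesgue)" for j
    proof -
      have "ennreal c * cube_sup \<alpha> (s k) x (F j)
          \<le> ennreal c * (ennreal (2 * (real ?n + 2) / s k ^ ?n) * (\<integral>\<^sup>+z\<in>nbhd (s k) x. ennreal (cmod (F j z)) \<partial>lebesgue))"
        by (intro mult_left_mono cube_sup_le[OF \<alpha> s0 F]) simp
      also have "\<dots> = ?d * (\<integral>\<^sup>+z\<in>nbhd (s k) x. ennreal (cmod (F j z)) \<partial>lebesgue)"
        using c0 by (simp add: ennreal_mult'[symmetric] mult.assoc[symmetric])
      also have "\<dots> \<le> ?d * (\<integral>\<^sup>+z\<in>?B. ennreal (cmod (F j z)) \<partial>lebesgue)"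
        by (intro mult_left_mono nn_integral_subset_le sub) simp
      finally show ?thesis .
    qed
    have "(\<Sum>j. (ennreal c * cube_sup \<alpha> (s k) x (F j))\<^sup>2) \<le> (\<Sum>j. (?d * (\<integral>\<^sup>+z. ennreal (cmod (F j z)) * indicator ?B z \<partial>lebesgue))\<^sup>2)"
      by (intro suminf_le summableI power_mono 1) simp
    also have "\<dots> = ?d\<^sup>2 * (\<Sum>j. (\<integral>\<^sup>+z. ennreal (cmod (F j z)) * indicator ?B z \<partial>lebesgue)\<^sup>2)"
      unfolding power_mult_distrib by (rule ennreal_suminf_cmult)
    also have "\<dots> \<le> ?d\<^sup>2 * (\<integral>\<^sup>+z. epowr (\<Sum>j. (ennreal (cmod (F j z)))\<^sup>2) (1/2) * indicator ?B z \<partial>lebesgue)\<^sup>2"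
    proof (intro mult_left_mono Minkowski_l2_integral)
      note [measurable] = F
      show "(\<lambda>z. ennreal (cmod (F j z))) \<in> borel_measurable lebesgue" for j by measurable
      show "indicator ?B \<in> borel_measurable lebesgue" by (rule borel_measurable_indicator) simp
    qed simp
    also have "\<dots> = (?E k)\<^sup>2" unfolding power_mult_distrib by (simp add: l2norm_def modulus_complex_def)
    finally show ?thesis .
  qed
  have "(l2norm (g_seq \<alpha> F) x)\<^sup>2 = (\<Sum>j. (g_function \<alpha> (F j) x)\<^sup>2)"
    by (simp add: l2norm_def modulus_ennreal_def g_seq_def)
  also have "\<dots> \<le> (\<Sum>j. (\<Sum>i. (ennreal c * cube_sup \<alpha> (r/2^i) x (F j))\<^sup>2) + (\<Sum>k. (ennreal c * cube_sup \<alpha> (s k) x (F j))\<^sup>2))"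
    unfolding c_def s_def by (intro suminf_le summableI g_function_square_le[OF \<alpha> r])
  also have "\<dots> = (\<Sum>j i. (ennreal c * cube_sup \<alpha> (r/2^i) x (F j))\<^sup>2) + (\<Sum>j k. (ennreal c * cube_sup \<alpha> (s k) x (F j))\<^sup>2)"
    by (intro suminf_add[symmetric] summableI)
  also have "(\<Sum>j i. (ennreal c * cube_sup \<alpha> (r/2^i) x (F j))\<^sup>2) = (\<Sum>i j. (ennreal c * cube_sup \<alpha> (r/2^i) x (F j))\<^sup>2)"
    by (rule suminf_swap_ennreal)
  also have "\<dots> = (ennreal c)\<^sup>2 * dyadic_sq \<alpha> r F x"
    unfolding dyadic_sq_def power_mult_distrib by (simp only: ennreal_suminf_cmult)
  also have "(\<Sum>j k. (ennreal c * cube_sup \<alpha> (s k) x (F j))\<^sup>2) = (\<Sum>k j. (ennreal c * cube_sup \<alpha> (s k) x (F j))\<^sup>2)"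
    by (rule suminf_swap_ennreal)
  also have "(ennreal c)\<^sup>2 * dyadic_sq \<alpha> r F x + \<dots> \<le> ?N\<^sup>2 + (\<Sum>k. ?E k)\<^sup>2"
  proof (rule add_mono)
    show "(ennreal c)\<^sup>2 * dyadic_sq \<alpha> r F x \<le> ?N\<^sup>2" by (simp add: power_mult_distrib)
    have "(\<Sum>k j. (ennreal c * cube_sup \<alpha> (s k) x (F j))\<^sup>2) \<le> (\<Sum>k. (?E k)\<^sup>2)" by (intro suminf_le summableI far)
    also have "\<dots> \<le> (\<Sum>k. ?E k)\<^sup>2" by (rule suminf_square_le)
    finally show "(\<Sum>k j. (ennreal c * cube_sup \<alpha> (s k) x (F j))\<^sup>2) \<le> (\<Sum>k. ?E k)\<^sup>2" .
  qed
  also have "\<dots> \<le> (?N + (\<Sum>k. ?E k))\<^sup>2"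
  proof -
    have "a\<^sup>2 + b\<^sup>2 \<le> (a + b)\<^sup>2" for a b :: ennreal
    proof -
      have "a\<^sup>2 + b\<^sup>2 \<le> a\<^sup>2 + b\<^sup>2 + 2 * a * b" by simp
      then show ?thesis by (simp only: power2_sum)
    qed
    then show ?thesis .
  qed
  finally have "epowr (l2norm (g_seq \<alpha> F) x) 2 \<le> epowr (?N + (\<Sum>k. ?E k)) 2" by (simp only: epowr_two)
  then show ?thesis by (simp only: epowr_le_iff zero_less_numeral)
qed

text \<open>Averages against Lebesgue measure are dominated by weighted averages.\<close>

lemma averaging_integral_le:
  fixes F :: "nat \<Rightarrow> 'a::euclidean_space \<Rightarrow> complex"
  assumes w: "averaging_weight p A w" and p: "0 < p" and F: "\<And>j. F j \<in> borel_measurable lebesgue" and r: "0 < r"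
  shows "(\<integral>\<^sup>+z\<in>ball y r. l2norm F z \<partial>lebesgue)
    \<le> ennreal (A powr (1/p) * (unit_ball_vol (real DIM('a)) * r ^ DIM('a))) * (Lp_norm p w (ball y r) F * epowr (wmeas w (ball y r)) (-1/p))"
proof -
  let ?I = "\<integral>\<^sup>+z\<in>ball y r. l2norm F z \<partial>lebesgue" let ?W = "wmeas w (ball y r)" let ?b = "emeasure lebesgue (ball y r)"
  let ?J = "\<integral>\<^sup>+z\<in>ball y r. (epowr (l2norm F z) p * w z) \<partial>lebesgue"
  have A: "0 \<le> A" and W: "0 < ?W" "?W < \<infinity>" using w r unfolding averaging_weight_def by blast+
  have W': "epowr ?W (1/p) \<noteq> 0" "epowr ?W (1/p) \<noteq> \<infinity>"
    using W p epowr_gt_zero[of "1/p" ?W] epowr_less_top[of "1/p" ?W] by auto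
  have av: "\<forall>y. \<forall>r>0. \<forall>u\<in>borel_measurable lebesgue. epowr (\<integral>\<^sup>+z\<in>ball y r. u z \<partial>lebesgue) p * wmeas w (ball y r)
      \<le> ennreal A * epowr (emeasure lebesgue (ball y r)) p * (\<integral>\<^sup>+z\<in>ball y r. (epowr (u z) p * w z) \<partial>lebesgue)"
    using w unfolding averaging_weight_def by (elim conjE)
  have "epowr ?I p * ?W \<le> ennreal A * epowr ?b p * ?J"
    by (rule av[rule_format, OF r borel_measurable_l2norm[OF F]])
  then have "epowr (epowr ?I p * ?W) (1/p) \<le> epowr (ennreal A * epowr ?b p * ?J) (1/p)" using p by (intro epowr_mono) simp_all
  then have "?I * epowr ?W (1/p) \<le> epowr (ennreal A) (1/p) * ?b * Lp_norm p w (ball y r) F"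
    using p by (simp add: epowr_mult epowr_inverse_power Lp_norm_def)
  then have "?I * epowr ?W (1/p) * inverse (epowr ?W (1/p)) \<le> epowr (ennreal A) (1/p) * ?b * Lp_norm p w (ball y r) F * inverse (epowr ?W (1/p))"
    by (rule mult_right_mono) simp
  moreover have "?I * epowr ?W (1/p) * inverse (epowr ?W (1/p)) = ?I"
    using W' by (simp add: divide_ennreal_def[symmetric] mult_divide_eq_ennreal)
  moreover have "epowr (ennreal A) (1/p) * ?b = ennreal (A powr (1/p) * (unit_ball_vol (real DIM('a)) * r ^ DIM('a)))"
    unfolding emeasure_lebesgue_ball[OF less_imp_le[OF r]] using A p by (simp add: epowr_ennreal ennreal_mult')
  moreover have "inverse (epowr ?W (1/p)) = epowr ?W (-1/p)" using epowr_minus[of "1/p" ?W] p by simp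
  ultimately show ?thesis by (simp only: mult.assoc)
qed

section \<open>Summation over the large scales\<close>

lemma dyadic_sum_le_integral:
  fixes c :: "nat \<Rightarrow> ennreal" and g :: "real \<Rightarrow> ennreal"
  assumes \<rho>: "0 < \<rho>" and le: "\<And>k t. 2^k * \<rho> < t \<Longrightarrow> t \<le> 2^Suc k * \<rho> \<Longrightarrow> c k \<le> g t * ennreal t"
  shows "(\<Sum>k. c k) \<le> 2 * (\<integral>\<^sup>+t\<in>{\<rho><..}. g t \<partial>lebesgue)"
proof -
  let ?q = "\<lambda>k::nat. 2^Suc k * \<rho>"
  let ?I = "\<lambda>k::nat. {2^k * \<rho><..?q k}"
  define h where "h k = c k * ennreal (1 / ?q k)" for k
  have q: "0 < ?q k" for k using \<rho> by simp
  have hg: "h k \<le> g t" if t: "t \<in> ?I k" for k t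
  proof -
    have "c k \<le> g t * ennreal t" using t by (intro le) simp_all
    also have "\<dots> \<le> g t * ennreal (?q k)" using t by (intro mult_left_mono ennreal_leI) simp_all
    finally have "h k \<le> g t * ennreal (?q k) * ennreal (1 / ?q k)" unfolding h_def by (rule mult_right_mono) simp
    also have "\<dots> = g t"
    proof -
      have "ennreal a * ennreal (1/a) = 1" if "0 < a" for a using that by (simp add: ennreal_mult'[symmetric])
      from this[OF q[of k]] show ?thesis by (simp only: mult.assoc mult_1_right)
    qed
    finally show ?thesis .
  qed
  have disj: "\<not> j < k" if "t \<in> ?I j" "t \<in> ?I k" for j k :: nat and t
  proof
    assume "j < k"
    then have "(2::real) ^ Suc j * \<rho> \<le> 2 ^ k * \<rho>" using \<rho> by (intro mult_right_mono power_increasing) simp_all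
    then show False using that by simp
  qed
  have pt: "(\<Sum>k. h k * indicator (?I k) t) \<le> g t * indicator {\<rho><..} t" for t
  proof (cases "\<exists>k. t \<in> ?I k")
    case True
    then obtain k where k: "t \<in> ?I k" ..
    have "indicator (?I j) t = (0::ennreal)" if "j \<noteq> k" for j
    proof -
      have "t \<notin> ?I j" using disj[of t j k] disj[of t k j] k that by (cases "j < k") (blast, auto)
      then show ?thesis by simp
    qed
    then have "(\<Sum>k. h k * indicator (?I k) t) = (\<Sum>k\<in>{k}. h k * indicator (?I k) t)" by (intro suminf_finite) simp_all
    also have "\<dots> = h k" using k by simp
    also have "\<dots> \<le> g t" by (rule hg[OF k])
    finally have 1: "(\<Sum>k. h k * indicator (?I k) t) \<le> g t" .
    have "1 * \<rho> \<le> 2 ^ k * \<rho>" using \<rho> by (intro mult_right_mono one_le_power) simp_all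
    then have "\<rho> < t" using k by simp
    then show ?thesis using 1 by simp
  next
    case False
    then have "(\<lambda>k. h k * indicator (?I k) t) = (\<lambda>_. 0)" by (intro ext) simp
    then have "(\<Sum>k. h k * indicator (?I k) t) = 0" by (simp only: suminf_zero)
    then show ?thesis by (simp only: zero_le)
  qed
  have ck: "c k = 2 * (h k * emeasure lebesgue (?I k))" for k
  proof -
    have "emeasure lebesgue (?I k) = ennreal (2^k * \<rho>)" using \<rho> by simp
    then have "2 * (h k * emeasure lebesgue (?I k)) = c k * (ennreal 2 * (ennreal (1 / ?q k) * ennreal (2^k * \<rho>)))"
      by (simp add: h_def mult_ac)
    also have "ennreal 2 * (ennreal (1 / ?q k) * ennreal (2^k * \<rho>)) = ennreal (2 * (1 / ?q k * (2^k * \<rho>)))"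
      using \<rho> by (simp only: ennreal_mult'[symmetric] ennreal_mult''[symmetric] q less_imp_le zero_le_divide_1_iff zero_le_numeral mult_nonneg_nonneg zero_le_power)
    also have "2 * (1 / ?q k * (2^k * \<rho>)) = 1" using \<rho> by simp
    finally show ?thesis by simp
  qed
  have "(\<Sum>k. c k) = 2 * (\<Sum>k. h k * emeasure lebesgue (?I k))" unfolding ck by (rule ennreal_suminf_cmult)
  also have "(\<Sum>k. h k * emeasure lebesgue (?I k)) = (\<Sum>k. \<integral>\<^sup>+t. h k * indicator (?I k) t \<partial>lebesgue)"
    by (intro suminf_cong nn_integral_cmult_indicator[symmetric]) simp
  also have "\<dots> = (\<integral>\<^sup>+t. (\<Sum>k. h k * indicator (?I k) t) \<partial>lebesgue)"
    by (intro nn_integral_suminf[symmetric] borel_measurable_times_ennreal borel_measurable_indicator measurable_const) simp_all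
  also have "\<dots> \<le> (\<integral>\<^sup>+t\<in>{\<rho><..}. g t \<partial>lebesgue)" by (rule nn_integral_mono) (rule pt)
  finally show ?thesis by (simp add: mult_left_mono)
qed

lemma epowr_inverse_cancel:
  assumes "0 < W" "W < \<infinity>" "0 < p" shows "epowr W (-1/p) * epowr W (1/p) = 1"
proof -
  have "epowr W (1/p) \<noteq> 0" "epowr W (1/p) \<noteq> \<infinity>"
    using assms epowr_gt_zero[of "1/p" W] epowr_less_top[of "1/p" W] by auto
  moreover have "epowr W (-1/p) = inverse (epowr W (1/p))" using epowr_minus[of "1/p" W] assms by simp
  moreover have "inverse X * X = 1" if "X \<noteq> 0" "X \<noteq> \<infinity>" for X :: ennreal
    using that by (subst mult.commute, subst divide_ennreal_def[symmetric]) (rule ennreal_divide_self, auto simp: less_top)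
  ultimately show ?thesis by simp
qed

lemma Lp_norm_mono: "0 < p \<Longrightarrow> B \<subseteq> B' \<Longrightarrow> Lp_norm p w B f \<le> Lp_norm p w B' f"
  unfolding Lp_norm_def by (intro epowr_mono nn_integral_subset_le) simp_all

definition tail_sum :: "real \<Rightarrow> ('a::euclidean_space \<Rightarrow> ennreal) \<Rightarrow> (nat \<Rightarrow> 'a \<Rightarrow> complex) \<Rightarrow> 'a \<Rightarrow> real \<Rightarrow> ennreal" where
  "tail_sum p w F x r = (\<Sum>k. Lp_norm p w (ball x ((real DIM('a) + 3) * (2^Suc k * r))) F
     * epowr (wmeas w (ball x ((real DIM('a) + 3) * (2^Suc k * r)))) (-1/p))"

lemma l2norm_g_seq_le_tail:
  fixes F :: "nat \<Rightarrow> 'a::euclidean_space \<Rightarrow> complex"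
  assumes \<alpha>: "0 < \<alpha>" "\<alpha> \<le> 1" and w: "averaging_weight p A w" and p: "0 < p"
    and F: "\<And>j. F j \<in> borel_measurable lebesgue" and r: "0 < r" and x: "x \<in> ball x0 r"
  shows "l2norm (g_seq \<alpha> F) x \<le> ennreal (2 ^ (DIM('a) + 1)) * epowr (dyadic_sq \<alpha> r F x) (1/2)
    + ennreal (2 ^ (DIM('a) + 1) * (2 * (real DIM('a) + 2)) * (A powr (1/p) * (unit_ball_vol (real DIM('a)) * (real DIM('a) + 3) ^ DIM('a))))
      * tail_sum p w F x0 r"
proof -
  let ?n = "DIM('a)" let ?M = "real ?n + 3" let ?u = "unit_ball_vol (real ?n)" let ?d = "2 ^ (?n + 1) * (2 * (real ?n + 2)) :: real"
  let ?c = "?d * (A powr (1/p) * (?u * ?M ^ ?n))"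
  let ?s = "\<lambda>k::nat. 2 ^ Suc k * r"
  have t: "ennreal (?d / ?s k ^ ?n) * (\<integral>\<^sup>+z\<in>ball x0 (?M * ?s k). l2norm F z \<partial>lebesgue)
      \<le> ennreal ?c * (Lp_norm p w (ball x0 (?M * ?s k)) F * epowr (wmeas w (ball x0 (?M * ?s k))) (-1/p))" (is "_ \<le> _ * ?a") for k
  proof -
    have s: "0 < ?s k" using r by simp
    define \<sigma> where "\<sigma> = ?s k"
    have s': "0 < \<sigma>" using r by (simp add: \<sigma>_def)
    have Ms: "0 < ?M * ?s k" using r by (intro mult_pos_pos) simp_all
    have "ennreal (?d / ?s k ^ ?n) * (\<integral>\<^sup>+z\<in>ball x0 (?M * ?s k). l2norm F z \<partial>lebesgue)
        \<le> ennreal (?d / ?s k ^ ?n) * (ennreal (A powr (1/p) * (?u * (?M * ?s k) ^ ?n)) * ?a)"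
      by (intro mult_left_mono averaging_integral_le[OF w p F Ms]) simp
    also have "\<dots> = ennreal (?d / ?s k ^ ?n * (A powr (1/p) * (?u * (?M * ?s k) ^ ?n))) * ?a"
    proof -
      have "ennreal a * (ennreal b * X) = ennreal (a * b) * X" if "0 \<le> a" for a b X using that by (simp add: ennreal_mult' mult.assoc)
      moreover have "0 \<le> ?d / ?s k ^ ?n" using r by simp
      ultimately show ?thesis by blast
    qed
    also have "?d / ?s k ^ ?n * (A powr (1/p) * (?u * (?M * ?s k) ^ ?n)) = ?c"
      unfolding \<sigma>_def[symmetric] using s' by (simp add: power_mult_distrib)
    finally show ?thesis .
  qed
  have "l2norm (g_seq \<alpha> F) x \<le> ennreal (2 ^ (?n + 1)) * epowr (dyadic_sq \<alpha> r F x) (1/2)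
      + (\<Sum>k. ennreal (?d / ?s k ^ ?n) * (\<integral>\<^sup>+z\<in>ball x0 (?M * ?s k). l2norm F z \<partial>lebesgue))"
    by (rule l2norm_g_seq_le[OF \<alpha> F r x])
  also have "\<dots> \<le> ennreal (2 ^ (?n + 1)) * epowr (dyadic_sq \<alpha> r F x) (1/2)
      + (\<Sum>k. ennreal ?c * (Lp_norm p w (ball x0 (?M * ?s k)) F * epowr (wmeas w (ball x0 (?M * ?s k))) (-1/p)))"
    by (intro add_left_mono suminf_le summableI t)
  finally show ?thesis unfolding tail_sum_def ennreal_suminf_cmult .
qed

lemma Lp_norm_le_tail:
  fixes F :: "nat \<Rightarrow> 'a::euclidean_space \<Rightarrow> complex"
  assumes w: "averaging_weight p A w" and p: "0 < p" and r: "0 < r"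
  shows "Lp_norm p w (ball x ((real DIM('a) + 3) * r)) F
    \<le> ennreal ((A * (((real DIM('a) + 3) * 2) ^ DIM('a)) powr p) powr (1/p)) * (epowr (wmeas w (ball x r)) (1/p) * tail_sum p w F x r)"
proof -
  let ?M = "real DIM('a) + 3" let ?D = "A * ((?M * 2) ^ DIM('a)) powr p"
  let ?B = "ball x (?M * (2 ^ Suc 0 * r))"
  have A: "0 \<le> A" using w unfolding averaging_weight_def by (elim conjE)
  have "0 < ?M * (2 ^ Suc 0 * r)" using r by (intro mult_pos_pos) simp_all
  then have W: "0 < wmeas w ?B" "wmeas w ?B < \<infinity>" using w unfolding averaging_weight_def by blast+
  have e: "?M * (2 ^ Suc 0 * r) = (?M * 2) * r" by simp
  have WD: "wmeas w ?B \<le> ennreal ?D * wmeas w (ball x r)" unfolding e by (rule averaging_dilate[OF w p r]) simp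
  have "Lp_norm p w (ball x (?M * r)) F \<le> Lp_norm p w ?B F"
    using r by (intro Lp_norm_mono p subset_ball mult_left_mono) simp_all
  also have "\<dots> = (Lp_norm p w ?B F * epowr (wmeas w ?B) (-1/p)) * epowr (wmeas w ?B) (1/p)"
    by (simp only: mult.assoc epowr_inverse_cancel[OF W p] mult_1_right)
  also have "\<dots> \<le> tail_sum p w F x r * epowr (ennreal ?D * wmeas w (ball x r)) (1/p)"
  proof (intro mult_mono epowr_mono WD)
    have "(\<Sum>k\<in>{0}. Lp_norm p w (ball x (?M * (2^Suc k * r))) F * epowr (wmeas w (ball x (?M * (2^Suc k * r)))) (-1/p)) \<le> tail_sum p w F x r"
      unfolding tail_sum_def by (rule sum_le_suminf[OF summableI]) simp_all
    then show "Lp_norm p w ?B F * epowr (wmeas w ?B) (-1/p) \<le> tail_sum p w F x r" by simp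
  qed (use p in simp_all)
  also have "epowr (ennreal ?D * wmeas w (ball x r)) (1/p) = ennreal (?D powr (1/p)) * epowr (wmeas w (ball x r)) (1/p)"
    using p A by (simp add: epowr_mult epowr_ennreal)
  finally show ?thesis by (simp only: mult_ac)
qed

text \<open>For \<open>t < s\<close> the norm over the ball of radius \<open>t\<close> is at most that over the ball of radius \<open>s\<close>,
  so the Morrey norm bounds it through the essential infimum over all \<open>s > t\<close>; doubling of \<open>w\<close> then
  lets the integral over \<open>t\<close> dominate its dyadic sum.\<close>

lemma tail_sum_le_morrey:
  fixes F :: "nat \<Rightarrow> 'a::euclidean_space \<Rightarrow> complex" and \<phi> :: "'a \<Rightarrow> real \<Rightarrow> real"
  assumes w: "averaging_weight p A w" and p: "0 < p" and r: "0 < r"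
    and \<phi>: "\<And>s. 0 < s \<Longrightarrow> 0 < \<phi> x s" and fin: "morrey_norm p \<phi> w F < \<infinity>"
  shows "tail_sum p w F x r \<le> ennreal (2 * (A * (2 ^ DIM('a)) powr p + 1) powr (1/p)) * morrey_norm p \<phi> w F *
     (\<integral>\<^sup>+ t\<in>{r<..}. (ess_inf_above t (\<lambda>s. ennreal (\<phi> x s) * epowr (wmeas w (ball x s)) (1/p))
                / epowr (wmeas w (ball x t)) (1/p) / ennreal t) \<partial>lebesgue)"
proof -
  let ?n = "DIM('a)" let ?M = "real ?n + 3" let ?N = "morrey_norm p \<phi> w F" let ?W = "\<lambda>t. wmeas w (ball x t)"
  let ?L = "\<lambda>t. Lp_norm p w (ball x t) F"
  define G where "G s = ennreal (\<phi> x s) * epowr (?W s) (1/p)" for s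
  define e where "e t = ess_inf_above t G" for t
  define D where "D = A * (2 ^ ?n) powr p + 1"
  define \<kappa> where "\<kappa> = D powr (1/p)"
  have A: "0 \<le> A" using w unfolding averaging_weight_def by (elim conjE)
  have D: "0 < D" using A by (simp add: D_def add_nonneg_pos)
  then have \<kappa>: "0 < \<kappa>" by (simp add: \<kappa>_def)
  have W: "0 < ?W s" "?W s < \<infinity>" if "0 < s" for s using w that unfolding averaging_weight_def by blast+
  have LG: "?L s \<le> ?N * G s" if s: "0 < s" for s
  proof -
    have "inverse (ennreal (\<phi> x s)) * epowr (?W s) (-1/p) * ?L s \<le> ?N"
      unfolding morrey_norm_def using s by (intro SUP_upper2[of x] SUP_upper2[of s]) simp_all
    then have "inverse (ennreal (\<phi> x s)) * epowr (?W s) (-1/p) * ?L s * G s \<le> ?N * G s" by (rule mult_right_mono) simp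
    moreover have "inverse (ennreal (\<phi> x s)) * epowr (?W s) (-1/p) * ?L s * G s
        = (ennreal (\<phi> x s) * inverse (ennreal (\<phi> x s))) * (epowr (?W s) (-1/p) * epowr (?W s) (1/p)) * ?L s"
      by (simp only: G_def mult_ac)
    moreover have "ennreal (\<phi> x s) * inverse (ennreal (\<phi> x s)) = 1" using \<phi>[OF s] by (subst divide_ennreal_def[symmetric]) (rule ennreal_divide_self, simp_all)
    ultimately show ?thesis by (simp only: epowr_inverse_cancel[OF W[OF s] p] mult_1_left mult_1_right)
  qed
  have Le: "?L t \<le> ?N * e t" if t: "0 < t" for t
  proof (cases "?N = 0")
    case True
    then show ?thesis using LG[OF t] by simp
  next
    case False
    have NN: "?N * (L / ?N) = L" for L
      using False fin by (simp add: ennreal_times_divide mult.commute[of ?N] mult_divide_eq_ennreal)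
    have "?L t / ?N \<le> G s" if "t < s" for s
    proof -
      have "?L t \<le> ?L s" using that by (intro Lp_norm_mono p subset_ball) simp
      also have "\<dots> \<le> ?N * G s" using t that by (intro LG) simp
      finally have "?L t / ?N \<le> ?N * G s / ?N" by (rule divide_right_mono_ennreal)
      also have "\<dots> = G s" using False fin by (subst mult.commute) (simp add: mult_divide_eq_ennreal)
      finally show ?thesis .
    qed
    then have "?L t / ?N \<le> e t" unfolding e_def ess_inf_above_def by (intro Sup_upper) simp
    then have "?N * (?L t / ?N) \<le> ?N * e t" by (rule mult_left_mono) simp
    then show ?thesis by (simp only: NN)
  qed
  have emono: "e t \<le> e t'" if "t \<le> t'" for t t'
    unfolding e_def ess_inf_above_def
  proof (rule Sup_subset_mono, rule subsetI, unfold mem_Collect_eq)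
    fix c assume "AE s in lebesgue. t < s \<longrightarrow> c \<le> G s"
    then show "AE s in lebesgue. t' < s \<longrightarrow> c \<le> G s" by eventually_elim (use that in auto)
  qed
  let ?\<rho> = "?M * (2 * r)"
  have \<rho>: "0 < ?\<rho>" using r by (intro mult_pos_pos) simp_all
  let ?g = "\<lambda>t. e t / epowr (?W t) (1/p) / ennreal t"
  have k\<rho>: "?M * (2^Suc k * r) = 2^k * ?\<rho>" for k :: nat by simp
  have c: "ennreal (1/\<kappa>) * (e (2^k * ?\<rho>) * epowr (?W (2^k * ?\<rho>)) (-1/p)) \<le> ?g t * ennreal t"
    if t: "2^k * ?\<rho> < t" "t \<le> 2^Suc k * ?\<rho>" for k t
  proof -
    define \<tau> where "\<tau> = 2^k * ?\<rho>"
    have \<tau>: "0 < \<tau>" using \<rho> by (simp only: \<tau>_def zero_less_mult_iff zero_less_power zero_less_numeral simp_thms)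
    have t': "\<tau> < t" "t \<le> 2 * \<tau>" using t by (simp_all add: \<tau>_def)
    have t0: "0 < t" using t'(1) \<tau> by simp
    have "?W t \<le> ?W (2 * \<tau>)" using t' by (intro wmeas_mono subset_ball)
    also have "\<dots> \<le> ennreal (A * (2 ^ ?n) powr p) * ?W \<tau>" by (rule averaging_dilate[OF w p \<tau>]) simp
    also have "\<dots> \<le> ennreal D * ?W \<tau>" by (intro mult_right_mono ennreal_leI) (simp_all add: D_def)
    finally have "epowr (?W t) (1/p) \<le> epowr (ennreal D * ?W \<tau>) (1/p)" using p by (intro epowr_mono) simp_all
    also have "\<dots> = ennreal \<kappa> * epowr (?W \<tau>) (1/p)" using p D by (simp add: epowr_mult epowr_ennreal \<kappa>_def)
    finally have Wt: "epowr (?W t) (1/p) \<le> ennreal \<kappa> * epowr (?W \<tau>) (1/p)" .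
    have "epowr (?W \<tau>) (-1/p) = epowr (?W \<tau>) (-1/p) * (epowr (?W t) (1/p) * epowr (?W t) (-1/p))"
      using epowr_inverse_cancel[OF W[OF t0] p] by (simp add: mult.commute)
    also have "\<dots> \<le> epowr (?W \<tau>) (-1/p) * ((ennreal \<kappa> * epowr (?W \<tau>) (1/p)) * epowr (?W t) (-1/p))"
      by (intro mult_left_mono mult_right_mono Wt) simp_all
    also have "\<dots> = ennreal \<kappa> * epowr (?W t) (-1/p) * (epowr (?W \<tau>) (-1/p) * epowr (?W \<tau>) (1/p))" by (simp only: mult_ac)
    also have "\<dots> = ennreal \<kappa> * epowr (?W t) (-1/p)" by (simp only: epowr_inverse_cancel[OF W[OF \<tau>] p] mult_1_right)
    finally have "ennreal (1/\<kappa>) * (e \<tau> * epowr (?W \<tau>) (-1/p)) \<le> ennreal (1/\<kappa>) * (e t * (ennreal \<kappa> * epowr (?W t) (-1/p)))"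
      using t' by (intro mult_left_mono mult_mono emono) simp_all
    also have "\<dots> = (ennreal (1/\<kappa>) * ennreal \<kappa>) * (e t * epowr (?W t) (-1/p))" by (simp only: mult_ac)
    also have "ennreal (1/\<kappa>) * ennreal \<kappa> = 1" using \<kappa> by (simp add: ennreal_mult'[symmetric])
    also have "1 * (e t * epowr (?W t) (-1/p)) = ?g t * ennreal t"
    proof -
      have "X / ennreal t * ennreal t = X" for X
        using t0 by (subst mult.commute) (simp add: ennreal_times_divide mult.commute[of "ennreal t"] mult_divide_eq_ennreal)
      moreover have "epowr (?W t) (-1/p) = inverse (epowr (?W t) (1/p))" using epowr_minus[of "1/p" "?W t"] p by simp
      ultimately show ?thesis by (simp only: mult_1_left) (simp only: divide_ennreal_def)
    qed
    finally show ?thesis by (simp only: \<tau>_def)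
  qed
  have "tail_sum p w F x r \<le> (\<Sum>k. (?N * ennreal \<kappa>) * (ennreal (1/\<kappa>) * (e (2^k * ?\<rho>) * epowr (?W (2^k * ?\<rho>)) (-1/p))))"
    unfolding tail_sum_def k\<rho>
  proof (intro suminf_le summableI)
    fix k :: nat
    have \<tau>: "0 < 2^k * ?\<rho>" using \<rho> by (simp only: zero_less_mult_iff zero_less_power zero_less_numeral simp_thms)
    have "?L (2^k * ?\<rho>) * epowr (?W (2^k * ?\<rho>)) (-1/p) \<le> ?N * e (2^k * ?\<rho>) * epowr (?W (2^k * ?\<rho>)) (-1/p)"
      by (intro mult_right_mono Le[OF \<tau>]) simp
    also have "\<dots> = (ennreal \<kappa> * ennreal (1/\<kappa>)) * (?N * e (2^k * ?\<rho>) * epowr (?W (2^k * ?\<rho>)) (-1/p))"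
      using \<kappa> by (simp add: ennreal_mult'[symmetric])
    finally show "?L (2^k * ?\<rho>) * epowr (?W (2^k * ?\<rho>)) (-1/p)
        \<le> (?N * ennreal \<kappa>) * (ennreal (1/\<kappa>) * (e (2^k * ?\<rho>) * epowr (?W (2^k * ?\<rho>)) (-1/p)))" by (simp only: mult_ac)
  qed
  also have "\<dots> = (?N * ennreal \<kappa>) * (\<Sum>k. ennreal (1/\<kappa>) * (e (2^k * ?\<rho>) * epowr (?W (2^k * ?\<rho>)) (-1/p)))"
    by (rule ennreal_suminf_cmult)
  also have "\<dots> \<le> (?N * ennreal \<kappa>) * (2 * (\<integral>\<^sup>+t\<in>{?\<rho><..}. ?g t \<partial>lebesgue))"
    by (intro mult_left_mono dyadic_sum_le_integral[OF \<rho>] c) simp_all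
  also have "\<dots> \<le> (?N * ennreal \<kappa>) * (2 * (\<integral>\<^sup>+t\<in>{r<..}. ?g t \<partial>lebesgue))"
  proof -
    have "r \<le> ?\<rho>" using r by (simp add: algebra_simps)
    then show ?thesis by (intro mult_left_mono nn_integral_subset_le) auto
  qed
  also have "\<dots> = ennreal (2 * \<kappa>) * ?N * (\<integral>\<^sup>+t\<in>{r<..}. ?g t \<partial>lebesgue)"
    using \<kappa> by (simp add: ennreal_mult' mult_ac)
  finally show ?thesis unfolding e_def G_def \<kappa>_def D_def .
qed

section \<open>Local estimates\<close>

lemma nbhd_in_ball:
  fixes x :: "'a::euclidean_space"
  assumes r: "0 < r" and x: "x \<in> ball x0 r"
  shows "nbhd r x \<subseteq> ball x0 ((real DIM('a) + 3) * r)"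
proof -
  have "nbhd r x \<subseteq> ball x ((real DIM('a) + 2) * r)" by (rule nbhd_subset_ball[OF r])
  also have "\<dots> \<subseteq> ball x0 ((real DIM('a) + 3) * r)"
    using x by (simp add: ball_subset_ball_iff dist_commute algebra_simps)
  finally show ?thesis .
qed

lemma dyadic_sq_restrict:
  assumes s: "0 < s" and N: "nbhd s x \<subseteq> B"
  shows "dyadic_sq \<alpha> s (\<lambda>j z. indicator B z *\<^sub>R F j z) x = dyadic_sq \<alpha> s F x"
proof -
  have "(\<lambda>j z. indicator (nbhd s x) z *\<^sub>R (indicator B z *\<^sub>R F j z)) = (\<lambda>j z. indicator (nbhd s x) z *\<^sub>R F j z)"
    using N by (intro ext) (auto simp: indicator_def)
  then show ?thesis
    using dyadic_sq_localize[OF s, of \<alpha> "\<lambda>j z. indicator B z *\<^sub>R F j z" x] dyadic_sq_localize[OF s, of \<alpha> F x] by (simp only:)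
qed

lemma measurable_restrict_ball:
  fixes F :: "nat \<Rightarrow> 'a::euclidean_space \<Rightarrow> complex"
  assumes [measurable]: "\<And>j. F j \<in> borel_measurable lebesgue"
  shows "(\<lambda>z. indicator (ball x r) z *\<^sub>R F j z) \<in> borel_measurable lebesgue"
proof -
  have [measurable]: "ball x r \<in> sets lebesgue" by simp
  show ?thesis by measurable
qed

lemma l2norm_restrict:
  fixes F :: "nat \<Rightarrow> 'a::euclidean_space \<Rightarrow> complex"
  assumes p: "0 < p"
  shows "(\<integral>\<^sup>+x. epowr (l2norm (\<lambda>j z. indicator B z *\<^sub>R F j z) x) p * w x \<partial>lebesgue) = epowr (Lp_norm p w B F) p"
proof -
  have "epowr (l2norm (\<lambda>j z. indicator B z *\<^sub>R F j z) x) p * w x = epowr (l2norm F x) p * w x * indicator B x" for x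
    using p by (cases "x \<in> B") (simp_all add: l2norm_def modulus_complex_def)
  then show ?thesis using p by (simp add: Lp_norm_def epowr_epowr)
qed

lemma g_seq_strong_local:
  fixes w :: "'a::euclidean_space \<Rightarrow> ennreal"
  assumes \<alpha>: "0 < \<alpha>" "\<alpha> \<le> 1" and wA: "Ap_weight p A w"
  shows "\<exists>C::real. 0 \<le> C \<and> (\<forall>F :: nat \<Rightarrow> 'a \<Rightarrow> complex. (\<forall>j. F j \<in> borel_measurable lebesgue) \<longrightarrow> (\<forall>x. \<forall>r>0.
    Lp_norm p w (ball x r) (g_seq \<alpha> F) \<le> ennreal C * (epowr (wmeas w (ball x r)) (1/p) * tail_sum p w F x r)))"
proof -
  let ?n = "DIM('a)" let ?M = "real ?n + 3"
  have p1: "1 < p" and A: "0 \<le> A" and wm [measurable]: "w \<in> borel_measurable lebesgue"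
    using wA by (simp_all add: Ap_weight_def)
  have p: "0 < p" using p1 by simp
  have w: "averaging_weight p A w" by (rule Ap_averaging[OF wA])
  obtain K where K: "0 \<le> K" "\<And>s (F :: nat \<Rightarrow> 'a \<Rightarrow> complex). 0 < s \<Longrightarrow> (\<And>j. F j \<in> borel_measurable lebesgue) \<Longrightarrow>
    (\<integral>\<^sup>+x. epowr (dyadic_sq \<alpha> s F x) (p/2) * w x \<partial>lebesgue) \<le> ennreal K * (\<integral>\<^sup>+x. epowr (l2norm F x) p * w x \<partial>lebesgue)"
    using dyadic_sq_Ap[OF \<alpha> wA] by blast
  define c1 :: real where "c1 = 2 ^ (?n + 1)"
  define c2 where "c2 = 2 ^ (?n + 1) * (2 * (real ?n + 2)) * (A powr (1/p) * (unit_ball_vol (real ?n) * ?M ^ ?n))"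
  define d where "d = (A * ((?M * 2) ^ ?n) powr p) powr (1/p)"
  have c: "0 \<le> c1" "0 \<le> c2" "0 \<le> d" by (simp_all add: c1_def c2_def d_def less_imp_le)
  define T where "T = 2 powr p * (c1 powr p * (K * d powr p)) + 2 powr p * c2 powr p"
  have T: "0 \<le> T" using K by (simp add: T_def)
  have "Lp_norm p w (ball x0 r) (g_seq \<alpha> F) \<le> ennreal (T powr (1/p)) * (epowr (wmeas w (ball x0 r)) (1/p) * tail_sum p w F x0 r)"
    if F: "\<And>j. F j \<in> borel_measurable lebesgue" and r: "0 < r" for F :: "nat \<Rightarrow> 'a \<Rightarrow> complex" and x0 r
  proof -
    let ?B = "ball x0 r" let ?B1 = "ball x0 (?M * r)" let ?S = "tail_sum p w F x0 r" let ?W = "wmeas w ?B"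
    let ?F1 = "\<lambda>j z. indicator ?B1 z *\<^sub>R F j z"
    let ?k1 = "ennreal (2 powr p) * epowr (ennreal c1) p" let ?k2 = "ennreal (2 powr p) * epowr (ennreal c2 * ?S) p"
    have [measurable]: "?B \<in> sets lebesgue" by simp
    have F1: "?F1 j \<in> borel_measurable lebesgue" for j by (rule measurable_restrict_ball[OF F])
    have pt: "epowr (l2norm (g_seq \<alpha> F) x) p * w x * indicator ?B x
        \<le> ?k1 * (epowr (dyadic_sq \<alpha> r ?F1 x) (p/2) * w x) + ?k2 * (w x * indicator ?B x)" for x
    proof (cases "x \<in> ?B")
      case True
      have "l2norm (g_seq \<alpha> F) x \<le> ennreal c1 * epowr (dyadic_sq \<alpha> r F x) (1/2) + ennreal c2 * ?S"
        unfolding c1_def c2_def by (rule l2norm_g_seq_le_tail[OF \<alpha> w p F r True])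
      also have "dyadic_sq \<alpha> r F x = dyadic_sq \<alpha> r ?F1 x"
        by (rule dyadic_sq_restrict[OF r nbhd_in_ball[OF r True], symmetric])
      finally have "epowr (l2norm (g_seq \<alpha> F) x) p \<le> epowr (ennreal c1 * epowr (dyadic_sq \<alpha> r ?F1 x) (1/2) + ennreal c2 * ?S) p"
        by (rule epowr_mono[OF p])
      also have "\<dots> \<le> ennreal (2 powr p) * (epowr (ennreal c1 * epowr (dyadic_sq \<alpha> r ?F1 x) (1/2)) p + epowr (ennreal c2 * ?S) p)"
        by (rule epowr_add_le[OF p])
      also have "\<dots> = ?k1 * epowr (dyadic_sq \<alpha> r ?F1 x) (p/2) + ?k2"
        using p by (simp add: epowr_mult epowr_epowr distrib_left mult_ac)
      finally have "epowr (l2norm (g_seq \<alpha> F) x) p * w x \<le> (?k1 * epowr (dyadic_sq \<alpha> r ?F1 x) (p/2) + ?k2) * w x"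
        by (rule mult_right_mono) simp
      then show ?thesis using True by (simp add: distrib_right mult.assoc)
    qed simp
    have "(\<integral>\<^sup>+x\<in>?B. (epowr (l2norm (g_seq \<alpha> F) x) p * w x) \<partial>lebesgue)
        \<le> (\<integral>\<^sup>+x. ?k1 * (epowr (dyadic_sq \<alpha> r ?F1 x) (p/2) * w x) + ?k2 * (w x * indicator ?B x) \<partial>lebesgue)"
      by (rule nn_integral_mono) (rule pt)
    also have "\<dots> = ?k1 * (\<integral>\<^sup>+x. epowr (dyadic_sq \<alpha> r ?F1 x) (p/2) * w x \<partial>lebesgue) + ?k2 * ?W"
    proof -
      have m1: "(\<lambda>x. epowr (dyadic_sq \<alpha> r ?F1 x) (p/2) * w x) \<in> borel_measurable lebesgue"
        by (intro borel_measurable_times_ennreal measurable_epowr borel_measurable_dyadic_sq wm)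
      have m2: "(\<lambda>x. w x * indicator ?B x) \<in> borel_measurable lebesgue"
        by (intro borel_measurable_times_ennreal wm borel_measurable_indicator) simp
      have lin: "(\<integral>\<^sup>+x. a * u x + b * v x \<partial>lebesgue) = a * (\<integral>\<^sup>+x. u x \<partial>lebesgue) + b * (\<integral>\<^sup>+x. v x \<partial>lebesgue)"
        if u: "u \<in> borel_measurable lebesgue" and v: "v \<in> borel_measurable lebesgue" for a b :: ennreal and u v :: "'a \<Rightarrow> ennreal"
        by (simp only: nn_integral_add[OF borel_measurable_times_ennreal[OF borel_measurable_const u] borel_measurable_times_ennreal[OF borel_measurable_const v]]
            nn_integral_cmult[OF u] nn_integral_cmult[OF v])
      show ?thesis unfolding wmeas_def by (rule lin[OF m1 m2])
    qed
    also have "\<dots> \<le> ?k1 * (ennreal K * (ennreal (d powr p) * (?W * epowr ?S p))) + ?k2 * ?W"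
    proof (intro add_right_mono mult_left_mono)
      have "(\<integral>\<^sup>+x. epowr (dyadic_sq \<alpha> r ?F1 x) (p/2) * w x \<partial>lebesgue) \<le> ennreal K * epowr (Lp_norm p w ?B1 F) p"
        unfolding l2norm_restrict[OF p, symmetric] by (rule K(2)[OF r F1])
      also have "\<dots> \<le> ennreal K * epowr (ennreal d * (epowr ?W (1/p) * ?S)) p"
        unfolding d_def by (intro mult_left_mono epowr_mono p Lp_norm_le_tail[OF w p r]) simp
      also have "epowr (ennreal d * (epowr ?W (1/p) * ?S)) p = ennreal (d powr p) * (?W * epowr ?S p)"
        using p c by (simp add: epowr_mult epowr_epowr epowr_ennreal)
      finally show "(\<integral>\<^sup>+x. epowr (dyadic_sq \<alpha> r ?F1 x) (p/2) * w x \<partial>lebesgue) \<le> ennreal K * (ennreal (d powr p) * (?W * epowr ?S p))" .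
    qed simp
    also have "\<dots> = ennreal T * (?W * epowr ?S p)"
    proof -
      have k1: "?k1 = ennreal (2 powr p) * ennreal (c1 powr p)" using p c by (simp add: epowr_ennreal)
      have k2: "?k2 = ennreal (2 powr p) * ennreal (c2 powr p) * epowr ?S p" using p c by (simp add: epowr_mult epowr_ennreal mult.assoc)
      have T': "ennreal T = ennreal (2 powr p) * (ennreal (c1 powr p) * (ennreal K * ennreal (d powr p))) + ennreal (2 powr p) * ennreal (c2 powr p)"
        using K(1) by (simp add: T_def ennreal_mult')
      show ?thesis unfolding k1 k2 T' by (simp only: distrib_right distrib_left mult_ac)
    qed
    finally have "Lp_norm p w ?B (g_seq \<alpha> F) \<le> epowr (ennreal T * (?W * epowr ?S p)) (1/p)"
      unfolding Lp_norm_def using p by (intro epowr_mono) simp_all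
    also have "\<dots> = ennreal (T powr (1/p)) * (epowr ?W (1/p) * ?S)"
      using p T by (simp add: epowr_mult epowr_ennreal epowr_inverse_power)
    finally show ?thesis .
  qed
  then show ?thesis by (intro exI[of _ "T powr (1/p)"]) simp
qed

lemma g_seq_weak_local:
  fixes w :: "'a::euclidean_space \<Rightarrow> ennreal"
  assumes \<alpha>: "0 < \<alpha>" "\<alpha> \<le> 1" and w1: "w \<in> muckenhoupt 1" and w: "averaging_weight 1 A w"
  shows "\<exists>C::real. 0 \<le> C \<and> (\<forall>F :: nat \<Rightarrow> 'a \<Rightarrow> complex. (\<forall>j. F j \<in> borel_measurable lebesgue) \<longrightarrow> (\<forall>x. \<forall>r>0. tail_sum 1 w F x r < \<infinity> \<longrightarrow>
    WLp_norm 1 w (ball x r) (g_seq \<alpha> F) \<le> ennreal C * (epowr (wmeas w (ball x r)) (1/1) * tail_sum 1 w F x r)))"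
proof -
  let ?n = "DIM('a)" let ?M = "real ?n + 3"
  obtain K where K: "0 \<le> K" "\<And>s \<theta> (F :: nat \<Rightarrow> 'a \<Rightarrow> complex). 0 < s \<Longrightarrow> 0 < \<theta> \<Longrightarrow> (\<And>j. F j \<in> borel_measurable lebesgue) \<Longrightarrow>
    (\<integral>\<^sup>+x. l2norm F x \<partial>lebesgue) < \<infinity> \<Longrightarrow>
    wmeas w {x. ennreal (\<theta>\<^sup>2) < dyadic_sq \<alpha> s F x} \<le> ennreal (K/\<theta>) * (\<integral>\<^sup>+x. l2norm F x * w x \<partial>lebesgue)"
    using dyadic_sq_A1_weak[OF \<alpha> w1] by blast
  define c1 :: real where "c1 = 2 ^ (?n + 1)"
  define c2 where "c2 = 2 ^ (?n + 1) * (2 * (real ?n + 2)) * (A powr (1/1) * (unit_ball_vol (real ?n) * ?M ^ ?n))"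
  define d where "d = (A * ((?M * 2) ^ ?n) powr 1) powr (1/1)"
  have c1: "0 < c1" and c: "0 \<le> c2" "0 \<le> d" by (simp_all add: c1_def c2_def d_def less_imp_le)
  let ?C = "2 * c2 + K * (2 * c1) * d"
  have "WLp_norm 1 w (ball x0 r) (g_seq \<alpha> F) \<le> ennreal ?C * (epowr (wmeas w (ball x0 r)) (1/1) * tail_sum 1 w F x0 r)"
    if F: "\<And>j. F j \<in> borel_measurable lebesgue" and r: "0 < r" and fin: "tail_sum 1 w F x0 r < \<infinity>"
    for F :: "nat \<Rightarrow> 'a \<Rightarrow> complex" and x0 r
  proof -
    let ?B = "ball x0 r" let ?B1 = "ball x0 (?M * r)" let ?S = "tail_sum 1 w F x0 r" let ?W = "wmeas w ?B"
    let ?F1 = "\<lambda>j z. indicator ?B1 z *\<^sub>R F j z"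
    have Mr: "0 < ?M * r" using r by (intro mult_pos_pos) simp_all
    have F1: "?F1 j \<in> borel_measurable lebesgue" for j by (rule measurable_restrict_ball[OF F])
    have Wf: "?W < \<infinity>" by (rule averaging_ball_finite[OF w r])
    have W1: "0 < wmeas w ?B1" using w Mr unfolding averaging_weight_def by blast
    have L0: "Lp_norm 1 w ?B1 F \<le> ennreal d * (?W * ?S)"
      using Lp_norm_le_tail[OF w _ r, of x0 F] by (simp only: d_def epowr_one div_by_1 zero_less_one)
    have "ennreal d * (?W * ?S) < \<infinity>" using Wf fin by (simp add: ennreal_mult_less_top)
    with L0 have Lf: "Lp_norm 1 w ?B1 F < \<infinity>" by (rule le_less_trans)
    have If: "(\<integral>\<^sup>+x. l2norm ?F1 x \<partial>lebesgue) < \<infinity>"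
    proof -
      have "(\<integral>\<^sup>+x. l2norm ?F1 x \<partial>lebesgue) = (\<integral>\<^sup>+z\<in>?B1. l2norm F z \<partial>lebesgue)" by (rule nn_integral_l2norm_restrict)
      also have "\<dots> \<le> ennreal (A powr (1/1) * (unit_ball_vol (real ?n) * (?M * r) ^ ?n)) * (Lp_norm 1 w ?B1 F * epowr (wmeas w ?B1) (-1/1))"
        by (rule averaging_integral_le[OF w _ F Mr]) simp
      also have "\<dots> < \<infinity>"
      proof -
        have "epowr (wmeas w ?B1) (-1/1) < \<infinity>" using epowr_minus[of 1 "wmeas w ?B1"] W1 by (simp add: less_top[symmetric] zero_less_iff_neq_zero)
        then show ?thesis using Lf by (simp add: ennreal_mult_less_top)
      qed
      finally show ?thesis .
    qed
    have LF: "(\<integral>\<^sup>+x. l2norm ?F1 x * w x \<partial>lebesgue) = Lp_norm 1 w ?B1 F"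
      using l2norm_restrict[of 1 ?B1 F w] by (simp only: epowr_one zero_less_one)
    have "ennreal t * wmeas w {y\<in>?B. ennreal t < l2norm (g_seq \<alpha> F) y} \<le> ennreal ?C * (?W * ?S)" if t: "0 < t" for t
    proof (cases "ennreal t \<le> ennreal (2 * c2) * ?S")
      case True
      have "ennreal t * wmeas w {y\<in>?B. ennreal t < l2norm (g_seq \<alpha> F) y} \<le> (ennreal (2 * c2) * ?S) * ?W"
        by (intro mult_mono True wmeas_mono) auto
      also have "\<dots> = ennreal (2 * c2) * (?W * ?S)" by (simp only: mult_ac)
      also have "\<dots> \<le> ennreal ?C * (?W * ?S)" using K(1) c1 c by (intro mult_right_mono ennreal_leI) simp_all
      finally show ?thesis .
    next
      case False
      define \<theta> where "\<theta> = t / (2 * c1)"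
      have \<theta>: "0 < \<theta>" using t c1 by (simp add: \<theta>_def)
      have sub: "{y\<in>?B. ennreal t < l2norm (g_seq \<alpha> F) y} \<subseteq> {x. ennreal (\<theta>\<^sup>2) < dyadic_sq \<alpha> r ?F1 x}"
      proof (rule subsetI, unfold mem_Collect_eq, elim conjE)
        fix x assume x: "x \<in> ?B" and tx: "ennreal t < l2norm (g_seq \<alpha> F) x"
        show "ennreal (\<theta>\<^sup>2) < dyadic_sq \<alpha> r ?F1 x"
        proof (rule ccontr)
          assume "\<not> ?thesis"
          then have "\<not> ennreal \<theta> < epowr (dyadic_sq \<alpha> r ?F1 x) (1/2)" using ennreal_less_root_iff \<theta> by (simp add: less_imp_le)
          then have e: "epowr (dyadic_sq \<alpha> r ?F1 x) (1/2) \<le> ennreal \<theta>" by simp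
          have "l2norm (g_seq \<alpha> F) x \<le> ennreal c1 * epowr (dyadic_sq \<alpha> r F x) (1/2) + ennreal c2 * ?S"
            unfolding c1_def c2_def by (rule l2norm_g_seq_le_tail[OF \<alpha> w _ F r x]) simp
          also have "dyadic_sq \<alpha> r F x = dyadic_sq \<alpha> r ?F1 x"
            by (rule dyadic_sq_restrict[OF r nbhd_in_ball[OF r x], symmetric])
          also have "ennreal c1 * epowr (dyadic_sq \<alpha> r ?F1 x) (1/2) + ennreal c2 * ?S \<le> ennreal (t/2) + ennreal (t/2)"
          proof (rule add_mono)
            have "ennreal c1 * epowr (dyadic_sq \<alpha> r ?F1 x) (1/2) \<le> ennreal c1 * ennreal \<theta>" by (intro mult_left_mono e) simp
            also have "\<dots> = ennreal (t/2)" using c1 \<theta> by (simp add: ennreal_mult'[symmetric] \<theta>_def)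
            finally show "ennreal c1 * epowr (dyadic_sq \<alpha> r ?F1 x) (1/2) \<le> ennreal (t/2)" .
            have "ennreal (1/2) * (ennreal (2 * c2) * ?S) \<le> ennreal (1/2) * ennreal t" using False by (intro mult_left_mono) simp_all
            moreover have "ennreal (1/2) * (ennreal (2 * c2) * ?S) = ennreal c2 * ?S"
            proof -
              have h: "ennreal (1/2) * ennreal (2 * c2) = ennreal c2" by (subst ennreal_mult'[symmetric]) simp_all
              show ?thesis by (simp only: mult.assoc[symmetric] h)
            qed
            moreover have "ennreal (1/2) * ennreal t = ennreal (t/2)" by (subst ennreal_mult'[symmetric]) simp_all
            ultimately show "ennreal c2 * ?S \<le> ennreal (t/2)" by (simp only:)
          qed
          also have "\<dots> = ennreal t" using t by (simp add: ennreal_plus[symmetric] del: ennreal_plus)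
          finally show False using tx by simp
        qed
      qed
      have "ennreal t * wmeas w {y\<in>?B. ennreal t < l2norm (g_seq \<alpha> F) y} \<le> ennreal t * (ennreal (K/\<theta>) * (ennreal d * (?W * ?S)))"
      proof (rule mult_left_mono)
        have "wmeas w {y\<in>?B. ennreal t < l2norm (g_seq \<alpha> F) y} \<le> wmeas w {x. ennreal (\<theta>\<^sup>2) < dyadic_sq \<alpha> r ?F1 x}"
          by (rule wmeas_mono[OF sub])
        also have "\<dots> \<le> ennreal (K/\<theta>) * Lp_norm 1 w ?B1 F"
          unfolding LF[symmetric] by (rule K(2)[OF r \<theta> F1 If])
        also have "\<dots> \<le> ennreal (K/\<theta>) * (ennreal d * (?W * ?S))" by (intro mult_left_mono L0) simp
        finally show "wmeas w {y\<in>?B. ennreal t < l2norm (g_seq \<alpha> F) y} \<le> ennreal (K/\<theta>) * (ennreal d * (?W * ?S))" .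
      qed simp
      also have "\<dots> = ennreal (t * (K/\<theta>) * d) * (?W * ?S)"
      proof -
        have "ennreal a * (ennreal b * (ennreal d * X)) = ennreal (a * b * d) * X" if "0 \<le> a" "0 \<le> b" for a b X
          using that by (simp add: ennreal_mult' mult.assoc)
        moreover have "0 \<le> t" "0 \<le> K/\<theta>" using t K(1) \<theta> by simp_all
        ultimately show ?thesis by blast
      qed
      also have "t * (K/\<theta>) * d = K * (2 * c1) * d" using t c1 by (simp add: \<theta>_def)
      also have "ennreal (K * (2 * c1) * d) * (?W * ?S) \<le> ennreal ?C * (?W * ?S)"
        using c by (intro mult_right_mono ennreal_leI) simp_all
      finally show ?thesis .
    qed
    then show ?thesis unfolding WLp_norm_def by (intro SUP_least) simp
  qed
  moreover have "0 \<le> ?C" using K(1) c1 c by simp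
  ultimately show ?thesis by (intro exI[of _ ?C]) simp
qed

lemma measurable_g_seq:
  fixes F :: "nat \<Rightarrow> 'a::euclidean_space \<Rightarrow> complex"
  assumes \<alpha>: "0 < \<alpha>" "\<alpha> \<le> 1" and w: "averaging_weight p A w" and p: "0 < p" and F: "F \<in> Lp_loc p w"
  shows "g_seq \<alpha> F j \<in> borel_measurable lebesgue"
proof -
  have Fm: "F j \<in> borel_measurable lebesgue" for j using F by (simp add: Lp_loc_def)
  have "(\<integral>\<^sup>+z\<in>cball 0 R. ennreal (cmod (F j z)) \<partial>lebesgue) < \<infinity>" for R
  proof -
    let ?B = "ball (0::'a) (\<bar>R\<bar> + 1)"
    have R: "0 < \<bar>R\<bar> + 1" by simp
    have W: "0 < wmeas w ?B" using w R unfolding averaging_weight_def by blast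
    have "epowr (wmeas w ?B) (-1/p) = inverse (epowr (wmeas w ?B) (1/p))" using epowr_minus[of "1/p" "wmeas w ?B"] p by simp
    moreover have "0 < epowr (wmeas w ?B) (1/p)" using W p by (simp add: epowr_gt_zero)
    ultimately have 1: "epowr (wmeas w ?B) (-1/p) < \<infinity>" by (simp add: less_top[symmetric] zero_less_iff_neq_zero)
    have "(\<integral>\<^sup>+z\<in>cball 0 R. ennreal (cmod (F j z)) \<partial>lebesgue) \<le> (\<integral>\<^sup>+z\<in>?B. l2norm F z \<partial>lebesgue)"
      by (intro nn_integral_mono) (auto simp: indicator_def norm_le_l2norm)
    also have "\<dots> \<le> ennreal (A powr (1/p) * (unit_ball_vol (real DIM('a)) * (\<bar>R\<bar> + 1) ^ DIM('a))) * (Lp_norm p w ?B F * epowr (wmeas w ?B) (-1/p))"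
      by (rule averaging_integral_le[OF w p Fm R])
    also have "\<dots> < \<infinity>"
    proof -
      have "Lp_norm p w ?B F < \<infinity>" using F R unfolding Lp_loc_def by blast
      then show ?thesis using 1 by (simp add: ennreal_mult_less_top)
    qed
    finally show ?thesis .
  qed
  then show ?thesis unfolding g_seq_def by (intro borel_measurable_g_function \<alpha> Fm)
qed

lemma morrey_quotient_bound:
  fixes W Q T N :: ennreal
  assumes W: "0 < W" "W < \<infinity>" and p: "0 < p" and \<phi>: "0 < (\<phi>::real)" and c: "0 \<le> C" "0 \<le> \<kappa>" "0 \<le> c"
    and Q: "Q \<le> ennreal C * (epowr W (1/p) * T)" and T: "T \<le> ennreal \<kappa> * N * ennreal (c * \<phi>)"
  shows "inverse (ennreal \<phi>) * epowr W (-1/p) * Q \<le> ennreal (C * \<kappa> * c) * N"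
proof -
  have i: "inverse (ennreal \<phi>) * ennreal \<phi> = 1"
    using \<phi> by (subst mult.commute, subst divide_ennreal_def[symmetric]) (rule ennreal_divide_self, simp_all)
  have "inverse (ennreal \<phi>) * epowr W (-1/p) * Q \<le> inverse (ennreal \<phi>) * epowr W (-1/p) * (ennreal C * (epowr W (1/p) * (ennreal \<kappa> * N * (ennreal c * ennreal \<phi>))))"
  proof (rule mult_left_mono)
    have "Q \<le> ennreal C * (epowr W (1/p) * T)" by (rule Q)
    also have "\<dots> \<le> ennreal C * (epowr W (1/p) * (ennreal \<kappa> * N * (ennreal c * ennreal \<phi>)))"
      using T c by (intro mult_left_mono) (simp_all add: ennreal_mult')
    finally show "Q \<le> ennreal C * (epowr W (1/p) * (ennreal \<kappa> * N * (ennreal c * ennreal \<phi>)))" .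
  qed simp
  also have "\<dots> = (inverse (ennreal \<phi>) * ennreal \<phi>) * (epowr W (-1/p) * epowr W (1/p)) * (ennreal C * ennreal \<kappa> * ennreal c) * N"
    by (simp only: mult_ac)
  also have "\<dots> = ennreal (C * \<kappa> * c) * N"
    unfolding i epowr_inverse_cancel[OF W p] using c by (simp add: ennreal_mult')
  finally show ?thesis .
qed

section \<open>Boundedness on generalized weighted Morrey spaces\<close>

theorem corollary1p5:
  fixes p \<alpha> :: real
    and w :: "real ^ 'n \<Rightarrow> ennreal"
    and \<phi>1 \<phi>2 :: "real ^ 'n \<Rightarrow> real \<Rightarrow> real"
  assumes "1 \<le> p" and "0 < \<alpha>" and "\<alpha> \<le> 1"
    and "w \<in> muckenhoupt p"
    and "positive_measurable \<phi>1" and "positive_measurable \<phi>2"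
    and "\<exists>C::real. C > 0 \<and> (\<forall>x. \<forall>r>0.
           (\<integral>\<^sup>+ t\<in>{r<..}.
              (ess_inf_above t (\<lambda>s. ennreal (\<phi>1 x s) * epowr (wmeas w (ball x s)) (1/p))
                / epowr (wmeas w (ball x t)) (1/p) / ennreal t) \<partial>lebesgue)
           \<le> ennreal (C * \<phi>2 x r))"
  shows "(p > 1 \<longrightarrow>
            bounded_operator (g_seq \<alpha>)
              (morrey p \<phi>1 w) (morrey_norm p \<phi>1 w)
              (morrey p \<phi>2 w) (morrey_norm p \<phi>2 w)) \<and>
         (p = 1 \<longrightarrow>
            bounded_operator (g_seq \<alpha>)
              (morrey 1 \<phi>1 w) (morrey_norm 1 \<phi>1 w)
              (weak_morrey 1 \<phi>2 w) (weak_morrey_norm 1 \<phi>2 w))"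
proof -
  let ?Int = "\<lambda>x r. \<integral>\<^sup>+ t\<in>{r<..}. (ess_inf_above t (\<lambda>s. ennreal (\<phi>1 x s) * epowr (wmeas w (ball x s)) (1/p))
                / epowr (wmeas w (ball x t)) (1/p) / ennreal t) \<partial>lebesgue"
  obtain C3 :: real where C3: "0 < C3" "\<And>x r. 0 < r \<Longrightarrow> ?Int x r \<le> ennreal (C3 * \<phi>2 x r)"
    using assms(7) by blast
  have \<alpha>: "0 < \<alpha>" "\<alpha> \<le> 1" and p: "0 < p" using assms(1-3) by simp_all
  have \<phi>1: "0 < \<phi>1 x s" and \<phi>2: "0 < \<phi>2 x s" if "0 < s" for x s
    using assms(5,6) that unfolding positive_measurable_def by blast+
  have iw: "is_weight w" using assms(4) by (simp add: muckenhoupt_def)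
  obtain A where w: "averaging_weight p A w"
  proof (cases "p = 1")
    case True
    then obtain C where C: "0 \<le> C" "AE z in lebesgue. \<forall>r>0. wmeas w (ball z r) \<le> ennreal (C * r ^ DIM(real ^ 'n)) * w z"
      using A1_ball_bound assms(4) by blast
    show ?thesis using A1_averaging[OF iw C] True that by blast
  next
    case False
    then have "1 < p" using assms(1) by simp
    then obtain A where "Ap_weight p A w" using Ap_weight_of_muckenhoupt assms(4) by blast
    then show ?thesis using Ap_averaging that by blast
  qed
  define \<kappa> where "\<kappa> = 2 * (A * (2 ^ DIM(real ^ 'n)) powr p + 1) powr (1/p)"
  have \<kappa>: "0 \<le> \<kappa>" by (simp add: \<kappa>_def)
  have W: "0 < wmeas w (ball x r)" "wmeas w (ball x r) < \<infinity>" if "0 < r" for x r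
    using w that unfolding averaging_weight_def by blast+
  have tail: "tail_sum p w F x r \<le> ennreal \<kappa> * morrey_norm p \<phi>1 w F * ennreal (C3 * \<phi>2 x r)"
    if F: "F \<in> morrey p \<phi>1 w" and r: "0 < r" for F :: "nat \<Rightarrow> real ^ 'n \<Rightarrow> complex" and x r
  proof -
    have "morrey_norm p \<phi>1 w F < \<infinity>" using F by (simp add: morrey_def)
    then have "tail_sum p w F x r \<le> ennreal \<kappa> * morrey_norm p \<phi>1 w F * ?Int x r"
      unfolding \<kappa>_def by (intro tail_sum_le_morrey[OF w p r] \<phi>1)
    also have "\<dots> \<le> ennreal \<kappa> * morrey_norm p \<phi>1 w F * ennreal (C3 * \<phi>2 x r)" by (intro mult_left_mono C3(2) r) simp
    finally show ?thesis .
  qed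
  have tailfin: "tail_sum p w F x r < \<infinity>" if F: "F \<in> morrey p \<phi>1 w" and r: "0 < r" for F :: "nat \<Rightarrow> real ^ 'n \<Rightarrow> complex" and x r
  proof -
    have "morrey_norm p \<phi>1 w F < \<infinity>" using F by (simp add: morrey_def)
    then have "ennreal \<kappa> * morrey_norm p \<phi>1 w F * ennreal (C3 * \<phi>2 x r) < \<infinity>" by (simp add: ennreal_mult_less_top)
    with tail[OF F r] show ?thesis by (rule le_less_trans)
  qed
  have Fm: "F j \<in> borel_measurable lebesgue" and gm: "g_seq \<alpha> F j \<in> borel_measurable lebesgue"
    if "F \<in> morrey p \<phi>1 w" for F :: "nat \<Rightarrow> real ^ 'n \<Rightarrow> complex" and j
    using that measurable_g_seq[OF \<alpha> w p, of F j] by (simp_all add: morrey_def Lp_loc_def)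
  have bound: "inverse (ennreal (\<phi>2 x r)) * epowr (wmeas w (ball x r)) (-1/p) * Q \<le> ennreal (C * \<kappa> * C3) * morrey_norm p \<phi>1 w F" (is ?q)
    and Qfin: "Q < \<infinity>"
    if F: "F \<in> morrey p \<phi>1 w" and r: "0 < r" and C: "0 \<le> C" and Q: "Q \<le> ennreal C * (epowr (wmeas w (ball x r)) (1/p) * tail_sum p w F x r)"
    for F :: "nat \<Rightarrow> real ^ 'n \<Rightarrow> complex" and x r C Q
  proof -
    show ?q by (rule morrey_quotient_bound[OF W[OF r] p \<phi>2[OF r] C \<kappa> less_imp_le[OF C3(1)] Q tail[OF F r]])
    have "epowr (wmeas w (ball x r)) (1/p) < \<infinity>" using W(2)[OF r] p by (simp only: epowr_less_top zero_less_divide_1_iff)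
    then have "ennreal C * (epowr (wmeas w (ball x r)) (1/p) * tail_sum p w F x r) < \<infinity>"
      using tailfin[OF F r, of x] by (simp add: ennreal_mult_less_top)
    with Q show "Q < \<infinity>" by (rule le_less_trans)
  qed
  show ?thesis
  proof (intro conjI impI)
    assume p1: "p > 1"
    obtain A' where "Ap_weight p A' w" using Ap_weight_of_muckenhoupt[OF p1 assms(4)] by blast
    then have "\<exists>C::real. 0 \<le> C \<and> (\<forall>F :: nat \<Rightarrow> real ^ 'n \<Rightarrow> complex. (\<forall>j. F j \<in> borel_measurable lebesgue) \<longrightarrow> (\<forall>x. \<forall>r>0.
        Lp_norm p w (ball x r) (g_seq \<alpha> F) \<le> ennreal C * (epowr (wmeas w (ball x r)) (1/p) * tail_sum p w F x r)))"
      by (rule g_seq_strong_local[OF \<alpha>])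
    then obtain C where C: "0 \<le> C" and loc': "\<forall>F :: nat \<Rightarrow> real ^ 'n \<Rightarrow> complex. (\<forall>j. F j \<in> borel_measurable lebesgue) \<longrightarrow> (\<forall>x. \<forall>r>0.
        Lp_norm p w (ball x r) (g_seq \<alpha> F) \<le> ennreal C * (epowr (wmeas w (ball x r)) (1/p) * tail_sum p w F x r))"
      by (elim exE conjE)
    note loc = loc'[rule_format]
    have le: "morrey_norm p \<phi>2 w (g_seq \<alpha> F) \<le> ennreal (C * \<kappa> * C3) * morrey_norm p \<phi>1 w F" if F: "F \<in> morrey p \<phi>1 w" for F :: "nat \<Rightarrow> real ^ 'n \<Rightarrow> complex"
      unfolding morrey_norm_def[of p \<phi>2]
    proof (intro SUP_least)
      fix x and r :: real assume "r \<in> {0<..}"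
      then have r: "0 < r" by simp
      show "inverse (ennreal (\<phi>2 x r)) * epowr (wmeas w (ball x r)) (-1/p) * Lp_norm p w (ball x r) (g_seq \<alpha> F)
          \<le> ennreal (C * \<kappa> * C3) * morrey_norm p \<phi>1 w F"
        by (rule bound[OF F r C loc[OF Fm[OF F] r]])
    qed
    have "g_seq \<alpha> F \<in> morrey p \<phi>2 w" if F: "F \<in> morrey p \<phi>1 w" for F :: "nat \<Rightarrow> real ^ 'n \<Rightarrow> complex"
    proof -
      have "g_seq \<alpha> F \<in> Lp_loc p w"
        unfolding Lp_loc_def mem_Collect_eq by (intro conjI allI impI gm[OF F]) (rule Qfin[OF F _ C loc[OF Fm[OF F]]])
      moreover have "ennreal (C * \<kappa> * C3) * morrey_norm p \<phi>1 w F < \<infinity>" using F by (simp add: morrey_def ennreal_mult_less_top)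
      ultimately show ?thesis using le_less_trans[OF le[OF F]] unfolding morrey_def by blast
    qed
    then show "bounded_operator (g_seq \<alpha>) (morrey p \<phi>1 w) (morrey_norm p \<phi>1 w) (morrey p \<phi>2 w) (morrey_norm p \<phi>2 w)"
      unfolding bounded_operator_def using le by blast
  next
    assume p1: "p = 1"
    note w' = w[unfolded p1] and bound' = bound[unfolded p1] and Qfin' = Qfin[unfolded p1] and Fm' = Fm[unfolded p1] and gm' = gm[unfolded p1]
      and tailfin' = tailfin[unfolded p1]
    obtain C where C: "0 \<le> C" and loc': "\<forall>F :: nat \<Rightarrow> real ^ 'n \<Rightarrow> complex. (\<forall>j. F j \<in> borel_measurable lebesgue) \<longrightarrow> (\<forall>x. \<forall>r>0.
        tail_sum 1 w F x r < \<infinity> \<longrightarrow>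
        WLp_norm 1 w (ball x r) (g_seq \<alpha> F) \<le> ennreal C * (epowr (wmeas w (ball x r)) (1/1) * tail_sum 1 w F x r))"
      using g_seq_weak_local[OF \<alpha> assms(4)[unfolded p1] w'] by (elim exE conjE)
    note loc = loc'[rule_format]
    have le: "weak_morrey_norm 1 \<phi>2 w (g_seq \<alpha> F) \<le> ennreal (C * \<kappa> * C3) * morrey_norm 1 \<phi>1 w F" if F: "F \<in> morrey 1 \<phi>1 w" for F :: "nat \<Rightarrow> real ^ 'n \<Rightarrow> complex"
      unfolding weak_morrey_norm_def
    proof (intro SUP_least)
      fix x and r :: real assume "r \<in> {0<..}"
      then have r: "0 < r" by simp
      show "inverse (ennreal (\<phi>2 x r)) * epowr (wmeas w (ball x r)) (-1/1) * WLp_norm 1 w (ball x r) (g_seq \<alpha> F)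
          \<le> ennreal (C * \<kappa> * C3) * morrey_norm 1 \<phi>1 w F"
        by (rule bound'[OF F r C loc[OF Fm'[OF F] r tailfin'[OF F r]]])
    qed
    have "g_seq \<alpha> F \<in> weak_morrey 1 \<phi>2 w" if F: "F \<in> morrey 1 \<phi>1 w" for F :: "nat \<Rightarrow> real ^ 'n \<Rightarrow> complex"
    proof -
      have "WLp_norm 1 w (ball x r) (g_seq \<alpha> F) < \<infinity>" if r: "0 < r" for x r
        by (rule Qfin'[OF F r C loc[OF Fm'[OF F] r tailfin'[OF F r]]])
      then have "g_seq \<alpha> F \<in> WLp_loc 1 w"
        unfolding WLp_loc_def mem_Collect_eq using gm'[OF F] by simp
      moreover have "ennreal (C * \<kappa> * C3) * morrey_norm 1 \<phi>1 w F < \<infinity>" using F by (simp add: morrey_def ennreal_mult_less_top)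
      ultimately show ?thesis using le_less_trans[OF le[OF F]] unfolding weak_morrey_def by blast
    qed
    then show "bounded_operator (g_seq \<alpha>) (morrey 1 \<phi>1 w) (morrey_norm 1 \<phi>1 w) (weak_morrey 1 \<phi>2 w) (weak_morrey_norm 1 \<phi>2 w)"
      unfolding bounded_operator_def using le by blast
  qed
qed

end
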